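(* Let $\delta>0$. Let $\{(\lambda_j,\psi_j)\}_{j=1}^m$ be the eigenpairs of $\mathcal L$ on $\mathcal X_0$ with $\Re\lambda_j\ge-\delta$ (all eigenvalues with this property, which are finitely many, repeated according to multiplicity, with linearly independent eigenfunctions $\psi_j$). If the shape functions $\alpha_j\in W^{1,\infty}(\Omega)\cap W^{2,p}(\Omega)$ solve $$\nabla\cdot(\bar\mu\nabla\alpha_j)=\psi_j,\qquad j=1,\dots,m,$$ with periodic boundary conditions, then, with $\mathcal B u=\sum_{j=1}^m u_j\,\nabla\cdot(\bar\mu\nabla\alpha_j)$, the pair $(\mathcal L,\mathcal B)$ satisfies the infinite-dimensional Hautus test $$\ker(\lambda I-\mathcal L^* )\cap\ker\mathcal B^*=\{0\}\qquad\text{for all }\lambda\in\mathbb C\text{ with }\Re\lambda\ge-\delta,$$ and is $\delta$-stabilizable.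
   Context: Setting: $\Omega=\mathbb T^d=(\mathbb R/2\pi\mathbb Z)^d$, $\sigma>0$; $V\in W^{1,\infty}(\Omega)\cap W^{2,p}(\Omega)$ with $p=\max\{d,2+\epsilon\}$ for some $\epsilon>0$; $W\in W^{2,\infty}(\Omega)$ is even in each coordinate; moreover $V,W\in C^2(\Omega)$ and either $W$ is $H$-stable, i.e. $\int_{\Omega\times\Omega}W(x-y)\nu(x)\nu(y)\,dx\,dy\ge0$ for all $\nu\in L^2(\Omega)$, or $\|W\|_\infty<\sigma$. All functions are periodic. $\bar\mu$ is a fixed stationary state: a probability density on $\Omega$ with $\bar\mu=\frac1Z\exp(-\frac1\sigma(V+W*\bar\mu))$, $Z$ the normalizing constant (so $\bar\mu$ is continuous and bounded above and below by positive constants); $*$ is convolution on $\Omega$. $\mathcal X=L^2(\Omega,\bar\mu^{-1})$ with inner product $\langle f,g\rangle_{\bar\mu^{-1}}=\int_\Omega f\bar g\,\bar\mu^{-1}dx$, and $\mathcal X_0=\{y\in\mathcal X:\int_\Omega y\,dx=0\}$. The linearized McKean-Vlasov operator is $$\mathcal L y=\nabla\cdot(\sigma\nabla y+y\nabla V)+\nabla\cdot\big(y\,\nabla W*\bar\mu+\bar\mu\,\nabla W*y\big),\qquad D(\mathcal L)=H^2(\Omega),$$ which maps into zero-mean functions and is here considered as an operator on $\mathcal X_0$ with domain $H^2(\Omega)\cap\mathcal X_0$. Spaces (and the control space, $\mathbb R^m$ or its complexification) are complexified when discussing spectra. Adjoints are taken with respect to $\langle\cdot,\cdot\rangle_{\bar\mu^{-1}}$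 and the Euclidean inner product. The pair $(\mathcal L,\mathcal B)$ is $\delta$-stabilizable if there is a bounded linear $F$ from $\mathcal X_0$ to the control space such that $\mathcal L+\delta I+\mathcal B F$ generates an exponentially stable semigroup on $\mathcal X_0$. *)

theory Defs
  imports "HOL-Probability.Probability"
begin

section \<open>Functions on the torus\<close>

text \<open>A function on the torus of dimension \<open>d = CARD('d)\<close> is a function on \<open>real ^ 'd\<close> that is
  \<open>2\<pi>\<close>-periodic in each coordinate; integration is over the fundamental cell \<open>[0, 2\<pi>)\<^sup>d\<close>.
  Elements of the Lebesgue and Sobolev spaces are Borel representatives, and equality in these
  spaces is equality almost everywhere.\<close>

definition torus :: "(real ^ 'd) measure" where
  "torus = restrict_space lborel {x. \<forall>i. 0 \<le> x $ i \<and> x $ i < 2 * pi}"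

definition periodic :: "(real ^ 'd \<Rightarrow> 'b) \<Rightarrow> bool" where
  "periodic f \<longleftrightarrow> (\<forall>x i. f (x + axis i (2 * pi)) = f x)"

definition torus_fun :: "(real ^ 'd \<Rightarrow> 'b::topological_space) \<Rightarrow> bool" where
  "torus_fun f \<longleftrightarrow> f \<in> borel_measurable borel \<and> periodic f"

definition pd :: "'d \<Rightarrow> (real ^ 'd \<Rightarrow> real) \<Rightarrow> real ^ 'd \<Rightarrow> real" where
  "pd i f x = frechet_derivative f (at x) (axis i 1)"

primrec Ck :: "nat \<Rightarrow> (real ^ 'd \<Rightarrow> real) \<Rightarrow> bool" where
  "Ck 0 = (\<lambda>f. continuous_on UNIV f)"
| "Ck (Suc k) = (\<lambda>f. (\<forall>x. f differentiable at x) \<and> (\<forall>i. Ck k (pd i f)))"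

definition test_fun :: "(real ^ 'd \<Rightarrow> real) \<Rightarrow> bool" where
  "test_fun \<phi> \<longleftrightarrow> periodic \<phi> \<and> (\<forall>k. Ck k \<phi>)"

definition ess_norm :: "(real ^ 'd \<Rightarrow> 'b::real_normed_vector) \<Rightarrow> ereal" where
  "ess_norm f = esssup torus (\<lambda>x. ereal (norm (f x)))"

definition Lp :: "ennreal \<Rightarrow> (real ^ 'd \<Rightarrow> 'b::real_normed_vector) \<Rightarrow> bool" where
  "Lp p f \<longleftrightarrow> torus_fun f \<and>
     (if p = \<infinity> then ess_norm f < \<infinity>
      else integrable torus (\<lambda>x. norm (f x) powr enn2real p))"

definition weak_pd ::
    "'d \<Rightarrow> (real ^ 'd \<Rightarrow> 'b::{banach, second_countable_topology}) \<Rightarrow> (real ^ 'd \<Rightarrow> 'b) \<Rightarrow> bool" where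
  "weak_pd i f g \<longleftrightarrow> integrable torus f \<and> integrable torus g \<and>
     (\<forall>\<phi>. test_fun \<phi> \<longrightarrow>
        (\<integral>x. pd i \<phi> x *\<^sub>R f x \<partial>torus) = - (\<integral>x. \<phi> x *\<^sub>R g x \<partial>torus))"

primrec sobolev ::
    "nat \<Rightarrow> ennreal \<Rightarrow> (real ^ 'd \<Rightarrow> 'b::{banach, second_countable_topology}) \<Rightarrow> bool" where
  "sobolev 0 p = (\<lambda>f. Lp p f)"
| "sobolev (Suc k) p = (\<lambda>f. Lp p f \<and> (\<forall>i. \<exists>g. weak_pd i f g \<and> sobolev k p g))"

text \<open>\<open>weak_div G f\<close>: the function \<open>f\<close> is the distributional divergence of the vector field with
  components \<open>G i\<close>.\<close>

definition weak_div :: "('d::finite \<Rightarrow> real ^ 'd \<Rightarrow> complex) \<Rightarrow> (real ^ 'd \<Rightarrow> complex) \<Rightarrow> bool" where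
  "weak_div G f \<longleftrightarrow> (\<forall>i. integrable torus (G i)) \<and> integrable torus f \<and>
     (\<forall>\<phi>. test_fun \<phi> \<longrightarrow>
        (\<Sum>i\<in>UNIV. \<integral>x. pd i \<phi> x *\<^sub>R G i x \<partial>torus) = - (\<integral>x. \<phi> x *\<^sub>R f x \<partial>torus))"

definition conv ::
    "(real ^ 'd \<Rightarrow> real) \<Rightarrow> (real ^ 'd \<Rightarrow> 'b::{banach, second_countable_topology}) \<Rightarrow> real ^ 'd \<Rightarrow> 'b" where
  "conv K f x = (\<integral>y. K (x - y) *\<^sub>R f y \<partial>torus)"


section \<open>Potentials and stationary states\<close>

definition even_each :: "(real ^ 'd \<Rightarrow> real) \<Rightarrow> bool" where
  "even_each W \<longleftrightarrow> (\<forall>i x. W (\<chi> j. if j = i then - (x $ j) else x $ j) = W x)"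

definition H_stable :: "(real ^ 'd \<Rightarrow> real) \<Rightarrow> bool" where
  "H_stable W \<longleftrightarrow> (\<forall>\<nu> :: real ^ 'd \<Rightarrow> real. Lp 2 \<nu> \<longrightarrow>
     0 \<le> (\<integral>z. W (fst z - snd z) * \<nu> (fst z) * \<nu> (snd z) \<partial>(torus \<Otimes>\<^sub>M torus)))"

definition gibbs :: "real \<Rightarrow> (real ^ 'd \<Rightarrow> real) \<Rightarrow> (real ^ 'd \<Rightarrow> real) \<Rightarrow> (real ^ 'd \<Rightarrow> real) \<Rightarrow> real ^ 'd \<Rightarrow> real" where
  "gibbs \<sigma> V W \<mu> x = exp (- (V x + conv W \<mu> x) / \<sigma>)"

text \<open>The fixed-point equation is imposed pointwise, which selects the continuous representative
  of the density.\<close>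

definition stationary_state ::
    "real \<Rightarrow> (real ^ 'd \<Rightarrow> real) \<Rightarrow> (real ^ 'd \<Rightarrow> real) \<Rightarrow> (real ^ 'd \<Rightarrow> real) \<Rightarrow> bool" where
  "stationary_state \<sigma> V W \<mu> \<longleftrightarrow>
     torus_fun \<mu> \<and> (\<forall>x. 0 \<le> \<mu> x) \<and> integrable torus \<mu> \<and> (\<integral>x. \<mu> x \<partial>torus) = 1 \<and>
     (\<forall>x. \<mu> x = gibbs \<sigma> V W \<mu> x / (\<integral>y. gibbs \<sigma> V W \<mu> y \<partial>torus))"


section \<open>Operators and semigroups on function spaces\<close>

text \<open>A complex Hilbert space is given here by a carrier \<open>X\<close> of complex-valued functions and a
  positive semidefinite sesquilinear form \<open>ip\<close> on it; vectors of seminorm zero are identified. A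
  (possibly unbounded) linear operator is given by its graph.\<close>

definition ip_norm :: "(('a \<Rightarrow> complex) \<Rightarrow> ('a \<Rightarrow> complex) \<Rightarrow> complex) \<Rightarrow> ('a \<Rightarrow> complex) \<Rightarrow> real" where
  "ip_norm ip f = sqrt (Re (ip f f))"

type_synonym ('a, 'b) opgraph = "(('a \<Rightarrow> complex) \<times> ('b \<Rightarrow> complex)) set"

definition adjoint_graph ::
    "('a \<Rightarrow> complex) set \<Rightarrow> (('a \<Rightarrow> complex) \<Rightarrow> ('a \<Rightarrow> complex) \<Rightarrow> complex) \<Rightarrow>
     ('b \<Rightarrow> complex) set \<Rightarrow> (('b \<Rightarrow> complex) \<Rightarrow> ('b \<Rightarrow> complex) \<Rightarrow> complex) \<Rightarrow>
     ('a, 'b) opgraph \<Rightarrow> ('b, 'a) opgraph" where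
  "adjoint_graph X ipX Y ipY A =
     {(g, h). g \<in> Y \<and> h \<in> X \<and> (\<forall>(f, k)\<in>A. ipY k g = ipX f h)}"

text \<open>The kernel of \<open>z I - A\<close>.\<close>

definition eigenspace :: "('a, 'a) opgraph \<Rightarrow> complex \<Rightarrow> ('a \<Rightarrow> complex) set" where
  "eigenspace A z = {f. (f, \<lambda>x. z * f x) \<in> A}"

definition op_kernel :: "('a, 'b) opgraph \<Rightarrow> ('a \<Rightarrow> complex) set" where
  "op_kernel A = {f. (f, \<lambda>_. 0) \<in> A}"

definition C0_semigroup ::
    "('a \<Rightarrow> complex) set \<Rightarrow> (('a \<Rightarrow> complex) \<Rightarrow> real) \<Rightarrow>
     (real \<Rightarrow> ('a \<Rightarrow> complex) \<Rightarrow> 'a \<Rightarrow> complex) \<Rightarrow> bool" where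
  "C0_semigroup X N T \<longleftrightarrow>
     (\<forall>t\<ge>0. \<forall>f\<in>X. T t f \<in> X) \<and>
     (\<forall>t\<ge>0. \<forall>f\<in>X. \<forall>g\<in>X. \<forall>a b.
        N (\<lambda>x. T t (\<lambda>x. a * f x + b * g x) x - (a * T t f x + b * T t g x)) = 0) \<and>
     (\<forall>t\<ge>0. \<exists>C. \<forall>f\<in>X. N (T t f) \<le> C * N f) \<and>
     (\<forall>f\<in>X. N (\<lambda>x. T 0 f x - f x) = 0) \<and>
     (\<forall>s\<ge>0. \<forall>t\<ge>0. \<forall>f\<in>X. N (\<lambda>x. T (s + t) f x - T s (T t f) x) = 0) \<and>
     (\<forall>f\<in>X. ((\<lambda>t. N (\<lambda>x. T t f x - f x)) \<longlongrightarrow> 0) (at_right 0))"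

definition is_generator ::
    "('a \<Rightarrow> complex) set \<Rightarrow> (('a \<Rightarrow> complex) \<Rightarrow> real) \<Rightarrow>
     (real \<Rightarrow> ('a \<Rightarrow> complex) \<Rightarrow> 'a \<Rightarrow> complex) \<Rightarrow> ('a, 'a) opgraph \<Rightarrow> bool" where
  "is_generator X N T A \<longleftrightarrow>
     A = {(f, g). f \<in> X \<and> g \<in> X \<and>
            ((\<lambda>t. N (\<lambda>x. (T t f x - f x) / of_real t - g x)) \<longlongrightarrow> 0) (at_right 0)}"

definition exp_stable ::
    "('a \<Rightarrow> complex) set \<Rightarrow> (('a \<Rightarrow> complex) \<Rightarrow> real) \<Rightarrow>
     (real \<Rightarrow> ('a \<Rightarrow> complex) \<Rightarrow> 'a \<Rightarrow> complex) \<Rightarrow> bool" where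
  "exp_stable X N T \<longleftrightarrow>
     (\<exists>M \<omega>. 0 < \<omega> \<and> (\<forall>t\<ge>0. \<forall>f\<in>X. N (T t f) \<le> M * exp (- \<omega> * t) * N f))"

text \<open>The control space \<open>\<complex>\<^sup>m\<close>: sequences vanishing from index \<open>m\<close> on. The case \<open>m = 0\<close> is
  included.\<close>

definition Cm :: "nat \<Rightarrow> (nat \<Rightarrow> complex) set" where
  "Cm m = {u. \<forall>j\<ge>m. u j = 0}"

definition Cm_ip :: "nat \<Rightarrow> (nat \<Rightarrow> complex) \<Rightarrow> (nat \<Rightarrow> complex) \<Rightarrow> complex" where
  "Cm_ip m u v = (\<Sum>j<m. u j * cnj (v j))"

definition control_graph :: "nat \<Rightarrow> ((nat \<Rightarrow> complex) \<Rightarrow> 'a \<Rightarrow> complex) \<Rightarrow> (nat, 'a) opgraph" where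
  "control_graph m B = {(u, B u) | u. u \<in> Cm m}"

definition feedback ::
    "('a \<Rightarrow> complex) set \<Rightarrow> (('a \<Rightarrow> complex) \<Rightarrow> real) \<Rightarrow> nat \<Rightarrow>
     (('a \<Rightarrow> complex) \<Rightarrow> nat \<Rightarrow> complex) \<Rightarrow> bool" where
  "feedback X N m F \<longleftrightarrow>
     (\<forall>f\<in>X. F f \<in> Cm m) \<and>
     (\<forall>f\<in>X. \<forall>g\<in>X. \<forall>a b j. F (\<lambda>x. a * f x + b * g x) j = a * F f j + b * F g j) \<and>
     (\<exists>C. \<forall>f\<in>X. ip_norm (Cm_ip m) (F f) \<le> C * N f)"

definition closed_loop ::
    "('a, 'a) opgraph \<Rightarrow> ((nat \<Rightarrow> complex) \<Rightarrow> 'a \<Rightarrow> complex) \<Rightarrow> real \<Rightarrow>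
     (('a \<Rightarrow> complex) \<Rightarrow> nat \<Rightarrow> complex) \<Rightarrow> ('a, 'a) opgraph" where
  "closed_loop A B \<delta> F = {(f, \<lambda>x. g x + of_real \<delta> * f x + B (F f) x) | f g. (f, g) \<in> A}"

definition stabilizing_feedback ::
    "('a \<Rightarrow> complex) set \<Rightarrow> (('a \<Rightarrow> complex) \<Rightarrow> real) \<Rightarrow> nat \<Rightarrow> ('a, 'a) opgraph \<Rightarrow>
     ((nat \<Rightarrow> complex) \<Rightarrow> 'a \<Rightarrow> complex) \<Rightarrow> real \<Rightarrow> (('a \<Rightarrow> complex) \<Rightarrow> nat \<Rightarrow> complex) \<Rightarrow> bool" where
  "stabilizing_feedback X N m A B \<delta> F \<longleftrightarrow>
     feedback X N m F \<and>
     (\<exists>T. C0_semigroup X N T \<and> is_generator X N T (closed_loop A B \<delta> F) \<and> exp_stable X N T)"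

definition stabilizable ::
    "('a \<Rightarrow> complex) set \<Rightarrow> (('a \<Rightarrow> complex) \<Rightarrow> real) \<Rightarrow> nat \<Rightarrow> ('a, 'a) opgraph \<Rightarrow>
     ((nat \<Rightarrow> complex) \<Rightarrow> 'a \<Rightarrow> complex) \<Rightarrow> real \<Rightarrow> bool" where
  "stabilizable X N m A B \<delta> \<longleftrightarrow> (\<exists>F. stabilizing_feedback X N m A B \<delta> F)"


section \<open>The linearized McKean-Vlasov operator\<close>

definition X_ip :: "(real ^ 'd \<Rightarrow> real) \<Rightarrow> (real ^ 'd \<Rightarrow> complex) \<Rightarrow> (real ^ 'd \<Rightarrow> complex) \<Rightarrow> complex" where
  "X_ip \<mu> f g = (\<integral>x. f x * cnj (g x) / of_real (\<mu> x) \<partial>torus)"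

definition X_space :: "(real ^ 'd \<Rightarrow> real) \<Rightarrow> (real ^ 'd \<Rightarrow> complex) set" where
  "X_space \<mu> = {f. torus_fun f \<and> integrable torus (\<lambda>x. (cmod (f x))\<^sup>2 / \<mu> x)}"

definition X0_space :: "(real ^ 'd \<Rightarrow> real) \<Rightarrow> (real ^ 'd \<Rightarrow> complex) set" where
  "X0_space \<mu> = {f \<in> X_space \<mu>. (\<integral>x. f x \<partial>torus) = 0}"

text \<open>The zero vector of \<open>X0_space\<close>, as an almost-everywhere class.\<close>

definition X0_zero :: "(real ^ 'd \<Rightarrow> real) \<Rightarrow> (real ^ 'd \<Rightarrow> complex) set" where
  "X0_zero \<mu> = {f \<in> X0_space \<mu>. AE x in torus. f x = 0}"

text \<open>The flux is \<open>\<sigma> \<nabla>y + y \<nabla>V + y (\<nabla>W * \<mu>) + \<mu> (\<nabla>W * y)\<close>, where \<open>Dy\<close> is a weak gradient of \<open>y\<close>.\<close>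

definition MV_flux ::
    "real \<Rightarrow> (real ^ 'd \<Rightarrow> real) \<Rightarrow> (real ^ 'd \<Rightarrow> real) \<Rightarrow> (real ^ 'd \<Rightarrow> real) \<Rightarrow>
     (real ^ 'd \<Rightarrow> complex) \<Rightarrow> ('d \<Rightarrow> real ^ 'd \<Rightarrow> complex) \<Rightarrow> 'd \<Rightarrow> real ^ 'd \<Rightarrow> complex" where
  "MV_flux \<sigma> V W \<mu> y Dy i x =
     of_real \<sigma> * Dy i x + y x * of_real (pd i V x)
     + y x * of_real (conv (pd i W) \<mu> x) + of_real (\<mu> x) * conv (pd i W) y x"

definition MV_graph ::
    "real \<Rightarrow> (real ^ 'd::finite \<Rightarrow> real) \<Rightarrow> (real ^ 'd \<Rightarrow> real) \<Rightarrow> (real ^ 'd \<Rightarrow> real) \<Rightarrow>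
     (real ^ 'd, real ^ 'd) opgraph" where
  "MV_graph \<sigma> V W \<mu> =
     {(y, f). sobolev 2 2 y \<and> f \<in> X_space \<mu> \<and>
        (\<exists>Dy. (\<forall>i. weak_pd i y (Dy i)) \<and> weak_div (MV_flux \<sigma> V W \<mu> y Dy) f)}"

definition MV_graph0 ::
    "real \<Rightarrow> (real ^ 'd::finite \<Rightarrow> real) \<Rightarrow> (real ^ 'd \<Rightarrow> real) \<Rightarrow> (real ^ 'd \<Rightarrow> real) \<Rightarrow>
     (real ^ 'd, real ^ 'd) opgraph" where
  "MV_graph0 \<sigma> V W \<mu> = MV_graph \<sigma> V W \<mu> \<inter> (X0_space \<mu> \<times> X0_space \<mu>)"

text \<open>\<open>is_div_grad \<mu> a f\<close>: \<open>\<nabla>\<cdot>(\<mu> \<nabla>a) = f\<close> on the torus.\<close>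

definition is_div_grad ::
    "(real ^ 'd::finite \<Rightarrow> real) \<Rightarrow> (real ^ 'd \<Rightarrow> complex) \<Rightarrow> (real ^ 'd \<Rightarrow> complex) \<Rightarrow> bool" where
  "is_div_grad \<mu> a f \<longleftrightarrow> torus_fun f \<and>
     (\<exists>Da. (\<forall>i. weak_pd i a (Da i)) \<and> weak_div (\<lambda>i x. of_real (\<mu> x) * Da i x) f)"

text \<open>\<open>\<nabla>\<cdot>(\<mu> \<nabla>a)\<close>, determined up to null sets when it exists as a function.\<close>

definition div_grad :: "(real ^ 'd::finite \<Rightarrow> real) \<Rightarrow> (real ^ 'd \<Rightarrow> complex) \<Rightarrow> real ^ 'd \<Rightarrow> complex" where
  "div_grad \<mu> a = (SOME f. is_div_grad \<mu> a f)"

definition control_op ::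
    "(real ^ 'd::finite \<Rightarrow> real) \<Rightarrow> nat \<Rightarrow> (nat \<Rightarrow> real ^ 'd \<Rightarrow> complex) \<Rightarrow> (nat \<Rightarrow> complex) \<Rightarrow>
     real ^ 'd \<Rightarrow> complex" where
  "control_op \<mu> m \<alpha> u x = (\<Sum>j<m. u j * div_grad \<mu> (\<alpha> j) x)"

text \<open>The indices \<open>j < m\<close> enumerate all eigenvalues of \<open>A\<close> with real part at least \<open>- \<delta>\<close>, each repeated
  according to its multiplicity (the dimension of the eigenspace), with linearly independent
  eigenfunctions.\<close>

definition unstable_eigenpairs ::
    "(real ^ 'd, real ^ 'd) opgraph \<Rightarrow> real \<Rightarrow> nat \<Rightarrow> (nat \<Rightarrow> complex) \<Rightarrow>
     (nat \<Rightarrow> real ^ 'd \<Rightarrow> complex) \<Rightarrow> bool" where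
  "unstable_eigenpairs A \<delta> m \<Lambda> \<psi> \<longleftrightarrow>
     (\<forall>j<m. - \<delta> \<le> Re (\<Lambda> j) \<and> \<psi> j \<in> eigenspace A (\<Lambda> j)) \<and>
     (\<forall>c. (AE x in torus. (\<Sum>j<m. c j * \<psi> j x) = 0) \<longrightarrow> (\<forall>j<m. c j = 0)) \<and>
     (\<forall>z y. - \<delta> \<le> Re z \<and> y \<in> eigenspace A z \<longrightarrow>
        (\<exists>c. AE x in torus. y x = (\<Sum>j | j < m \<and> \<Lambda> j = z. c j * \<psi> j x)))"

definition hautus ::
    "('a \<Rightarrow> complex) set \<Rightarrow> (('a \<Rightarrow> complex) \<Rightarrow> ('a \<Rightarrow> complex) \<Rightarrow> complex) \<Rightarrow>
     ('a \<Rightarrow> complex) set \<Rightarrow> nat \<Rightarrow> ('a, 'a) opgraph \<Rightarrow> ((nat \<Rightarrow> complex) \<Rightarrow> 'a \<Rightarrow> complex) \<Rightarrow> real \<Rightarrow> bool" where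
  "hautus X ip Z m A B \<delta> \<longleftrightarrow>
     (\<forall>z. - \<delta> \<le> Re z \<longrightarrow>
        eigenspace (adjoint_graph X ip X ip A) z
        \<inter> op_kernel (adjoint_graph (Cm m) (Cm_ip m) X ip (control_graph m B)) = Z)"

end

theory Submission
  imports Defs
begin

text \<open>The symmetrizer \<open>S y = \<sigma> y / \<mu> + W * y\<close> satisfies \<open>L y = \<nabla>\<cdot>(\<mu> \<nabla>(S y))\<close>, and either hypothesis on
  \<open>W\<close> makes \<open>\<langle>S y, z\<rangle>\<close> an inner product on the real zero mean functions, equivalent to that of \<open>L\<^sup>2\<close>.
  With respect to it, \<open>L\<close> is symmetric and negative with compact inverse \<open>- G\<close>, so it is diagonal in
  an orthonormal basis of real eigenfunctions. Since \<open>\<nabla>\<cdot>(\<mu> \<nabla>\<alpha>\<^sub>j) = \<psi>\<^sub>j\<close>, the control acts on exactly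
  the span of the unstable modes. A vector as in the Hautus test is orthogonal to the stable modes by
  the eigenvalue equation and to the unstable ones by \<open>B\<^sup>* v = 0\<close>, hence is zero. The feedback that
  shifts the unstable modes by \<open>- (\<delta> + 1)\<close> gives a diagonal generator with spectrum bounded away
  from the right half plane. Complex functions are treated by their real and imaginary parts.\<close>

section \<open>Abstract Hilbert space theory: Riesz representation, orthonormal bases, spectral
  theorem, diagonal semigroups\<close>

section \<open>Coercive symmetric forms on a closed subspace of a Banach space\<close>

text \<open>The adjoint in the Hautus test is taken for the weight \<open>1 / \<mu>\<close>, whereas
  \<open>L\<close> is symmetric for another form \<open>b\<close>. So the adjoint is never
  diagonalized: its eigenvalue equation is only tested with eigenfunctions of \<open>L\<close>, and
  both norms are equivalent to that of L2. Symmetry for \<open>b\<close> also explains why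
  dimensions of eigenspaces are the right multiplicities and why all eigenvalues are real. Solving
  \<open>L y = q\<close> splits into \<open>\<nabla>\<cdot>(\<mu> \<nabla>h) = q\<close> and
  \<open>S y = h\<close> up to a constant, each a Riesz problem for its own form, which is why the
  theory below is built on an arbitrary coercive form and not on one inner product. Derivatives are
  read off real Fourier coefficients; closedness, compactness and H2 regularity become statements on
  weighted sums. In the closed loop the shift \<open>- (\<delta> + 1)\<close> cancels the added
  \<open>\<delta>\<close> and leaves one unit of decay. When the shape functions are real, the
  coefficients of the unstable modes in the \<open>\<psi>\<^sub>j\<close> can be chosen real, which
  is the source of the real feedback in the conclusion.\<close>

locale hilbert_form =
  fixes M :: "'a::banach set" and b :: "'a \<Rightarrow> 'a \<Rightarrow> real" and c :: real
  assumes subspace_M: "subspace M" and closed_M: "closed M"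
    and bilin: "bounded_bilinear b" and sym: "b x y = b y x"
    and c_pos: "0 < c" and coercive: "x \<in> M \<Longrightarrow> c * (norm x)\<^sup>2 \<le> b x x"
begin

sublocale b: bounded_bilinear b by (rule bilin)

lemmas bsimps = b.add_left b.add_right b.diff_left b.diff_right b.scaleR_left b.scaleR_right
  b.minus_left b.minus_right b.zero_left b.zero_right

lemma M_mem: "0 \<in> M" "x \<in> M \<Longrightarrow> y \<in> M \<Longrightarrow> x + y \<in> M" "x \<in> M \<Longrightarrow> y \<in> M \<Longrightarrow> x - y \<in> M"
  "x \<in> M \<Longrightarrow> r *\<^sub>R x \<in> M" "x \<in> M \<Longrightarrow> - x \<in> M"
  using subspace_M by (auto intro: subspace_0 subspace_add subspace_diff subspace_scale subspace_neg)

lemma sum_mem: "(\<And>i. i \<in> F \<Longrightarrow> f i \<in> M) \<Longrightarrow> sum f F \<in> M"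
  using subspace_M by (rule subspace_sum)

lemma pos: "x \<in> M \<Longrightarrow> 0 \<le> b x x"
  by (rule order_trans[OF _ coercive]) (use c_pos in auto)

lemma definite: "x \<in> M \<Longrightarrow> b x x \<le> 0 \<Longrightarrow> x = 0"
proof -
  assume a: "x \<in> M" "b x x \<le> 0"
  then have "c * (norm x)\<^sup>2 \<le> 0" using coercive[of x] by linarith
  then show "x = 0" using c_pos by (simp add: mult_le_0_iff)
qed

lemma pos_strict: "x \<in> M \<Longrightarrow> x \<noteq> 0 \<Longrightarrow> 0 < b x x"
  using definite[of x] by (meson not_le)

lemma cauchy_schwarz: "x \<in> M \<Longrightarrow> y \<in> M \<Longrightarrow> (b x y)\<^sup>2 \<le> b x x * b y y"
proof (cases "y = 0")
  case True
  then show ?thesis by (simp add: bsimps)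
next
  case False
  assume xy: "x \<in> M" "y \<in> M"
  \<comment> \<open>A multiple of the component of \<open>x\<close> that is
    \<open>b\<close>-orthogonal to \<open>y\<close>; clearing the denominator avoids a
    division.\<close>
  define z where "z = b y y *\<^sub>R x - b x y *\<^sub>R y"
  have yy: "0 < b y y" using pos_strict xy False by auto
  have "z \<in> M" unfolding z_def using xy by (intro M_mem)
  then have "0 \<le> b z z" by (rule pos)
  also have "b z z = b y y * (b x x * b y y - (b x y)\<^sup>2)"
    unfolding z_def by (simp add: bsimps sym[of y x] algebra_simps power2_eq_square)
  finally show ?thesis using yy by (simp add: zero_le_mult_iff)
qed

lemma bound: obtains K where "0 < K" "\<And>x y. \<bar>b x y\<bar> \<le> K * norm x * norm y"
proof -
  obtain K where "0 < K" "\<And>x y. norm (b x y) \<le> norm x * norm y * K"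
    using b.pos_bounded by blast
  then show ?thesis using that[of K] by (simp add: mult.commute mult.left_commute)
qed

lemma norm_le_sqrt: "x \<in> M \<Longrightarrow> norm x \<le> sqrt (b x x / c)"
  using coercive[of x] c_pos
  by (intro real_le_rsqrt) (simp add: field_simps)

text \<open>Coercivity bounds the norm by the form and continuity bounds the form by the norm, so
  convergence in energy can be read in the norm of the Banach space.\<close>

lemma tendsto_0_iff:
  assumes "eventually (\<lambda>t. X t \<in> M) F"
  shows "((\<lambda>t. b (X t) (X t)) \<longlongrightarrow> 0) F \<longleftrightarrow> (X \<longlongrightarrow> 0) F"
proof
  assume "((\<lambda>t. b (X t) (X t)) \<longlongrightarrow> 0) F"
  then have "((\<lambda>t. sqrt (b (X t) (X t) / c)) \<longlongrightarrow> sqrt (0 / c)) F"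
    using c_pos by (intro tendsto_intros) auto
  then have "((\<lambda>t. sqrt (b (X t) (X t) / c)) \<longlongrightarrow> 0) F" by simp
  then show "(X \<longlongrightarrow> 0) F"
    by (rule Lim_null_comparison[rotated]) (use assms in eventually_elim, rule norm_le_sqrt)
next
  assume "(X \<longlongrightarrow> 0) F"
  then show "((\<lambda>t. b (X t) (X t)) \<longlongrightarrow> 0) F"
    using b.tendsto[of X 0 F X 0] by (simp add: bsimps)
qed

text \<open>The representing vector minimizes \<open>b x x - 2 \<phi> x\<close> on \<open>M\<close>.\<close>

lemma riesz:
  assumes phi: "bounded_linear \<phi>"
  obtains x where "x \<in> M" "\<And>y. y \<in> M \<Longrightarrow> b x y = \<phi> y"
proof -
  interpret phi: bounded_linear \<phi> by (rule phi)
  define J where "J x = b x x - 2 * \<phi> x" for x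
  obtain C where C: "\<And>x. \<bar>\<phi> x\<bar> \<le> norm x * C" using phi.bounded by auto
  have below: "- (C\<^sup>2 / c) \<le> J x" if "x \<in> M" for x
  proof -
    have "0 \<le> (c * norm x - C)\<^sup>2" by simp
    then have "0 \<le> c * (c * (norm x)\<^sup>2 - 2 * (norm x * C) + C\<^sup>2 / c)"
      using c_pos by (simp add: power2_eq_square algebra_simps)
    then have "- (C\<^sup>2 / c) \<le> c * (norm x)\<^sup>2 - 2 * (norm x * C)"
      using c_pos by (simp add: zero_le_mult_iff)
    also have "\<dots> \<le> J x" unfolding J_def using coercive[OF that] C[of x] by linarith
    finally show ?thesis .
  qed
  define m where "m = Inf (J ` M)"
  have bdd: "bdd_below (J ` M)" using below by (intro bdd_belowI2)
  have m_le: "m \<le> J x" if "x \<in> M" for x unfolding m_def using bdd that by (intro cInf_lower) auto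
  have "\<exists>x\<in>M. J x < m + 1 / real (Suc n)" for n
  proof -
    have "Inf (J ` M) < m + 1 / real (Suc n)" unfolding m_def by simp
    then show ?thesis using cInf_less_iff[of "J ` M"] bdd M_mem(1) by auto
  qed
  then obtain X where X: "\<And>n. X n \<in> M" "\<And>n. J (X n) < m + 1 / real (Suc n)" by metis
  \<comment> \<open>The midpoint lies in \<open>M\<close>, so \<open>J\<close> is at least
    \<open>m\<close> there; with the parallelogram identity this makes any minimizing sequence
    Cauchy.\<close>
  have par: "b (x - y) (x - y) \<le> 2 * (J x - m) + 2 * (J y - m)" if "x \<in> M" "y \<in> M" for x y
  proof -
    have "(1/2) *\<^sub>R (x + y) \<in> M" using that by (intro M_mem)
    then have "m \<le> J ((1/2) *\<^sub>R (x + y))" by (rule m_le)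
    then show ?thesis unfolding J_def
      by (simp add: bsimps phi.add phi.scaleR sym[of y x] algebra_simps)
  qed
  have "Cauchy X"
  proof (rule metric_CauchyI)
    fix e :: real assume e: "0 < e"
    \<comment> \<open>Beyond \<open>N\<close> each excess over \<open>m\<close> is below a quarter
      of \<open>c * e\<^sup>2\<close>, and the bound \<open>par\<close> adds four such
      quarters.\<close>
    obtain N where N: "1 / real (Suc N) < c * e\<^sup>2 / 4"
      using reals_Archimedean[of "c * e\<^sup>2 / 4"] e c_pos by (auto simp: inverse_eq_divide)
    show "\<exists>N. \<forall>m\<ge>N. \<forall>n\<ge>N. dist (X m) (X n) < e"
    proof (intro exI[of _ N] allI impI)
      fix i j assume ij: "N \<le> i" "N \<le> j"
      have le: "1 / real (Suc k) \<le> 1 / real (Suc N)" if "N \<le> k" for k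
        using that by (intro divide_left_mono) auto
      define E where "E = c * e\<^sup>2"
      have "c * (norm (X i - X j))\<^sup>2 \<le> b (X i - X j) (X i - X j)"
        using X by (intro coercive M_mem)
      also have "\<dots> \<le> 2 * (J (X i) - m) + 2 * (J (X j) - m)" using X by (intro par)
      also have "\<dots> < c * e\<^sup>2"
      proof -
        have "J (X k) - m < c * e\<^sup>2 / 4" if "N \<le> k" for k using less_trans[OF _ N] X(2)[of k] le[OF that] N
          by (smt (verit))
        from this[OF ij(1)] this[OF ij(2)] show ?thesis unfolding E_def[symmetric] by argo
      qed
      finally have "(norm (X i - X j))\<^sup>2 < e\<^sup>2" using c_pos by simp
      then show "dist (X i) (X j) < e" using e by (simp add: dist_norm power_less_imp_less_base)
    qed
  qed
  then obtain x where x: "X \<longlonglongrightarrow> x" using Cauchy_convergent convergent_def by blast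
  have xM: "x \<in> M" using closed_M X(1) x closed_sequentially by blast
  have "(\<lambda>n. J (X n)) \<longlonglongrightarrow> J x" unfolding J_def
    using x by (intro tendsto_intros b.tendsto phi.tendsto)
  moreover have "(\<lambda>n. m + 1 / real (Suc n)) \<longlonglongrightarrow> m"
    using tendsto_add[OF tendsto_const LIMSEQ_inverse_real_of_nat, of m] by (simp add: inverse_eq_divide)
  ultimately have Jx: "J x \<le> m"
    by (rule LIMSEQ_le) (use X(2) less_imp_le in blast)
  have "b x y = \<phi> y" if y: "y \<in> M" for y
  proof -
    define D B where "D = b x y - \<phi> y" and "B = b y y"
    \<comment> \<open>A step against the defect \<open>D\<close>. With \<open>B + 1\<close> in the
      denominator it is defined even for \<open>y = 0\<close>, and \<open>J\<close> would drop by
      \<open>D\<^sup>2 * (B + 2) / (B + 1)\<^sup>2\<close>, so minimality forces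
      \<open>D = 0\<close>.\<close>
    define t where "t = - D / (B + 1)"
    have B: "0 \<le> B" unfolding B_def using y by (rule pos)
    have "J x \<le> J (x + t *\<^sub>R y)" using Jx m_le[of "x + t *\<^sub>R y"] xM y by (auto intro: M_mem order_trans)
    then have "0 \<le> 2 * t * D + t\<^sup>2 * B" unfolding J_def D_def B_def
      by (simp add: bsimps phi.add phi.scaleR sym[of y x] algebra_simps power2_eq_square)
    then have "0 \<le> (B + 1)\<^sup>2 * (2 * t * D + t\<^sup>2 * B)" by simp
    also have "\<dots> = 2 * (B + 1) * D * ((B + 1) * t) + B * ((B + 1) * t)\<^sup>2"
      by (simp add: power2_eq_square algebra_simps)
    also have "(B + 1) * t = - D" unfolding t_def using B by simp
    finally have "D\<^sup>2 * (B + 2) \<le> 0" by (simp add: power2_eq_square algebra_simps)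
    then have "D = 0" using B by (simp add: mult_le_0_iff)
    then show ?thesis by (simp add: D_def)
  qed
  then show ?thesis using that xM by blast
qed

end

section \<open>Orthonormal bases\<close>

text \<open>\<open>I\<close> may be any set and sums over it are unordered, so an eigenbasis can be
  indexed by its own vectors. \<open>total\<close> asks only that no nonzero vector has all
  coefficients zero; convergence of expansions comes from completeness.\<close>

locale hilbert_basis = hilbert_form +
  fixes I :: "'i set" and e :: "'i \<Rightarrow> 'a"
  assumes e_mem: "i \<in> I \<Longrightarrow> e i \<in> M"
    and ortho: "i \<in> I \<Longrightarrow> j \<in> I \<Longrightarrow> b (e i) (e j) = (if i = j then 1 else 0)"
    and total: "x \<in> M \<Longrightarrow> (\<And>i. i \<in> I \<Longrightarrow> b x (e i) = 0) \<Longrightarrow> x = 0"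
begin

lemma eqI:
  assumes "x \<in> M" "y \<in> M" "\<And>i. i \<in> I \<Longrightarrow> b x (e i) = b y (e i)"
  shows "x = y"
proof -
  have "x - y = 0" by (rule total) (use assms in \<open>simp_all add: M_mem b.diff_left\<close>)
  then show ?thesis by simp
qed

lemma b_sum_e:
  assumes "finite F" "F \<subseteq> I" "j \<in> I"
  shows "b (\<Sum>i\<in>F. a i *\<^sub>R e i) (e j) = (if j \<in> F then a j else 0)"
proof -
  have "b (\<Sum>i\<in>F. a i *\<^sub>R e i) (e j) = (\<Sum>i\<in>F. a i * b (e i) (e j))"
    by (simp add: b.sum_left b.scaleR_left)
  also have "\<dots> = (\<Sum>i\<in>F. if i = j then a i else 0)"
    using assms by (intro sum.cong) (auto simp: ortho)
  finally show ?thesis using assms by simp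
qed

lemma b_sum_sum:
  assumes "finite F" "F \<subseteq> I"
  shows "b (\<Sum>i\<in>F. a i *\<^sub>R e i) (\<Sum>i\<in>F. a i *\<^sub>R e i) = (\<Sum>i\<in>F. (a i)\<^sup>2)"
proof -
  have "b (\<Sum>i\<in>F. a i *\<^sub>R e i) (\<Sum>i\<in>F. a i *\<^sub>R e i) = (\<Sum>j\<in>F. a j * b (\<Sum>i\<in>F. a i *\<^sub>R e i) (e j))"
    by (simp add: b.sum_right b.scaleR_right)
  also have "\<dots> = (\<Sum>j\<in>F. (a j)\<^sup>2)" using assms
    by (intro sum.cong refl) (subst b_sum_e, auto simp: power2_eq_square)
  finally show ?thesis .
qed

lemma fin_mem: "F \<subseteq> I \<Longrightarrow> (\<Sum>i\<in>F. a i *\<^sub>R e i) \<in> M"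
  by (intro sum_mem M_mem) (auto intro: e_mem)

lemma bessel:
  assumes "finite F" "F \<subseteq> I" "x \<in> M"
  shows "(\<Sum>i\<in>F. (b x (e i))\<^sup>2) \<le> b x x"
proof -
  define s where "s = (\<Sum>i\<in>F. b x (e i) *\<^sub>R e i)"
  have sM: "s \<in> M" unfolding s_def using assms by (intro fin_mem)
  have "b x s = (\<Sum>i\<in>F. (b x (e i))\<^sup>2)" unfolding s_def
    by (simp add: b.sum_right b.scaleR_right power2_eq_square)
  moreover have "b s s = (\<Sum>i\<in>F. (b x (e i))\<^sup>2)" unfolding s_def using assms by (intro b_sum_sum)
  moreover have "0 \<le> b (x - s) (x - s)" using assms sM by (intro pos M_mem)
  ultimately show ?thesis by (simp add: bsimps sym[of s x])
qed

lemma summable_coeffs: "x \<in> M \<Longrightarrow> (\<lambda>i. (b x (e i))\<^sup>2) summable_on I"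
  by (intro nonneg_bdd_above_summable_on bdd_aboveI2[where M = "b x x"]) (auto intro: bessel)

lemma riesz_fischer:
  assumes "(\<lambda>i. (a i)\<^sup>2) summable_on I"
  obtains x where "x \<in> M" "\<And>i. i \<in> I \<Longrightarrow> b x (e i) = a i" "((\<lambda>i. a i *\<^sub>R e i) has_sum x) I"
proof -
  define s where "s = sum (\<lambda>i. a i *\<^sub>R e i)"
  let ?F = "finite_subsets_at_top I"
  obtain A where A: "((\<lambda>i. (a i)\<^sup>2) has_sum A) I" using assms summable_on_def by blast
  have "cauchy_filter (filtermap s ?F)"
    unfolding cauchy_filter_metric_filtermap
  proof (intro allI impI)
    fix \<epsilon> :: real assume eps: "0 < \<epsilon>"
    \<comment> \<open>Chosen with \<open>2 * \<eta> = c * (\<epsilon> / 2)\<^sup>2\<close>: if the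
      sums of squares over \<open>G\<close> and a larger \<open>H\<close> are within
      \<open>\<eta>\<close> of \<open>A\<close>, coercivity puts the partial sums at distance below
      \<open>\<epsilon> / 2\<close>.\<close>
    define \<eta> where "\<eta> = c * \<epsilon>\<^sup>2 / 8"
    have eta: "0 < \<eta>" unfolding \<eta>_def using eps c_pos by simp
    have "eventually (\<lambda>G. dist (sum (\<lambda>i. (a i)\<^sup>2) G) A < \<eta>) ?F"
      using A eta unfolding has_sum_def by (rule tendstoD)
    then obtain G where G: "finite G" "G \<subseteq> I"
      and G': "\<And>H. finite H \<Longrightarrow> G \<subseteq> H \<Longrightarrow> H \<subseteq> I \<Longrightarrow> dist (sum (\<lambda>i. (a i)\<^sup>2) H) A < \<eta>"
      by (auto simp: eventually_finite_subsets_at_top)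
    have near: "dist (s H) (s G) < \<epsilon> / 2" if H: "finite H" "G \<subseteq> H" "H \<subseteq> I" for H
    proof -
      have "s H - s G = (\<Sum>i\<in>H - G. a i *\<^sub>R e i)" unfolding s_def using H G by (simp add: sum_diff)
      moreover have "b (\<Sum>i\<in>H - G. a i *\<^sub>R e i) (\<Sum>i\<in>H - G. a i *\<^sub>R e i) = (\<Sum>i\<in>H - G. (a i)\<^sup>2)"
        using H by (intro b_sum_sum) auto
      moreover have "(\<Sum>i\<in>H - G. (a i)\<^sup>2) = (\<Sum>i\<in>H. (a i)\<^sup>2) - (\<Sum>i\<in>G. (a i)\<^sup>2)"
        using H G by (simp add: sum_diff)
      moreover have "(\<Sum>i\<in>H. (a i)\<^sup>2) - (\<Sum>i\<in>G. (a i)\<^sup>2) < 2 * \<eta>"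
        using G'[of H] G'[of G] H G by (auto simp: dist_real_def abs_if split: if_splits)
      moreover have "(\<Sum>i\<in>H - G. a i *\<^sub>R e i) \<in> M" using H by (intro fin_mem) auto
      ultimately have "c * (norm (s H - s G))\<^sup>2 < 2 * \<eta>" using coercive[of "s H - s G"] by simp
      then have "(norm (s H - s G))\<^sup>2 < (\<epsilon> / 2)\<^sup>2" using c_pos unfolding \<eta>_def
        by (simp add: power_divide)
      then have "norm (s H - s G) < \<epsilon> / 2" by (rule power_less_imp_less_base) (use eps in simp)
      then show ?thesis by (simp add: dist_norm)
    qed
    show "\<exists>P. eventually P ?F \<and> (\<forall>x y. P x \<and> P y \<longrightarrow> dist (s x) (s y) < \<epsilon>)"
    proof (intro exI[of _ "\<lambda>H. finite H \<and> G \<subseteq> H \<and> H \<subseteq> I"] conjI allI impI)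
      show "eventually (\<lambda>H. finite H \<and> G \<subseteq> H \<and> H \<subseteq> I) ?F"
        using G by (auto simp: eventually_finite_subsets_at_top)
      show "dist (s x) (s y) < \<epsilon>" if "(finite x \<and> G \<subseteq> x \<and> x \<subseteq> I) \<and> finite y \<and> G \<subseteq> y \<and> y \<subseteq> I" for x y
        using near[of x] near[of y] that dist_triangle_half_l[of "s x" "s G" \<epsilon> "s y"]
        by (simp add: dist_commute)
    qed
  qed
  then obtain x where "filtermap s ?F \<le> nhds x"
    using cauchy_filter_complete_converges[of "filtermap s ?F" UNIV] complete_UNIV
    by (auto simp: filtermap_bot_iff)
  then have lim: "(s \<longlongrightarrow> x) ?F" by (simp add: filterlim_def)
  then have hs: "((\<lambda>i. a i *\<^sub>R e i) has_sum x) I" by (simp add: has_sum_def s_def)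
  have "eventually (\<lambda>G. s G \<in> M) ?F"
    using fin_mem by (auto simp: eventually_finite_subsets_at_top s_def)
  then have xM: "x \<in> M" using closed_M lim by (intro Lim_in_closed_set[of M s ?F]) auto
  have "b x (e j) = a j" if "j \<in> I" for j
  proof -
    have "((\<lambda>i. b (a i *\<^sub>R e i) (e j)) has_sum b x (e j)) I"
      using hs by (intro has_sum_bounded_linear[of "\<lambda>x. b x (e j)"] b.bounded_linear_left)
    moreover have "((\<lambda>i. b (a i *\<^sub>R e i) (e j)) has_sum a j) I"
      using has_sum_finite_neutralI[of "{j}" I "\<lambda>i. b (a i *\<^sub>R e i) (e j)" "a j"] that
      by (auto simp: bsimps ortho)
    ultimately show ?thesis by (rule has_sum_unique)
  qed
  then show ?thesis using that xM hs by blast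
qed

lemma expansion: "x \<in> M \<Longrightarrow> ((\<lambda>i. b x (e i) *\<^sub>R e i) has_sum x) I"
proof -
  assume x: "x \<in> M"
  obtain z where z: "z \<in> M" "\<And>i. i \<in> I \<Longrightarrow> b z (e i) = b x (e i)"
    "((\<lambda>i. b x (e i) *\<^sub>R e i) has_sum z) I"
    using riesz_fischer[OF summable_coeffs[OF x]] by blast
  moreover have "z = x" using z x by (intro eqI)
  ultimately show ?thesis by simp
qed

lemma parseval:
  assumes "x \<in> M" shows "((\<lambda>i. b x (e i) * b y (e i)) has_sum b x y) I"
  using has_sum_bounded_linear[OF b.bounded_linear_right[of y] expansion[OF assms]]
  unfolding sym[of y x] b.scaleR_right by simp

lemma parseval_sq: "x \<in> M \<Longrightarrow> ((\<lambda>i. (b x (e i))\<^sup>2) has_sum b x x) I"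
  using parseval[of x x] by (simp add: power2_eq_square)

text \<open>Bounded factors keep the coefficients square summable, so Riesz-Fischer supplies the
  vector. The diagonal semigroup is obtained from this with factors
  \<open>exp (\<theta> i * t)\<close>.\<close>

lemma multiplier:
  assumes x: "x \<in> M" and r: "\<And>i. i \<in> I \<Longrightarrow> \<bar>r i\<bar> \<le> C"
  obtains z where "z \<in> M" "\<And>i. i \<in> I \<Longrightarrow> b z (e i) = r i * b x (e i)"
proof -
  have "(\<lambda>i. (r i * b x (e i))\<^sup>2) summable_on I"
  proof (rule summable_on_comparison_test)
    show "(\<lambda>i. C\<^sup>2 * (b x (e i))\<^sup>2) summable_on I"
      using summable_coeffs[OF x] by (rule summable_on_cmult_right)
    show "(r i * b x (e i))\<^sup>2 \<le> C\<^sup>2 * (b x (e i))\<^sup>2" if "i \<in> I" for i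
      unfolding power_mult_distrib using r[OF that]
      by (intro mult_right_mono) (auto simp: abs_le_square_iff[symmetric])
  qed simp
  then show ?thesis
    by (rule riesz_fischer) (use that in auto)
qed

lemma coeff_le:
  assumes "x \<in> M" "z \<in> M" "0 \<le> C" "\<And>i. i \<in> I \<Longrightarrow> \<bar>b z (e i)\<bar> \<le> C * \<bar>b x (e i)\<bar>"
  shows "b z z \<le> C\<^sup>2 * b x x"
proof (rule has_sum_mono)
  show "((\<lambda>i. (b z (e i))\<^sup>2) has_sum b z z) I" using assms by (intro parseval_sq)
  show "((\<lambda>i. C\<^sup>2 * (b x (e i))\<^sup>2) has_sum C\<^sup>2 * b x x) I"
    using assms by (intro has_sum_cmult_right parseval_sq)
  show "(b z (e i))\<^sup>2 \<le> C\<^sup>2 * (b x (e i))\<^sup>2" if "i \<in> I" for i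
    using power_mono[OF assms(4)[OF that], of 2] by (simp add: power_mult_distrib)
qed

text \<open>A dominated convergence theorem for coefficients: outside a finite set \<open>G\<close>
  the squares are bounded by the tail of Parseval's sum for \<open>a\<close>, and on
  \<open>G\<close> the finitely many factors tend to zero.\<close>

lemma dominated:
  assumes a: "a \<in> M" and X: "\<And>t. t \<in> S \<Longrightarrow> X t \<in> M"
    and coeff: "\<And>t i. t \<in> S \<Longrightarrow> i \<in> I \<Longrightarrow> b (X t) (e i) = r i t * b a (e i)"
    and r1: "\<And>t i. t \<in> S \<Longrightarrow> i \<in> I \<Longrightarrow> \<bar>r i t\<bar> \<le> 1"
    and r0: "\<And>i. i \<in> I \<Longrightarrow> (r i \<longlongrightarrow> 0) F" and S: "eventually (\<lambda>t. t \<in> S) F"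
  shows "(X \<longlongrightarrow> 0) F"
proof -
  have "((\<lambda>t. b (X t) (X t)) \<longlongrightarrow> 0) F"
  proof (rule tendstoI)
    fix \<epsilon> :: real assume eps: "0 < \<epsilon>"
    have pa: "((\<lambda>i. (b a (e i))\<^sup>2) has_sum b a a) I" using a by (rule parseval_sq)
    then have "eventually (\<lambda>G. dist (\<Sum>i\<in>G. (b a (e i))\<^sup>2) (b a a) < \<epsilon> / 2) (finite_subsets_at_top I)"
      unfolding has_sum_def using eps by (intro tendstoD) auto
    then obtain G where G: "finite G" "G \<subseteq> I" "dist (\<Sum>i\<in>G. (b a (e i))\<^sup>2) (b a a) < \<epsilon> / 2"
      by (auto simp: eventually_finite_subsets_at_top)
    have "((\<lambda>t. \<Sum>i\<in>G. (r i t * b a (e i))\<^sup>2) \<longlongrightarrow> (\<Sum>i\<in>G. (0 * b a (e i))\<^sup>2)) F"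
      using G r0 by (intro tendsto_intros) auto
    then have "eventually (\<lambda>t. dist (\<Sum>i\<in>G. (r i t * b a (e i))\<^sup>2) 0 < \<epsilon> / 2) F"
      using eps by (intro tendstoD) auto
    then show "eventually (\<lambda>t. dist (b (X t) (X t)) 0 < \<epsilon>) F" using S
    proof eventually_elim
      case (elim t)
      have "((\<lambda>i. (b (X t) (e i))\<^sup>2) has_sum (b (X t) (X t) - (\<Sum>i\<in>G. (b (X t) (e i))\<^sup>2))) (I - G)"
        using has_sum_Diff[OF parseval_sq[OF X[OF elim(2)]] _ G(2)] G(1) by (simp add: has_sum_finite)
      moreover have "((\<lambda>i. (b a (e i))\<^sup>2) has_sum (b a a - (\<Sum>i\<in>G. (b a (e i))\<^sup>2))) (I - G)"
        using has_sum_Diff[OF pa _ G(2)] G(1) by (simp add: has_sum_finite)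
      ultimately have "b (X t) (X t) - (\<Sum>i\<in>G. (b (X t) (e i))\<^sup>2) \<le> b a a - (\<Sum>i\<in>G. (b a (e i))\<^sup>2)"
      proof (rule has_sum_mono)
        fix i assume i: "i \<in> I - G"
        then have "(r i t)\<^sup>2 \<le> 1" using r1[OF elim(2), of i] by (simp add: abs_square_le_1)
        then show "(b (X t) (e i))\<^sup>2 \<le> (b a (e i))\<^sup>2"
          using coeff[OF elim(2), of i] i by (simp add: power_mult_distrib mult_left_le_one_le)
      qed
      moreover have "(\<Sum>i\<in>G. (b (X t) (e i))\<^sup>2) = (\<Sum>i\<in>G. (r i t * b a (e i))\<^sup>2)"
        using G coeff[OF elim(2)] by (intro sum.cong) auto
      moreover have "0 \<le> b (X t) (X t)" using X elim by (intro pos) auto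
      ultimately show ?case using G(3) elim(1) unfolding dist_real_def by linarith
    qed
  qed
  moreover have "eventually (\<lambda>t. X t \<in> M) F" using S by (rule eventually_mono) (rule X)
  ultimately show ?thesis using tendsto_0_iff by blast
qed

end

section \<open>Compact positive operators\<close>

text \<open>Strict positivity excludes a kernel, so eigenvectors with positive eigenvalue will
  already be total. Compactness is stated on bounded sequences, the form in which Rellich's theorem
  delivers it.\<close>

locale compact_positive = hilbert_form +
  fixes G :: "'a \<Rightarrow> 'a"
  assumes G_mem: "x \<in> M \<Longrightarrow> G x \<in> M"
    and G_add: "x \<in> M \<Longrightarrow> y \<in> M \<Longrightarrow> G (x + y) = G x + G y"
    and G_scale: "x \<in> M \<Longrightarrow> G (r *\<^sub>R x) = r *\<^sub>R G x"
    and G_sym: "x \<in> M \<Longrightarrow> y \<in> M \<Longrightarrow> b (G x) y = b x (G y)"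
    and G_pos: "x \<in> M \<Longrightarrow> x \<noteq> 0 \<Longrightarrow> 0 < b (G x) x"
    and G_bounded: "\<exists>C. \<forall>x\<in>M. norm (G x) \<le> C * norm x"
    and G_compact: "(\<And>n::nat. X n \<in> M) \<Longrightarrow> bounded (range X) \<Longrightarrow>
      \<exists>r l. strict_mono r \<and> (\<lambda>n. G (X (r n))) \<longlonglongrightarrow> l"
begin

lemma G_diff: "x \<in> M \<Longrightarrow> y \<in> M \<Longrightarrow> G (x - y) = G x - G y"
  using G_add[of x "(-1) *\<^sub>R y"] G_scale[of y "-1"] M_mem(4)[of y "-1"] by simp

lemma G_zero: "G 0 = 0"
  using G_scale[of 0 0] M_mem(1) by simp

lemma G_nonneg: "x \<in> M \<Longrightarrow> 0 \<le> b (G x) x"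
  using G_pos[of x] by (cases "x = 0") (auto simp: bsimps)

text \<open>\<open>b (G x) y\<close> is itself a positive symmetric form, so the argument of
  \<open>cauchy_schwarz\<close> applies to it.\<close>

lemma cauchy_schwarz_G:
  assumes "x \<in> M" "y \<in> M" shows "(b (G x) y)\<^sup>2 \<le> b (G x) x * b (G y) y"
proof (cases "y = 0")
  case True
  then show ?thesis by (simp add: bsimps)
next
  case False
  define z where "z = b (G y) y *\<^sub>R x - b (G x) y *\<^sub>R y"
  have yy: "0 < b (G y) y" using G_pos assms False by auto
  have z: "z \<in> M" unfolding z_def using assms by (intro M_mem)
  have Gz: "G z = b (G y) y *\<^sub>R G x - b (G x) y *\<^sub>R G y" unfolding z_def
    using assms by (simp add: G_diff G_scale M_mem)
  have s: "b (G y) x = b (G x) y" using G_sym[OF assms] sym[of x "G y"] by simp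
  have "0 \<le> b (G z) z" using z by (rule G_nonneg)
  also have "b (G z) z = b (G y) y * (b (G x) x * b (G y) y - (b (G x) y)\<^sup>2)"
    unfolding Gz by (simp add: z_def bsimps s algebra_simps power2_eq_square)
  finally show ?thesis using yy by (simp add: zero_le_mult_iff)
qed

text \<open>The maximum of the Rayleigh quotient over an invariant subspace is attained at an eigenvector.\<close>

lemma eigenvector_exists:
  assumes N: "subspace N" "closed N" "N \<subseteq> M" "\<And>x. x \<in> N \<Longrightarrow> G x \<in> N" and ne: "y \<in> N" "y \<noteq> 0"
  obtains v k where "v \<in> N" "b v v = 1" "0 < k" "G v = k *\<^sub>R v"
proof -
  define Q where "Q = (\<lambda>x. b (G x) x) ` {x \<in> N. b x x = 1}"
  obtain C0 where C0: "\<And>x. x \<in> M \<Longrightarrow> norm (G x) \<le> C0 * norm x" using G_bounded by blast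
  define C where "C = \<bar>C0\<bar>"
  have C: "norm (G x) \<le> C * norm x" if "x \<in> M" for x
    by (rule order_trans[OF C0[OF that]]) (auto simp: C_def intro: mult_right_mono)
  obtain K where K: "0 < K" "\<And>x y. \<bar>b x y\<bar> \<le> K * norm x * norm y" using bound by blast
  have bddQ: "bdd_above Q" unfolding Q_def
  proof (rule bdd_aboveI2)
    fix x assume x: "x \<in> {x \<in> N. b x x = 1}"
    then have xM: "x \<in> M" using N by auto
    have n1: "(norm x)\<^sup>2 \<le> 1 / c" using coercive[OF xM] x c_pos by (simp add: field_simps)
    have "b (G x) x \<le> K * norm (G x) * norm x" using K(2)[of "G x" x] by linarith
    also have "\<dots> \<le> K * (C * norm x) * norm x"
      using K(1) C[OF xM] by (intro mult_right_mono mult_left_mono) auto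
    also have "\<dots> = K * C * (norm x)\<^sup>2" by (simp add: power2_eq_square)
    also have "\<dots> \<le> K * C * (1 / c)" using n1 K(1) by (intro mult_left_mono) (auto simp: C_def)
    finally show "b (G x) x \<le> K * C * (1 / c)" .
  qed
  define k where "k = Sup Q"
  have scale: "(1 / sqrt (b x x)) *\<^sub>R x \<in> {x \<in> N. b x x = 1}" if "x \<in> N" "x \<noteq> 0" for x
  proof -
    have "0 < b x x" using pos_strict that N by auto
    then show ?thesis using that N(1) by (simp add: bsimps subspace_scale)
  qed
  have ray: "b (G x) x \<le> k * b x x" if x: "x \<in> N" for x
  proof (cases "x = 0")
    case True then show ?thesis by (simp add: bsimps)
  next
    case False
    have p: "0 < b x x" using pos_strict x False N by auto
    have "b (G ((1 / sqrt (b x x)) *\<^sub>R x)) ((1 / sqrt (b x x)) *\<^sub>R x) \<le> k"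
      unfolding k_def Q_def[symmetric] using scale[OF x False] bddQ
      by (intro cSup_upper) (auto simp: Q_def)
    then show ?thesis using p x N by (simp add: G_scale subset_iff bsimps field_simps)
  qed
  have kpos: "0 < k"
  proof -
    have "0 < b (G y) y" using G_pos ne N by auto
    also have "\<dots> \<le> k * b y y" using ne by (intro ray)
    finally show ?thesis using pos[of y] ne N by (auto simp: zero_less_mult_iff)
  qed
  have "\<exists>x\<in>N. b x x = 1 \<and> k - 1 / real (Suc n) < b (G x) x" for n
  proof -
    have "Q \<noteq> {}" unfolding Q_def using scale[OF ne] by auto
    moreover have "k - 1 / real (Suc n) < Sup Q" unfolding k_def by simp
    ultimately have "\<exists>q\<in>Q. k - 1 / real (Suc n) < q" using less_cSup_iff bddQ by blast
    then show ?thesis by (auto simp: Q_def)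
  qed
  then obtain X where X: "\<And>n. X n \<in> N" "\<And>n. b (X n) (X n) = 1"
    "\<And>n. k - 1 / real (Suc n) < b (G (X n)) (X n)" by metis
  have XM: "X n \<in> M" for n using X N by auto
  have "(\<lambda>n. k - 1 / real (Suc n)) \<longlonglongrightarrow> k - 0"
    using LIMSEQ_inverse_real_of_nat by (intro tendsto_intros) (simp add: inverse_eq_divide)
  then have "(\<lambda>n. k - 1 / real (Suc n)) \<longlonglongrightarrow> k" by simp
  then have lim1: "(\<lambda>n. b (G (X n)) (X n)) \<longlonglongrightarrow> k"
  proof (rule real_tendsto_sandwich[rotated 2])
    show "\<forall>\<^sub>F n in sequentially. b (G (X n)) (X n) \<le> k" using ray[OF X(1)] X(2) by auto
    show "\<forall>\<^sub>F n in sequentially. k - 1 / real (Suc n) \<le> b (G (X n)) (X n)"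
      using X(3) by (intro always_eventually) (auto intro: less_imp_le)
  qed auto
  \<comment> \<open>Cauchy-Schwarz for the form of \<open>G\<close>, applied to \<open>x\<close> and
    \<open>G x\<close>, together with the Rayleigh bound at \<open>G x\<close>. It makes the
    residual \<open>D\<close> of a maximizing sequence tend to zero.\<close>
  have GG: "b (G x) (G x) \<le> k * b (G x) x" if x: "x \<in> N" for x
  proof (cases "G x = 0")
    case True then show ?thesis by (simp add: bsimps)
  next
    case False
    have xM: "x \<in> M" and gM: "G x \<in> M" using x N G_mem by auto
    have "(b (G x) (G x))\<^sup>2 \<le> b (G x) x * b (G (G x)) (G x)" using xM gM by (rule cauchy_schwarz_G)
    also have "\<dots> \<le> b (G x) x * (k * b (G x) (G x))" using ray[OF N(4)[OF x]] G_nonneg[OF xM]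
      by (intro mult_left_mono)
    finally have "b (G x) (G x) * b (G x) (G x) \<le> b (G x) (G x) * (k * b (G x) x)"
      by (simp add: power2_eq_square mult.commute mult.left_commute)
    then show ?thesis using pos_strict[OF gM False] by simp
  qed
  define D where "D n = G (X n) - k *\<^sub>R X n" for n
  have DM: "D n \<in> M" for n unfolding D_def using XM by (intro M_mem G_mem)
  have "(\<lambda>n. b (D n) (D n)) \<longlonglongrightarrow> 0"
  proof (rule real_tendsto_sandwich[OF _ _ tendsto_const])
    show "\<forall>\<^sub>F n in sequentially. 0 \<le> b (D n) (D n)" using pos[OF DM] by auto
    have "b (D n) (D n) \<le> k * (k - b (G (X n)) (X n))" for n
    proof -
      have "b (D n) (D n) = b (G (X n)) (G (X n)) - 2 * k * b (G (X n)) (X n) + k * k" unfolding D_def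
        by (simp add: bsimps X(2) sym[of "X n" "G (X n)"] algebra_simps)
      then show ?thesis using GG[OF X(1), of n] by (simp add: algebra_simps)
    qed
    then show "\<forall>\<^sub>F n in sequentially. b (D n) (D n) \<le> k * (k - b (G (X n)) (X n))" by auto
    have "(\<lambda>n. k * (k - b (G (X n)) (X n))) \<longlonglongrightarrow> k * (k - k)" using lim1 by (intro tendsto_intros)
    then show "(\<lambda>n. k * (k - b (G (X n)) (X n))) \<longlonglongrightarrow> 0" by simp
  qed
  then have D0: "D \<longlonglongrightarrow> 0" using tendsto_0_iff[of D sequentially] DM by auto
  have "bounded (range X)"
  proof (rule boundedI)
    fix x assume "x \<in> range X"
    then obtain n where n: "x = X n" by auto
    show "norm x \<le> sqrt (1 / c)" using norm_le_sqrt[OF XM[of n]] X(2)[of n] n by simp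
  qed
  then obtain r l where r: "strict_mono r" "(\<lambda>n. G (X (r n))) \<longlonglongrightarrow> l" using G_compact XM by blast
  \<comment> \<open>Compactness gives convergence of \<open>G (X (r n))\<close> only; since
    \<open>X (r n)\<close> is \<open>1 / k\<close> times the difference of that and the residual,
    the maximizing sequence itself converges to \<open>v\<close>.\<close>
  define v where "v = (1 / k) *\<^sub>R l"
  have "(\<lambda>n. (1 / k) *\<^sub>R (G (X (r n)) - D (r n))) \<longlonglongrightarrow> (1 / k) *\<^sub>R (l - 0)"
    using r(2) LIMSEQ_subseq_LIMSEQ[OF D0 r(1)] by (intro tendsto_intros) (auto simp: o_def)
  then have Xv: "(\<lambda>n. X (r n)) \<longlonglongrightarrow> v" using kpos by (simp add: D_def v_def)
  have vN: "v \<in> N" using closed_sequentially[OF N(2) _ Xv] X(1) by blast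
  have "(\<lambda>n. b (X (r n)) (X (r n))) \<longlonglongrightarrow> b v v" using Xv by (intro b.tendsto)
  then have v1: "b v v = 1" using X(2) by (simp add: LIMSEQ_const_iff)
  have vM: "v \<in> M" using vN N by auto
  have "(\<lambda>n. G (X (r n)) - G v) \<longlonglongrightarrow> 0"
  proof (rule Lim_null_comparison)
    have "norm (G (X (r n)) - G v) \<le> C * norm (X (r n) - v)" for n
      using C[of "X (r n) - v"] XM vM by (simp add: G_diff M_mem)
    then show "\<forall>\<^sub>F n in sequentially. norm (G (X (r n)) - G v) \<le> C * norm (X (r n) - v)" by auto
    have "(\<lambda>n. C * norm (X (r n) - v)) \<longlonglongrightarrow> C * norm (v - v)" using Xv by (intro tendsto_intros)
    then show "(\<lambda>n. C * norm (X (r n) - v)) \<longlonglongrightarrow> 0" by simp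
  qed
  then have "(\<lambda>n. G (X (r n))) \<longlonglongrightarrow> G v" by (simp add: LIM_zero_iff)
  then have "G v = l" using r(2) LIMSEQ_unique by blast
  then have "G v = k *\<^sub>R v" unfolding v_def using kpos by simp
  then show ?thesis using that vN v1 kpos by blast
qed

text \<open>Zorn's lemma gives a maximal orthonormal set of eigenvectors. Its orthogonal complement
  is closed and \<open>G\<close>-invariant by symmetry, so if it were not zero it would contain a
  further eigenvector. Infinitely many eigenvalues above \<open>k > 0\<close> would give images
  under \<open>G\<close> at mutual squared \<open>b\<close>-distance at least
  \<open>k\<^sup>2\<close>, against compactness.\<close>

lemma spectral:
  obtains E ev where "hilbert_basis M b c E (\<lambda>x. x)" "\<And>x. x \<in> E \<Longrightarrow> G x = ev x *\<^sub>R x"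
    "\<And>x. x \<in> E \<Longrightarrow> 0 < ev x" "\<And>k. 0 < k \<Longrightarrow> finite {x \<in> E. k \<le> ev x}"
proof -
  define EV where "EV = {x \<in> M. b x x = 1 \<and> (\<exists>k. G x = k *\<^sub>R x)}"
  define \<A> where "\<A> = {E. E \<subseteq> EV \<and> (\<forall>x\<in>E. \<forall>y\<in>E. x \<noteq> y \<longrightarrow> b x y = 0)}"
  have "\<A> \<noteq> {}" unfolding \<A>_def by auto
  moreover have "\<Union>\<C> \<in> \<A>" if "\<C> \<noteq> {}" "subset.chain \<A> \<C>" for \<C>
  proof -
    have sub: "\<And>S. S \<in> \<C> \<Longrightarrow> S \<in> \<A>" using that(2) by (auto simp: subset.chain_def)
    have "b x y = 0" if x: "x \<in> \<Union>\<C>" and y: "y \<in> \<Union>\<C>" and xy: "x \<noteq> y" for x y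
    proof -
      obtain S S' where S: "x \<in> S" "S \<in> \<C>" "y \<in> S'" "S' \<in> \<C>" using x y by auto
      then have "S \<subseteq> S' \<or> S' \<subseteq> S" using \<open>subset.chain \<A> \<C>\<close> by (auto simp: subset.chain_def)
      then obtain R where "R \<in> \<C>" "x \<in> R" "y \<in> R" using S by auto
      then show ?thesis using sub xy unfolding \<A>_def by blast
    qed
    moreover have "\<Union>\<C> \<subseteq> EV" using sub unfolding \<A>_def by auto
    ultimately show ?thesis unfolding \<A>_def by blast
  qed
  ultimately obtain E where E: "E \<in> \<A>" and max: "\<And>S. S \<in> \<A> \<Longrightarrow> E \<subseteq> S \<Longrightarrow> S = E"
    using subset_Zorn_nonempty[of \<A>] by blast
  have EM: "x \<in> M" and E1: "b x x = 1" and Eev: "\<exists>k. G x = k *\<^sub>R x" if "x \<in> E" for x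
    using E that unfolding \<A>_def EV_def by auto
  have orth: "b x y = 0" if "x \<in> E" "y \<in> E" "x \<noteq> y" for x y using E that unfolding \<A>_def by auto
  define ev where "ev x = b (G x) x" for x
  have Gev: "G x = ev x *\<^sub>R x" if "x \<in> E" for x
    using Eev[OF that] E1[OF that] by (auto simp: ev_def bsimps)
  have E0: "x \<noteq> 0" if "x \<in> E" for x using E1[OF that] by (auto simp: bsimps)
  have "hilbert_basis M b c E (\<lambda>x. x)"
  proof unfold_locales
    show "x = 0" if x: "x \<in> M" "\<And>i. i \<in> E \<Longrightarrow> b x i = 0" for x
    proof (rule ccontr)
      assume x0: "x \<noteq> 0"
      define N where "N = M \<inter> (\<Inter>e\<in>E. {x. b x e = 0})"
      have "subspace N" unfolding N_def subspace_def by (auto simp: M_mem bsimps)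
      moreover have "closed N" unfolding N_def
        by (intro closed_Int closed_M closed_INT ballI closed_Collect_eq)
          (auto intro!: linear_continuous_on b.bounded_linear_left continuous_intros)
      moreover have "N \<subseteq> M" unfolding N_def by auto
      moreover have "G z \<in> N" if "z \<in> N" for z
        using that G_sym[of z] EM G_mem Gev unfolding N_def by (auto simp: bsimps)
      moreover have "x \<in> N" unfolding N_def using x by auto
      ultimately obtain v k where v: "v \<in> N" "b v v = 1" "G v = k *\<^sub>R v"
        using eigenvector_exists x0 by metis
      have "b v y = 0" "b y v = 0" if "y \<in> E" for y using v that sym[of y v] unfolding N_def by auto
      moreover have "v \<in> EV" using v unfolding EV_def N_def by blast
      ultimately have "insert v E \<in> \<A>" using E unfolding \<A>_def by auto
      then have "v \<in> E" using max by blast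
      then show False using v unfolding N_def by auto
    qed
  qed (auto simp: EM E1 orth)
  moreover have "0 < ev x" if "x \<in> E" for x
    unfolding ev_def using G_pos EM E0 that by auto
  moreover have "finite {x \<in> E. k \<le> ev x}" if k: "0 < k" for k
  proof (rule ccontr)
    assume "infinite {x \<in> E. k \<le> ev x}"
    then obtain X :: "nat \<Rightarrow> _" where X: "inj X" "range X \<subseteq> {x \<in> E. k \<le> ev x}"
      using infinite_countable_subset by blast
    then have XE: "X n \<in> E" and Xk: "k \<le> ev (X n)" for n by auto
    have "bounded (range X)"
    proof (rule boundedI)
      fix x assume "x \<in> range X"
      then obtain n where n: "x = X n" by auto
      show "norm x \<le> sqrt (1 / c)" using norm_le_sqrt[OF EM[OF XE[of n]]] E1[OF XE[of n]] n by simp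
    qed
    then obtain r l where r: "strict_mono r" "(\<lambda>n. G (X (r n))) \<longlonglongrightarrow> l" using G_compact EM XE by blast
    define d where "d n = G (X (r (Suc n))) - G (X (r n))" for n
    have "d \<longlonglongrightarrow> l - l" unfolding d_def using r(2) LIMSEQ_Suc by (intro tendsto_diff) auto
    then have "(\<lambda>n. b (d n) (d n)) \<longlonglongrightarrow> b 0 0" by (intro b.tendsto) auto
    then have "(\<lambda>n. b (d n) (d n)) \<longlonglongrightarrow> 0" by (simp add: bsimps)
    moreover have "k\<^sup>2 \<le> b (d n) (d n)" for n
    proof -
      let ?x = "X (r (Suc n))" and ?y = "X (r n)"
      have ne: "?x \<noteq> ?y" using X(1) r(1) by (metis injD lessI less_irrefl strict_mono_less)
      have "b (d n) (d n) = (ev ?x)\<^sup>2 + (ev ?y)\<^sup>2" unfolding d_def Gev[OF XE]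
        using orth[OF XE XE ne] orth[OF XE XE ne[symmetric]] E1[OF XE]
        by (simp add: bsimps power2_eq_square)
      moreover have "k\<^sup>2 \<le> (ev ?x)\<^sup>2" using Xk k by (intro power_mono) auto
      ultimately show ?thesis by (simp add: add_increasing2)
    qed
    ultimately have "k\<^sup>2 \<le> 0" by (intro LIMSEQ_le_const) auto
    then show False using k by simp
  qed
  ultimately show ?thesis using that[of E ev] Gev by blast
qed

end

section \<open>Diagonal semigroups\<close>

locale diagonal_semigroup = hilbert_basis +
  fixes \<theta> :: "'b \<Rightarrow> real" and \<omega> :: real
  assumes omega: "0 < \<omega>" and theta: "i \<in> I \<Longrightarrow> \<theta> i \<le> - \<omega>"
begin

definition T :: "real \<Rightarrow> 'a \<Rightarrow> 'a" where
  "T t x = (SOME z. z \<in> M \<and> (\<forall>i\<in>I. b z (e i) = exp (\<theta> i * t) * b x (e i)))"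

lemma exp_theta: "i \<in> I \<Longrightarrow> 0 \<le> t \<Longrightarrow> exp (\<theta> i * t) \<le> exp (- \<omega> * t)"
  using theta mult_right_mono[of "\<theta> i" "- \<omega>" t] by simp

lemma exp_theta_le_1: "i \<in> I \<Longrightarrow> 0 \<le> t \<Longrightarrow> exp (\<theta> i * t) \<le> 1"
  using theta[of i] omega by (simp add: mult_nonpos_nonneg)

lemma T_props:
  assumes "x \<in> M" "0 \<le> t"
  shows T_mem: "T t x \<in> M" and T_coeff: "i \<in> I \<Longrightarrow> b (T t x) (e i) = exp (\<theta> i * t) * b x (e i)"
proof -
  obtain z where "z \<in> M" "\<And>i. i \<in> I \<Longrightarrow> b z (e i) = exp (\<theta> i * t) * b x (e i)"
    by (rule multiplier[OF assms(1), of "\<lambda>i. exp (\<theta> i * t)" 1])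
      (use exp_theta_le_1 assms(2) in auto)
  then have "\<exists>z. z \<in> M \<and> (\<forall>i\<in>I. b z (e i) = exp (\<theta> i * t) * b x (e i))" by blast
  from someI_ex[OF this] show "T t x \<in> M" "i \<in> I \<Longrightarrow> b (T t x) (e i) = exp (\<theta> i * t) * b x (e i)"
    unfolding T_def[symmetric] by blast+
qed

lemma T_linear:
  assumes "x \<in> M" "y \<in> M" "0 \<le> t"
  shows "T t (p *\<^sub>R x + q *\<^sub>R y) = p *\<^sub>R T t x + q *\<^sub>R T t y"
  by (rule eqI) (use assms in \<open>auto intro!: M_mem T_mem simp: T_coeff M_mem bsimps algebra_simps\<close>)

lemma T_zero: "x \<in> M \<Longrightarrow> T 0 x = x"
  by (rule eqI) (auto simp: T_mem T_coeff)

lemma T_add: "x \<in> M \<Longrightarrow> 0 \<le> s \<Longrightarrow> 0 \<le> t \<Longrightarrow> T (s + t) x = T s (T t x)"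
  by (rule eqI) (auto simp: T_mem T_coeff exp_add distrib_left)

lemma T_decay: "x \<in> M \<Longrightarrow> 0 \<le> t \<Longrightarrow> b (T t x) (T t x) \<le> (exp (- \<omega> * t))\<^sup>2 * b x x"
  by (intro coeff_le T_mem) (auto simp: T_coeff abs_mult intro!: mult_right_mono dest: exp_theta)

lemma T_cont:
  assumes "x \<in> M" shows "((\<lambda>t. T t x - x) \<longlongrightarrow> 0) (at_right 0)"
proof (rule dominated[of x "{0<..}" _ "\<lambda>i t. exp (\<theta> i * t) - 1"])
  show "((\<lambda>t. exp (\<theta> i * t) - 1) \<longlongrightarrow> 0) (at_right 0)" for i
    by (rule tendsto_eq_intros refl | simp)+
  show "\<bar>exp (\<theta> i * t) - 1\<bar> \<le> 1" if "t \<in> {0<..}" "i \<in> I" for t i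
    using exp_theta_le_1[of i t] that by (simp add: abs_le_iff)
qed (use assms in \<open>auto intro!: M_mem T_mem simp: bsimps T_coeff algebra_simps eventually_at_right_less\<close>)

lemma diff_quotient: "((\<lambda>t. (exp (\<theta> i * t) - 1) / t) \<longlongrightarrow> \<theta> i) (at_right 0)"
proof -
  have "((\<lambda>t. exp (\<theta> i * t)) has_real_derivative \<theta> i) (at 0)"
    by (auto intro!: derivative_eq_intros)
  then have "((\<lambda>t. (exp (\<theta> i * t) - 1) / t) \<longlongrightarrow> \<theta> i) (at 0)"
    by (simp add: DERIV_def)
  then show ?thesis by (rule filterlim_mono) (auto simp: at_within_le_at)
qed

text \<open>Membership of \<open>x\<close> in the domain is hidden in the existence of
  \<open>g\<close> in \<open>M\<close>: its coefficients must be those of \<open>x\<close> times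
  \<open>\<theta>\<close>. Sufficiency is \<open>dominated\<close> by \<open>g\<close>, because the
  factor \<open>(exp s - 1) / s - 1\<close> lies between -1 and 0 for \<open>s < 0\<close>.\<close>

lemma generator_iff:
  assumes x: "x \<in> M" and g: "g \<in> M"
  shows "((\<lambda>t. (1 / t) *\<^sub>R (T t x - x) - g) \<longlongrightarrow> 0) (at_right 0) \<longleftrightarrow> (\<forall>i\<in>I. b g (e i) = \<theta> i * b x (e i))"
proof
  assume lim: "((\<lambda>t. (1 / t) *\<^sub>R (T t x - x) - g) \<longlongrightarrow> 0) (at_right 0)"
  show "\<forall>i\<in>I. b g (e i) = \<theta> i * b x (e i)"
  proof
    fix i assume i: "i \<in> I"
    have "((\<lambda>t. b ((1 / t) *\<^sub>R (T t x - x) - g) (e i)) \<longlongrightarrow> b 0 (e i)) (at_right 0)"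
      using lim by (intro b.tendsto tendsto_const)
    then have l1: "((\<lambda>t. b ((1 / t) *\<^sub>R (T t x - x) - g) (e i)) \<longlongrightarrow> 0) (at_right 0)" by (simp add: bsimps)
    have "((\<lambda>t. (exp (\<theta> i * t) - 1) / t * b x (e i) - b g (e i)) \<longlongrightarrow> \<theta> i * b x (e i) - b g (e i)) (at_right 0)"
      by (intro tendsto_intros diff_quotient)
    moreover have "\<forall>\<^sub>F t in at_right 0. (exp (\<theta> i * t) - 1) / t * b x (e i) - b g (e i) =
        b ((1 / t) *\<^sub>R (T t x - x) - g) (e i)"
      using eventually_at_right_less
      by eventually_elim (use x i in \<open>simp add: bsimps T_coeff algebra_simps diff_divide_distrib\<close>)
    ultimately have "((\<lambda>t. b ((1 / t) *\<^sub>R (T t x - x) - g) (e i)) \<longlongrightarrow> \<theta> i * b x (e i) - b g (e i)) (at_right 0)"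
      by (rule Lim_transform_eventually)
    from tendsto_unique[OF _ this l1] show "b g (e i) = \<theta> i * b x (e i)" by simp
  qed
next
  assume eq: "\<forall>i\<in>I. b g (e i) = \<theta> i * b x (e i)"
  have th: "\<theta> i < 0" if "i \<in> I" for i using theta[OF that] omega by linarith
  show "((\<lambda>t. (1 / t) *\<^sub>R (T t x - x) - g) \<longlongrightarrow> 0) (at_right 0)"
  proof (rule dominated[of g "{0<..}" _ "\<lambda>i t. (exp (\<theta> i * t) - 1) / t / \<theta> i - 1"])
    show "((\<lambda>t. (exp (\<theta> i * t) - 1) / t / \<theta> i - 1) \<longlongrightarrow> 0) (at_right 0)" if "i \<in> I" for i
    proof -
      have "((\<lambda>t. (exp (\<theta> i * t) - 1) / t / \<theta> i - 1) \<longlongrightarrow> \<theta> i / \<theta> i - 1) (at_right 0)"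
        using th[OF that] by (intro tendsto_intros diff_quotient) auto
      then show ?thesis using th[OF that] by simp
    qed
    show "\<bar>(exp (\<theta> i * t) - 1) / t / \<theta> i - 1\<bar> \<le> 1" if t: "t \<in> {0<..}" and i: "i \<in> I" for t i
    proof -
      define s where "s = \<theta> i * t"
      have s: "s < 0" unfolding s_def using t th[OF i] by (simp add: mult_neg_pos)
      have "(exp s - 1) / s \<le> 1" using exp_ge_add_one_self[of s] s by (simp add: field_simps)
      moreover have "0 \<le> (exp s - 1) / s" using s by (simp add: divide_nonpos_neg)
      moreover have "(exp (\<theta> i * t) - 1) / t / \<theta> i = (exp s - 1) / s" by (simp add: s_def mult.commute)
      ultimately show ?thesis by simp
    qed
    show "b ((1 / t) *\<^sub>R (T t x - x) - g) (e i) = ((exp (\<theta> i * t) - 1) / t / \<theta> i - 1) * b g (e i)"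
      if t: "t \<in> {0<..}" and i: "i \<in> I" for t i
      using t th[OF i] eq i x by (simp add: bsimps T_coeff field_simps)
  qed (use x g in \<open>auto intro!: M_mem T_mem simp: eventually_at_right_less\<close>)
qed

end

section \<open>Integration, differentiation and Fourier uniqueness on the torus\<close>

section \<open>Integration on the torus\<close>

definition cell :: "(real ^ 'd::finite) set" where
  "cell = {x. \<forall>i. 0 \<le> x $ i \<and> x $ i < 2 * pi}"

lemma torus_eq: "torus = restrict_space lborel cell"
  unfolding torus_def cell_def ..

lemma cell_borel [measurable]: "cell \<in> sets borel"
  unfolding cell_def by measurable

lemma space_torus [simp]: "space torus = cell"
  by (simp add: torus_eq space_restrict_space)

lemma cell_sets_torus: "cell \<in> sets torus"
  using sets.top[of torus] by simp

lemma measurable_torus [measurable_dest]: "f \<in> borel_measurable borel \<Longrightarrow> f \<in> borel_measurable torus"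
  unfolding torus_eq by (intro measurable_restrict_space1) simp

lemma AE_torus: "(AE x in torus. P x) \<longleftrightarrow> (AE x in lborel. x \<in> cell \<longrightarrow> P x)"
  unfolding torus_eq by (intro AE_restrict_space_iff) auto

lemma integral_torus:
  "(\<integral>x. f x \<partial>torus) = (\<integral>x. indicator cell x *\<^sub>R (f x :: 'b::{banach, second_countable_topology}) \<partial>lborel)"
  unfolding torus_eq by (intro integral_restrict_space) auto

lemma integrable_torus:
  "integrable torus f \<longleftrightarrow> integrable lborel (\<lambda>x. indicator cell x *\<^sub>R (f x :: 'b::{banach, second_countable_topology}))"
  unfolding torus_eq by (intro integrable_restrict_space) auto

lemma emeasure_torus_finite: "emeasure torus (cell :: (real ^ 'd::finite) set) < \<infinity>"
proof -
  have "emeasure torus (cell :: (real ^ 'd) set) = emeasure lborel (cell :: (real ^ 'd) set)"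
    unfolding torus_eq by (subst emeasure_restrict_space) auto
  also have "\<dots> \<le> emeasure lborel (cbox 0 (\<chi> i. 2 * pi) :: (real ^ 'd) set)"
    by (intro emeasure_mono) (auto simp: cell_def mem_box_cart less_imp_le)
  also have "\<dots> < \<infinity>" by (rule emeasure_lborel_cbox_finite)
  finally show ?thesis .
qed

interpretation torus: finite_measure "torus :: (real ^ 'd::finite) measure"
  by (rule finite_measureI) (use emeasure_torus_finite in \<open>auto simp: less_top\<close>)

text \<open>The number \<open>(2 \<pi>)\<^sup>d\<close>. By \<open>cas_orthogonal\<close> it is also
  the squared norm of every Hartley function.\<close>

definition vol :: "'d::finite itself \<Rightarrow> real" where
  "vol _ = measure torus (cell :: (real ^ 'd) set)"

lemma vol_pos: "0 < vol TYPE('d::finite)"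
proof -
  let ?B = "box 0 (\<chi> i. 2 * pi) :: (real ^ 'd) set"
  have "0 < measure lborel ?B"
    by (subst measure_lborel_box_eq) (auto intro!: prod_pos simp: Basis_vec_def inner_axis)
  also have "\<dots> = measure torus ?B" unfolding torus_eq
    by (subst measure_restrict_space) (auto simp: cell_def mem_box_cart less_imp_le)
  also have "\<dots> \<le> vol TYPE('d)" unfolding vol_def
    by (intro torus.finite_measure_mono cell_sets_torus) (auto simp: cell_def mem_box_cart less_imp_le)
  finally show ?thesis .
qed

lemma integrable_torus_bounded:
  assumes "f \<in> borel_measurable borel" "\<And>x. norm (f x) \<le> C"
  shows "integrable torus (f :: _ \<Rightarrow> 'b::{banach, second_countable_topology})"
  by (rule torus.integrable_const_bound[of _ C]) (use assms in \<open>auto intro: measurable_torus\<close>)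

lemma integrable_mult_bounded:
  fixes f g :: "real ^ 'd::finite \<Rightarrow> real"
  assumes f: "integrable torus f" and g: "g \<in> borel_measurable borel" "\<And>x. \<bar>g x\<bar> \<le> C"
  shows "integrable torus (\<lambda>x. f x * g x)"
proof (rule Bochner_Integration.integrable_bound)
  show "integrable torus (\<lambda>x. C * f x)" using f by simp
  show "(\<lambda>x. f x * g x) \<in> borel_measurable torus"
    using f measurable_torus[OF g(1)] by (intro borel_measurable_times) auto
  have "\<bar>f x * g x\<bar> \<le> \<bar>C * f x\<bar>" for x
  proof -
    have "\<bar>g x\<bar> \<le> \<bar>C\<bar>" using g(2)[of x] by linarith
    then show ?thesis by (simp add: abs_mult mult.commute[of "\<bar>f x\<bar>"] mult_right_mono)
  qed
  then show "AE x in torus. norm (f x * g x) \<le> norm (C * f x)" by simp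
qed

section \<open>Periodic functions\<close>

lemma axis_add: "axis i (s + t) = axis i s + (axis i t :: real ^ 'd)"
  by (simp add: vec_eq_iff axis_def)

lemma periodic_add: "periodic f \<Longrightarrow> f (x + axis i (2 * pi)) = f x"
  by (simp add: periodic_def)

lemma axis_zero [simp]: "axis i 0 = 0"
  by (simp add: vec_eq_iff axis_def)

lemma periodic_int:
  assumes "periodic f" shows "f (x + axis i (2 * pi * of_int n)) = f x"
proof (induction n arbitrary: x rule: int_induct[where k = 0])
  case base
  show ?case by simp
next
  case (step1 n)
  have "axis i (2 * pi * of_int (n + 1)) = axis i (2 * pi * of_int n) + (axis i (2 * pi) :: real ^ 'a)"
    by (simp add: axis_add[symmetric] algebra_simps)
  then show ?case using periodic_add[OF assms, of "x + axis i (2 * pi * of_int n)" i] step1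
    by (simp add: add.assoc)
next
  case (step2 n)
  have "axis i (2 * pi * of_int n) = axis i (2 * pi * of_int (n - 1)) + (axis i (2 * pi) :: real ^ 'a)"
    by (simp add: axis_add[symmetric] algebra_simps)
  then show ?case using periodic_add[OF assms, of "x + axis i (2 * pi * of_int (n - 1))" i] step2(2)[of x]
    by (simp add: add.assoc)
qed

definition fold_cell :: "real ^ 'd::finite \<Rightarrow> real ^ 'd" where
  "fold_cell x = (\<chi> i. x $ i + 2 * pi * of_int (- \<lfloor>x $ i / (2 * pi)\<rfloor>))"

lemma fold_cell_in: "fold_cell x \<in> cell"
proof -
  have "0 \<le> a + 2 * pi * of_int (- \<lfloor>a / (2 * pi)\<rfloor>)" "a + 2 * pi * of_int (- \<lfloor>a / (2 * pi)\<rfloor>) < 2 * pi" for a :: real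
  proof -
    have "of_int \<lfloor>a / (2 * pi)\<rfloor> * (2 * pi) \<le> a" "a < (of_int \<lfloor>a / (2 * pi)\<rfloor> + 1) * (2 * pi)"
      using floor_divide_lower[of "2 * pi" a] floor_divide_upper[of "2 * pi" a] by simp_all
    then show "0 \<le> a + 2 * pi * of_int (- \<lfloor>a / (2 * pi)\<rfloor>)" "a + 2 * pi * of_int (- \<lfloor>a / (2 * pi)\<rfloor>) < 2 * pi"
      by (simp_all add: algebra_simps)
  qed
  then show ?thesis unfolding fold_cell_def cell_def by simp
qed

lemma periodic_fold:
  fixes f :: "real ^ 'd::finite \<Rightarrow> 'b"
  assumes "periodic f" shows "f (fold_cell x) = f x"
proof -
  define n :: "'d \<Rightarrow> int" where "n i = - \<lfloor>x $ i / (2 * pi)\<rfloor>" for i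
  have "f (x + (\<Sum>i\<in>A. axis i (2 * pi * of_int (n i)))) = f x" if "finite A" for A
    using that
  proof (induction A)
    case (insert i A)
    then show ?case using periodic_int[OF assms, of "x + (\<Sum>i\<in>A. axis i (2 * pi * of_int (n i)))" i "n i"]
      by (simp add: ac_simps)
  qed simp
  from this[of UNIV] have "f (x + (\<Sum>i\<in>UNIV. axis i (2 * pi * of_int (n i)))) = f x" by simp
  moreover have "x + (\<Sum>i\<in>UNIV. axis i (2 * pi * of_int (n i))) = fold_cell x"
    unfolding fold_cell_def vec_eq_iff by (auto simp: sum_component axis_def n_def)
  ultimately show ?thesis by simp
qed

lemma periodic_ext:
  assumes "periodic f" "\<And>x. x \<in> cell \<Longrightarrow> P (f x)" shows "P (f x)"
  using assms(2)[OF fold_cell_in] periodic_fold[OF assms(1)] by simp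

lemma periodic_bounded:
  fixes f :: "real ^ 'd::finite \<Rightarrow> real"
  assumes "periodic f" "continuous_on UNIV f"
  obtains C where "0 < C" "\<And>x. \<bar>f x\<bar> \<le> C"
proof -
  let ?K = "cbox 0 (\<chi> i. 2 * pi) :: (real ^ 'd) set"
  have "bounded (f ` ?K)"
    using assms(2) by (intro compact_imp_bounded compact_continuous_image) (auto intro: continuous_on_subset)
  then obtain C where C: "0 < C" "\<And>x. x \<in> ?K \<Longrightarrow> \<bar>f x\<bar> \<le> C" by (auto simp: bounded_pos)
  have "\<bar>f x\<bar> \<le> C" for x
    by (rule periodic_ext[OF assms(1)], rule C(2)) (auto simp: cell_def mem_box_cart less_imp_le)
  then show ?thesis using that C(1) by blast
qed

lemma integrable_torus_continuous:
  fixes f :: "real ^ 'd::finite \<Rightarrow> real"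
  assumes "periodic f" "continuous_on UNIV f" shows "integrable torus f"
proof -
  obtain C where "\<And>x. \<bar>f x\<bar> \<le> C" using periodic_bounded[OF assms] by blast
  then show ?thesis using assms(2)
    by (intro integrable_torus_bounded[of _ C] borel_measurable_continuous_onI) auto
qed

lemma integrable_mult_continuous:
  fixes f g :: "real ^ 'd::finite \<Rightarrow> real"
  assumes "integrable torus f" "periodic g" "continuous_on UNIV g"
  shows "integrable torus (\<lambda>x. f x * g x)"
proof -
  obtain C where "\<And>x. \<bar>g x\<bar> \<le> C" using periodic_bounded[OF assms(2,3)] by blast
  then show ?thesis using assms by (intro integrable_mult_bounded borel_measurable_continuous_onI)
qed

lemma lborel_integral_translate:
  fixes g :: "real ^ 'd::finite \<Rightarrow> real"
  assumes "g \<in> borel_measurable borel"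
  shows "(\<integral>x. g (x - c) \<partial>lborel) = (\<integral>x. g x \<partial>lborel)"
    and "integrable lborel (\<lambda>x. g (x - c)) \<longleftrightarrow> integrable lborel g"
proof -
  have "(\<integral>x. g (- c + x) \<partial>lborel) = (\<integral>x. g x \<partial>distr lborel borel ((+) (- c)))"
    using assms by (subst integral_distr) auto
  then show "(\<integral>x. g (x - c) \<partial>lborel) = (\<integral>x. g x \<partial>lborel)" by (simp add: lborel_distr_plus)
  have "integrable lborel (\<lambda>x. g (- c + x)) \<longleftrightarrow> integrable (distr lborel borel ((+) (- c))) g"
    using assms by (subst integrable_distr_eq) auto
  then show "integrable lborel (\<lambda>x. g (x - c)) \<longleftrightarrow> integrable lborel g" by (simp add: lborel_distr_plus)
qed

text \<open>The shifted cell is cut along \<open>x $ i = t\<close> and one piece is moved back by a period.\<close>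

lemma integral_torus_shift:
  fixes f :: "real ^ 'd::finite \<Rightarrow> real"
  assumes per: "periodic f" and f [measurable]: "f \<in> borel_measurable borel" and int: "integrable torus f"
    and t: "0 \<le> t" "t \<le> 2 * pi"
  shows "(\<integral>x. f (x + axis i t) \<partial>torus) = (\<integral>x. f x \<partial>torus)"
proof -
  define A where "A = {x \<in> cell. t \<le> x $ i}"
  define B where "B = {x \<in> cell. x $ i < t}"
  define p :: "real ^ 'd" where "p = axis i (2 * pi)"
  have AB [measurable]: "A \<in> sets borel" "B \<in> sets borel" unfolding A_def B_def by measurable
  have intc: "integrable lborel (\<lambda>x. indicator cell x * f x)" using int by (simp add: integrable_torus)
  have iA: "integrable lborel (\<lambda>x. indicator A x * f x)" and iB: "integrable lborel (\<lambda>x. indicator B x * f x)"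
    by (rule Bochner_Integration.integrable_bound[OF intc]; auto simp: A_def B_def indicator_def)+
  have fp: "f (x - p) = f x" for x using periodic_add[OF per, of "x - p" i] by (simp add: p_def)
  have iB': "integrable lborel (\<lambda>x. indicator B (x - p) * f x)"
    using lborel_integral_translate(2)[of "\<lambda>x. indicator B x * f x" p] iB unfolding fp by simp
  have split: "indicator cell (x - axis i t) = (indicator A x + indicator B (x - p) :: real)" for x
  proof -
    have c: "x - axis i t \<in> cell \<longleftrightarrow> (\<forall>j. j \<noteq> i \<longrightarrow> 0 \<le> x $ j \<and> x $ j < 2 * pi) \<and> t \<le> x $ i \<and> x $ i < 2 * pi + t"
      unfolding cell_def by (auto simp: axis_def)
    have a: "x \<in> A \<longleftrightarrow> (\<forall>j. j \<noteq> i \<longrightarrow> 0 \<le> x $ j \<and> x $ j < 2 * pi) \<and> t \<le> x $ i \<and> x $ i < 2 * pi"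
      unfolding A_def cell_def using t by (auto intro: order_trans)
    have b: "x - p \<in> B \<longleftrightarrow> (\<forall>j. j \<noteq> i \<longrightarrow> 0 \<le> x $ j \<and> x $ j < 2 * pi) \<and> 2 * pi \<le> x $ i \<and> x $ i < 2 * pi + t"
      unfolding B_def cell_def p_def using t by (auto simp: axis_def)
    show ?thesis unfolding indicator_def c a b using t by auto
  qed
  have "(\<integral>x. f (x + axis i t) \<partial>torus) = (\<integral>x. indicator cell (x - - axis i t - axis i t) * f (x - - axis i t) \<partial>lborel)"
    unfolding integral_torus by simp
  also have "\<dots> = (\<integral>x. indicator cell (x - axis i t) * f x \<partial>lborel)"
    by (rule lborel_integral_translate(1)[of "\<lambda>x. indicator cell (x - axis i t) * f x"]) measurable
  also have "\<dots> = (\<integral>x. indicator A x * f x + indicator B (x - p) * f x \<partial>lborel)"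
    by (simp only: split distrib_right)
  also have "\<dots> = (\<integral>x. indicator A x * f x \<partial>lborel) + (\<integral>x. indicator B (x - p) * f x \<partial>lborel)"
    using iA iB' by simp
  also have "(\<integral>x. indicator B (x - p) * f x \<partial>lborel) = (\<integral>x. indicator B x * f x \<partial>lborel)"
    using lborel_integral_translate(1)[of "\<lambda>x. indicator B x * f x" p] unfolding fp by simp
  also have "(\<integral>x. indicator A x * f x \<partial>lborel) + \<dots> = (\<integral>x. indicator A x * f x + indicator B x * f x \<partial>lborel)"
    using iA iB by simp
  also have "\<dots> = (\<integral>x. indicator cell x * f x \<partial>lborel)"
    by (rule Bochner_Integration.integral_cong) (auto simp: A_def B_def indicator_def)
  finally show ?thesis by (simp add: integral_torus)
qed

section \<open>Partial derivatives along a coordinate\<close>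

text \<open>A one coordinate version of C1: it is what integration by parts asks for, and the class
  is closed under sums, products, exponentials and convolution, so that \<open>\<mu>\<close> can be
  handled without its Frechet derivative.\<close>

definition C1_along :: "'d::finite \<Rightarrow> (real ^ 'd \<Rightarrow> real) \<Rightarrow> (real ^ 'd \<Rightarrow> real) \<Rightarrow> bool" where
  "C1_along i f f' \<longleftrightarrow> continuous_on UNIV f \<and> continuous_on UNIV f' \<and> periodic f \<and> periodic f' \<and>
     (\<forall>x. ((\<lambda>t. f (x + axis i t)) has_real_derivative f' x) (at 0))"

lemma C1_alongD:
  assumes "C1_along i f f'"
  shows "continuous_on UNIV f" "continuous_on UNIV f'" "periodic f" "periodic f'"
    "((\<lambda>t. f (x + axis i t)) has_real_derivative f' x) (at 0)"
  using assms by (auto simp: C1_along_def)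

lemma C1_along_at:
  assumes "C1_along i f f'"
  shows "((\<lambda>t. f (x + axis i t)) has_real_derivative f' (x + axis i t)) (at t)"
proof -
  have "((\<lambda>s. f (x + axis i t + axis i s)) has_real_derivative f' (x + axis i t)) (at 0)"
    by (rule C1_alongD(5)[OF assms])
  then have "((\<lambda>s. f (x + axis i (s + t))) has_real_derivative f' (x + axis i t)) (at 0)"
    by (simp add: axis_add ac_simps)
  then show ?thesis
    using DERIV_shift[of "\<lambda>s. f (x + axis i s)" "f' (x + axis i t)" 0 t] by simp
qed

lemma C1_along_lipschitz:
  assumes f: "C1_along i f f'" and C: "\<And>x. \<bar>f' x\<bar> \<le> C"
  shows "\<bar>f (x + axis i t) - f x\<bar> \<le> C * \<bar>t\<bar>"
proof -
  have "norm (f (x + axis i t) - f (x + axis i 0)) \<le> C * norm (t - 0)"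
    by (rule field_differentiable_bound[of UNIV "\<lambda>t. f (x + axis i t)" "\<lambda>t. f' (x + axis i t)"])
      (use C C1_along_at[OF f] in \<open>auto intro: has_field_derivative_at_within\<close>)
  then show ?thesis by simp
qed

lemma periodic_comb:
  fixes f g :: "real ^ 'd::finite \<Rightarrow> real"
  shows "periodic f \<Longrightarrow> periodic g \<Longrightarrow> periodic (\<lambda>x. f x + g x)"
  "periodic f \<Longrightarrow> periodic g \<Longrightarrow> periodic (\<lambda>x. f x - g x)"
  "periodic f \<Longrightarrow> periodic g \<Longrightarrow> periodic (\<lambda>x. f x * g x)"
  "periodic f \<Longrightarrow> periodic g \<Longrightarrow> periodic (\<lambda>x. f x / g x)"
  "periodic (\<lambda>x. c)"
  by (auto simp: periodic_def)

lemma C1_along_add: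
  assumes f: "C1_along i f f'" and g: "C1_along i g g'"
  shows "C1_along i (\<lambda>x. f x + g x) (\<lambda>x. f' x + g' x)"
  using C1_alongD(1-4)[OF f] C1_alongD(1-4)[OF g] DERIV_add[OF C1_alongD(5)[OF f] C1_alongD(5)[OF g]]
  unfolding C1_along_def by (intro conjI allI continuous_intros periodic_comb)

lemma C1_along_cmult:
  assumes f: "C1_along i f f'" shows "C1_along i (\<lambda>x. c * f x) (\<lambda>x. c * f' x)"
  using C1_alongD(1-4)[OF f] DERIV_cmult[OF C1_alongD(5)[OF f]]
  unfolding C1_along_def by (intro conjI allI continuous_intros periodic_comb)

lemma C1_along_mult:
  assumes f: "C1_along i f f'" and g: "C1_along i g g'"
  shows "C1_along i (\<lambda>x. f x * g x) (\<lambda>x. f' x * g x + f x * g' x)"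
proof -
  have "((\<lambda>t. f (x + axis i t) * g (x + axis i t)) has_real_derivative f' x * g x + f x * g' x) (at 0)" for x
    using DERIV_mult[OF C1_alongD(5)[OF f, of x] C1_alongD(5)[OF g, of x]] by (simp add: algebra_simps)
  then show ?thesis using C1_alongD(1-4)[OF f] C1_alongD(1-4)[OF g]
    unfolding C1_along_def by (intro conjI allI continuous_intros periodic_comb)
qed

lemma C1_along_exp:
  assumes f: "C1_along i f f'" shows "C1_along i (\<lambda>x. exp (f x)) (\<lambda>x. exp (f x) * f' x)"
proof -
  have "((\<lambda>t. exp (f (x + axis i t))) has_real_derivative exp (f x) * f' x) (at 0)" for x
    using DERIV_fun_exp[OF C1_alongD(5)[OF f, of x]] by simp
  moreover have "periodic (\<lambda>x. exp (f x))" using C1_alongD(3)[OF f] by (simp add: periodic_def)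
  ultimately show ?thesis using C1_alongD(1-4)[OF f]
    unfolding C1_along_def by (intro conjI allI continuous_intros periodic_comb)
qed

text \<open>The difference quotients of \<open>f\<close> along the axis have integral zero by
  translation invariance, and they converge boundedly because \<open>f\<close> is Lipschitz in that
  direction.\<close>

lemma integral_C1_along:
  assumes f: "C1_along i f f'" shows "(\<integral>x. f' x \<partial>torus) = 0"
proof -
  note fD = C1_alongD[OF f]
  obtain C where C: "\<And>x. \<bar>f' x\<bar> \<le> C" using periodic_bounded[OF fD(4,2)] by blast
  \<comment> \<open>All steps are at most 1, hence below one period as
    \<open>integral_torus_shift\<close> requires.\<close>
  define s where "s n = inverse (real (Suc n))" for n
  have s: "0 < s n" "s n \<le> 1" for n unfolding s_def by (auto simp: field_simps)
  have s0: "s \<longlonglongrightarrow> 0" unfolding s_def by (rule LIMSEQ_inverse_real_of_nat)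
  define q where "q n x = (f (x + axis i (s n)) - f x) / s n" for n x
  have m: "continuous_on UNIV (q n)" for n
    unfolding q_def using fD(1) s(1)[of n] by (auto intro!: continuous_intros continuous_on_compose2[OF fD(1)])
  have "(\<lambda>n. \<integral>x. q n x \<partial>torus) \<longlonglongrightarrow> (\<integral>x. f' x \<partial>torus)"
  proof (rule integral_dominated_convergence[where w = "\<lambda>_. C"])
    show "f' \<in> borel_measurable torus" "\<And>n. q n \<in> borel_measurable torus"
      using fD(2) m by (auto intro!: measurable_torus borel_measurable_continuous_onI)
    show "AE x in torus. norm (q n x) \<le> C" for n
      using C1_along_lipschitz[OF f C, of _ "s n"] s[of n] by (auto simp: q_def abs_divide divide_le_eq)
    show "AE x in torus. (\<lambda>n. q n x) \<longlonglongrightarrow> f' x"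
    proof (rule AE_I2)
      fix x
      have "((\<lambda>h. (f (x + axis i h) - f x) / h) \<longlongrightarrow> f' x) (at 0)"
        using fD(5)[of x] by (simp add: DERIV_def)
      then show "(\<lambda>n. q n x) \<longlonglongrightarrow> f' x" unfolding q_def
        by (rule filterlim_compose) (use s0 s(1) in \<open>auto simp: filterlim_at less_imp_neq[symmetric]\<close>)
    qed
  qed simp
  moreover have "(\<integral>x. q n x \<partial>torus) = 0" for n
  proof -
    have i: "integrable torus f" using fD by (intro integrable_torus_continuous)
    have p: "periodic (\<lambda>x. f (x + axis i (s n)))"
      using fD(3) unfolding periodic_def by (metis add.assoc add.commute)
    have c: "continuous_on UNIV (\<lambda>x. f (x + axis i (s n)))"
      by (auto intro!: continuous_intros continuous_on_compose2[OF fD(1)])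
    have i': "integrable torus (\<lambda>x. f (x + axis i (s n)))" using p c by (rule integrable_torus_continuous)
    have "(\<integral>x. q n x \<partial>torus) = ((\<integral>x. f (x + axis i (s n)) \<partial>torus) - (\<integral>x. f x \<partial>torus)) / s n"
      unfolding q_def using i i' by simp
    also have "(\<integral>x. f (x + axis i (s n)) \<partial>torus) = (\<integral>x. f x \<partial>torus)"
    proof (rule integral_torus_shift)
      show "s n \<le> 2 * pi" using s(2)[of n] pi_gt3 by linarith
    qed (use fD i s[of n] in \<open>auto intro: borel_measurable_continuous_onI\<close>)
    finally show ?thesis by simp
  qed
  ultimately show ?thesis by (simp add: LIMSEQ_const_iff)
qed

lemma integration_by_parts:
  assumes "C1_along i f f'" "C1_along i g g'"
  shows "(\<integral>x. f' x * g x \<partial>torus) = - (\<integral>x. f x * g' x \<partial>torus)"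
proof -
  have "(\<integral>x. f' x * g x + f x * g' x \<partial>torus) = 0"
    using C1_along_mult[OF assms] by (rule integral_C1_along)
  moreover have "integrable torus (\<lambda>x. f' x * g x)" "integrable torus (\<lambda>x. f x * g' x)"
    using C1_alongD(1-4)[OF assms(1)] C1_alongD(1-4)[OF assms(2)]
    by (auto intro!: integrable_torus_continuous continuous_intros periodic_comb)
  ultimately show ?thesis by simp
qed

lemma periodic_shift:
  assumes "periodic f" shows "(\<lambda>y. f (y + axis i (2 * pi))) = f"
  using assms by (auto simp: periodic_def)

lemma pd_C1_along:
  assumes "periodic f" "Ck 1 f" shows "C1_along i f (pd i f)"
proof -
  have d: "(f has_derivative frechet_derivative f (at x)) (at x)" for x
    using assms(2) by (simp add: frechet_derivative_works[symmetric])
  have "continuous_on UNIV f"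
    using assms(2) by (auto intro!: differentiable_imp_continuous_on simp: differentiable_on_def differentiable_at_withinI)
  moreover have "continuous_on UNIV (pd i f)" using assms(2) by simp
  moreover have "pd i f (x + axis j (2 * pi)) = pd i f x" for x j
  proof -
    have "((\<lambda>y. f (y + axis j (2 * pi))) has_derivative frechet_derivative f (at (x + axis j (2 * pi)))) (at x)"
      by (rule has_derivative_compose[of "\<lambda>y. y + axis j (2 * pi)" "\<lambda>h. h", OF _ d])
        (auto intro!: derivative_eq_intros)
    then have "(f has_derivative frechet_derivative f (at (x + axis j (2 * pi)))) (at x)"
      by (simp only: periodic_shift[OF assms(1)])
    then have "frechet_derivative f (at (x + axis j (2 * pi))) = frechet_derivative f (at x)"
      using d[of x] has_derivative_unique by blast
    then show ?thesis by (simp add: pd_def)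
  qed
  moreover have "((\<lambda>t. f (x + axis i t)) has_real_derivative pd i f x) (at 0)" for x
  proof -
    have ax: "t *\<^sub>R axis i (1 :: real) = axis i t" for t by (simp add: vec_eq_iff axis_def)
    have "((\<lambda>t. f (x + t *\<^sub>R axis i 1)) has_derivative (\<lambda>t. frechet_derivative f (at (x + 0 *\<^sub>R axis i 1)) (t *\<^sub>R axis i 1))) (at 0)"
      by (rule has_derivative_compose[OF _ d]) (auto intro!: derivative_eq_intros)
    moreover have "frechet_derivative f (at x) (t *\<^sub>R axis i 1) = pd i f x * t" for t
      using linear_scale[OF has_derivative_linear[OF d[of x]]] by (simp add: pd_def)
    ultimately show ?thesis unfolding has_field_derivative_def by (simp add: ax)
  qed
  ultimately show ?thesis using assms(1) unfolding C1_along_def periodic_def by blast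
qed

lemma Ck2_C1_along:
  assumes "periodic f" "Ck 2 f"
  shows "C1_along i f (pd i f)" "C1_along j (pd i f) (pd j (pd i f))"
proof -
  have c1: "Ck 1 (pd k f)" for k using assms(2) by (simp add: numeral_2_eq_2)
  have "continuous_on UNIV (pd k f)" for k
    using c1[of k] by (auto intro!: differentiable_imp_continuous_on simp: differentiable_on_def differentiable_at_withinI)
  then have "Ck 1 f" using assms(2) by (simp add: numeral_2_eq_2)
  then show 1: "C1_along i f (pd i f)" by (rule pd_C1_along[OF assms(1)])
  show "C1_along j (pd i f) (pd j (pd i f))"
    using C1_alongD(4)[OF 1] c1 by (rule pd_C1_along)
qed

lemma pd_eqI: "(f has_derivative D) (at x) \<Longrightarrow> pd i f x = D (axis i 1)"
  unfolding pd_def by (drule frechet_derivative_at) simp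

section \<open>Hartley functions\<close>

text \<open>The functions \<open>cos (k \<bullet> x) + sin (k \<bullet> x)\<close> form a real orthogonal system indexed by the whole
  lattice, and \<open>\<partial>\<^sub>i\<close> maps the one with index \<open>k\<close> to \<open>k\<^sub>i\<close> times the one with index \<open>- k\<close>.\<close>

definition phase :: "int ^ 'd::finite \<Rightarrow> real ^ 'd \<Rightarrow> real" where
  "phase k x = (\<Sum>i\<in>UNIV. of_int (k $ i) * x $ i)"

definition cas :: "int ^ 'd::finite \<Rightarrow> real ^ 'd \<Rightarrow> real" where
  "cas k x = cos (phase k x) + sin (phase k x)"

lemma phase_simps: "phase (k + l) x = phase k x + phase l x" "phase (k - l) x = phase k x - phase l x"
  "phase (- k) x = - phase k x" "phase 0 x = 0" "phase k (x + y) = phase k x + phase k y"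
  "phase k (axis i t) = of_int (k $ i) * t" "phase (axis i 1) x = x $ i"
  by (simp_all add: phase_def algebra_simps sum.distrib sum_subtractf sum_negf axis_def if_distrib
      if_distribR cong: if_cong)

lemma cas_zero: "cas 0 x = 1"
  by (simp add: cas_def phase_simps)

lemma phase_has_derivative: "(phase k has_derivative phase k) (at x)"
  unfolding phase_def
  by (intro bounded_linear_imp_has_derivative bounded_linear_sum bounded_linear_const_mult bounded_linear_vec_nth)

lemma cas_has_derivative: "(cas k has_derivative (\<lambda>h. cas (- k) x * phase k h)) (at x)"
proof -
  have "(cas k has_derivative (\<lambda>h. - sin (phase k x) * phase k h + cos (phase k x) * phase k h)) (at x)"
    unfolding cas_def by (auto intro!: derivative_eq_intros phase_has_derivative simp: algebra_simps)
  then show ?thesis by (simp add: cas_def phase_simps algebra_simps)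
qed

lemma cas_continuous: "continuous_on UNIV (cas k)"
  by (intro continuous_at_imp_continuous_on ballI has_derivative_continuous[OF cas_has_derivative])

lemma cas_measurable [measurable]: "cas k \<in> borel_measurable borel"
  by (intro borel_measurable_continuous_onI cas_continuous)

lemma cas_bounded: "\<bar>cas k x\<bar> \<le> 2"
proof -
  have "\<bar>cas k x\<bar> \<le> \<bar>cos (phase k x)\<bar> + \<bar>sin (phase k x)\<bar>" unfolding cas_def by (rule abs_triangle_ineq)
  then show ?thesis using abs_cos_le_one[of "phase k x"] abs_sin_le_one[of "phase k x"] by linarith
qed

lemma cas_periodic: "periodic (cas k)"
proof -
  have "of_int (k $ i) * (2 * pi) = (2 * pi) * of_int (k $ i)" for i by simp
  then show ?thesis unfolding periodic_def cas_def phase_simps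
    by (simp only: cos_add sin_add cos_int_2pin sin_int_2pin) simp
qed

lemma cas_C1_along: "C1_along i (cas k) (\<lambda>x. of_int (k $ i) * cas (- k) x)"
  unfolding C1_along_def
proof (intro conjI allI)
  fix x
  have "((\<lambda>t. cos (phase k x + of_int (k $ i) * t) + sin (phase k x + of_int (k $ i) * t)) has_real_derivative
      of_int (k $ i) * cas (- k) x) (at 0)"
    by (auto intro!: derivative_eq_intros simp: cas_def phase_simps algebra_simps)
  then show "((\<lambda>t. cas k (x + axis i t)) has_real_derivative of_int (k $ i) * cas (- k) x) (at 0)"
    by (simp add: cas_def phase_simps)
qed (auto intro!: continuous_intros cas_continuous cas_periodic periodic_comb)

text \<open>If \<open>k $ i \<noteq> 0\<close> then \<open>cas k\<close> is, up to a nonzero factor,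
  the derivative of the periodic function \<open>cas (- k)\<close> along \<open>i\<close>.\<close>

lemma integral_cas: "(\<integral>x. cas (k :: int ^ 'd::finite) x \<partial>torus) = (if k = 0 then vol TYPE('d) else 0)"
proof (cases "k = 0")
  case True
  then show ?thesis by (simp add: cas_zero vol_def)
next
  case False
  then obtain i where i: "k $ i \<noteq> 0" by (auto simp: vec_eq_iff)
  have "(\<integral>x. of_int ((- k) $ i) * cas (- (- k)) x \<partial>torus) = 0"
    by (rule integral_C1_along[OF cas_C1_along])
  then show ?thesis using i False by simp
qed

text \<open>The product of two Hartley functions is \<open>cos (a - b) + sin (a + b)\<close> in
  their phases \<open>a\<close> and \<open>b\<close>; the two summands are the even part of one
  Hartley function and the odd part of another.\<close>

lemma cas_mult: "cas k x * cas l x = (cas (k - l) x + cas (l - k) x) / 2 + (cas (k + l) x - cas (- (k + l)) x) / 2"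
  unfolding cas_def phase_simps by (simp add: cos_add sin_add cos_diff sin_diff field_simps)

lemma cas_integrable: "integrable torus (cas k)"
  by (intro integrable_torus_continuous cas_periodic cas_continuous)

lemma cas_orthogonal:
  "(\<integral>x. cas k x * cas (l :: int ^ 'd::finite) x \<partial>torus) = (if k = l then vol TYPE('d) else 0)"
proof -
  have "(\<integral>x. cas k x * cas l x \<partial>torus) = ((\<integral>x. cas (k - l) x \<partial>torus) + (\<integral>x. cas (l - k) x \<partial>torus)) / 2
      + ((\<integral>x. cas (k + l) x \<partial>torus) - (\<integral>x. cas (- (k + l)) x \<partial>torus)) / 2"
    unfolding cas_mult by (simp add: cas_integrable del: minus_add_distrib)
  then show ?thesis unfolding integral_cas neg_equal_0_iff_equal by auto
qed

lemma cas_Ck: "Ck n (\<lambda>x. a * cas k x)"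
proof (induction n arbitrary: a k)
  case 0
  then show ?case by (auto intro!: continuous_intros cas_continuous)
next
  case (Suc n)
  have d: "((\<lambda>x. a * cas k x) has_derivative (\<lambda>h. a * (cas (- k) x * phase k h))) (at x)" for x
    by (rule has_derivative_mult_right[OF cas_has_derivative])
  have "pd i (\<lambda>x. a * cas k x) = (\<lambda>x. (a * of_int (k $ i)) * cas (- k) x)" for i
    by (simp add: fun_eq_iff pd_eqI[OF d] phase_simps)
  moreover have "(\<lambda>x. a * cas k x) differentiable at x" for x using d differentiable_def by blast
  ultimately show ?case using Suc by simp
qed

lemma pd_cas: "pd i (cas k) x = of_int (k $ i) * cas (- k) x"
  using pd_eqI[OF cas_has_derivative, of i k x] by (simp add: phase_simps)

lemma cas_test_fun: "test_fun (cas k)"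
  using cas_Ck[of _ 1 k] cas_periodic[of k] by (simp add: test_fun_def)

section \<open>Uniqueness of Fourier coefficients\<close>

inductive trig_poly :: "(real ^ 'd::finite \<Rightarrow> real) \<Rightarrow> bool" where
  cas: "trig_poly (cas k)"
| add: "trig_poly u \<Longrightarrow> trig_poly v \<Longrightarrow> trig_poly (\<lambda>x. u x + v x)"
| scale: "trig_poly u \<Longrightarrow> trig_poly (\<lambda>x. a * u x)"

lemma trig_poly_const: "trig_poly (\<lambda>x. a)"
  using trig_poly.scale[OF trig_poly.cas[of 0], of a] by (simp add: cas_zero)

lemma trig_poly_diff: "trig_poly u \<Longrightarrow> trig_poly v \<Longrightarrow> trig_poly (\<lambda>x. u x - v x)"
  using trig_poly.add[OF _ trig_poly.scale[of v "-1"], of u] by simp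

lemma trig_poly_sum: "finite A \<Longrightarrow> (\<And>i. i \<in> A \<Longrightarrow> trig_poly (u i)) \<Longrightarrow> trig_poly (\<lambda>x. \<Sum>i\<in>A. u i x)"
  by (induction A rule: finite_induct) (auto intro: trig_poly.add trig_poly_const)

lemma trig_poly_cas_mult: "trig_poly v \<Longrightarrow> trig_poly (\<lambda>x. cas k x * v x)"
proof (induction rule: trig_poly.induct)
  case (cas l)
  have "trig_poly (\<lambda>x. 1 / 2 * (cas (k - l) x + cas (l - k) x) + 1 / 2 * (cas (k + l) x - cas (- (k + l)) x))"
    by (intro trig_poly.intros trig_poly_diff)
  then show ?case unfolding cas_mult by simp
next
  case (add u v)
  then show ?case using trig_poly.add by (simp add: distrib_left)
next
  case (scale u a)
  then show ?case using trig_poly.scale[of _ a] by (simp add: mult.left_commute)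
qed

lemma trig_poly_mult: "trig_poly u \<Longrightarrow> trig_poly v \<Longrightarrow> trig_poly (\<lambda>x. u x * v x)"
proof (induction rule: trig_poly.induct)
  case (cas k)
  then show ?case by (rule trig_poly_cas_mult)
next
  case (add u u')
  then show ?case using trig_poly.add by (simp add: distrib_right)
next
  case (scale u a)
  then show ?case using trig_poly.scale[of _ a] by (simp add: mult.assoc)
qed

text \<open>Stone-Weierstrass is applied on the compact torus in \<open>\<complex>\<^sup>d\<close>; the Borel inverse of the
  parametrization by the cell transfers the result to all Borel sets of the cell.\<close>

definition expi :: "real ^ 'd::finite \<Rightarrow> complex ^ 'd" where
  "expi x = (\<chi> j. cis (x $ j))"

text \<open>Clamping the real part to \<open>[-1, 1]\<close> keeps \<open>arccos\<close> continuous
  on the whole plane, so \<open>angle\<close> is Borel everywhere while inverting \<open>cis\<close>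
  on the half open period.\<close>

definition angle :: "complex \<Rightarrow> real" where
  "angle z = (let a = arccos (max (-1) (min 1 (Re z))) in if 0 \<le> Im z then a else 2 * pi - a)"

definition expi_inv :: "complex ^ 'd::finite \<Rightarrow> real ^ 'd" where
  "expi_inv z = (\<chi> j. angle (z $ j))"

lemma angle_cis:
  assumes "0 \<le> t" "t < 2 * pi" shows "angle (cis t) = t"
proof (cases "t \<le> pi")
  case True
  then have "0 \<le> sin t" using assms by (intro sin_ge_zero) auto
  then show ?thesis using True assms by (simp add: angle_def arccos_cos)
next
  case False
  then have "sin t < 0" using assms by (intro sin_lt_zero) auto
  moreover have "arccos (cos t) = 2 * pi - t"
    using arccos_cos[of "2 * pi - t"] False assms by (simp add: cos_2pi_minus)
  ultimately show ?thesis by (simp add: angle_def)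
qed

lemma expi_inv_expi: "x \<in> cell \<Longrightarrow> expi_inv (expi x) = x"
  by (simp add: expi_inv_def expi_def cell_def angle_cis vec_eq_iff)

lemma angle_measurable: "angle \<in> borel_measurable borel"
proof -
  have "continuous_on UNIV (\<lambda>z :: complex. arccos (max (-1) (min 1 (Re z))))"
    by (intro continuous_on_compose2[OF continuous_on_arccos'] continuous_intros) auto
  then have [measurable]: "(\<lambda>z :: complex. arccos (max (-1) (min 1 (Re z)))) \<in> borel_measurable borel"
    by (rule borel_measurable_continuous_onI)
  have [measurable]: "Im \<in> borel_measurable borel"
    by (intro borel_measurable_continuous_onI continuous_intros)
  show ?thesis unfolding angle_def[abs_def] Let_def by measurable
qed

lemma expi_inv_measurable: "expi_inv \<in> borel_measurable borel"
proof (rule borel_measurable_euclidean_space[THEN iffD2], rule ballI)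
  fix b :: "real ^ 'd" assume "b \<in> Basis"
  then obtain i where b: "b = axis i 1" by (auto simp: Basis_vec_def)
  have "(\<lambda>z :: complex ^ 'd. z $ i) \<in> borel_measurable borel"
    by (intro borel_measurable_continuous_onI continuous_intros)
  then have "(\<lambda>z :: complex ^ 'd. angle (z $ i)) \<in> borel_measurable borel"
    using angle_measurable by (rule measurable_compose)
  then show "(\<lambda>z. expi_inv z \<bullet> b) \<in> borel_measurable borel"
    by (simp add: b expi_inv_def inner_axis)
qed

lemma expi_continuous: "continuous_on UNIV expi"
  unfolding expi_def by (intro continuous_intros)

lemma expi_measurable: "expi \<in> borel_measurable borel"
  using expi_continuous by (rule borel_measurable_continuous_onI)

lemma trig_poly_cos: "trig_poly (\<lambda>x. cos (x $ j))"
proof -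
  have "trig_poly (\<lambda>x. 1 / 2 * (cas (axis j 1) x + cas (- axis j 1) x))"
    by (intro trig_poly.intros)
  then show ?thesis by (simp add: cas_def phase_simps)
qed

lemma trig_poly_sin: "trig_poly (\<lambda>x. sin (x $ j))"
proof -
  have "trig_poly (\<lambda>x. 1 / 2 * (cas (axis j 1) x - cas (- axis j 1) x))"
    by (intro trig_poly.intros trig_poly_diff)
  then show ?thesis by (simp add: cas_def phase_simps)
qed

lemma trig_poly_polynomial:
  "real_polynomial_function p \<Longrightarrow> trig_poly (\<lambda>x. p (expi x))"
proof (induction rule: real_polynomial_function.induct)
  case (linear f)
  interpret bounded_linear f by (rule linear)
  have "f (expi x) = (\<Sum>b\<in>Basis. f b * (expi x \<bullet> b))" for x
  proof -
    have "f (expi x) = f (\<Sum>b\<in>Basis. (expi x \<bullet> b) *\<^sub>R b)" by (simp add: euclidean_representation)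
    also have "\<dots> = (\<Sum>b\<in>Basis. f b * (expi x \<bullet> b))" by (simp add: sum scale mult.commute)
    finally show ?thesis .
  qed
  moreover have "trig_poly (\<lambda>x. expi x \<bullet> b)" if "b \<in> Basis" for b
  proof -
    obtain j u where b: "b = axis j u" "u = 1 \<or> u = \<i>"
      using \<open>b \<in> Basis\<close> by (auto simp: Basis_vec_def Basis_complex_def)
    have "expi x \<bullet> b = (if u = 1 then cos (x $ j) else sin (x $ j))" for x
      using b(2) unfolding b(1) expi_def by (auto simp: inner_axis inner_complex_def)
    then show ?thesis using trig_poly_cos trig_poly_sin by (cases "u = 1") simp_all
  qed
  then have "trig_poly (\<lambda>x. \<Sum>b\<in>Basis. f b * (expi x \<bullet> b))"
    by (intro trig_poly_sum trig_poly.scale) auto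
  ultimately show ?case by simp
qed (auto intro: trig_poly.intros trig_poly_const trig_poly_mult)

text \<open>Orthogonality to the Hartley functions is extended by approximation to trigonometric
  polynomials, continuous functions of \<open>expi\<close>, indicators of closed sets and finally
  Borel sets. As \<open>f\<close> is merely integrable, all these limits are uniform or
  dominated.\<close>

locale vanishing_coefficients =
  fixes f :: "real ^ 'd::finite \<Rightarrow> real"
  assumes int: "integrable torus f" and coeff: "\<And>k. (\<integral>x. f x * cas k x \<partial>torus) = 0"
begin

lemma integral_trig_poly: "trig_poly u \<Longrightarrow> integrable torus (\<lambda>x. f x * u x) \<and> (\<integral>x. f x * u x \<partial>torus) = 0"
proof (induction rule: trig_poly.induct)
  case (cas k)
  then show ?case using coeff integrable_mult_bounded[OF int cas_measurable cas_bounded] by blast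
next
  case (add u v)
  then show ?case by (simp add: distrib_left)
next
  case (scale u a)
  then show ?case by (simp add: mult.left_commute)
qed

lemma integral_continuous:
  fixes F :: "complex ^ 'd \<Rightarrow> real"
  assumes F: "continuous_on UNIV F" and bound: "\<And>z. \<bar>F z\<bar> \<le> C"
  shows "(\<integral>x. f x * F (expi x) \<partial>torus) = 0"
proof -
  let ?I = "\<integral>x. f x * F (expi x) \<partial>torus" and ?N = "\<integral>x. \<bar>f x\<bar> \<partial>torus"
  have mF: "(\<lambda>x. F (expi x)) \<in> borel_measurable borel"
    using F by (intro borel_measurable_continuous_onI continuous_on_compose2[OF F expi_continuous]) auto
  have iF: "integrable torus (\<lambda>x. f x * F (expi x))"
    using int mF bound by (rule integrable_mult_bounded)
  have small: "\<bar>?I\<bar> \<le> \<epsilon> * ?N" if eps: "0 < \<epsilon>" for \<epsilon>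
  proof -
    \<comment> \<open>A compact set containing the image of \<open>expi\<close>: each of the
      \<open>CARD('d)\<close> coordinates has modulus 1.\<close>
    let ?S = "cball (0 :: complex ^ 'd) (real CARD('d))"
    have S: "expi x \<in> ?S" for x :: "real ^ 'd"
    proof -
      have "norm (expi x) \<le> (\<Sum>j\<in>UNIV. norm (expi x $ j))"
        unfolding norm_vec_def by (rule L2_set_le_sum) simp
      then show ?thesis by (simp add: expi_def)
    qed
    obtain p where p: "real_polynomial_function p" "\<And>z. z \<in> ?S \<Longrightarrow> \<bar>F z - p z\<bar> < \<epsilon>"
      using Stone_Weierstrass_real_polynomial_function[OF compact_cball continuous_on_subset[OF F subset_UNIV] eps] by metis
    have ip: "integrable torus (\<lambda>x. f x * p (expi x))" "(\<integral>x. f x * p (expi x) \<partial>torus) = 0"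
      using integral_trig_poly[OF trig_poly_polynomial[OF p(1)]] by auto
    have "?I = (\<integral>x. f x * F (expi x) - f x * p (expi x) \<partial>torus)"
      using iF ip by simp
    also have "\<bar>\<dots>\<bar> \<le> (\<integral>x. \<epsilon> * \<bar>f x\<bar> \<partial>torus)"
    proof (rule order_trans[OF integral_abs_bound], rule integral_mono)
      show "integrable torus (\<lambda>x. \<bar>f x * F (expi x) - f x * p (expi x)\<bar>)" using iF ip by auto
      show "integrable torus (\<lambda>x. \<epsilon> * \<bar>f x\<bar>)" using int by auto
      show "\<bar>f x * F (expi x) - f x * p (expi x)\<bar> \<le> \<epsilon> * \<bar>f x\<bar>" for x
        using p(2)[OF S[of x]] unfolding right_diff_distrib[symmetric] abs_mult
        by (simp add: mult.commute[of \<epsilon>] mult_left_mono)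
    qed
    finally show ?thesis by simp
  qed
  have "\<bar>?I\<bar> \<le> 0"
  proof (rule field_le_epsilon)
    fix e :: real assume e: "0 < e"
    have N: "0 < ?N + 1" by (rule add_nonneg_pos) simp_all
    have "\<bar>?I\<bar> \<le> e / (?N + 1) * ?N" by (intro small divide_pos_pos e N)
    also have "\<dots> \<le> e"
      by (simp only: times_divide_eq_left pos_divide_le_eq[OF N]) (use e in \<open>simp add: distrib_left\<close>)
    finally show "\<bar>?I\<bar> \<le> 0 + e" by simp
  qed
  then show ?thesis by simp
qed

text \<open>The functions \<open>F n\<close> are continuous, bounded by 1 and decrease to the
  indicator; off \<open>A\<close> they vanish for large \<open>n\<close> because a closed set has
  positive distance from such a point.\<close>

lemma integral_closed:
  assumes "closed A" shows "(\<integral>x. f x * indicator A (expi x) \<partial>torus) = 0"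
proof (cases "A = {}")
  case False
  define F where "F n z = max 0 (1 - real n * infdist z A)" for n :: nat and z
  have Fc: "continuous_on UNIV (F n)" for n unfolding F_def by (intro continuous_intros)
  have Fb: "\<bar>F n z\<bar> \<le> 1" for n z unfolding F_def by (simp add: infdist_nonneg)
  have mF: "(\<lambda>x. F n (expi x)) \<in> borel_measurable borel" for n
    by (intro borel_measurable_continuous_onI continuous_on_compose2[OF Fc expi_continuous]) auto
  have mA: "(\<lambda>x. indicator A (expi x) :: real) \<in> borel_measurable borel"
    using expi_measurable borel_measurable_indicator[OF borel_closed[OF assms]] by (rule measurable_compose)
  have "(\<lambda>n. \<integral>x. f x * F n (expi x) \<partial>torus) \<longlonglongrightarrow> (\<integral>x. f x * indicator A (expi x) \<partial>torus)"
  proof (rule integral_dominated_convergence[where w = "\<lambda>x. \<bar>f x\<bar>"])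
    show "AE x in torus. norm (f x * F n (expi x)) \<le> \<bar>f x\<bar>" for n
      using Fb by (simp add: abs_mult mult_left_le)
    show "AE x in torus. (\<lambda>n. f x * F n (expi x)) \<longlonglongrightarrow> f x * indicator A (expi x)"
    proof (rule AE_I2)
      fix x :: "real ^ 'd"
      have "(\<lambda>n. F n (expi x)) \<longlonglongrightarrow> indicator A (expi x)"
      proof (cases "expi x \<in> A")
        case True
        then show ?thesis by (simp add: F_def)
      next
        case n: False
        then have pos: "0 < infdist (expi x) A" using infdist_pos_not_in_closed assms False by blast
        obtain N where N: "1 < real N * infdist (expi x) A" using reals_Archimedean3[OF pos] by blast
        have "F n (expi x) = 0" if "N \<le> n" for n
        proof -
          have "real N * infdist (expi x) A \<le> real n * infdist (expi x) A"
            using that pos by (intro mult_right_mono) auto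
          then show ?thesis using N by (simp add: F_def)
        qed
        then have "\<forall>\<^sub>F n in sequentially. F n (expi x) = 0" unfolding eventually_sequentially by blast
        then show ?thesis using n by (simp add: tendsto_eventually)
      qed
      then show "(\<lambda>n. f x * F n (expi x)) \<longlonglongrightarrow> f x * indicator A (expi x)" by (intro tendsto_intros)
    qed
  qed (use int measurable_torus[OF mF] measurable_torus[OF mA] in auto)
  then show ?thesis using integral_continuous[OF Fc Fb] by (simp add: LIMSEQ_const_iff)
qed simp

text \<open>Closed sets are stable under intersection, so Dynkin's theorem applies. The complement
  step rests on the coefficient at \<open>k = 0\<close>, which says that \<open>f\<close> has
  integral zero.\<close>

lemma integral_borel:
  assumes "A \<in> sets borel" shows "(\<integral>x. indicator (expi -` A) x *\<^sub>R f x \<partial>torus) = 0"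
proof -
  have "Int_stable (Collect closed :: (complex ^ 'd) set set)" by (auto simp: Int_stable_def)
  moreover have "Collect closed \<subseteq> Pow (UNIV :: (complex ^ 'd) set)" by simp
  moreover have "A \<in> sigma_sets UNIV (Collect closed)" using assms by (simp add: borel_eq_closed)
  ultimately show ?thesis
  proof (induction rule: sigma_sets_induct_disjoint)
    case (basic A)
    then show ?case using integral_closed[of A] by (simp add: mult.commute indicator_def)
  next
    case (compl A)
    then have A: "A \<in> sets borel" by (simp add: borel_eq_closed)
    have "expi -` A \<in> sets (borel :: (real ^ 'd) measure)" using measurable_sets[OF expi_measurable A] by simp
    then have "(\<lambda>x. indicator (expi -` A) x :: real) \<in> borel_measurable borel" by simp
    then have "integrable torus (\<lambda>x. f x * indicator (expi -` A) x)"
      using int by (intro integrable_mult_bounded[of _ _ 1]) (auto simp: indicator_def)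
    then have "(\<integral>x. f x - f x * indicator (expi -` A) x \<partial>torus) = (\<integral>x. f x \<partial>torus) - (\<integral>x. f x * indicator (expi -` A) x \<partial>torus)"
      using int by simp
    moreover have "(\<integral>x. f x \<partial>torus) = 0" using coeff[of 0] by (simp add: cas_zero)
    moreover have "indicator (expi -` (UNIV - A)) x *\<^sub>R f x = f x - f x * indicator (expi -` A) x" for x
      by (auto simp: indicator_def)
    ultimately show ?case using compl(2) by (simp add: mult.commute)
  next
    case (union A)
    have A: "range A \<subseteq> sets borel" using union(2) by (simp add: borel_eq_closed)
    have S: "expi -` A i \<inter> cell \<in> sets torus" for i
      using measurable_sets[OF measurable_torus[OF expi_measurable], of "A i"] A by auto
    have c: "(\<integral>x. indicator (expi -` B \<inter> cell) x *\<^sub>R f x \<partial>torus) = (\<integral>x. indicator (expi -` B) x *\<^sub>R f x \<partial>torus)" for B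
      by (rule Bochner_Integration.integral_cong) (auto simp: indicator_def)
    have "set_lebesgue_integral torus (\<Union>i. expi -` A i \<inter> cell) f = (\<Sum>i. set_lebesgue_integral torus (expi -` A i \<inter> cell) f)"
    proof (rule lebesgue_integral_countable_add)
      show "set_integrable torus (\<Union>i. expi -` A i \<inter> cell) f"
        unfolding set_integrable_def using int S
        by (intro integrable_mult_indicator sets.countable_UN) auto
    qed (use S union(1) in \<open>auto simp: disjoint_family_on_def\<close>)
    also have "\<dots> = 0" unfolding set_lebesgue_integral_def c union(3) by simp
    also have "(\<Union>i. expi -` A i \<inter> cell) = expi -` (\<Union>i. A i) \<inter> cell" by auto
    finally show ?case unfolding set_lebesgue_integral_def c .
  qed simp_all
qed

text \<open>On the cell \<open>expi\<close> is injective with Borel inverse \<open>expi_inv\<close>,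
  so every measurable part of the cell is the trace of a preimage under \<open>expi\<close>. The
  sets where \<open>f\<close> is positive and negative then give the integral of
  \<open>\<bar>f\<bar>\<close>.\<close>

lemma AE_zero: "AE x in torus. f x = 0"
proof -
  have mf [measurable]: "f \<in> borel_measurable torus" using int by auto
  have zero: "(\<integral>x. indicator B x *\<^sub>R f x \<partial>torus) = 0" if B: "B \<in> sets torus" for B
  proof -
    have B': "B \<in> sets borel" "B \<subseteq> cell"
      using B unfolding torus_eq by (auto simp: sets_restrict_space)
    have A: "expi_inv -` B \<in> sets borel" using measurable_sets[OF expi_inv_measurable B'(1)] by simp
    have "(\<integral>x. indicator B x *\<^sub>R f x \<partial>torus) = (\<integral>x. indicator (expi -` (expi_inv -` B)) x *\<^sub>R f x \<partial>torus)"
      by (rule Bochner_Integration.integral_cong) (auto simp: indicator_def expi_inv_expi)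
    then show ?thesis using integral_borel[OF A] by simp
  qed
  have B: "{x \<in> space torus. 0 < f x} \<in> sets torus" "{x \<in> space torus. f x < 0} \<in> sets torus" by measurable
  have "(\<integral>x. indicator {x \<in> space torus. 0 < f x} x *\<^sub>R f x - indicator {x \<in> space torus. f x < 0} x *\<^sub>R f x \<partial>torus) = 0"
    using zero[OF B(1)] zero[OF B(2)] integrable_mult_indicator[OF B(1) int] integrable_mult_indicator[OF B(2) int]
    by simp
  moreover have "(\<integral>x. indicator {x \<in> space torus. 0 < f x} x *\<^sub>R f x - indicator {x \<in> space torus. f x < 0} x *\<^sub>R f x \<partial>torus)
    = (\<integral>x. \<bar>f x\<bar> \<partial>torus)"
    by (rule Bochner_Integration.integral_cong) (auto simp: indicator_def)
  ultimately have "(\<integral>x. \<bar>f x\<bar> \<partial>torus) = 0" by simp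
  then have "AE x in torus. \<bar>f x\<bar> = 0"
    using integral_nonneg_eq_0_iff_AE[of torus "\<lambda>x. \<bar>f x\<bar>"] int by simp
  then show ?thesis by simp
qed

end

lemma AE_zero_of_coefficients:
  fixes f :: "real ^ 'd::finite \<Rightarrow> real"
  assumes "integrable torus f" "\<And>k. (\<integral>x. f x * cas k x \<partial>torus) = 0"
  shows "AE x in torus. f x = 0"
  using assms by (intro vanishing_coefficients.AE_zero) unfold_locales

lemma AE_zero_of_test_funs:
  fixes f :: "real ^ 'd::finite \<Rightarrow> complex"
  assumes f: "integrable torus f" and z: "\<And>\<phi>. test_fun \<phi> \<Longrightarrow> (\<integral>x. \<phi> x *\<^sub>R f x \<partial>torus) = 0"
  shows "AE x in torus. f x = 0"
proof -
  have i: "integrable torus (\<lambda>x. cas k x *\<^sub>R f x)" for k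
  proof (rule Bochner_Integration.integrable_bound)
    show "integrable torus (\<lambda>x. 2 *\<^sub>R f x)" using f by simp
    show "(\<lambda>x. cas k x *\<^sub>R f x) \<in> borel_measurable torus"
      using f measurable_torus[OF cas_measurable] by (intro borel_measurable_scaleR) auto
    show "AE x in torus. norm (cas k x *\<^sub>R f x) \<le> norm (2 *\<^sub>R f x)"
      using cas_bounded by (auto intro!: AE_I2 mult_right_mono)
  qed
  have p: "AE x in torus. p (f x) = 0" if p: "bounded_linear p" for p :: "complex \<Rightarrow> real"
  proof (rule AE_zero_of_coefficients)
    show "integrable torus (\<lambda>x. p (f x))" using p f by (rule integrable_bounded_linear)
    fix k
    have "(\<integral>x. p (f x) * cas k x \<partial>torus) = (\<integral>x. p (cas k x *\<^sub>R f x) \<partial>torus)"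
      using linear_scale[OF bounded_linear.linear[OF p]] by (simp add: mult.commute)
    also have "\<dots> = p (\<integral>x. cas k x *\<^sub>R f x \<partial>torus)" using p i by (rule integral_bounded_linear)
    also have "\<dots> = 0" using z[OF cas_test_fun] bounded_linear.linear[OF p] by (simp add: linear_0)
    finally show "(\<integral>x. p (f x) * cas k x \<partial>torus) = 0" .
  qed
  show ?thesis using p[OF bounded_linear_Re] p[OF bounded_linear_Im]
    by eventually_elim (simp add: complex_eq_iff)
qed

section \<open>Convolutions\<close>

lemma conv_real: "conv K f x = (\<integral>y. K (x - y) * f y \<partial>torus)" for f :: "_ \<Rightarrow> real"
  by (simp add: conv_def)

lemma conv_integrable:
  fixes K f :: "real ^ 'd::finite \<Rightarrow> real"
  assumes K: "periodic K" "continuous_on UNIV K" and f: "integrable torus f"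
  shows "integrable torus (\<lambda>y. K (x - y) * f y)"
proof -
  obtain C where C: "\<And>x. \<bar>K x\<bar> \<le> C" using periodic_bounded[OF K] by blast
  have "integrable torus (\<lambda>y. f y * K (x - y))"
    by (rule integrable_mult_bounded[OF f, of _ C])
      (use C in \<open>auto intro!: borel_measurable_continuous_onI continuous_on_compose2[OF K(2)] continuous_intros\<close>)
  then show ?thesis by (simp add: mult.commute)
qed

lemma conv_continuous:
  fixes K f :: "real ^ 'd::finite \<Rightarrow> real"
  assumes K: "periodic K" "continuous_on UNIV K" and f: "integrable torus f"
  shows "continuous_on UNIV (conv K f)"
proof -
  obtain C where C: "\<And>x. \<bar>K x\<bar> \<le> C" using periodic_bounded[OF K] by blast
  have "(\<lambda>n. conv K f (X n)) \<longlonglongrightarrow> conv K f x" if X: "X \<longlonglongrightarrow> x" for X x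
    unfolding conv_real
  proof (rule integral_dominated_convergence[where w = "\<lambda>y. C * \<bar>f y\<bar>"])
    show "AE y in torus. norm (K (X n - y) * f y) \<le> C * \<bar>f y\<bar>" for n
      using C by (auto simp: abs_mult intro!: mult_right_mono)
    show "AE y in torus. (\<lambda>n. K (X n - y) * f y) \<longlonglongrightarrow> K (x - y) * f y"
      using X by (auto intro!: tendsto_intros continuous_on_tendsto_compose[OF K(2)])
  qed (use f conv_integrable[OF K f] in auto)
  then show ?thesis unfolding continuous_on_sequentially by (auto simp: o_def)
qed

lemma conv_periodic: "periodic K \<Longrightarrow> periodic (conv K f)"
proof -
  assume "periodic K"
  then have "K (x + axis i (2 * pi) - y) = K (x - y)" for x y i
    using periodic_add[of K "x - y" i] by (simp add: algebra_simps)
  then show ?thesis by (simp add: periodic_def conv_def)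
qed

text \<open>The derivative falls on the kernel, and \<open>f\<close> is only integrated: the
  Lipschitz bound of \<open>K\<close> dominates the difference quotients by a multiple of
  \<open>\<bar>f\<bar>\<close>.\<close>

lemma conv_C1_along:
  assumes K: "C1_along i K K'" and f: "integrable torus f"
  shows "C1_along i (conv K f) (conv K' f)"
proof -
  note KD = C1_alongD[OF K]
  obtain C where C: "\<And>x. \<bar>K' x\<bar> \<le> C" using periodic_bounded[OF KD(4,2)] by blast
  have "((\<lambda>t. conv K f (x + axis i t)) has_real_derivative conv K' f x) (at 0)" for x
  proof -
    have "((\<lambda>h. (conv K f (x + axis i h) - conv K f x) / h) \<longlongrightarrow> conv K' f x) (at 0)"
      unfolding tendsto_at_iff_sequentially
    proof (intro allI impI)
      fix s :: "nat \<Rightarrow> real" assume s: "\<forall>n. s n \<in> UNIV - {0}" "s \<longlonglongrightarrow> 0"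
      have s': "s n \<noteq> 0" for n using s by auto
      have "(\<lambda>n. \<integral>y. (K (x + axis i (s n) - y) * f y - K (x - y) * f y) / s n \<partial>torus) \<longlonglongrightarrow> (\<integral>y. K' (x - y) * f y \<partial>torus)"
      proof (rule integral_dominated_convergence[where w = "\<lambda>y. C * \<bar>f y\<bar>"])
        show "AE y in torus. norm ((K (x + axis i (s n) - y) * f y - K (x - y) * f y) / s n) \<le> C * \<bar>f y\<bar>" for n
        proof (rule AE_I2)
          fix y
          have "\<bar>K (x - y + axis i (s n)) - K (x - y)\<bar> / \<bar>s n\<bar> \<le> C"
            using C1_along_lipschitz[OF K C, of "x - y" "s n"] s' by (simp add: divide_le_eq)
          then have "\<bar>K (x - y + axis i (s n)) - K (x - y)\<bar> / \<bar>s n\<bar> * \<bar>f y\<bar> \<le> C * \<bar>f y\<bar>"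
            by (rule mult_right_mono) simp
          moreover have "x + axis i (s n) - y = x - y + axis i (s n)" by simp
          ultimately show "norm ((K (x + axis i (s n) - y) * f y - K (x - y) * f y) / s n) \<le> C * \<bar>f y\<bar>"
            by (simp only: left_diff_distrib[symmetric] abs_mult abs_divide real_norm_def times_divide_eq_left)
        qed
        show "AE y in torus. (\<lambda>n. (K (x + axis i (s n) - y) * f y - K (x - y) * f y) / s n) \<longlonglongrightarrow> K' (x - y) * f y"
        proof (rule AE_I2)
          fix y
          have "((\<lambda>h. (K (x - y + axis i h) - K (x - y)) / h) \<longlongrightarrow> K' (x - y)) (at 0)"
            using KD(5)[of "x - y"] by (simp add: DERIV_def)
          then have "(\<lambda>n. (K (x - y + axis i (s n)) - K (x - y)) / s n) \<longlonglongrightarrow> K' (x - y)"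
            using s unfolding tendsto_at_iff_sequentially by (auto simp: o_def)
          then have "(\<lambda>n. (K (x - y + axis i (s n)) - K (x - y)) / s n * f y) \<longlonglongrightarrow> K' (x - y) * f y"
            by (intro tendsto_intros)
          then show "(\<lambda>n. (K (x + axis i (s n) - y) * f y - K (x - y) * f y) / s n) \<longlonglongrightarrow> K' (x - y) * f y"
            by (simp add: left_diff_distrib[symmetric] diff_add_eq)
        qed
      qed (use f conv_integrable[OF KD(3,1) f] conv_integrable[OF KD(4,2) f] in auto)
      moreover have "(\<integral>y. (K (x + axis i (s n) - y) * f y - K (x - y) * f y) / s n \<partial>torus)
          = (conv K f (x + axis i (s n)) - conv K f x) / s n" for n
        unfolding conv_real using conv_integrable[OF KD(3,1) f] by (simp add: Bochner_Integration.integral_diff)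
      ultimately show "((\<lambda>h. (conv K f (x + axis i h) - conv K f x) / h) \<circ> s) \<longlonglongrightarrow> conv K' f x"
        unfolding o_def conv_real[of K' f x] by (simp only:)
    qed
    then show ?thesis by (simp add: DERIV_def)
  qed
  then show ?thesis unfolding C1_along_def
    using conv_continuous[OF KD(3,1) f] conv_continuous[OF KD(4,2) f] conv_periodic KD by blast
qed

lemma conv_pair_integrable:
  fixes K f g :: "real ^ 'd::finite \<Rightarrow> real"
  assumes K: "periodic K" "continuous_on UNIV K" and f: "integrable torus f" and g: "integrable torus g"
  shows "integrable (torus \<Otimes>\<^sub>M torus) (\<lambda>(x, y). K (x - y) * g x * f y)"
proof -
  interpret pair_sigma_finite "torus :: (real ^ 'd) measure" "torus :: (real ^ 'd) measure" ..
  have [measurable]: "f \<in> borel_measurable torus" "g \<in> borel_measurable torus" using f g by auto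
  have id: "(\<lambda>x. x) \<in> measurable torus (borel :: (real ^ 'd) measure)"
    by (rule measurable_torus) simp
  have m: "(\<lambda>z. fst z) \<in> measurable (torus \<Otimes>\<^sub>M torus) (borel :: (real ^ 'd) measure)"
     "(\<lambda>z. snd z) \<in> measurable (torus \<Otimes>\<^sub>M torus) (borel :: (real ^ 'd) measure)"
    by (rule measurable_compose[OF measurable_fst id], rule measurable_compose[OF measurable_snd id])
  have "(\<lambda>z. fst z - snd z) \<in> measurable (torus \<Otimes>\<^sub>M torus) (borel :: (real ^ 'd) measure)"
    using m by (rule borel_measurable_diff)
  then have [measurable]: "(\<lambda>z. K (fst z - snd z)) \<in> borel_measurable (torus \<Otimes>\<^sub>M torus)"
    using borel_measurable_continuous_onI[OF K(2)] by (rule measurable_compose)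
  have Ka: "periodic (\<lambda>x. \<bar>K x\<bar>)" "continuous_on UNIV (\<lambda>x. \<bar>K x\<bar>)"
    using K by (auto simp: periodic_def intro: continuous_intros)
  show ?thesis
  proof (rule Fubini_integrable)
    show "(\<lambda>(x, y). K (x - y) * g x * f y) \<in> borel_measurable (torus \<Otimes>\<^sub>M torus)"
      unfolding case_prod_beta by measurable
    have "integrable torus (\<lambda>x. \<bar>g x\<bar> * conv (\<lambda>x. \<bar>K x\<bar>) (\<lambda>y. \<bar>f y\<bar>) x)"
      using f g Ka by (intro integrable_mult_continuous conv_continuous conv_periodic) auto
    moreover have "\<bar>g x\<bar> * conv (\<lambda>x. \<bar>K x\<bar>) (\<lambda>y. \<bar>f y\<bar>) x = (\<integral>y. norm (case (x, y) of (x, y) \<Rightarrow> K (x - y) * g x * f y) \<partial>torus)" for x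
    proof -
      have "\<bar>g x\<bar> * conv (\<lambda>x. \<bar>K x\<bar>) (\<lambda>y. \<bar>f y\<bar>) x = (\<integral>y. \<bar>g x\<bar> * (\<bar>K (x - y)\<bar> * \<bar>f y\<bar>) \<partial>torus)"
        unfolding conv_real by simp
      then show ?thesis by (simp add: abs_mult ac_simps)
    qed
    ultimately show "integrable torus (\<lambda>x. \<integral>y. norm (case (x, y) of (x, y) \<Rightarrow> K (x - y) * g x * f y) \<partial>torus)" by simp
    have "integrable torus (\<lambda>y. g x * (K (x - y) * f y))" for x
      using conv_integrable[OF K f] by simp
    then show "AE x in torus. integrable torus (\<lambda>y. case (x, y) of (x, y) \<Rightarrow> K (x - y) * g x * f y)"
      by (simp add: ac_simps)
  qed
qed

text \<open>Fubini. The first identity turns the double integral of \<open>H_stable\<close> into a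
  quadratic form, the second makes convolution with an even kernel symmetric.\<close>

lemma conv_pairing:
  fixes K f g :: "real ^ 'd::finite \<Rightarrow> real"
  assumes K: "periodic K" "continuous_on UNIV K" and f: "integrable torus f" and g: "integrable torus g"
  shows "(\<integral>z. K (fst z - snd z) * g (fst z) * f (snd z) \<partial>(torus \<Otimes>\<^sub>M torus)) = (\<integral>x. g x * conv K f x \<partial>torus)"
    and "(\<integral>x. g x * conv K f x \<partial>torus) = (\<integral>y. f y * conv (\<lambda>x. K (- x)) g y \<partial>torus)"
proof -
  interpret pair_sigma_finite "torus :: (real ^ 'd) measure" "torus :: (real ^ 'd) measure" ..
  have i: "integrable (torus \<Otimes>\<^sub>M torus) (\<lambda>(x, y). K (x - y) * g x * f y)" by (rule conv_pair_integrable[OF assms])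
  have 1: "(\<integral>y. K (x - y) * g x * f y \<partial>torus) = g x * conv K f x" for x
    unfolding conv_real integral_mult_right_zero[symmetric] by (simp add: ac_simps)
  have 2: "(\<integral>x. K (x - y) * g x * f y \<partial>torus) = f y * conv (\<lambda>x. K (- x)) g y" for y
    unfolding conv_real integral_mult_right_zero[symmetric] by (simp add: ac_simps)
  have "(\<integral>x. (\<integral>y. K (x - y) * g x * f y \<partial>torus) \<partial>torus) = (\<integral>z. (case z of (x, y) \<Rightarrow> K (x - y) * g x * f y) \<partial>(torus \<Otimes>\<^sub>M torus))"
    using integral_fst'[OF i] by simp
  then show "(\<integral>z. K (fst z - snd z) * g (fst z) * f (snd z) \<partial>(torus \<Otimes>\<^sub>M torus)) = (\<integral>x. g x * conv K f x \<partial>torus)"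
    unfolding 1 by (simp add: case_prod_beta)
  have "(\<integral>y. (\<integral>x. K (x - y) * g x * f y \<partial>torus) \<partial>torus) = (\<integral>x. (\<integral>y. K (x - y) * g x * f y \<partial>torus) \<partial>torus)"
    using i by (rule Fubini_integral)
  then show "(\<integral>x. g x * conv K f x \<partial>torus) = (\<integral>y. f y * conv (\<lambda>x. K (- x)) g y \<partial>torus)"
    unfolding 1 2 by simp
qed

section \<open>The L2 space of real classes and the Fourier description of weak derivatives\<close>

section \<open>The Hilbert space of square integrable functions\<close>

lemma Lp2_iff: "Lp 2 f \<longleftrightarrow> torus_fun f \<and> integrable torus (\<lambda>x. (norm (f x))\<^sup>2)"
proof -
  have "(2 :: ennreal) \<noteq> \<infinity>" by simp
  moreover have "norm (f x) powr enn2real 2 = (norm (f x))\<^sup>2" for x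
    by (simp add: powr_numeral)
  ultimately show ?thesis unfolding Lp_def by simp
qed

lemma Lp2_real_iff: "Lp 2 f \<longleftrightarrow> torus_fun f \<and> integrable torus (\<lambda>x. (f x)\<^sup>2)" for f :: "_ \<Rightarrow> real"
  unfolding Lp2_iff by simp

lemma Lp2D:
  fixes f :: "real ^ 'd::finite \<Rightarrow> real"
  assumes "Lp 2 f"
  shows "f \<in> borel_measurable borel" "periodic f" "integrable torus (\<lambda>x. (f x)\<^sup>2)" "f \<in> borel_measurable torus"
  using assms by (auto simp: Lp2_real_iff torus_fun_def intro: measurable_torus)

lemma Lp2_mult_integrable:
  fixes f g :: "real ^ 'd::finite \<Rightarrow> real"
  assumes f: "Lp 2 f" and g: "Lp 2 g" shows "integrable torus (\<lambda>x. f x * g x)"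
proof (rule Bochner_Integration.integrable_bound)
  show "integrable torus (\<lambda>x. (f x)\<^sup>2 + (g x)\<^sup>2)" using Lp2D(3)[OF f] Lp2D(3)[OF g] by simp
  show "(\<lambda>x. f x * g x) \<in> borel_measurable torus" using Lp2D(4)[OF f] Lp2D(4)[OF g] by simp
  have "\<bar>a * b\<bar> \<le> a\<^sup>2 + b\<^sup>2" for a b :: real
    using sum_squares_bound[of a b] sum_squares_bound[of "-a" b] zero_le_power2[of a] zero_le_power2[of b]
    by (auto simp: abs_if)
  then show "AE x in torus. norm (f x * g x) \<le> norm ((f x)\<^sup>2 + (g x)\<^sup>2)" by simp
qed

lemma Lp2_continuous:
  fixes f :: "real ^ 'd::finite \<Rightarrow> real"
  assumes "periodic f" "continuous_on UNIV f" shows "Lp 2 f"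
  unfolding Lp2_real_iff torus_fun_def using assms
  by (auto intro!: borel_measurable_continuous_onI integrable_torus_continuous continuous_intros
      simp: power2_eq_square periodic_comb)

lemma Lp2_const: "Lp 2 (\<lambda>x :: real ^ 'd::finite. c :: real)"
  by (intro Lp2_continuous periodic_comb continuous_intros)

lemma Lp2_integrable:
  fixes f :: "real ^ 'd::finite \<Rightarrow> real"
  assumes "Lp 2 f" shows "integrable torus f"
  using Lp2_mult_integrable[OF assms Lp2_const[of 1]] by simp

lemma Lp2_add:
  fixes f g :: "real ^ 'd::finite \<Rightarrow> real"
  assumes f: "Lp 2 f" and g: "Lp 2 g" shows "Lp 2 (\<lambda>x. f x + g x)"
proof -
  have "integrable torus (\<lambda>x. (f x)\<^sup>2 + (g x)\<^sup>2 + 2 * (f x * g x))"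
    using Lp2D(3)[OF f] Lp2D(3)[OF g] Lp2_mult_integrable[OF f g] by simp
  then have "integrable torus (\<lambda>x. (f x + g x)\<^sup>2)" by (simp add: power2_sum mult.assoc)
  then show ?thesis unfolding Lp2_real_iff torus_fun_def
    using Lp2D(1,2)[OF f] Lp2D(1,2)[OF g] by (auto intro: periodic_comb)
qed

lemma Lp2_bounded_mult:
  fixes f g :: "real ^ 'd::finite \<Rightarrow> real"
  assumes f: "Lp 2 f" and g: "torus_fun g" "\<And>x. \<bar>g x\<bar> \<le> C" shows "Lp 2 (\<lambda>x. g x * f x)"
proof -
  have "integrable torus (\<lambda>x. (f x)\<^sup>2 * (g x)\<^sup>2)"
  proof (rule integrable_mult_bounded[OF Lp2D(3)[OF f]])
    show "(\<lambda>x. (g x)\<^sup>2) \<in> borel_measurable borel" using g(1) by (intro borel_measurable_power) (simp add: torus_fun_def)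
    show "\<bar>(g x)\<^sup>2\<bar> \<le> C\<^sup>2" for x using power_mono[OF g(2)[of x], of 2] by simp
  qed
  then show ?thesis unfolding Lp2_real_iff torus_fun_def
    using Lp2D(1,2)[OF f] g(1) by (auto intro: periodic_comb simp: torus_fun_def power_mult_distrib mult.commute)
qed

lemma Lp2_scale: "Lp 2 f \<Longrightarrow> Lp 2 (\<lambda>x. c * f x)" for f :: "real ^ 'd::finite \<Rightarrow> real"
  by (rule Lp2_bounded_mult[where C = "\<bar>c\<bar>"]) (auto simp: torus_fun_def periodic_def)

lemma Lp2_diff: "Lp 2 f \<Longrightarrow> Lp 2 g \<Longrightarrow> Lp 2 (\<lambda>x. f x - g x)" for f g :: "real ^ 'd::finite \<Rightarrow> real"
  using Lp2_add[OF _ Lp2_scale[of g "-1"]] by simp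

lemma Lp2_minus: "Lp 2 f \<Longrightarrow> Lp 2 (\<lambda>x. - f x)" for f :: "real ^ 'd::finite \<Rightarrow> real"
  using Lp2_scale[of f "-1"] by simp

definition l2rel :: "(real ^ 'd::finite \<Rightarrow> real) \<Rightarrow> (real ^ 'd \<Rightarrow> real) \<Rightarrow> bool" where
  "l2rel f g \<longleftrightarrow> Lp 2 f \<and> Lp 2 g \<and> (AE x in torus. f x = g x)"

\<comment> \<open>A partial quotient: the relation is reflexive exactly on the square integrable
  functions. Working with classes makes the norm separate points, so that the abstract Hilbert space
  theory applies.\<close>
quotient_type (overloaded) 'd l2 = "real ^ 'd::finite \<Rightarrow> real" / partial: l2rel
proof (rule part_equivpI)
  show "\<exists>f :: real ^ 'd \<Rightarrow> real. l2rel f f" using Lp2_const[of 0] by (auto simp: l2rel_def)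
  show "symp (l2rel :: (real ^ 'd \<Rightarrow> real) \<Rightarrow> _)" by (auto simp: symp_def l2rel_def)
  show "transp (l2rel :: (real ^ 'd \<Rightarrow> real) \<Rightarrow> _)" unfolding transp_def l2rel_def
  proof (intro allI impI conjI)
    fix f g h :: "real ^ 'd \<Rightarrow> real"
    assume "Lp 2 f \<and> Lp 2 g \<and> (AE x in torus. f x = g x)" "Lp 2 g \<and> Lp 2 h \<and> (AE x in torus. g x = h x)"
    then have "AE x in torus. f x = g x" "AE x in torus. g x = h x" by auto
    then show "AE x in torus. f x = h x" by eventually_elim simp
  qed auto
qed

abbreviation cl :: "(real ^ 'd::finite \<Rightarrow> real) \<Rightarrow> 'd l2" where "cl \<equiv> abs_l2"
abbreviation rp :: "'d::finite l2 \<Rightarrow> real ^ 'd \<Rightarrow> real" where "rp \<equiv> rep_l2"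

lemma cl_rp [simp]: "cl (rp F) = F"
  by (rule Quotient3_abs_rep[OF Quotient3_l2])

lemma rp_Lp2: "Lp 2 (rp F)"
  using Quotient3_rep_reflp[OF Quotient3_l2, of F] by (simp add: l2rel_def)

lemma cl_eq_iff: "Lp 2 f \<Longrightarrow> Lp 2 g \<Longrightarrow> cl f = cl g \<longleftrightarrow> (AE x in torus. f x = g x)"
  using Quotient3_rel[OF Quotient3_l2, of f g] by (auto simp: l2rel_def)

lemma rp_cl: "Lp 2 f \<Longrightarrow> AE x in torus. rp (cl f) x = f x"
  using cl_eq_iff[OF rp_Lp2, of f "cl f"] by simp

lemma l2_cases: obtains f where "Lp 2 f" "F = cl f"
  using rp_Lp2[of F] cl_rp[of F] by metis

instantiation l2 :: (finite) real_vector
begin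

lift_definition zero_l2 :: "'a l2" is "\<lambda>_. 0" by (simp add: l2rel_def Lp2_const)

lift_definition plus_l2 :: "'a l2 \<Rightarrow> 'a l2 \<Rightarrow> 'a l2" is "\<lambda>f g x. f x + g x"
  unfolding l2rel_def by (auto intro: Lp2_add)

lift_definition minus_l2 :: "'a l2 \<Rightarrow> 'a l2 \<Rightarrow> 'a l2" is "\<lambda>f g x. f x - g x"
  unfolding l2rel_def by (auto intro: Lp2_diff)

lift_definition uminus_l2 :: "'a l2 \<Rightarrow> 'a l2" is "\<lambda>f x. - f x"
  unfolding l2rel_def by (auto intro: Lp2_minus)

lift_definition scaleR_l2 :: "real \<Rightarrow> 'a l2 \<Rightarrow> 'a l2" is "\<lambda>c f x. c * f x"
  unfolding l2rel_def by (auto intro: Lp2_scale)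

instance
proof
  fix F G H :: "'a l2" and a b :: real
  show "F + G + H = F + (G + H)" by transfer (auto simp: l2rel_def algebra_simps intro!: Lp2_add)
  show "F + G = G + F" by transfer (auto simp: l2rel_def algebra_simps intro!: Lp2_add)
  show "0 + F = F" by transfer (auto simp: l2rel_def)
  show "- F + F = 0" by transfer (auto simp: l2rel_def Lp2_const)
  show "F - G = F + - G" by transfer (auto simp: l2rel_def intro!: Lp2_diff)
  show "a *\<^sub>R (F + G) = a *\<^sub>R F + a *\<^sub>R G"
    by transfer (auto simp: l2rel_def algebra_simps intro!: Lp2_add Lp2_scale)
  show "(a + b) *\<^sub>R F = a *\<^sub>R F + b *\<^sub>R F"
    by transfer (auto simp: l2rel_def algebra_simps intro!: Lp2_add Lp2_scale)
  show "a *\<^sub>R b *\<^sub>R F = (a * b) *\<^sub>R F"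
    by transfer (auto simp: l2rel_def algebra_simps intro!: Lp2_scale)
  show "1 *\<^sub>R F = F" by transfer (auto simp: l2rel_def)
qed

end

instantiation l2 :: (finite) real_inner
begin

lift_definition inner_l2 :: "'a l2 \<Rightarrow> 'a l2 \<Rightarrow> real" is "\<lambda>f g. \<integral>x. f x * g x \<partial>torus"
proof (rule integral_cong_AE)
  fix f f' g g' :: "real ^ 'a \<Rightarrow> real"
  assume *: "l2rel f f'" "l2rel g g'"
  then show "(\<lambda>x. f x * g x) \<in> borel_measurable torus" "(\<lambda>x. f' x * g' x) \<in> borel_measurable torus"
    using Lp2D(4) unfolding l2rel_def by (auto intro!: borel_measurable_times)
  from * have "AE x in torus. f x = f' x" "AE x in torus. g x = g' x" by (auto simp: l2rel_def)
  then show "AE x in torus. f x * g x = f' x * g' x" by eventually_elim simp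
qed

definition norm_l2 :: "'a l2 \<Rightarrow> real" where "norm_l2 F = sqrt (inner F F)"
definition dist_l2 :: "'a l2 \<Rightarrow> 'a l2 \<Rightarrow> real" where "dist_l2 F G = norm (F - G)"
definition sgn_l2 :: "'a l2 \<Rightarrow> 'a l2" where "sgn_l2 F = F /\<^sub>R norm F"
definition uniformity_l2 :: "('a l2 \<times> 'a l2) filter" where
  "uniformity_l2 = (INF e\<in>{0 <..}. principal {(x, y). dist x y < e})"
definition open_l2 :: "'a l2 set \<Rightarrow> bool" where
  "open_l2 U = (\<forall>x\<in>U. eventually (\<lambda>(x', y). x' = x \<longrightarrow> y \<in> U) uniformity)"

instance
proof
  fix F G H :: "'a l2" and a :: real
  show "sgn F = inverse (norm F) *\<^sub>R F" by (simp add: sgn_l2_def)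
  show "dist F G = norm (F - G)" by (simp add: dist_l2_def)
  show "uniformity = (INF e\<in>{0 <..}. principal {(x, y :: 'a l2). dist x y < e})"
    by (rule uniformity_l2_def)
  show "open U \<longleftrightarrow> (\<forall>x\<in>U. eventually (\<lambda>(x', y). x' = x \<longrightarrow> y \<in> U) uniformity)" for U :: "'a l2 set"
    by (rule open_l2_def)
  show "inner F G = inner G F" by transfer (simp add: mult.commute)
  show "inner (F + G) H = inner F H + inner G H"
    by transfer (auto simp: l2rel_def distrib_right Lp2_mult_integrable)
  show "inner (a *\<^sub>R F) G = a * inner F G" by transfer (auto simp: mult.assoc)
  show "0 \<le> inner F F" by transfer simp
  show "inner F F = 0 \<longleftrightarrow> F = 0"
  proof transfer
    fix f :: "real ^ 'a \<Rightarrow> real" assume "l2rel f f"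
    then have f: "Lp 2 f" by (simp add: l2rel_def)
    have "(\<integral>x. f x * f x \<partial>torus) = 0 \<longleftrightarrow> (AE x in torus. f x * f x = 0)"
      by (rule integral_nonneg_eq_0_iff_AE) (auto intro: Lp2_mult_integrable f)
    then show "(\<integral>x. f x * f x \<partial>torus) = 0 \<longleftrightarrow> l2rel f (\<lambda>_. 0)" using f by (simp add: l2rel_def Lp2_const)
  qed
  show "norm F = sqrt (inner F F)" by (rule norm_l2_def)
qed

end

lemma cl_simps:
  "cl (\<lambda>x. 0) = 0"
  "Lp 2 f \<Longrightarrow> Lp 2 g \<Longrightarrow> cl (\<lambda>x. f x + g x) = cl f + cl g"
  "Lp 2 f \<Longrightarrow> Lp 2 g \<Longrightarrow> cl (\<lambda>x. f x - g x) = cl f - cl g"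
  "Lp 2 f \<Longrightarrow> cl (\<lambda>x. - f x) = - cl f"
  "Lp 2 f \<Longrightarrow> cl (\<lambda>x. c * f x) = c *\<^sub>R cl f"
  by (simp_all add: zero_l2.abs_eq plus_l2.abs_eq minus_l2.abs_eq uminus_l2.abs_eq scaleR_l2.abs_eq eq_onp_def l2rel_def)

lemma inner_cl: "Lp 2 f \<Longrightarrow> Lp 2 g \<Longrightarrow> inner (cl f) (cl g) = (\<integral>x. f x * g x \<partial>torus)"
  by (simp add: inner_l2.abs_eq eq_onp_def l2rel_def)

lemma norm_cl: "Lp 2 f \<Longrightarrow> (norm (cl f))\<^sup>2 = (\<integral>x. (f x)\<^sup>2 \<partial>torus)"
  unfolding power2_norm_eq_inner by (simp add: inner_cl power2_eq_square)

lemma cl_cong: "Lp 2 f \<Longrightarrow> Lp 2 g \<Longrightarrow> (AE x in torus. f x = g x) \<Longrightarrow> cl f = cl g"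
  by (simp add: cl_eq_iff)

lemma nn_integral_square:
  fixes f :: "real ^ 'd::finite \<Rightarrow> real"
  assumes "Lp 2 f" shows "(\<integral>\<^sup>+x. ennreal ((f x)\<^sup>2) \<partial>torus) = ennreal ((norm (cl f))\<^sup>2)"
  unfolding norm_cl[OF assms] by (rule nn_integral_eq_integral) (use Lp2D(3)[OF assms] in auto)

lemma Lp2_of_nn_integral:
  fixes f :: "real ^ 'd::finite \<Rightarrow> real"
  assumes "torus_fun f" "(\<integral>\<^sup>+x. ennreal ((f x)\<^sup>2) \<partial>torus) \<le> ennreal C" shows "Lp 2 f"
proof -
  have "f \<in> borel_measurable torus" using assms(1) by (auto simp: torus_fun_def intro: measurable_torus)
  moreover have "(\<integral>\<^sup>+x. ennreal ((f x)\<^sup>2) \<partial>torus) < \<infinity>"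
    by (rule le_less_trans[OF assms(2)]) simp
  ultimately have "integrable torus (\<lambda>x. (f x)\<^sup>2)"
    by (intro integrableI_nonneg) auto
  then show ?thesis using assms(1) by (simp add: Lp2_real_iff)
qed

text \<open>Along a rapidly converging subsequence the increments are summable in \<open>L\<^sup>1\<close>, since
  \<open>2 \<bar>u\<bar> \<le> 2\<^sup>n u\<^sup>2 + 2\<^sup>-\<^sup>n\<close>; this gives a pointwise limit, and Fatou's lemma gives convergence in \<open>L\<^sup>2\<close>.\<close>

lemma l2_complete:
  fixes X :: "nat \<Rightarrow> 'd::finite l2"
  assumes X: "Cauchy X" shows "convergent X"
proof -
  have "\<forall>n. \<exists>N. \<forall>i\<ge>N. \<forall>j\<ge>N. dist (X i) (X j) < (1/2)^n"
    using metric_CauchyD[OF X] by (meson zero_less_power half_gt_zero zero_less_one)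
  then obtain N where N: "\<And>n i j. N n \<le> i \<Longrightarrow> N n \<le> j \<Longrightarrow> dist (X i) (X j) < (1/2)^n" by metis
  \<comment> \<open>The summand \<open>n\<close> makes \<open>r\<close> strictly increasing, the sum
    of thresholds makes it at least \<open>N n\<close>.\<close>
  define r where "r n = n + (\<Sum>i\<le>n. N i)" for n
  have r: "strict_mono r" unfolding strict_mono_Suc_iff r_def by simp
  have rN: "N n \<le> r n" for n unfolding r_def using member_le_sum[of n "{..n}" N] by simp
  define f where "f n = rp (X (r n))" for n
  define u where "u n x = f (Suc n) x - f n x" for n x
  have f: "Lp 2 (f n)" and clf: "cl (f n) = X (r n)" for n unfolding f_def by (auto intro: rp_Lp2)
  have u: "Lp 2 (u n)" for n unfolding u_def using f by (intro Lp2_diff)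
  have nu: "(norm (cl (u n)))\<^sup>2 \<le> ((1/2)^n)\<^sup>2" for n
  proof -
    have "r n \<le> r (Suc n)" using r by (simp add: strict_mono_less_eq)
    then have "dist (X (r (Suc n))) (X (r n)) < (1/2)^n" using rN[of n] by (intro N) auto
    moreover have "cl (u n) = X (r (Suc n)) - X (r n)" unfolding u_def clf[symmetric] by (intro cl_simps f)
    ultimately show ?thesis by (intro power_mono) (auto simp: dist_norm)
  qed
  let ?v = "1 + vol TYPE('d)"
  have "(\<integral>\<^sup>+x. ennreal \<bar>u n x\<bar> \<partial>torus) \<le> ennreal ((1/2)^n * ?v)" for n
  proof -
    have *: "\<bar>u n x\<bar> \<le> 2^n * (u n x)\<^sup>2 + (1/2)^n" for x
    proof -
      have "0 \<le> 2^n * (\<bar>u n x\<bar> - (1/2)^n)\<^sup>2" by simp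
      also have "\<dots> = 2^n * (u n x)\<^sup>2 - 2 * \<bar>u n x\<bar> * (2^n * (1/2)^n) + (2^n * (1/2)^n) * (1/2)^n"
        by (simp add: power2_diff algebra_simps power2_eq_square)
      also have "2^n * (1/2)^n = (1 :: real)" by (simp add: power_mult_distrib[symmetric])
      finally have "2 * \<bar>u n x\<bar> \<le> 2^n * (u n x)\<^sup>2 + (1/2)^n" by simp
      then show ?thesis by linarith
    qed
    have iu: "integrable torus (\<lambda>x. 2^n * (u n x)\<^sup>2 + (1/2)^n)" using Lp2D(3)[OF u] by simp
    have "(\<integral>\<^sup>+x. ennreal \<bar>u n x\<bar> \<partial>torus) = ennreal (\<integral>x. \<bar>u n x\<bar> \<partial>torus)"
      using Lp2_integrable[OF u] by (intro nn_integral_eq_integral) auto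
    also have "(\<integral>x. \<bar>u n x\<bar> \<partial>torus) \<le> (\<integral>x. 2^n * (u n x)\<^sup>2 + (1/2)^n \<partial>torus)"
      using Lp2_integrable[OF u] iu * by (intro integral_mono) auto
    also have "\<dots> = 2^n * (norm (cl (u n)))\<^sup>2 + (1/2)^n * vol TYPE('d)"
      using Lp2D(3)[OF u] by (simp add: norm_cl[OF u] vol_def mult.commute)
    also have "\<dots> \<le> 2^n * ((1/2)^n)\<^sup>2 + (1/2)^n * vol TYPE('d)" using nu by (intro add_right_mono mult_left_mono) auto
    also have "2^n * ((1/2)^n)\<^sup>2 = (1/2 :: real)^n" by (simp add: power2_eq_square power_mult_distrib[symmetric] mult.assoc[symmetric])
    also have "(1/2)^n + (1/2)^n * vol TYPE('d) = (1/2)^n * ?v" by (simp add: distrib_left)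
    finally show ?thesis by (simp add: ennreal_leI)
  qed
  then have "(\<Sum>n. \<integral>\<^sup>+x. ennreal \<bar>u n x\<bar> \<partial>torus) \<le> (\<Sum>n. ennreal ((1/2)^n * ?v))"
    by (intro suminf_le) auto
  also have "\<dots> = ennreal (\<Sum>n. (1/2)^n * ?v)"
    using vol_pos[where ?'d = 'd] by (intro suminf_ennreal2) (auto intro!: summable_mult2 summable_geometric)
  finally have "(\<integral>\<^sup>+x. (\<Sum>n. ennreal \<bar>u n x\<bar>) \<partial>torus) \<le> ennreal (\<Sum>n. (1/2)^n * ?v)"
    using Lp2D(4)[OF u] by (subst nn_integral_suminf) auto
  then have "(\<integral>\<^sup>+x. (\<Sum>n. ennreal \<bar>u n x\<bar>) \<partial>torus) \<noteq> \<infinity>" by (metis ennreal_neq_top infinity_ennreal_def neq_top_trans)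
  then have "AE x in torus. (\<Sum>n. ennreal \<bar>u n x\<bar>) \<noteq> \<infinity>"
    using Lp2D(4)[OF u] by (intro nn_integral_PInf_AE) auto
  then have conv: "AE x in torus. convergent (\<lambda>n. f n x)"
  proof eventually_elim
    case (elim x)
    then have "summable (\<lambda>n. \<bar>u n x\<bar>)" by (intro summable_suminf_not_top) auto
    then have "summable (\<lambda>n. u n x)" by (rule summable_rabs_cancel)
    then have "convergent (\<lambda>n. f 0 x + (\<Sum>i<n. u i x))"
      by (intro convergent_add convergent_const) (simp add: summable_iff_convergent)
    then show ?case unfolding u_def using sum_lessThan_telescope[of "\<lambda>n. f n x"] by simp
  qed
  \<comment> \<open>Even where the sequence diverges, \<open>lim\<close> gives a value that depends
    on \<open>x\<close> in a Borel and periodic way, so \<open>g\<close> is an admissible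
    representative.\<close>
  define g where "g x = lim (\<lambda>n. f n x)" for x
  have tg: "torus_fun g" unfolding torus_fun_def
  proof
    show "g \<in> borel_measurable borel" unfolding g_def
      using Lp2D(1)[OF f] by (intro borel_measurable_lim_metric)
    show "periodic g" using Lp2D(2)[OF f] unfolding g_def periodic_def by simp
  qed
  have fg: "AE x in torus. (\<lambda>n. f n x) \<longlonglongrightarrow> g x"
    using conv by eventually_elim (simp add: g_def convergent_LIMSEQ_iff)
  have tfg: "torus_fun (\<lambda>x. f n x - g x)" for n
    using tg Lp2D(1,2)[OF f[of n]] by (auto simp: torus_fun_def intro: periodic_comb)
  have est: "(\<integral>\<^sup>+x. ennreal ((f n x - g x)\<^sup>2) \<partial>torus) \<le> ennreal (((1/2)^n)\<^sup>2)" for n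
  proof -
    have "(\<integral>\<^sup>+x. ennreal ((f n x - g x)\<^sup>2) \<partial>torus) = (\<integral>\<^sup>+x. liminf (\<lambda>m. ennreal ((f n x - f m x)\<^sup>2)) \<partial>torus)"
    proof (rule nn_integral_cong_AE)
      show "AE x in torus. ennreal ((f n x - g x)\<^sup>2) = liminf (\<lambda>m. ennreal ((f n x - f m x)\<^sup>2))"
        using fg
      proof eventually_elim
        case (elim x)
        then have "(\<lambda>m. ennreal ((f n x - f m x)\<^sup>2)) \<longlonglongrightarrow> ennreal ((f n x - g x)\<^sup>2)"
          by (intro tendsto_intros tendsto_ennrealI)
        from lim_imp_Liminf[OF _ this] show ?case by simp
      qed
    qed
    also have "\<dots> \<le> liminf (\<lambda>m. \<integral>\<^sup>+x. ennreal ((f n x - f m x)\<^sup>2) \<partial>torus)"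
      using Lp2D(4)[OF f] by (intro nn_integral_liminf) auto
    also have "\<dots> \<le> limsup (\<lambda>m. \<integral>\<^sup>+x. ennreal ((f n x - f m x)\<^sup>2) \<partial>torus)"
      by (rule Liminf_le_Limsup) simp
    also have "\<dots> \<le> ennreal (((1/2)^n)\<^sup>2)"
    proof (rule Limsup_bounded)
      show "\<forall>\<^sub>F m in sequentially. (\<integral>\<^sup>+x. ennreal ((f n x - f m x)\<^sup>2) \<partial>torus) \<le> ennreal (((1/2)^n)\<^sup>2)"
        using eventually_ge_at_top[of n]
      proof eventually_elim
        case (elim m)
        have "r n \<le> r m" using r elim by (simp add: strict_mono_less_eq)
        then have "dist (X (r n)) (X (r m)) < (1/2)^n" using rN[of n] by (intro N) auto
        moreover have "cl (\<lambda>x. f n x - f m x) = X (r n) - X (r m)" unfolding clf[symmetric] by (intro cl_simps f)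
        ultimately have "(norm (cl (\<lambda>x. f n x - f m x)))\<^sup>2 \<le> ((1/2)^n)\<^sup>2" by (intro power_mono) (auto simp: dist_norm)
        then show ?case using f by (subst nn_integral_square) (auto intro: Lp2_diff ennreal_leI)
      qed
    qed
    finally show ?thesis .
  qed
  have Lfg: "Lp 2 (\<lambda>x. f n x - g x)" for n using tfg est by (rule Lp2_of_nn_integral)
  have "Lp 2 (\<lambda>x. f 0 x - (f 0 x - g x))" using f Lfg by (rule Lp2_diff)
  then have g: "Lp 2 g" by simp
  have "norm (X (r n) - cl g) \<le> (1/2)^n" for n
  proof -
    have "X (r n) - cl g = cl (\<lambda>x. f n x - g x)" unfolding clf[symmetric] by (intro cl_simps(3)[symmetric] f g)
    moreover have "ennreal ((norm (cl (\<lambda>x. f n x - g x)))\<^sup>2) \<le> ennreal (((1/2)^n)\<^sup>2)"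
      using est[of n] by (simp add: nn_integral_square[OF Lfg])
    ultimately have "(norm (X (r n) - cl g))\<^sup>2 \<le> ((1/2)^n)\<^sup>2" by simp
    then show ?thesis by (rule power2_le_imp_le) simp
  qed
  then have "(\<lambda>n. X (r n) - cl g) \<longlonglongrightarrow> 0"
    by (intro Lim_null_comparison[OF _ LIMSEQ_power_zero[of "1/2 :: real"]]) auto
  then have "(X \<circ> r) \<longlonglongrightarrow> cl g" by (simp add: LIM_zero_iff o_def)
  then have "X \<longlonglongrightarrow> cl g" using Cauchy_converges_subseq[OF X r] by blast
  then show ?thesis by (rule convergentI)
qed

instance l2 :: (finite) banach
  by standard (rule l2_complete)

section \<open>The Hartley basis\<close>

definition casL :: "int ^ 'd::finite \<Rightarrow> 'd l2" where
  "casL k = cl (cas k)"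

text \<open>Two normalizations: coefficients against \<open>casL\<close> are plain integrals as in
  the weak formulations, while \<open>casN\<close> is orthonormal and serves Parseval.\<close>

definition casN :: "int ^ 'd::finite \<Rightarrow> 'd l2" where
  "casN k = (1 / sqrt (vol TYPE('d))) *\<^sub>R casL k"

lemma cas_Lp2: "Lp 2 (cas k)"
  by (intro Lp2_continuous cas_periodic cas_continuous)

lemma inner_casL: "Lp 2 f \<Longrightarrow> inner (cl f) (casL k) = (\<integral>x. f x * cas k x \<partial>torus)"
  unfolding casL_def by (intro inner_cl cas_Lp2)

lemma inner_casL_zero: "(\<And>k. inner F (casL k) = 0) \<Longrightarrow> F = 0"
proof -
  assume z: "\<And>k. inner F (casL k) = 0"
  obtain f where f: "Lp 2 f" "F = cl f" by (rule l2_cases)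
  have "AE x in torus. f x = 0"
    using z f by (intro AE_zero_of_coefficients Lp2_integrable) (auto simp: inner_casL)
  then have "cl f = cl (\<lambda>x. 0)" by (intro cl_cong f Lp2_const)
  then show ?thesis using f by (simp add: cl_simps)
qed

interpretation cas: hilbert_basis "UNIV :: 'd::finite l2 set" inner 1 "UNIV :: (int ^ 'd) set" casN
proof unfold_locales
  show "inner (casN k) (casN l) = (if k = l then 1 else 0)" for k l :: "int ^ 'd"
    using vol_pos[where ?'d = 'd] unfolding casN_def casL_def
    by (simp add: inner_cl cas_Lp2 cas_orthogonal)
  show "F = 0" if "\<And>k. k \<in> UNIV \<Longrightarrow> inner F (casN k) = 0" for F :: "'d l2"
    using that vol_pos[where ?'d = 'd] by (intro inner_casL_zero) (simp add: casN_def)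
  show "\<exists>K. \<forall>F G :: 'd l2. norm (inner F G) \<le> norm F * norm G * K"
    by (rule bounded_bilinear.bounded[OF bounded_bilinear_inner])
qed (auto simp: inner_commute power2_norm_eq_inner inner_add_left inner_add_right)

section \<open>Multiplication and convolution operators\<close>

definition pcont :: "(real ^ 'd::finite \<Rightarrow> real) \<Rightarrow> bool" where
  "pcont a \<longleftrightarrow> periodic a \<and> continuous_on UNIV a"

definition mulop :: "(real ^ 'd::finite \<Rightarrow> real) \<Rightarrow> 'd l2 \<Rightarrow> 'd l2" where
  "mulop a F = cl (\<lambda>x. a x * rp F x)"

definition convop :: "(real ^ 'd::finite \<Rightarrow> real) \<Rightarrow> 'd l2 \<Rightarrow> 'd l2" where
  "convop K F = cl (conv K (rp F))"

lemma pcont_intros: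
  "pcont (\<lambda>x. c)" "pcont a \<Longrightarrow> pcont b \<Longrightarrow> pcont (\<lambda>x. a x + b x)" "pcont a \<Longrightarrow> pcont b \<Longrightarrow> pcont (\<lambda>x. a x * b x)"
  by (auto simp: pcont_def intro: periodic_comb continuous_intros)

lemma pcont_Lp2: "pcont a \<Longrightarrow> Lp 2 a"
  by (simp add: pcont_def Lp2_continuous)

lemma C1_along_pcont: "C1_along i a a' \<Longrightarrow> pcont a" "C1_along i a a' \<Longrightarrow> pcont a'"
  by (auto simp: C1_along_def pcont_def)

lemma mul_Lp2:
  assumes "pcont a" "Lp 2 f" shows "Lp 2 (\<lambda>x. a x * f x)"
proof -
  obtain C where "\<And>x. \<bar>a x\<bar> \<le> C" using assms(1) periodic_bounded unfolding pcont_def by metis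
  then show ?thesis using assms
    by (intro Lp2_bounded_mult) (auto simp: pcont_def torus_fun_def borel_measurable_continuous_onI)
qed

lemma mulop_cl:
  assumes "pcont a" "Lp 2 f" shows "mulop a (cl f) = cl (\<lambda>x. a x * f x)"
  unfolding mulop_def
  by (intro cl_cong mul_Lp2 assms rp_Lp2) (use rp_cl[OF assms(2)] in eventually_elim, simp)

lemma mulop_bounded_linear:
  assumes a: "pcont a" shows "bounded_linear (mulop a)"
proof -
  obtain C where C: "\<And>x. \<bar>a x\<bar> \<le> C" using a periodic_bounded unfolding pcont_def by metis
  show ?thesis
  proof (rule bounded_linear_intro[of _ "\<bar>C\<bar>"])
    fix F G :: "'a l2" and r :: real
    obtain f g where f: "Lp 2 f" "F = cl f" and g: "Lp 2 g" "G = cl g" by (metis l2_cases)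
    show "mulop a (F + G) = mulop a F + mulop a G" using f g a
      by (simp add: cl_simps(2)[symmetric] mulop_cl Lp2_add mul_Lp2 distrib_left)
    show "mulop a (r *\<^sub>R F) = r *\<^sub>R mulop a F" using f a
      by (simp add: cl_simps(5)[symmetric] mulop_cl Lp2_scale mul_Lp2 mult.left_commute)
    have "(norm (mulop a F))\<^sup>2 = (\<integral>x. (a x * f x)\<^sup>2 \<partial>torus)" using f a by (simp add: mulop_cl norm_cl mul_Lp2)
    also have "\<dots> \<le> (\<integral>x. C\<^sup>2 * (f x)\<^sup>2 \<partial>torus)"
    proof (rule integral_mono)
      show "integrable torus (\<lambda>x. (a x * f x)\<^sup>2)" using mul_Lp2[OF a f(1)] by (rule Lp2D(3))
      show "(a x * f x)\<^sup>2 \<le> C\<^sup>2 * (f x)\<^sup>2" for x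
        using power_mono[OF C[of x], of 2] by (simp add: power_mult_distrib mult_right_mono)
    qed (use Lp2D(3)[OF f(1)] in simp)
    also have "\<dots> = (norm F * \<bar>C\<bar>)\<^sup>2" using f by (simp add: norm_cl power_mult_distrib)
    finally show "norm (mulop a F) \<le> norm F * \<bar>C\<bar>" by (rule power2_le_imp_le) simp
  qed
qed

lemma inner_mulop:
  assumes a: "pcont a" shows "inner (mulop a F) G = inner F (mulop a G)"
proof -
  obtain f g where "Lp 2 f" "F = cl f" "Lp 2 g" "G = cl g" by (metis l2_cases)
  then show ?thesis using a by (simp add: mulop_cl inner_cl mul_Lp2 ac_simps)
qed

lemma mulop_mulop: "pcont a \<Longrightarrow> pcont b \<Longrightarrow> mulop a (mulop b F) = mulop (\<lambda>x. a x * b x) F"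
  by (cases F rule: l2_cases) (simp add: mulop_cl mul_Lp2 pcont_intros mult.assoc)

lemma mulop_one: "mulop (\<lambda>x. 1) F = F"
  by (cases F rule: l2_cases) (simp add: mulop_cl pcont_intros)

lemma mulop_const: "mulop (\<lambda>x. c) F = c *\<^sub>R F"
  by (cases F rule: l2_cases) (simp add: mulop_cl pcont_intros cl_simps)

lemma conv_pcont: "pcont K \<Longrightarrow> integrable torus f \<Longrightarrow> pcont (conv K f)" for f :: "real ^ 'd::finite \<Rightarrow> real"
  unfolding pcont_def using conv_periodic conv_continuous by blast

lemma conv_cong_AE:
  fixes f g :: "real ^ 'd::finite \<Rightarrow> real"
  assumes K: "pcont K" and f: "integrable torus f" "integrable torus g" and eq: "AE x in torus. f x = g x"
  shows "conv K f = conv K g"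
proof
  fix x
  show "conv K f x = conv K g x" unfolding conv_real
  proof (rule integral_cong_AE)
    show "AE y in torus. K (x - y) * f y = K (x - y) * g y" using eq by eventually_elim simp
  qed (use conv_integrable[of K f x] conv_integrable[of K g x] K f in \<open>auto simp: pcont_def\<close>)
qed

lemma convop_cl: "pcont K \<Longrightarrow> Lp 2 f \<Longrightarrow> convop K (cl f) = cl (conv K f)"
  unfolding convop_def using rp_cl[of f] by (subst conv_cong_AE[of K _ f]) (auto intro: Lp2_integrable rp_Lp2)

lemma abs_Lp2: "Lp 2 f \<Longrightarrow> Lp 2 (\<lambda>x. \<bar>f x\<bar>)" for f :: "real ^ 'd::finite \<Rightarrow> real"
  by (auto simp: Lp2_real_iff torus_fun_def periodic_def)

lemma L1_le_L2:
  fixes f :: "real ^ 'd::finite \<Rightarrow> real"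
  assumes "Lp 2 f" shows "(\<integral>x. \<bar>f x\<bar> \<partial>torus) \<le> sqrt (vol TYPE('d)) * norm (cl f)"
proof -
  have "(\<integral>x. \<bar>f x\<bar> \<partial>torus) = inner (cl (\<lambda>x. \<bar>f x\<bar>)) (cl (\<lambda>x. 1))"
    by (simp add: inner_cl abs_Lp2 assms Lp2_const)
  also have "\<dots> \<le> norm (cl (\<lambda>x. \<bar>f x\<bar>)) * norm (cl (\<lambda>x :: real ^ 'd. 1))"
    by (rule norm_cauchy_schwarz)
  also have "norm (cl (\<lambda>x :: real ^ 'd. 1)) = sqrt (vol TYPE('d))"
    unfolding norm_eq_sqrt_inner by (simp add: inner_cl Lp2_const vol_def)
  also have "norm (cl (\<lambda>x. \<bar>f x\<bar>)) = norm (cl f)"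
    unfolding norm_eq_sqrt_inner using assms by (simp add: inner_cl abs_Lp2)
  finally show ?thesis by (simp add: mult.commute)
qed

lemma convop_bounded_linear:
  fixes K :: "real ^ 'd::finite \<Rightarrow> real"
  assumes K: "pcont K" shows "bounded_linear (convop K)"
proof -
  obtain C where C: "0 < C" "\<And>x. \<bar>K x\<bar> \<le> C" using K periodic_bounded unfolding pcont_def by metis
  note Ki = conv_integrable[of K, OF K[unfolded pcont_def, THEN conjunct1] K[unfolded pcont_def, THEN conjunct2]]
  let ?v = "vol TYPE('d)"
  show ?thesis
  \<comment> \<open>One factor \<open>sqrt ?v\<close> comes from bounding the L1 norm by the L2
    norm, the other from integrating the resulting uniform bound.\<close>
  proof (rule bounded_linear_intro[of _ "?v * C"])
    fix F G :: "'d l2" and r :: real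
    obtain f g where f: "Lp 2 f" "F = cl f" and g: "Lp 2 g" "G = cl g" by (metis l2_cases)
    have cf: "Lp 2 (conv K h)" if "Lp 2 h" for h :: "real ^ 'd \<Rightarrow> real" using conv_pcont[OF K Lp2_integrable[OF that]] by (rule pcont_Lp2)
    have "conv K (\<lambda>x. f x + g x) = (\<lambda>x. conv K f x + conv K g x)"
      unfolding conv_real using Ki f g by (simp add: distrib_left Lp2_integrable)
    then show "convop K (F + G) = convop K F + convop K G" using f g K cf
      by (simp add: cl_simps(2)[symmetric] convop_cl Lp2_add)
    have "conv K (\<lambda>x. r * f x) = (\<lambda>x. r * conv K f x)" unfolding conv_real by (simp add: mult.left_commute)
    then show "convop K (r *\<^sub>R F) = r *\<^sub>R convop K F" using f K cf
      by (simp add: cl_simps(5)[symmetric] convop_cl Lp2_scale)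
    have b: "\<bar>conv K f x\<bar> \<le> C * (sqrt ?v * norm F)" for x
    proof -
      have "\<bar>conv K f x\<bar> \<le> (\<integral>y. \<bar>K (x - y) * f y\<bar> \<partial>torus)" unfolding conv_real by (rule integral_abs_bound)
      also have "\<dots> \<le> (\<integral>y. C * \<bar>f y\<bar> \<partial>torus)"

      proof (rule integral_mono)
        show "integrable torus (\<lambda>y. \<bar>K (x - y) * f y\<bar>)" using Ki[OF Lp2_integrable[OF f(1)], of x] by (rule integrable_abs)
        show "integrable torus (\<lambda>y. C * \<bar>f y\<bar>)" using Lp2_integrable[OF f(1)] by simp
        show "\<bar>K (x - y) * f y\<bar> \<le> C * \<bar>f y\<bar>" for y using C(2) by (auto simp: abs_mult intro: mult_right_mono)
      qed
      also have "\<dots> \<le> C * (sqrt ?v * norm F)" using L1_le_L2[OF f(1)] f(2) C(1) by simp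
      finally show ?thesis .
    qed
    have "(norm (convop K F))\<^sup>2 = (\<integral>x. (conv K f x)\<^sup>2 \<partial>torus)" using f K cf by (simp add: convop_cl norm_cl)
    also have "\<dots> \<le> (\<integral>x. (C * (sqrt ?v * norm F))\<^sup>2 \<partial>(torus :: (real ^ 'd) measure))"
    proof (rule integral_mono)
      show "integrable torus (\<lambda>x. (conv K f x)\<^sup>2)" using cf[OF f(1)] by (rule Lp2D(3))
      show "(conv K f x)\<^sup>2 \<le> (C * (sqrt ?v * norm F))\<^sup>2" for x
        using power_mono[OF b[of x], of 2] by simp
    qed simp
    also have "\<dots> = (norm F * (?v * C))\<^sup>2"
      using vol_pos[where ?'d = 'd] by (simp add: vol_def[symmetric] power_mult_distrib power2_eq_square)
    finally show "norm (convop K F) \<le> norm F * (?v * C)"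
      by (rule power2_le_imp_le) (use vol_pos[where ?'d = 'd] C(1) in simp)
  qed
qed

lemma inner_convop:
  fixes K :: "real ^ 'd::finite \<Rightarrow> real"
  assumes K: "pcont K" and even: "\<And>x. K (- x) = K x" shows "inner (convop K F) G = inner F (convop K G)"
proof -
  obtain f g where f: "Lp 2 f" "F = cl f" and g: "Lp 2 g" "G = cl g" by (metis l2_cases)
  have cf: "Lp 2 (conv K h)" if "Lp 2 h" for h :: "real ^ 'd \<Rightarrow> real" using conv_pcont[OF K Lp2_integrable[OF that]] by (rule pcont_Lp2)
  have "inner (convop K F) G = (\<integral>x. g x * conv K f x \<partial>torus)"
    using cf[OF f(1)] f g K by (simp add: convop_cl inner_cl mult.commute)
  also have "\<dots> = (\<integral>x. f x * conv K g x \<partial>torus)"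
    using conv_pairing(2)[of K f g] f g K by (simp add: Lp2_integrable pcont_def even)
  also have "\<dots> = inner F (convop K G)"
    using cf[OF g(1)] f g K by (simp add: convop_cl inner_cl)
  finally show ?thesis .
qed

section \<open>Weak derivatives in terms of Hartley coefficients\<close>

text \<open>The weak derivative along \<open>i\<close>, tested with Hartley functions only; the
  reflected index comes from \<open>\<partial>\<^sub>i cas k = k\<^sub>i cas (- k)\<close>. As a
  family of closed linear conditions on coefficients it is stable under limits.\<close>

definition wd :: "'d::finite \<Rightarrow> 'd l2 \<Rightarrow> 'd l2 \<Rightarrow> bool" where
  "wd i F G \<longleftrightarrow> (\<forall>k. inner G (casN k) = - of_int (k $ i) * inner F (casN (- k)))"

lemma wd_casL: "wd i F G \<longleftrightarrow> (\<forall>k. inner G (casL k) = - of_int (k $ i) * inner F (casL (- k)))"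
  using vol_pos[where ?'d = 'a] unfolding wd_def casN_def by (simp add: field_simps)

lemma wd_unique: "wd i F G \<Longrightarrow> wd i F G' \<Longrightarrow> G = G'"
  by (rule cas.eqI) (auto simp: wd_def)

lemma wd_add: "wd i F G \<Longrightarrow> wd i F' G' \<Longrightarrow> wd i (F + F') (G + G')"
  by (simp add: wd_def inner_add_left algebra_simps)

lemma wd_scale: "wd i F G \<Longrightarrow> wd i (c *\<^sub>R F) (c *\<^sub>R G)"
  by (simp add: wd_def)

lemma wd_diff: "wd i F G \<Longrightarrow> wd i F' G' \<Longrightarrow> wd i (F - F') (G - G')"
  by (simp add: wd_def inner_diff_left algebra_simps)

lemma wd_zero: "wd i 0 0"
  by (simp add: wd_def)

lemma wd_closed:
  assumes "\<And>n. wd i (F n) (G n)" "F \<longlonglongrightarrow> F'" "G \<longlonglongrightarrow> G'" shows "wd i F' G'"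
  unfolding wd_def
proof
  fix k
  have "(\<lambda>n. inner (G n) (casN k)) \<longlonglongrightarrow> inner G' (casN k)" using assms by (intro tendsto_intros)
  moreover have "(\<lambda>n. - of_int (k $ i) * inner (F n) (casN (- k))) \<longlonglongrightarrow> - of_int (k $ i) * inner F' (casN (- k))"
    using assms by (intro tendsto_intros)
  ultimately show "inner G' (casN k) = - of_int (k $ i) * inner F' (casN (- k))"
    using assms(1) by (simp add: wd_def LIMSEQ_unique)
qed

lemma has_sum_uminus_UNIV: "((\<lambda>k :: int ^ 'd::finite. f (- k)) has_sum S) UNIV \<longleftrightarrow> (f has_sum S) UNIV"
  by (rule has_sum_reindex_bij_betw) (rule bij_uminus)

text \<open>Integration by parts for two weakly differentiable classes: Parseval on both sides, with
  the sum over \<open>k\<close> reflected to \<open>- k\<close> on one of them.\<close>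

lemma wd_pair:
  assumes "wd i F G" "wd i U V" shows "inner G U = - inner F V"
proof -
  have "((\<lambda>k. inner G (casN k) * inner U (casN k)) has_sum inner G U) UNIV"
    by (rule cas.parseval) simp
  moreover have "((\<lambda>k. inner F (casN k) * inner V (casN k)) has_sum inner F V) UNIV"
    by (rule cas.parseval) simp
  then have "((\<lambda>k. inner F (casN (- k)) * inner V (casN (- k))) has_sum inner F V) UNIV"
    using has_sum_uminus_UNIV[of "\<lambda>k. inner F (casN k) * inner V (casN k)"] by simp
  then have "((\<lambda>k. - (inner F (casN (- k)) * inner V (casN (- k)))) has_sum - inner F V) UNIV"
    by (simp add: has_sum_uminus)
  moreover have "inner G (casN k) * inner U (casN k) = - (inner F (casN (- k)) * inner V (casN (- k)))" for k
  proof -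
    have "inner V (casN (- k)) = of_int (k $ i) * inner U (casN k)" using assms(2) by (simp add: wd_def)
    moreover have "inner G (casN k) = - of_int (k $ i) * inner F (casN (- k))" using assms(1) by (simp add: wd_def)
    ultimately show ?thesis by simp
  qed
  ultimately show ?thesis by (simp add: has_sum_unique)
qed

lemma wd_C1:
  assumes "C1_along i f f'" shows "wd i (cl f) (cl f')"
  unfolding wd_casL
proof
  fix k
  have f: "Lp 2 f" "Lp 2 f'" using C1_along_pcont[OF assms] pcont_Lp2 by auto
  have "inner (cl f') (casL k) = (\<integral>x. f' x * cas k x \<partial>torus)" using f by (simp add: inner_casL)
  also have "\<dots> = - (\<integral>x. f x * (of_int (k $ i) * cas (- k) x) \<partial>torus)"
    using assms cas_C1_along by (rule integration_by_parts)
  also have "(\<integral>x. f x * (of_int (k $ i) * cas (- k) x) \<partial>torus) = (\<integral>x. of_int (k $ i) * (f x * cas (- k) x) \<partial>torus)"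
    by (rule Bochner_Integration.integral_cong) auto
  also have "- \<dots> = - of_int (k $ i) * inner (cl f) (casL (- k))" using f by (simp add: inner_casL)
  finally show "inner (cl f') (casL k) = - of_int (k $ i) * inner (cl f) (casL (- k))" .
qed

lemma wd_casL_casL: "wd i (casL k) (of_int (k $ i) *\<^sub>R casL (- k))"
  using wd_C1[OF cas_C1_along, of i k] by (simp add: casL_def cl_simps cas_Lp2)

lemma inner_mulop_cl: "pcont a \<Longrightarrow> Lp 2 g \<Longrightarrow> inner (mulop a F) (cl g) = inner F (cl (\<lambda>x. a x * g x))"
  by (simp add: inner_mulop mulop_cl)

text \<open>\<open>a * cas k\<close> is classically differentiable, so by \<open>wd_pair\<close> the
  weak product rule reduces to the classical one for this test function.\<close>

lemma wd_mult:
  assumes F: "wd i F G" and a: "C1_along i a a'"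
  shows "wd i (mulop a F) (mulop a G + mulop a' F)"
  unfolding wd_casL
proof
  fix k
  note ac = C1_along_pcont[OF a]
  have U: "wd i (cl (\<lambda>x. a x * cas k x)) (cl (\<lambda>x. a' x * cas k x + a x * (of_int (k $ i) * cas (- k) x)))"
    by (rule wd_C1[OF C1_along_mult[OF a cas_C1_along]])
  have L: "Lp 2 (\<lambda>x. a' x * cas k x)" "Lp 2 (\<lambda>x. a x * cas (- k) x)"
    by (rule mul_Lp2[OF ac(2) cas_Lp2], rule mul_Lp2[OF ac(1) cas_Lp2])
  have V: "cl (\<lambda>x. a' x * cas k x + a x * (of_int (k $ i) * cas (- k) x)) =
      cl (\<lambda>x. a' x * cas k x) + of_int (k $ i) *\<^sub>R cl (\<lambda>x. a x * cas (- k) x)"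
    unfolding mult.left_commute[of "a _"]
    by (simp only: cl_simps(2)[OF L(1) Lp2_scale[OF L(2)]] cl_simps(5)[OF L(2)])
  have "inner (mulop a G + mulop a' F) (casL k) = inner G (cl (\<lambda>x. a x * cas k x)) + inner F (cl (\<lambda>x. a' x * cas k x))"
    unfolding casL_def using ac by (simp add: inner_add_left inner_mulop_cl cas_Lp2)
  also have "\<dots> = - of_int (k $ i) * inner F (cl (\<lambda>x. a x * cas (- k) x))"
    unfolding wd_pair[OF F U] V by (simp add: inner_add_right)
  also have "\<dots> = - of_int (k $ i) * inner (mulop a F) (casL (- k))"
    unfolding casL_def using ac by (simp add: inner_mulop_cl cas_Lp2)
  finally show "inner (mulop a G + mulop a' F) (casL k) = - of_int (k $ i) * inner (mulop a F) (casL (- k))" .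
qed

lemma wd_convop:
  assumes K: "C1_along i K K'" shows "wd i (convop K F) (convop K' F)"
  unfolding convop_def
  by (intro wd_C1 conv_C1_along[OF K] Lp2_integrable rp_Lp2)

text \<open>Hartley functions are test functions, which gives one direction; conversely
  \<open>wd_pair\<close> extends the identity from them to all test functions.\<close>

lemma weak_pd_iff_wd:
  fixes f g :: "real ^ 'd::finite \<Rightarrow> real"
  assumes f: "Lp 2 f" and g: "Lp 2 g"
  shows "weak_pd i f g \<longleftrightarrow> wd i (cl f) (cl g)"
proof
  assume w: "weak_pd i f g"
  show "wd i (cl f) (cl g)" unfolding wd_casL
  proof
    fix k
    have "(\<integral>x. pd i (cas (- k)) x *\<^sub>R f x \<partial>torus) = - (\<integral>x. cas (- k) x *\<^sub>R g x \<partial>torus)" for k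
      using w cas_test_fun unfolding weak_pd_def by blast
    from this[of "- k"] show "inner (cl g) (casL k) = - of_int (k $ i) * inner (cl f) (casL (- k))"
      using f g by (simp add: inner_casL pd_cas mult.assoc) (simp add: mult.commute)
  qed
next
  assume w: "wd i (cl f) (cl g)"
  show "weak_pd i f g" unfolding weak_pd_def
  proof (intro conjI allI impI)
    show "integrable torus f" "integrable torus g" using f g by (auto intro: Lp2_integrable)
    fix \<phi> :: "real ^ 'd \<Rightarrow> real" assume t: "test_fun \<phi>"
    then have c: "C1_along i \<phi> (pd i \<phi>)" unfolding test_fun_def by (intro pd_C1_along) blast+
    have L: "Lp 2 \<phi>" "Lp 2 (pd i \<phi>)" using C1_along_pcont[OF c] pcont_Lp2 by auto
    have "inner (cl g) (cl \<phi>) = - inner (cl f) (cl (pd i \<phi>))" by (rule wd_pair[OF w wd_C1[OF c]])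
    then show "(\<integral>x. pd i \<phi> x *\<^sub>R f x \<partial>torus) = - (\<integral>x. \<phi> x *\<^sub>R g x \<partial>torus)"
      using f g L by (simp add: inner_cl mult.commute)
  qed
qed

section \<open>Compactness and the Poincare inequality\<close>

definition freq :: "int ^ 'd::finite \<Rightarrow> real" where
  "freq k = (\<Sum>i\<in>UNIV. (of_int (k $ i))\<^sup>2)"

lemma freq_ge_1: "k \<noteq> 0 \<Longrightarrow> 1 \<le> freq k"
proof -
  assume "k \<noteq> 0"
  then obtain i where i: "k $ i \<noteq> 0" by (auto simp: vec_eq_iff)
  have "1 \<le> (k $ i)\<^sup>2" using i by (simp add: int_one_le_iff_zero_less)
  then have "1 \<le> (real_of_int (k $ i))\<^sup>2" by (metis of_int_1_le_iff of_int_power)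
  also have "\<dots> \<le> freq k" unfolding freq_def by (rule member_le_sum) auto
  finally show ?thesis .
qed

lemma freq_nonneg: "0 \<le> freq k"
  unfolding freq_def by (intro sum_nonneg) auto

lemma finite_freq: "finite {k :: int ^ 'd::finite. freq k \<le> N}"
proof -
  let ?B = "{- \<lceil>\<bar>N\<bar>\<rceil> .. \<lceil>\<bar>N\<bar>\<rceil>} :: int set"
  have "{k :: int ^ 'd. freq k \<le> N} \<subseteq> vec_lambda ` (UNIV \<rightarrow>\<^sub>E ?B)"
  proof
    fix k :: "int ^ 'd" assume "k \<in> {k. freq k \<le> N}"
    then have N: "freq k \<le> N" by simp
    have "k $ i \<in> ?B" for i
    proof -
      have a: "\<bar>z\<bar> \<le> z\<^sup>2" for z :: int
        by (metis abs_ge_zero abs_le_square_iff abs_power2 mult_left_le_imp_le nat_abs_mult_distrib power2_abs power2_eq_square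
            self_le_power linorder_not_less zero_less_abs_iff abs_0 order_refl power2_nonneg_ge_1_iff pos2 int_one_le_iff_zero_less zero_le_power2)
      have "real_of_int \<bar>k $ i\<bar> \<le> real_of_int ((k $ i)\<^sup>2)" using a by (simp only: of_int_le_iff)
      also have "\<dots> \<le> freq k" unfolding freq_def of_int_power by (rule member_le_sum) auto
      also have "\<dots> \<le> \<bar>N\<bar>" using N by simp
      finally have "\<bar>k $ i\<bar> \<le> \<lceil>\<bar>N\<bar>\<rceil>" by linarith
      then show ?thesis by auto
    qed
    then have "vec_nth k \<in> UNIV \<rightarrow>\<^sub>E ?B" by auto
    then show "k \<in> vec_lambda ` (UNIV \<rightarrow>\<^sub>E ?B)" by (metis image_eqI vec_nth_inverse)
  qed
  then show ?thesis by (rule finite_subset) (intro finite_imageI finite_PiE, auto)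
qed

lemma wd_coeff: "wd i F G \<Longrightarrow> (inner G (casN (- k)))\<^sup>2 = (of_int (k $ i))\<^sup>2 * (inner F (casN k))\<^sup>2"
  by (simp add: wd_def power_mult_distrib)

lemma has_sum_finite_sum:
  fixes f :: "'i \<Rightarrow> 'j \<Rightarrow> real"
  assumes "finite A" "\<And>i. i \<in> A \<Longrightarrow> (f i has_sum S i) B"
  shows "((\<lambda>x. \<Sum>i\<in>A. f i x) has_sum (\<Sum>i\<in>A. S i)) B"
  using assms by (induction A rule: finite_induct) (auto intro: has_sum_add)

text \<open>Zero mean removes the coefficient at \<open>k = 0\<close>, and \<open>freq\<close> is at
  least 1 at every other index, whence the constant 1.\<close>

lemma poincare:
  fixes F :: "'d::finite l2"
  assumes "\<And>i. wd i F (G i)" and z: "inner F (casL 0) = 0"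
  shows "(norm F)\<^sup>2 \<le> (\<Sum>i\<in>UNIV. (norm (G i))\<^sup>2)"
proof (rule has_sum_mono)
  show "((\<lambda>k. (inner F (casN k))\<^sup>2) has_sum (norm F)\<^sup>2) UNIV"
    unfolding power2_norm_eq_inner by (rule cas.parseval_sq) simp
  have "((\<lambda>k. (inner (G i) (casN (- k)))\<^sup>2) has_sum (norm (G i))\<^sup>2) UNIV" for i
    using cas.parseval_sq[of "G i"] has_sum_uminus_UNIV[of "\<lambda>k. (inner (G i) (casN k))\<^sup>2"]
    by (simp add: power2_norm_eq_inner)
  then show "((\<lambda>k. \<Sum>i\<in>UNIV. (inner (G i) (casN (- k)))\<^sup>2) has_sum (\<Sum>i\<in>UNIV. (norm (G i))\<^sup>2)) UNIV"
    by (intro has_sum_finite_sum) auto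
  show "(inner F (casN k))\<^sup>2 \<le> (\<Sum>i\<in>UNIV. (inner (G i) (casN (- k)))\<^sup>2)" for k
  proof -
    have "(\<Sum>i\<in>UNIV. (inner (G i) (casN (- k)))\<^sup>2) = freq k * (inner F (casN k))\<^sup>2"
      unfolding freq_def sum_distrib_right by (intro sum.cong refl wd_coeff assms)
    moreover have "k = 0 \<Longrightarrow> inner F (casN k) = 0" using z by (simp add: casN_def)
    ultimately show ?thesis using mult_right_mono[OF freq_ge_1[of k], of "(inner F (casN k))\<^sup>2"]
      by (cases "k = 0") auto
  qed
qed

text \<open>One compact segment is added at a time. This provides the finite dimensional part in the
  proof of Rellich's theorem.\<close>

lemma compact_span_box:
  fixes v :: "'k \<Rightarrow> 'a::real_normed_vector"
  assumes "finite A" shows "compact {\<Sum>k\<in>A. a k *\<^sub>R v k | a. \<forall>k\<in>A. \<bar>a k\<bar> \<le> (D :: real)}"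
  using assms
proof (induction A)
  case (insert j A)
  have "{\<Sum>k\<in>insert j A. a k *\<^sub>R v k | a. \<forall>k\<in>insert j A. \<bar>a k\<bar> \<le> D} =
    {x + y | x y. x \<in> (\<lambda>t. t *\<^sub>R v j) ` {- D..D} \<and> y \<in> {\<Sum>k\<in>A. a k *\<^sub>R v k | a. \<forall>k\<in>A. \<bar>a k\<bar> \<le> D}}" (is "?L = ?R")
  proof
    show "?L \<subseteq> ?R" using insert(1,2) by (auto simp: abs_le_iff) (metis (mono_tags, lifting) atLeastAtMost_iff imageI minus_le_iff abs_le_iff)
    show "?R \<subseteq> ?L"
    proof
      fix z assume "z \<in> ?R"
      then obtain t a where z: "z = t *\<^sub>R v j + (\<Sum>k\<in>A. a k *\<^sub>R v k)" "t \<in> {- D..D}" "\<forall>k\<in>A. \<bar>a k\<bar> \<le> D" by auto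
      define a' where "a' = a(j := t)"
      have "(\<Sum>k\<in>A. a' k *\<^sub>R v k) = (\<Sum>k\<in>A. a k *\<^sub>R v k)"
        using insert(2) by (intro sum.cong) (auto simp: a'_def)
      then have "z = (\<Sum>k\<in>insert j A. a' k *\<^sub>R v k)" unfolding z using insert(1,2) by (simp add: a'_def)
      moreover have "\<forall>k\<in>insert j A. \<bar>a' k\<bar> \<le> D" unfolding a'_def using z insert(2) by (auto simp: abs_le_iff)
      ultimately show "z \<in> ?L" by blast
    qed
  qed
  moreover have "compact ?R"
    by (rule compact_sums[OF compact_continuous_image[OF _ compact_Icc] insert.IH]) (intro continuous_intros)
  ultimately show ?case by simp
qed simp

text \<open>Rellich's theorem: the high frequency tails are uniformly small.\<close>

lemma rellich_compact:
  "compact {F :: 'd::finite l2. \<forall>A. finite A \<longrightarrow> (\<Sum>k\<in>A. (1 + freq k) * (inner F (casN k))\<^sup>2) \<le> C}" (is "compact ?S")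
  unfolding compact_eq_totally_bounded
proof (intro conjI allI impI, goal_cases)
  case 1
  have "?S = (\<Inter>A\<in>{A. finite A}. {F. (\<Sum>k\<in>A. (1 + freq k) * (inner F (casN k))\<^sup>2) \<le> C})" by auto
  moreover have "closed \<dots>"
    by (intro closed_INT ballI closed_Collect_le continuous_intros)
  ultimately show ?case by (simp add: complete_eq_closed)
next
  case (2 \<epsilon>)
  then have eps: "0 < \<epsilon>" by simp
  show "\<exists>k. finite k \<and> ?S \<subseteq> (\<Union>x\<in>k. ball x \<epsilon>)"
  proof (cases "?S = {}")
    case False
    then obtain F0 where "F0 \<in> ?S" by blast
    then have C0: "0 \<le> C" by (auto dest: spec[of _ "{}"])
    \<comment> \<open>Makes the tail small: above frequency \<open>N\<close> the squares sum to at
      most \<open>C / N\<close>, which is half of \<open>(\<epsilon> / 2)\<^sup>2\<close>.\<close>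
    define N where "N = 8 * C / \<epsilon>\<^sup>2"
    define A where "A = {k :: int ^ 'd. freq k \<le> N}"
    have A: "finite A" unfolding A_def by (rule finite_freq)
    define T where "T = {\<Sum>k\<in>A. a k *\<^sub>R casN k | a. \<forall>k\<in>A. \<bar>a k\<bar> \<le> sqrt C}"
    have "compact T" unfolding T_def using A by (rule compact_span_box)
    then obtain K where K: "finite K" "T \<subseteq> (\<Union>x\<in>K. ball x (\<epsilon> / 2))"
      unfolding compact_eq_totally_bounded using eps by (meson half_gt_zero)
    have "F \<in> (\<Union>x\<in>K. ball x \<epsilon>)" if F: "F \<in> ?S" for F
    proof -
      define P where "P = (\<Sum>k\<in>A. inner F (casN k) *\<^sub>R casN k)"
      have "\<bar>inner F (casN k)\<bar> \<le> sqrt C" for k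
      proof -
        have "(1 + freq k) * (inner F (casN k))\<^sup>2 \<le> C" using F by (auto dest: spec[of _ "{k}"])
        moreover have "0 \<le> freq k * (inner F (casN k))\<^sup>2" by (intro mult_nonneg_nonneg freq_nonneg) simp
        ultimately have "(inner F (casN k))\<^sup>2 \<le> C" by (simp add: distrib_right)
        then show ?thesis by (rule real_le_rsqrt[of "\<bar>_\<bar>", simplified])
      qed
      then have "P \<in> T" unfolding T_def P_def by (intro CollectI exI[of _ "\<lambda>k. inner F (casN k)"]) auto
      then obtain x where x: "x \<in> K" "dist x P < \<epsilon> / 2" using K(2) by auto
      have coeff: "inner (F - P) (casN k) = (if k \<in> A then 0 else inner F (casN k))" for k
        unfolding P_def inner_diff_left using cas.b_sum_e[OF A, of k "\<lambda>k. inner F (casN k)"] by simp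
      have "(norm (F - P))\<^sup>2 \<le> (\<epsilon> / 2)\<^sup>2 / 2"
      proof (rule has_sum_le_finite_sums)
        show "((\<lambda>k. (inner (F - P) (casN k))\<^sup>2) has_sum (norm (F - P))\<^sup>2) UNIV"
          unfolding power2_norm_eq_inner by (rule cas.parseval_sq) simp
        fix B :: "(int ^ 'd) set" assume B: "finite B"
        have "N * (\<Sum>k\<in>B. (inner (F - P) (casN k))\<^sup>2) \<le> (\<Sum>k\<in>B. (1 + freq k) * (inner F (casN k))\<^sup>2)"
          unfolding sum_distrib_left
        proof (rule sum_mono)
          fix k
          show "N * (inner (F - P) (casN k))\<^sup>2 \<le> (1 + freq k) * (inner F (casN k))\<^sup>2"
            unfolding coeff using freq_nonneg[of k] by (auto simp: A_def intro!: mult_right_mono)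
        qed
        also have "\<dots> \<le> C" using F B by blast
        finally have *: "N * (\<Sum>k\<in>B. (inner (F - P) (casN k))\<^sup>2) \<le> C" .
        show "(\<Sum>k\<in>B. (inner (F - P) (casN k))\<^sup>2) \<le> (\<epsilon> / 2)\<^sup>2 / 2"
        \<comment> \<open>If \<open>C = 0\<close> then \<open>N = 0\<close> and the bound just
          obtained is void, but then all coefficients of \<open>F\<close> vanish.\<close>
        proof (cases "C = 0")
          case True
          have "(inner (F - P) (casN k))\<^sup>2 \<le> 0" for k
          proof -
            have "(1 + freq k) * (inner F (casN k))\<^sup>2 \<le> 0" using F True by (auto dest: spec[of _ "{k}"])
            then have "inner F (casN k) = 0" using freq_nonneg[of k] by (auto simp: mult_le_0_iff)
            then show ?thesis unfolding coeff by simp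
          qed
          then have "(\<Sum>k\<in>B. (inner (F - P) (casN k))\<^sup>2) \<le> 0" by (intro sum_nonpos)
          then show ?thesis using zero_le_power2[of "\<epsilon> / 2"] by linarith
        next
          case False
          then have "0 < C" using C0 by simp
          then show ?thesis using * eps by (simp add: N_def field_simps)
        qed
      qed
      also have "\<dots> < (\<epsilon> / 2)\<^sup>2" using eps by simp
      finally have "norm (F - P) < \<epsilon> / 2" by (rule power_less_imp_less_base) (use eps in simp)
      then have "dist x F < \<epsilon>" using x(2) dist_triangle_half_l[of x P \<epsilon> F] by (simp add: dist_norm norm_minus_commute)
      then show ?thesis using x(1) by auto
    qed
    then show ?thesis using K(1) by blast
  next
    case True
    show ?thesis unfolding True by (intro exI[of _ "{}"]) simp
  qed
qed

lemma rellich: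
  fixes F :: "nat \<Rightarrow> 'd::finite l2"
  assumes F: "\<And>n. norm (F n) \<le> C" and G: "\<And>n i. wd i (F n) (G n i)" "\<And>n i. norm (G n i) \<le> C"
  shows "\<exists>r l. strict_mono r \<and> (\<lambda>n. F (r n)) \<longlonglongrightarrow> l"
proof -
  \<comment> \<open>The norm contributes \<open>C\<^sup>2\<close> and so does each partial
    derivative; the coefficients of the derivatives carry the factors \<open>(k $ i)\<^sup>2\<close>
    that add up to \<open>freq k\<close>.\<close>
  define D where "D = C\<^sup>2 + (\<Sum>i\<in>(UNIV :: 'd set). C\<^sup>2)"
  let ?S = "{F :: 'd l2. \<forall>A. finite A \<longrightarrow> (\<Sum>k\<in>A. (1 + freq k) * (inner F (casN k))\<^sup>2) \<le> D}"
  have bes: "(\<Sum>k\<in>A. (inner H (casN k))\<^sup>2) \<le> C\<^sup>2" if "finite A" "norm H \<le> C" for A and H :: "'d l2"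
  proof -
    have "(\<Sum>k\<in>A. (inner H (casN k))\<^sup>2) \<le> (norm H)\<^sup>2"
      using cas.bessel[of A H] that(1) by (simp add: power2_norm_eq_inner)
    also have "\<dots> \<le> C\<^sup>2" using that(2) by (intro power_mono) auto
    finally show ?thesis .
  qed
  have "F n \<in> ?S" for n
  proof (intro CollectI allI impI)
    fix A :: "(int ^ 'd) set" assume A: "finite A"
    have "(\<Sum>k\<in>A. (1 + freq k) * (inner (F n) (casN k))\<^sup>2) =
      (\<Sum>k\<in>A. (inner (F n) (casN k))\<^sup>2) + (\<Sum>k\<in>A. \<Sum>i\<in>UNIV. (inner (G n i) (casN (- k)))\<^sup>2)"
      unfolding freq_def wd_coeff[OF G(1)] sum.distrib[symmetric] by (simp add: distrib_right sum_distrib_right)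
    also have "(\<Sum>k\<in>A. \<Sum>i\<in>UNIV. (inner (G n i) (casN (- k)))\<^sup>2) = (\<Sum>i\<in>UNIV. \<Sum>k\<in>A. (inner (G n i) (casN (- k)))\<^sup>2)"
      by (rule sum.swap)
    also have "\<dots> = (\<Sum>i\<in>UNIV. \<Sum>k\<in>uminus ` A. (inner (G n i) (casN k))\<^sup>2)"
      by (simp add: sum.reindex)
    also have "(\<Sum>k\<in>A. (inner (F n) (casN k))\<^sup>2) + \<dots> \<le> D" unfolding D_def
      using A F G(2) by (intro add_mono sum_mono bes) auto
    finally show "(\<Sum>k\<in>A. (1 + freq k) * (inner (F n) (casN k))\<^sup>2) \<le> D" .
  qed
  then have all: "\<forall>n. F n \<in> ?S" ..
  have "seq_compact ?S" by (rule compact_imp_seq_compact[OF rellich_compact])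
  from this[unfolded seq_compact_def, THEN spec, THEN mp, OF all]
  obtain l r where r: "strict_mono r" "(F \<circ> r) \<longlonglongrightarrow> l" by (elim bexE exE conjE)
  then have "(\<lambda>n. F (r n)) \<longlonglongrightarrow> l" by (simp only: o_def)
  with r(1) show ?thesis by (intro exI conjI)
qed

section \<open>The stationary state, the symmetrizer and the compact inverse on real zero mean
  classes\<close>

section \<open>The stationary state\<close>

text \<open>Reflect the coordinates one at a time, by induction on the set of reflected
  ones.\<close>

lemma even_each_minus:
  fixes W :: "real ^ 'd::finite \<Rightarrow> real"
  assumes "even_each W" shows "W (- x) = W x"
proof -
  have "W (\<chi> j. if j \<in> A then - (x $ j) else x $ j) = W x" if "finite A" for A
    using that
  proof (induction A)
    case (insert i A)
    let ?y = "\<chi> j. if j \<in> A then - (x $ j) else x $ j"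
    have "(\<chi> j. if j \<in> insert i A then - (x $ j) else x $ j) = (\<chi> j. if j = i then - (?y $ j) else ?y $ j)"
      using insert(2) by (auto simp: vec_eq_iff)
    moreover have "W (\<chi> j. if j = i then - (?y $ j) else ?y $ j) = W ?y"
      using assms unfolding even_each_def by (elim allE)
    ultimately show ?case using insert.IH by (simp only:)
  qed (simp add: vec_lambda_eta)
  from this[of UNIV] show ?thesis by (simp add: uminus_vec_def)
qed

text \<open>For continuous \<open>W\<close> an essential bound holds everywhere: the closed set
  where it is valid contains almost all of an open box, hence the box, its closure and by
  periodicity all points.\<close>

lemma ess_norm_less:
  fixes W :: "real ^ 'd::finite \<Rightarrow> real"
  assumes "pcont W" "ess_norm W < ereal s"
  obtains C where "0 \<le> C" "C < s" "\<And>x. \<bar>W x\<bar> \<le> C"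
proof -
  obtain C where C: "ess_norm W < ereal C" "C < s" using ereal_dense2[OF assms(2)] by auto
  have Wc: "continuous_on UNIV W" and Wp: "periodic W" using assms(1) by (auto simp: pcont_def)
  have "AE x in torus. ereal \<bar>W x\<bar> \<le> ess_norm W"
    unfolding ess_norm_def real_norm_def
    by (rule esssup_AE)
  then have "AE x in torus. \<bar>W x\<bar> \<le> C"
    by eventually_elim (use C(1) in \<open>metis ereal_less_eq(3) less_imp_le order_trans\<close>)
  then have ae: "AE x in lborel. x \<in> cell \<longrightarrow> \<bar>W x\<bar> \<le> C" by (simp add: AE_torus)
  have cl: "closed {x. \<bar>W x\<bar> \<le> C}" by (intro closed_Collect_le continuous_intros Wc)
  let ?B = "box 0 (\<chi> i. 2 * pi) :: (real ^ 'd) set"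
  have "\<bar>W x\<bar> \<le> C" if x: "x \<in> ?B" for x
  proof -
    have "AE x in lebesgue. x \<in> ?B \<longrightarrow> x \<in> {x. \<bar>W x\<bar> \<le> C}"
      using AE_completion[OF ae] by eventually_elim (auto simp: cell_def mem_box_cart less_imp_le)
    then have "AE x\<in>?B in lebesgue. x \<in> {x. \<bar>W x\<bar> \<le> C}" by simp
    from mem_closed_if_AE_lebesgue_open[OF open_box cl this x] show ?thesis by simp
  qed
  then have "closure ?B \<subseteq> {x. \<bar>W x\<bar> \<le> C}" by (intro closure_minimal cl) auto
  moreover have "cell \<subseteq> closure ?B"
  proof -
    have "(\<chi> i. pi) \<in> ?B" by (simp add: mem_box_cart)
    then have "?B \<noteq> {}" by blast
    then show ?thesis by (subst closure_box) (auto simp: cell_def mem_box_cart less_imp_le)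
  qed
  ultimately have "\<bar>W x\<bar> \<le> C" for x
    using periodic_ext[OF Wp, where P = "\<lambda>w. \<bar>w\<bar> \<le> C"] by blast
  moreover from this[of 0] have "0 \<le> C" by linarith
  ultimately show ?thesis using that C(2) by blast
qed

text \<open>The divergence of \<open>G\<close> is \<open>Q\<close>, tested with Hartley functions
  only.\<close>

definition divL :: "('d::finite \<Rightarrow> 'd l2) \<Rightarrow> 'd l2 \<Rightarrow> bool" where
  "divL G Q \<longleftrightarrow> (\<forall>k. (\<Sum>i\<in>UNIV. of_int (k $ i) * inner (G i) (casL (- k))) = - inner Q (casL k))"

text \<open>Parseval extends the defining identity of \<open>divL\<close> from Hartley functions to
  every weakly differentiable \<open>P\<close>; this is Green's formula on the torus.\<close>

lemma div_pair:
  fixes Q :: "'d::finite l2"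
  assumes G: "divL G Q" and P: "\<And>i. wd i P (P' i)"
  shows "(\<Sum>i\<in>UNIV. inner (G i) (P' i)) = - inner Q P"
proof -
  have "((\<lambda>k. inner (G i) (casN (- k)) * inner (P' i) (casN (- k))) has_sum inner (G i) (P' i)) UNIV" for i
    by (rule has_sum_uminus_UNIV[THEN iffD2, OF cas.parseval[OF UNIV_I]])
  then have "((\<lambda>k. \<Sum>i\<in>UNIV. inner (G i) (casN (- k)) * inner (P' i) (casN (- k))) has_sum
      (\<Sum>i\<in>UNIV. inner (G i) (P' i))) UNIV"
    by (intro has_sum_finite_sum) auto
  moreover have "((\<lambda>k. - (inner Q (casN k) * inner P (casN k))) has_sum - inner Q P) UNIV"
    using cas.parseval[of Q P] by (simp add: has_sum_uminus)
  moreover have "(\<Sum>i\<in>UNIV. inner (G i) (casN (- k)) * inner (P' i) (casN (- k))) = - (inner Q (casN k) * inner P (casN k))" for k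
  proof -
    have "inner (P' i) (casN (- k)) = of_int (k $ i) * inner P (casN k)" for i
      using P[of i] by (simp add: wd_def)
    then have "(\<Sum>i\<in>UNIV. inner (G i) (casN (- k)) * inner (P' i) (casN (- k))) =
      (\<Sum>i\<in>UNIV. of_int (k $ i) * inner (G i) (casL (- k))) * inner P (casN k) / sqrt (vol TYPE('d))"
      by (simp add: casN_def[of "- k"] sum_distrib_right sum_distrib_left sum_divide_distrib ac_simps)
    also have "\<dots> = - (inner Q (casN k) * inner P (casN k))"
      using G unfolding divL_def by (simp add: casN_def[of k])
    finally show ?thesis .
  qed
  ultimately show ?thesis by (simp add: has_sum_unique)
qed

locale mckean_vlasov =
  fixes V W \<mu> :: "real ^ 'd::finite \<Rightarrow> real" and \<sigma> :: real
  assumes sigma: "0 < \<sigma>" and V: "periodic V" "Ck 2 V" and W: "periodic W" "Ck 2 W" "even_each W"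
    and stable: "H_stable W \<or> ess_norm W < ereal \<sigma>" and stat: "stationary_state \<sigma> V W \<mu>"
begin

lemmas V_C1 = Ck2_C1_along[OF V] and W_C1 = Ck2_C1_along[OF W(1,2)]

lemma W_pcont: "pcont W" "pcont (pd i W)"
  using C1_along_pcont[OF W_C1(1)] by auto

lemma W_even: "W (- x) = W x"
  using W(3) by (rule even_each_minus)

lemma mu_integrable: "integrable torus \<mu>" and mu_integral: "(\<integral>x. \<mu> x \<partial>torus) = 1"
  using stat by (auto simp: stationary_state_def)

text \<open>The effective potential, of which \<open>\<mu>\<close> is the Gibbs density at
  temperature \<open>\<sigma>\<close>.\<close>

definition U :: "real ^ 'd \<Rightarrow> real" where "U x = V x + conv W \<mu> x"
definition dU :: "'d \<Rightarrow> real ^ 'd \<Rightarrow> real" where "dU i x = pd i V x + conv (pd i W) \<mu> x"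
definition Z :: real where "Z = (\<integral>x. gibbs \<sigma> V W \<mu> x \<partial>torus)"

lemma mu_eq: "\<mu> x = exp (- U x / \<sigma>) / Z"
  using stat unfolding stationary_state_def gibbs_def Z_def U_def by blast

lemma Z_pos: "0 < Z"
proof -
  have "0 \<le> Z" unfolding Z_def gibbs_def by (intro integral_nonneg_AE) simp
  moreover have "Z \<noteq> 0"
  proof
    assume "Z = 0"
    \<comment> \<open>Division by zero yields zero, so the fixed point equation would give a density
      without mass.\<close>
    then have "\<mu> = (\<lambda>x. 0)" by (simp add: mu_eq fun_eq_iff)
    then have "(\<integral>x. \<mu> x \<partial>torus) = 0" by (simp only: integral_zero)
    then show False using mu_integral by simp
  qed
  ultimately show ?thesis by simp
qed

text \<open>The reciprocal of \<open>\<mu>\<close> as an explicit exponential, so that its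
  derivative comes from the exponential rule.\<close>

definition imu :: "real ^ 'd \<Rightarrow> real" where "imu x = Z * exp (U x / \<sigma>)"

lemma mu_pos: "0 < \<mu> x" and imu_pos: "0 < imu x"
  using Z_pos by (simp_all add: mu_eq imu_def)

lemma mu_imu: "\<mu> x * imu x = 1"
  using Z_pos by (simp add: mu_eq imu_def exp_minus field_simps)

lemma imu_inverse: "imu x = 1 / \<mu> x"
  using mu_imu[of x] mu_pos[of x] by (simp add: field_simps)

lemma U_C1: "C1_along i U (dU i)"
  unfolding U_def[abs_def] dU_def[abs_def] by (intro C1_along_add V_C1 conv_C1_along W_C1 mu_integrable)

lemma dU_C1: "C1_along j (dU i) (\<lambda>x. pd j (pd i V) x + conv (pd j (pd i W)) \<mu> x)"
  unfolding dU_def[abs_def] by (intro C1_along_add V_C1 conv_C1_along W_C1 mu_integrable)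

lemma mu_C1: "C1_along i \<mu> (\<lambda>x. - (1 / \<sigma>) * (\<mu> x * dU i x))"
proof -
  have "C1_along i (\<lambda>x. 1 / Z * exp (- (1 / \<sigma>) * U x)) (\<lambda>x. 1 / Z * (exp (- (1 / \<sigma>) * U x) * (- (1 / \<sigma>) * dU i x)))"
    by (intro C1_along_cmult C1_along_exp U_C1)
  moreover have "(\<lambda>x. 1 / Z * exp (- (1 / \<sigma>) * U x)) = \<mu>" by (simp add: mu_eq fun_eq_iff)
  moreover have "(\<lambda>x. 1 / Z * (exp (- (1 / \<sigma>) * U x) * (- (1 / \<sigma>) * dU i x))) = (\<lambda>x. - (1 / \<sigma>) * (\<mu> x * dU i x))"
    by (simp add: mu_eq fun_eq_iff)
  ultimately show ?thesis by simp
qed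

lemma imu_C1: "C1_along i imu (\<lambda>x. 1 / \<sigma> * (imu x * dU i x))"
proof -
  have "C1_along i (\<lambda>x. Z * exp (1 / \<sigma> * U x)) (\<lambda>x. Z * (exp (1 / \<sigma> * U x) * (1 / \<sigma> * dU i x)))"
    by (intro C1_along_cmult C1_along_exp U_C1)
  moreover have "(\<lambda>x. Z * exp (1 / \<sigma> * U x)) = imu" by (simp add: imu_def fun_eq_iff)
  moreover have "(\<lambda>x. Z * (exp (1 / \<sigma> * U x) * (1 / \<sigma> * dU i x))) = (\<lambda>x. 1 / \<sigma> * (imu x * dU i x))"
    by (simp add: imu_def fun_eq_iff)
  ultimately show ?thesis by simp
qed

lemma pconts: "pcont \<mu>" "pcont imu" "pcont (dU i)"
  using C1_along_pcont(1)[OF mu_C1] C1_along_pcont(1)[OF imu_C1] C1_along_pcont(1)[OF dU_C1] by auto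

text \<open>The gradient of \<open>\<mu>\<close> is again differentiable because \<open>V\<close>
  and \<open>W\<close> are C2; \<open>solution_regular\<close> uses this to differentiate a solution
  twice.\<close>

lemma dmu_C1: "\<exists>c. C1_along j (\<lambda>x. - (1 / \<sigma>) * (\<mu> x * dU i x)) c"
  using C1_along_cmult[OF C1_along_mult[OF mu_C1 dU_C1]] by blast

text \<open>\<open>\<mu>\<close> and \<open>imu\<close> are bounded and have product 1, so an upper
  bound of each gives a lower bound of the other.\<close>

lemma bounds: "\<exists>m>0. \<forall>x. m \<le> \<mu> x \<and> m \<le> imu x"
proof -
  obtain A B where A: "0 < A" "\<And>x. \<bar>\<mu> x\<bar> \<le> A" and B: "0 < B" "\<And>x. \<bar>imu x\<bar> \<le> B"
    using pconts(1,2) periodic_bounded unfolding pcont_def by metis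
  show ?thesis
  proof (intro exI[of _ "min (1 / A) (1 / B)"] conjI allI)
    show "0 < min (1 / A) (1 / B)" using A B by simp
    show "min (1 / A) (1 / B) \<le> \<mu> x" for x
    proof -
      have "1 = \<mu> x * imu x" by (simp add: mu_imu)
      also have "\<dots> \<le> \<mu> x * B" using B(2)[of x] mu_pos[of x] by (intro mult_left_mono) auto
      finally have "1 / B \<le> \<mu> x" using B(1) by (simp add: field_simps)
      then show ?thesis by simp
    qed
    show "min (1 / A) (1 / B) \<le> imu x" for x
    proof -
      have "1 = \<mu> x * imu x" by (simp add: mu_imu)
      also have "\<dots> \<le> A * imu x" using A(2)[of x] imu_pos[of x] by (intro mult_right_mono) auto
      finally have "1 / A \<le> imu x" using A(1) by (simp add: field_simps)
      then show ?thesis by simp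
    qed
  qed
qed

lemma inner_mulop_ge:
  assumes a: "pcont a" and m: "\<And>x. m \<le> a x" shows "m * (norm F)\<^sup>2 \<le> inner (mulop a F) F"
proof -
  obtain f where f: "Lp 2 f" "F = cl f" by (rule l2_cases)
  have "m * (norm F)\<^sup>2 = (\<integral>x. m * (f x)\<^sup>2 \<partial>torus)" using f by (simp add: norm_cl)
  also have "\<dots> \<le> (\<integral>x. a x * f x * f x \<partial>torus)"
  proof (rule integral_mono)
    show "integrable torus (\<lambda>x. m * (f x)\<^sup>2)" using Lp2D(3)[OF f(1)] by simp
    show "integrable torus (\<lambda>x. a x * f x * f x)" using mul_Lp2[OF a f(1)] f(1) by (rule Lp2_mult_integrable)
    show "m * (f x)\<^sup>2 \<le> a x * f x * f x" for x
      using mult_right_mono[OF m[of x] zero_le_power2[of "f x"]] by (simp add: power2_eq_square mult.assoc)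
  qed
  also have "\<dots> = inner (mulop a F) F" using f a by (simp add: mulop_cl inner_cl mul_Lp2)
  finally show ?thesis .
qed

section \<open>The symmetrizing operator\<close>

text \<open>With \<open>S y = \<sigma> y / \<mu> + W * y\<close> the flux is \<open>\<mu> \<nabla>(S y)\<close>, because \<open>\<sigma> \<nabla>\<mu> = - \<mu> \<nabla>(V + W * \<mu>)\<close>.\<close>

definition S :: "'d l2 \<Rightarrow> 'd l2" where
  "S F = \<sigma> *\<^sub>R mulop imu F + convop W F"

lemma S_bounded_linear: "bounded_linear S"
  unfolding S_def by (intro bounded_linear_add bounded_linear_const_scaleR mulop_bounded_linear
      convop_bounded_linear pconts W_pcont)

lemmas S_linear = bounded_linear.linear[OF S_bounded_linear]
lemma S_sym: "inner (S F) G = inner F (S G)"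
  unfolding S_def by (simp add: inner_add_left inner_add_right inner_mulop pconts inner_convop W_pcont W_even)

text \<open>If \<open>W\<close> is H-stable the convolution term is nonnegative and
  \<open>r = \<sigma>\<close>. Otherwise \<open>\<bar>W\<bar> \<le> C < \<sigma>\<close>, and the
  convolution term is at most \<open>C\<close> times the squared L1 norm of \<open>f\<close>; since
  \<open>\<mu>\<close> has mass 1, Cauchy-Schwarz for
  \<open>\<bar>f\<bar> = (\<bar>f\<bar> / sqrt \<mu>) * sqrt \<mu>\<close> bounds this by
  \<open>C\<close> times the weighted square norm, and \<open>r = \<sigma> - C\<close>.\<close>

lemma interaction_ge:
  obtains r where "0 < r" "\<And>F. r * inner (mulop imu F) F \<le> inner (S F) F"
  using stable
proof (rule disjE)
  assume H: "H_stable W"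
  have "\<sigma> * inner (mulop imu F) F \<le> inner (S F) F" for F
  proof -
    obtain f where f: "Lp 2 f" "F = cl f" by (rule l2_cases)
    have cf: "Lp 2 (conv W f)" using conv_pcont[OF W_pcont(1) Lp2_integrable[OF f(1)]] by (rule pcont_Lp2)
    have "0 \<le> (\<integral>z. W (fst z - snd z) * f (fst z) * f (snd z) \<partial>(torus \<Otimes>\<^sub>M torus))"
      using H f(1) unfolding H_stable_def by blast
    also have "\<dots> = (\<integral>x. f x * conv W f x \<partial>torus)"
      using W_pcont(1) f by (intro conv_pairing Lp2_integrable) (auto simp: pcont_def)
    also have "\<dots> = inner (convop W F) F" using f cf W_pcont by (simp add: convop_cl inner_cl mult.commute)
    finally show ?thesis by (simp add: S_def inner_add_left)
  qed
  then show ?thesis using that sigma by blast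
next
  assume "ess_norm W < ereal \<sigma>"
  then obtain C where C: "0 \<le> C" "C < \<sigma>" "\<And>x. \<bar>W x\<bar> \<le> C" using ess_norm_less W_pcont(1) by blast
  have "(\<sigma> - C) * inner (mulop imu F) F \<le> inner (S F) F" for F
  proof -
    obtain f where f: "Lp 2 f" "F = cl f" by (rule l2_cases)
    have fi: "integrable torus f" using f(1) by (rule Lp2_integrable)
    have cf: "Lp 2 (conv W f)" using conv_pcont[OF W_pcont(1) fi] by (rule pcont_Lp2)
    let ?N = "\<integral>x. \<bar>f x\<bar> \<partial>torus"
    have b: "\<bar>conv W f x\<bar> \<le> C * ?N" for x
    proof -
      have "\<bar>conv W f x\<bar> \<le> (\<integral>y. \<bar>W (x - y) * f y\<bar> \<partial>torus)" unfolding conv_real by (rule integral_abs_bound)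
      also have "\<dots> \<le> (\<integral>y. C * \<bar>f y\<bar> \<partial>torus)"
      proof (rule integral_mono)
        show "integrable torus (\<lambda>y. \<bar>W (x - y) * f y\<bar>)"
          using conv_integrable[of W f x] W_pcont(1) fi by (intro integrable_abs) (auto simp: pcont_def)
        show "\<bar>W (x - y) * f y\<bar> \<le> C * \<bar>f y\<bar>" for y using C(3) by (auto simp: abs_mult intro: mult_right_mono)
      qed (use fi in simp)
      finally show ?thesis by simp
    qed
    have "\<bar>inner (convop W F) F\<bar> = \<bar>\<integral>x. conv W f x * f x \<partial>torus\<bar>"
      using f cf W_pcont by (simp add: convop_cl inner_cl)
    also have "\<dots> \<le> (\<integral>x. \<bar>conv W f x * f x\<bar> \<partial>torus)" by (rule integral_abs_bound)
    also have "\<dots> \<le> (\<integral>x. C * ?N * \<bar>f x\<bar> \<partial>torus)"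
    proof (rule integral_mono)
      show "integrable torus (\<lambda>x. \<bar>conv W f x * f x\<bar>)" using cf f(1) by (intro integrable_abs Lp2_mult_integrable)
      show "\<bar>conv W f x * f x\<bar> \<le> C * ?N * \<bar>f x\<bar>" for x
        unfolding abs_mult[of "conv W f x"] using b[of x] by (intro mult_right_mono) auto
    qed (use fi in simp)
    also have "\<dots> = C * ?N\<^sup>2" by (simp add: power2_eq_square)
    also have "\<dots> \<le> C * inner (mulop imu F) F"
    proof (rule mult_left_mono)
      have s1: "pcont (\<lambda>x. sqrt (imu x))" "pcont (\<lambda>x. sqrt (\<mu> x))"
        using pconts(1,2) by (auto simp: pcont_def periodic_def intro: continuous_intros)
      define P Q where "P = cl (\<lambda>x. sqrt (imu x) * \<bar>f x\<bar>)" and "Q = cl (\<lambda>x. sqrt (\<mu> x))"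
      have L: "Lp 2 (\<lambda>x. sqrt (imu x) * \<bar>f x\<bar>)" "Lp 2 (\<lambda>x. sqrt (\<mu> x))"
        using s1 f(1) by (auto intro: mul_Lp2 abs_Lp2 pcont_Lp2)
      have "sqrt (imu x) * sqrt (\<mu> x) = 1" for x
        using mu_imu[of x] by (simp add: real_sqrt_mult[symmetric] mult.commute)
      then have e: "sqrt (imu x) * \<bar>f x\<bar> * sqrt (\<mu> x) = \<bar>f x\<bar>" for x by (simp add: mult.commute mult.left_commute)
      have "?N = inner P Q" unfolding P_def Q_def inner_cl[OF L] e ..
      then have "?N\<^sup>2 = (inner P Q)\<^sup>2" by simp
      also have "\<dots> \<le> inner P P * inner Q Q" by (rule Cauchy_Schwarz_ineq)
      also have "inner Q Q = 1"
        unfolding Q_def using L mu_integral mu_pos by (simp add: inner_cl less_imp_le)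
      also have "inner P P = inner (mulop imu F) F"
      proof -
        have "sqrt (imu x) * \<bar>f x\<bar> * (sqrt (imu x) * \<bar>f x\<bar>) = imu x * f x * f x" for x
          using imu_pos[of x] real_sqrt_mult_self[of "imu x"] abs_mult_self_eq[of "f x"]
          by (metis abs_of_pos mult.assoc mult.left_commute)
        then show ?thesis unfolding P_def using L f pconts(2) by (simp add: inner_cl mulop_cl mul_Lp2)
      qed
      finally show "?N\<^sup>2 \<le> inner (mulop imu F) F" by simp
    qed (rule C(1))
    finally have "- (C * inner (mulop imu F) F) \<le> inner (convop W F) F" by linarith
    then show ?thesis by (simp add: S_def inner_add_left left_diff_distrib)
  qed
  then show ?thesis using that C(2) by (metis diff_gt_0_iff_gt)
qed

definition b :: "'d l2 \<Rightarrow> 'd l2 \<Rightarrow> real" where "b F G = inner (S F) G"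

lemma coercive_ex: "\<exists>c>0. \<forall>F. c * (norm F)\<^sup>2 \<le> b F F"
proof -
  obtain r where r: "0 < r" "\<And>F. r * inner (mulop imu F) F \<le> inner (S F) F" using interaction_ge by metis
  obtain m where m: "0 < m" "\<And>x. m \<le> imu x" using bounds by blast
  have "r * m * (norm F)\<^sup>2 \<le> b F F" for F

  proof -
    have "r * (m * (norm F)\<^sup>2) \<le> r * inner (mulop imu F) F"
      by (intro mult_left_mono inner_mulop_ge pconts m) (use r in simp)
    also have "\<dots> \<le> b F F" unfolding b_def by (rule r)
    finally show ?thesis by (simp add: mult.assoc)
  qed
  then show ?thesis using r(1) m(1) by (intro exI[of _ "r * m"]) simp
qed

definition c\<^sub>0 :: real where "c\<^sub>0 = (SOME c. 0 < c \<and> (\<forall>F. c * (norm F)\<^sup>2 \<le> b F F))"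

lemma c0: "0 < c\<^sub>0" "c\<^sub>0 * (norm F)\<^sup>2 \<le> b F F"
  using someI_ex[OF coercive_ex] unfolding c\<^sub>0_def by blast+

definition X0 :: "'d l2 set" where "X0 = {F. inner F (casL 0) = 0}"

lemma X0_subspace: "subspace X0"
  unfolding X0_def subspace_def by (simp add: inner_add_left)

lemma X0_closed: "closed X0"
  unfolding X0_def by (intro closed_Collect_eq continuous_intros)

sublocale form: hilbert_form X0 b c\<^sub>0
proof (rule hilbert_form.intro)
  show "bounded_bilinear b" unfolding b_def
    by (rule bounded_bilinear.comp[OF bounded_bilinear_inner S_bounded_linear bounded_linear_ident])
qed (use X0_subspace X0_closed c0 S_sym in \<open>auto simp: b_def inner_commute\<close>)

section \<open>The linearized operator\<close>

definition fluxL :: "'d l2 \<Rightarrow> ('d \<Rightarrow> 'd l2) \<Rightarrow> 'd \<Rightarrow> 'd l2" where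
  "fluxL F D i = \<sigma> *\<^sub>R D i + mulop (dU i) F + mulop \<mu> (convop (pd i W) F)"

text \<open>The graph of \<open>L\<close> on real zero mean classes; weak differentiability of the
  components of \<open>D\<close> expresses that \<open>Y\<close> is in H2.\<close>

definition mv_rel :: "'d l2 \<Rightarrow> 'd l2 \<Rightarrow> bool" where
  "mv_rel Y Q \<longleftrightarrow> Y \<in> X0 \<and> Q \<in> X0 \<and>
     (\<exists>D. (\<forall>i. wd i Y (D i)) \<and> (\<forall>i j. \<exists>E. wd j (D i) E) \<and> divL (fluxL Y D) Q)"

lemma mv_relI:
  assumes "Y \<in> X0" "Q \<in> X0" "\<And>i. wd i Y (D i)" "\<And>i j. \<exists>E. wd j (D i) E" "divL (fluxL Y D) Q"
  shows "mv_rel Y Q"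
  unfolding mv_rel_def using assms by (intro conjI exI[of _ D] allI)

lemma mv_rel_X0: "mv_rel Y Q \<Longrightarrow> Y \<in> X0" "mv_rel Y Q \<Longrightarrow> Q \<in> X0"
  by (auto simp: mv_rel_def)

lemma mulop_mu_imu: "mulop \<mu> (mulop imu F) = F" "mulop imu (mulop \<mu> F) = F"
  by (simp_all add: mulop_mulop pconts mu_imu mulop_one mult.commute[of "imu _"])

lemmas mulop_linear = bounded_linear.linear[OF mulop_bounded_linear]

lemma S_wd:
  assumes "wd i F (D i)" shows "wd i (S F) (mulop imu (fluxL F D i))"
proof -
  have "wd i (S F) (\<sigma> *\<^sub>R (mulop imu (D i) + mulop (\<lambda>x. 1 / \<sigma> * (imu x * dU i x)) F) + convop (pd i W) F)"
    unfolding S_def by (intro wd_add wd_scale wd_mult assms imu_C1 wd_convop W_C1)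
  moreover have "mulop (\<lambda>x. 1 / \<sigma> * (imu x * dU i x)) F = (1 / \<sigma>) *\<^sub>R mulop imu (mulop (dU i) F)"
    using mulop_mulop[of "\<lambda>x. 1 / \<sigma>" "\<lambda>x. imu x * dU i x" F] by (simp add: pconts pcont_intros mulop_const mulop_mulop)
  moreover have "mulop imu (fluxL F D i) = \<sigma> *\<^sub>R mulop imu (D i) + mulop imu (mulop (dU i) F) + convop (pd i W) F"
    unfolding fluxL_def using mulop_linear[OF pconts(2)] by (simp add: linear_add linear_scale mulop_mu_imu)
  ultimately show ?thesis using sigma by (simp add: scaleR_add_right)
qed

definition grad :: "'d l2 \<Rightarrow> 'd \<Rightarrow> 'd l2" where "grad F i = (SOME G. wd i F G)"

lemma grad_eq:
  assumes "wd i F G" shows "grad F i = G"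
proof -
  have "wd i F (grad F i)" unfolding grad_def using assms by (rule someI)
  then show ?thesis using assms by (rule wd_unique)
qed

lemma mv_rel_S:
  assumes "mv_rel Y Q"
  shows "wd i (S Y) (grad (S Y) i)" "divL (\<lambda>i. mulop \<mu> (grad (S Y) i)) Q"
proof -
  obtain D where D: "\<And>i. wd i Y (D i)" "divL (fluxL Y D) Q" using assms unfolding mv_rel_def by blast
  have g: "grad (S Y) i = mulop imu (fluxL Y D i)" for i by (rule grad_eq[OF S_wd[OF D(1)]])
  show "wd i (S Y) (grad (S Y) i)" unfolding g by (rule S_wd[OF D(1)])
  show "divL (\<lambda>i. mulop \<mu> (grad (S Y) i)) Q" unfolding g mulop_mu_imu using D(2) by simp
qed

text \<open>Green's formula for \<open>Q = \<nabla>\<cdot>(\<mu> \<nabla>(S Y))\<close> tested with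
  \<open>S Y'\<close>. The right side is symmetric in \<open>Y\<close> and \<open>Y'\<close>, and
  this is the symmetry of \<open>L\<close> for \<open>b\<close>.\<close>

lemma mv_energy:
  assumes "mv_rel Y Q" "mv_rel Y' R"
  shows "b Y' Q = - (\<Sum>i\<in>UNIV. inner (mulop \<mu> (grad (S Y) i)) (grad (S Y') i))"
  using div_pair[OF mv_rel_S(2)[OF assms(1)] mv_rel_S(1)[OF assms(2)]]
  by (simp add: b_def inner_commute)

lemma mv_sym:
  assumes "mv_rel Y Q" "mv_rel Y' R" shows "b Y R = b Y' Q"
proof -
  have "inner (mulop \<mu> F) F' = inner (mulop \<mu> F') F" for F F'
    by (rule trans[OF inner_mulop[OF pconts(1)] inner_commute])
  then show ?thesis unfolding mv_energy[OF assms] mv_energy[OF assms(2,1)]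
    by (intro arg_cong[where f = uminus] sum.cong refl)
qed

lemma grad_zero_of_energy:
  fixes g :: "'d \<Rightarrow> 'd l2"
  assumes "(\<Sum>i\<in>UNIV. inner (mulop \<mu> (g i)) (g i)) \<le> 0" shows "g i = 0"
proof -
  obtain m where m: "0 < m" "\<And>x. m \<le> \<mu> x" using bounds by blast
  have n: "0 \<le> inner (mulop \<mu> (g i)) (g i)" "m * (norm (g i))\<^sup>2 \<le> inner (mulop \<mu> (g i)) (g i)" for i
  proof -
    show "m * (norm (g i))\<^sup>2 \<le> inner (mulop \<mu> (g i)) (g i)" by (rule inner_mulop_ge[OF pconts(1) m(2)])
    moreover have "0 \<le> m * (norm (g i))\<^sup>2" using m(1) by simp
    ultimately show "0 \<le> inner (mulop \<mu> (g i)) (g i)" by linarith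
  qed
  have "inner (mulop \<mu> (g i)) (g i) \<le> (\<Sum>i\<in>UNIV. inner (mulop \<mu> (g i)) (g i))"
    by (rule member_le_sum) (use n in auto)
  then have "m * (norm (g i))\<^sup>2 \<le> 0" using n(2)[of i] assms by linarith
  then show ?thesis using m(1) by (simp add: mult_le_0_iff)
qed

lemma casL_zero_norm: "inner (casL 0) (casL 0 :: 'd l2) = vol TYPE('d)"
  by (simp add: casL_def inner_cl cas_Lp2 cas_orthogonal)

text \<open>The orthogonal projection onto \<open>X0\<close>, that is, removal of the mean;
  \<open>S\<close> need not preserve zero mean.\<close>

definition P0 :: "'d l2 \<Rightarrow> 'd l2" where
  "P0 F = F - (inner F (casL 0) / vol TYPE('d)) *\<^sub>R casL 0"

lemma P0_mem: "P0 F \<in> X0"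
  using vol_pos[where ?'d = 'd] by (simp add: P0_def X0_def inner_diff_left casL_zero_norm)

lemma wd_const: "wd i (casL 0) 0"
  using wd_casL_casL[of i 0] by simp

lemma wd_P0:
  assumes "wd i F G" shows "wd i (P0 F) G"
proof -
  have "wd i (P0 F) (G - (inner F (casL 0) / vol TYPE('d)) *\<^sub>R 0)"
    unfolding P0_def by (intro wd_diff wd_scale wd_const assms)
  then show ?thesis by simp
qed

lemma orthogonal_X0:
  assumes "\<And>G. G \<in> X0 \<Longrightarrow> inner F G = 0" shows "P0 F = 0"
proof -
  have "inner F (P0 F) = 0" using assms P0_mem by blast
  moreover have "inner (P0 F) (casL 0) = 0" using P0_mem[of F] by (simp add: X0_def)
  moreover have "inner (P0 F) G = inner F G - inner F (casL 0) / vol TYPE('d) * inner G (casL 0)" for G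
    unfolding P0_def inner_diff_left inner_scaleR_left inner_commute[of "casL 0" G] ..
  from this[of "P0 F"] have "inner (P0 F) (P0 F) = inner F (P0 F) - inner F (casL 0) / vol TYPE('d) * inner (P0 F) (casL 0)" .
  ultimately have "inner (P0 F) (P0 F) = 0" by (simp only: mult_zero_right diff_zero)
  then show ?thesis by simp
qed

text \<open>The energy vanishes, so \<open>S Y\<close> is constant. Constants are orthogonal to the
  zero mean class \<open>Y\<close>, so \<open>b Y Y = 0\<close>.\<close>

lemma mv_unique:
  assumes "mv_rel Y 0" shows "Y = 0"
proof -
  have Y: "Y \<in> X0" using assms by (simp add: mv_rel_def)
  have "b Y 0 = 0" by (simp add: b_def)
  then have "grad (S Y) i = 0" for i
    by (intro grad_zero_of_energy) (use mv_energy[OF assms assms] in simp)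
  then have "wd i (P0 (S Y)) 0" for i using wd_P0[OF mv_rel_S(1)[OF assms]] by metis
  then have "(norm (P0 (S Y)))\<^sup>2 \<le> (\<Sum>i\<in>(UNIV :: 'd set). (norm (0 :: 'd l2))\<^sup>2)"
    using P0_mem by (intro poincare) (auto simp: X0_def)
  then have "P0 (S Y) = 0" by simp
  then have "S Y = (inner (S Y) (casL 0) / vol TYPE('d)) *\<^sub>R casL 0" unfolding P0_def by simp
  then have "b Y Y = (inner (S Y) (casL 0) / vol TYPE('d)) * inner (casL 0) Y" unfolding b_def
    by (metis inner_scaleR_left)
  then have "b Y Y = 0" using Y by (simp add: X0_def inner_commute)
  then show ?thesis using form.definite[OF Y] by simp
qed

lemma fluxL_add: "fluxL (F + F') (\<lambda>i. D i + D' i) = (\<lambda>i. fluxL F D i + fluxL F' D' i)"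
  and fluxL_scale: "fluxL (r *\<^sub>R F) (\<lambda>i. r *\<^sub>R D i) = (\<lambda>i. r *\<^sub>R fluxL F D i)"
  unfolding fluxL_def
  using mulop_linear[OF pconts(1)] mulop_linear[OF pconts(3)] bounded_linear.linear[OF convop_bounded_linear[OF W_pcont(2)]]
  by (auto simp: linear_add linear_scale algebra_simps)

lemma mv_rel_add:
  assumes "mv_rel Y Q" "mv_rel Y' Q'" shows "mv_rel (Y + Y') (Q + Q')"
proof -
  obtain D D' where D: "\<And>i. wd i Y (D i)" "\<And>i j. \<exists>E. wd j (D i) E" "divL (fluxL Y D) Q"
    and D': "\<And>i. wd i Y' (D' i)" "\<And>i j. \<exists>E. wd j (D' i) E" "divL (fluxL Y' D') Q'"
    using assms unfolding mv_rel_def by blast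
  have "wd i (Y + Y') (D i + D' i)" for i using D(1) D'(1) by (rule wd_add)
  moreover have "\<exists>E. wd j (D i + D' i) E" for i j using D(2)[of j i] D'(2)[of j i] wd_add by blast
  moreover have "divL (fluxL (Y + Y') (\<lambda>i. D i + D' i)) (Q + Q')"
    using D(3) D'(3) unfolding fluxL_add divL_def by (simp add: inner_add_left distrib_left sum.distrib)
  ultimately show ?thesis
    by (intro mv_relI subspace_add[OF X0_subspace] mv_rel_X0[OF assms(1)] mv_rel_X0[OF assms(2)])
qed

lemma mv_rel_scale:
  assumes "mv_rel Y Q" shows "mv_rel (r *\<^sub>R Y) (r *\<^sub>R Q)"
proof -
  obtain D where D: "\<And>i. wd i Y (D i)" "\<And>i j. \<exists>E. wd j (D i) E" "divL (fluxL Y D) Q"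
    using assms unfolding mv_rel_def by blast
  have "wd i (r *\<^sub>R Y) (r *\<^sub>R D i)" for i using D(1) by (rule wd_scale)
  moreover have "\<exists>E. wd j (r *\<^sub>R D i) E" for i j using D(2)[of j i] wd_scale by blast
  moreover have "divL (fluxL (r *\<^sub>R Y) (\<lambda>i. r *\<^sub>R D i)) (r *\<^sub>R Q)"
    using D(3) unfolding fluxL_scale divL_def by (simp add: mult.left_commute sum_distrib_left[symmetric])
  ultimately show ?thesis
    by (intro mv_relI subspace_scale[OF X0_subspace] mv_rel_X0[OF assms])
qed

lemma mv_rel_fun:
  assumes "mv_rel Y Q" "mv_rel Y' Q" shows "Y = Y'"
proof -
  have "mv_rel (Y + (-1) *\<^sub>R Y') (Q + (-1) *\<^sub>R Q)" using assms by (intro mv_rel_add mv_rel_scale)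
  then have "mv_rel (Y - Y') 0" by simp
  then show ?thesis using mv_unique by fastforce
qed

section \<open>Solvability\<close>

text \<open>Zero mean H1 classes stored together with their gradient. In this way they form a closed
  subspace of a product of copies of L2, whose norm is the Sobolev norm, and
  \<open>hilbert_form\<close> applies.\<close>

definition H1 :: "('d l2 \<times> (('d l2) ^ 'd)) set" where
  "H1 = {(h, g). h \<in> X0 \<and> (\<forall>i. wd i h (g $ i))}"

definition energy :: "('d l2 \<times> (('d l2) ^ 'd)) \<Rightarrow> ('d l2 \<times> (('d l2) ^ 'd)) \<Rightarrow> real" where
  "energy p q = (\<Sum>i\<in>UNIV. inner (mulop \<mu> (snd p $ i)) (snd q $ i))"

lemma norm_fst_snd_le: "norm (fst p) \<le> norm p" "norm (snd p) \<le> norm p"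
  by (cases p, simp add: norm_fst_le norm_snd_le)+

lemma H1_form: "\<exists>c. hilbert_form H1 energy c"
proof -
  obtain m where m: "0 < m" "\<And>x. m \<le> \<mu> x" using bounds by blast
  obtain K where K: "\<And>F. norm (mulop \<mu> F) \<le> norm F * K"
    using bounded_linear.bounded[OF mulop_bounded_linear[OF pconts(1)]] by blast
  \<comment> \<open>By the Poincare inequality a class is bounded by its gradient, so the squared
    product norm is at most twice that of the gradient; hence the factor one half.\<close>
  have "hilbert_form H1 energy (m / 2)"
  proof (rule hilbert_form.intro)
    show "subspace H1" unfolding H1_def subspace_def using X0_subspace
      by (auto simp: zero_prod_def subspace_0 subspace_add subspace_scale wd_zero intro: wd_add wd_scale)
    show "closed H1" unfolding closed_sequential_limits
    proof (intro allI impI)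
      fix x and l :: "'d l2 \<times> (('d l2) ^ 'd)"
      assume a: "(\<forall>n. x n \<in> H1) \<and> x \<longlonglongrightarrow> l"
      have f: "(\<lambda>n. fst (x n)) \<longlonglongrightarrow> fst l" using a by (auto intro: tendsto_fst)
      have s: "(\<lambda>n. snd (x n) $ i) \<longlonglongrightarrow> snd l $ i" for i using a by (auto intro: tendsto_snd tendsto_vec_nth)
      have "fst (x n) \<in> X0" "wd i (fst (x n)) (snd (x n) $ i)" for n i
        using a unfolding H1_def by (auto simp: case_prod_beta)
      then have "fst l \<in> X0" "wd i (fst l) (snd l $ i)" for i
        using closed_sequentially[OF X0_closed _ f] wd_closed[OF _ f s] by blast+
      then show "l \<in> H1" unfolding H1_def by (auto simp: case_prod_beta)
    qed
    show "bounded_bilinear energy"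
    proof (rule bounded_bilinear.intro)
      show "\<exists>K. \<forall>p q. norm (energy p q) \<le> norm p * norm q * K"
      proof (intro exI allI)
        fix p q :: "'d l2 \<times> (('d l2) ^ 'd)"
        have "norm (energy p q) \<le> (\<Sum>i\<in>(UNIV :: 'd set). \<bar>K\<bar> * (norm p * norm q))"
          unfolding energy_def
        proof (rule order_trans[OF norm_sum], rule sum_mono)
          fix i :: 'd
          have pq: "norm (snd p $ i) \<le> norm p" "norm (snd q $ i) \<le> norm q"
            using Finite_Cartesian_Product.norm_nth_le[of "snd p" i] Finite_Cartesian_Product.norm_nth_le[of "snd q" i] norm_fst_snd_le(2)[of p] norm_fst_snd_le(2)[of q]
            by (meson order_trans)+
          have "norm (inner (mulop \<mu> (snd p $ i)) (snd q $ i)) \<le> norm (mulop \<mu> (snd p $ i)) * norm (snd q $ i)"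
            by (rule Cauchy_Schwarz_ineq2[THEN order_trans[rotated]]) simp
          also have "\<dots> \<le> (norm p * \<bar>K\<bar>) * norm q"
          proof (rule mult_mono)
            have "norm (snd p $ i) * K \<le> norm p * \<bar>K\<bar>"
              by (rule order_trans[OF mult_left_mono[of K "\<bar>K\<bar>"] mult_right_mono[OF pq(1)]]) auto
            then show "norm (mulop \<mu> (snd p $ i)) \<le> norm p * \<bar>K\<bar>" using K[of "snd p $ i"] by linarith
          qed (use pq in auto)
          finally show "norm (inner (mulop \<mu> (snd p $ i)) (snd q $ i)) \<le> \<bar>K\<bar> * (norm p * norm q)" by (simp add: ac_simps)
        qed
        then show "norm (energy p q) \<le> norm p * norm q * (real CARD('d) * \<bar>K\<bar>)" by (simp add: ac_simps)
      qed
    qed (simp_all add: energy_def mulop_linear[OF pconts(1)] linear_add linear_scale inner_add_left inner_add_right sum.distrib sum_distrib_left)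
    show "energy p q = energy q p" for p q
      unfolding energy_def by (intro sum.cong refl trans[OF inner_mulop[OF pconts(1)] inner_commute])
    show "0 < m / 2" using m by simp
    show "m / 2 * (norm p)\<^sup>2 \<le> energy p p" if p: "p \<in> H1" for p
    proof -
      have "(norm (snd p))\<^sup>2 = (\<Sum>i\<in>UNIV. (norm (snd p $ i))\<^sup>2)"
        unfolding norm_vec_def L2_set_def by (simp add: sum_nonneg)
      moreover have "(norm (fst p))\<^sup>2 \<le> (\<Sum>i\<in>UNIV. (norm (snd p $ i))\<^sup>2)"
        using p unfolding H1_def X0_def by (intro poincare) (auto simp: case_prod_beta)
      moreover have "(norm p)\<^sup>2 = (norm (fst p))\<^sup>2 + (norm (snd p))\<^sup>2" by (simp add: norm_prod_def)
      ultimately have "m / 2 * (norm p)\<^sup>2 \<le> m / 2 * (2 * (\<Sum>i\<in>UNIV. (norm (snd p $ i))\<^sup>2))"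
        using m(1) by (intro mult_left_mono) auto
      also have "\<dots> = (\<Sum>i\<in>UNIV. m * (norm (snd p $ i))\<^sup>2)" by (simp add: sum_distrib_left)
      also have "\<dots> \<le> energy p p" unfolding energy_def
        by (intro sum_mono inner_mulop_ge pconts m(2))
      finally show ?thesis .
    qed
  qed
  then show ?thesis ..
qed

text \<open>Riesz for \<open>energy\<close> solves
  \<open>\<nabla>\<cdot>(\<mu> \<nabla>h) = Q\<close> weakly. Test classes \<open>P\<close> with
  nonzero mean are allowed because \<open>Q\<close> has zero mean, and coercivity bounds
  \<open>h\<close> and its gradient by \<open>1 / c\<close> times the norm of
  \<open>Q\<close>.\<close>

lemma weak_solution:
  obtains C where "0 \<le> C" "\<And>Q. Q \<in> X0 \<Longrightarrow> \<exists>h g. h \<in> X0 \<and> (\<forall>i. wd i h (g i)) \<and> norm h \<le> C * norm Q \<and>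
    (\<forall>i. norm (g i) \<le> C * norm Q) \<and>
    (\<forall>P P'. (\<forall>i. wd i P (P' i)) \<longrightarrow> (\<Sum>i\<in>UNIV. inner (mulop \<mu> (g i)) (P' i)) = - inner Q P)"
proof -
  obtain c where c: "hilbert_form H1 energy c" using H1_form by blast
  interpret H1: hilbert_form H1 energy c by (rule c)
  show ?thesis
  proof (rule that[of "1 / c"])
    show "0 \<le> 1 / c" using H1.c_pos by simp
    fix Q :: "'d l2" assume Q: "Q \<in> X0"
    have "bounded_linear (\<lambda>p :: 'd l2 \<times> (('d l2) ^ 'd). - inner Q (fst p))"
      by (intro bounded_linear_minus bounded_linear_inner_right_comp bounded_linear_fst)
    from H1.riesz[OF this]
    obtain p where p: "p \<in> H1" "\<And>q. q \<in> H1 \<Longrightarrow> energy p q = - inner Q (fst q)" by blast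
    have "c * (norm p)\<^sup>2 \<le> - inner Q (fst p)" using H1.coercive[OF p(1)] p(2)[OF p(1)] by simp
    also have "\<dots> \<le> norm Q * norm (fst p)" using Cauchy_Schwarz_ineq2[of Q "fst p"] by linarith
    also have "\<dots> \<le> norm Q * norm p" using norm_fst_snd_le(1)[of p] by (intro mult_left_mono) auto
    finally have "c * norm p * norm p \<le> norm Q * norm p" by (simp add: power2_eq_square mult.assoc)
    then have np: "norm p \<le> 1 / c * norm Q"
      using H1.c_pos by (cases "norm p = 0") (auto simp: field_simps)
    have "norm (fst p) \<le> 1 / c * norm Q" using norm_fst_snd_le(1)[of p] np by linarith
    moreover have "norm (snd p $ i) \<le> 1 / c * norm Q" for i
      using Finite_Cartesian_Product.norm_nth_le[of "snd p" i] norm_fst_snd_le(2)[of p] np by linarith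
    moreover have "(\<Sum>i\<in>UNIV. inner (mulop \<mu> (snd p $ i)) (P' i)) = - inner Q P" if P: "\<And>i. wd i P (P' i)" for P P'
    proof -
      have "(P0 P, \<chi> i. P' i) \<in> H1" unfolding H1_def using P0_mem wd_P0[OF P] by simp
      from p(2)[OF this] have "(\<Sum>i\<in>UNIV. inner (mulop \<mu> (snd p $ i)) (P' i)) = - inner Q (P0 P)"
        by (simp add: energy_def)
      then show ?thesis using Q by (simp add: P0_def X0_def inner_diff_right)
    qed
    ultimately show "\<exists>h g. h \<in> X0 \<and> (\<forall>i. wd i h (g i)) \<and> norm h \<le> 1 / c * norm Q \<and>
      (\<forall>i. norm (g i) \<le> 1 / c * norm Q) \<and>
      (\<forall>P P'. (\<forall>i. wd i P (P' i)) \<longrightarrow> (\<Sum>i\<in>UNIV. inner (mulop \<mu> (g i)) (P' i)) = - inner Q P)"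
      using p(1) unfolding H1_def by (intro exI[of _ "fst p"] exI[of _ "\<lambda>i. snd p $ i"]) (auto simp: case_prod_beta)
  qed
qed

text \<open>Testing with \<open>cas k / \<mu>\<close> shows that \<open>\<bar>k\<bar>\<^sup>2\<close> times the coefficients of \<open>h\<close> are those of an \<open>L\<^sup>2\<close> function.\<close>

lemma regularity:
  assumes h: "\<And>i. wd i h (g i)"
    and weak: "\<And>P P'. (\<And>i. wd i P (P' i)) \<Longrightarrow> (\<Sum>i\<in>UNIV. inner (mulop \<mu> (g i)) (P' i)) = - inner Q P"
  shows "\<exists>E. wd j (g i) E"
proof -
  \<comment> \<open>This is \<open>- \<Delta> h\<close>: expanding
    \<open>\<nabla>\<cdot>(\<mu> \<nabla>h) = Q\<close> with
    \<open>\<nabla>\<mu> = - \<mu> \<nabla>U / \<sigma>\<close> and dividing by \<open>\<mu>\<close>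
    leaves only \<open>Q\<close> and first derivatives of \<open>h\<close>.\<close>
  define r where "r = - mulop imu Q - (\<Sum>i\<in>UNIV. (1 / \<sigma>) *\<^sub>R mulop (dU i) (g i))"
  have coeff: "freq k * inner h (casL k) = inner r (casL k)" for k
  proof -
    define P' where "P' i = mulop imu (of_int (k $ i) *\<^sub>R casL (- k)) + mulop (\<lambda>x. 1 / \<sigma> * (imu x * dU i x)) (casL k)" for i
    have "wd i (mulop imu (casL k)) (P' i)" for i
      unfolding P'_def by (intro wd_mult wd_casL_casL imu_C1)
    from weak[OF this] have "(\<Sum>i\<in>UNIV. inner (mulop \<mu> (g i)) (P' i)) = - inner (mulop imu Q) (casL k)"
      by (simp add: inner_mulop pconts)
    moreover have "inner (mulop \<mu> (g i)) (P' i) = (of_int (k $ i))\<^sup>2 * inner h (casL k) + (1 / \<sigma>) * inner (mulop (dU i) (g i)) (casL k)" for i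
    proof -
      have pc: "pcont (\<lambda>x. 1 / \<sigma> * (imu x * dU i x))" by (intro pcont_intros pconts)
      have "inner (mulop \<mu> (g i)) (P' i) = inner (mulop imu (mulop \<mu> (g i))) (of_int (k $ i) *\<^sub>R casL (- k)) +
        inner (mulop (\<lambda>x. 1 / \<sigma> * (imu x * dU i x)) (mulop \<mu> (g i))) (casL k)"
        unfolding P'_def inner_add_right inner_mulop[OF pconts(2), symmetric] inner_mulop[OF pc, symmetric] ..
      moreover have "mulop (\<lambda>x. 1 / \<sigma> * (imu x * dU i x)) (mulop \<mu> (g i)) = (1 / \<sigma>) *\<^sub>R mulop (dU i) (g i)"
      proof -
        have "(\<lambda>x. 1 / \<sigma> * (imu x * dU i x) * \<mu> x) = (\<lambda>x. 1 / \<sigma> * dU i x)"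
          using mu_imu by (auto simp: fun_eq_iff imu_inverse mu_pos[THEN less_imp_neq, symmetric])
        then have "mulop (\<lambda>x. 1 / \<sigma> * (imu x * dU i x)) (mulop \<mu> (g i)) = mulop (\<lambda>x. 1 / \<sigma> * dU i x) (g i)"
          using mulop_mulop[OF pc pconts(1)] by simp
        also have "\<dots> = mulop (\<lambda>x. 1 / \<sigma>) (mulop (dU i) (g i))" by (intro mulop_mulop[symmetric] pconts pcont_intros)
        finally show ?thesis by (simp add: mulop_const)
      qed
      moreover have "inner (g i) (casL (- k)) = of_int (k $ i) * inner h (casL k)"
        using h[of i] unfolding wd_casL by simp
      ultimately show ?thesis by (simp add: mulop_mu_imu power2_eq_square)
    qed
    ultimately have "(\<Sum>i\<in>UNIV. (of_int (k $ i))\<^sup>2 * inner h (casL k) + (1 / \<sigma>) * inner (mulop (dU i) (g i)) (casL k)) = - inner (mulop imu Q) (casL k)"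
      by simp
    then show ?thesis unfolding r_def freq_def
      by (simp add: sum.distrib sum_distrib_right inner_diff_left inner_sum_left)
  qed
  \<comment> \<open>Every mixed second derivative is dominated by the Laplacian coefficientwise,
    since \<open>\<bar>k\<^sub>i k\<^sub>j\<bar> \<le> \<bar>k\<bar>\<^sup>2\<close>.\<close>
  have N: "\<bar>of_int (k $ j) * inner (g i) (casN (- k))\<bar> \<le> \<bar>inner r (casN k)\<bar>" for k
  proof -
    have sq: "(of_int (k $ l))\<^sup>2 \<le> freq k" for l unfolding freq_def by (rule member_le_sum) auto
    have "(\<bar>of_int (k $ j) * of_int (k $ i)\<bar> :: real)\<^sup>2 \<le> (freq k)\<^sup>2"
      unfolding power2_abs power_mult_distrib power2_eq_square[of "freq k"] by (intro mult_mono sq freq_nonneg) auto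
    then have "(\<bar>of_int (k $ j) * of_int (k $ i)\<bar> :: real) \<le> freq k" using freq_nonneg by (rule power2_le_imp_le)
    then have "\<bar>of_int (k $ j) * of_int (k $ i)\<bar> * \<bar>inner h (casN k)\<bar> \<le> freq k * \<bar>inner h (casN k)\<bar>"
      by (intro mult_right_mono) auto
    also have "\<dots> = \<bar>freq k * inner h (casN k)\<bar>" using freq_nonneg[of k] by (simp add: abs_mult)
    also have "freq k * inner h (casN k) = inner r (casN k)" using coeff[of k] by (simp add: casN_def)
    finally show ?thesis using h[of i] unfolding wd_def by (simp add: abs_mult mult.assoc)
  qed
  have "(\<lambda>k. (- of_int (k $ j) * inner (g i) (casN (- k)))\<^sup>2) summable_on UNIV"
  proof (rule summable_on_comparison_test)
    show "(\<lambda>k. (inner r (casN k))\<^sup>2) summable_on UNIV" using cas.summable_coeffs[of r] by simp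
    show "(- of_int (k $ j) * inner (g i) (casN (- k)))\<^sup>2 \<le> (inner r (casN k))\<^sup>2" for k
      using N[of k] by (simp add: abs_le_square_iff)
  qed simp
  from cas.riesz_fischer[OF this]
  obtain E where "\<And>k. k \<in> UNIV \<Longrightarrow> inner E (casN k) = - of_int (k $ j) * inner (g i) (casN (- k))" by blast
  then have "wd j (g i) E" by (simp add: wd_def)
  then show ?thesis ..
qed

text \<open>\<open>S\<close> is inverted by \<open>Y = (\<mu> / \<sigma>) (S Y - W * Y)\<close>.
  Here \<open>S Y\<close> inherits two derivatives from \<open>h\<close>, and the convolution and
  \<open>\<mu>\<close> have two derivatives as well; the multiple of \<open>casL 0\<close>
  disappears under differentiation.\<close>

lemma solution_regular:
  assumes h: "\<And>i. wd i h (g i)" "\<And>i j. \<exists>E. wd j (g i) E" and Y: "S Y = h + r *\<^sub>R casL 0"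
  shows "\<exists>D. (\<forall>i. wd i Y (D i)) \<and> (\<forall>i j. \<exists>E. wd j (D i) E) \<and> fluxL Y D = (\<lambda>i. mulop \<mu> (g i))"
proof -
  define R where "R = S Y - convop W Y"
  have "mulop imu Y = (1 / \<sigma>) *\<^sub>R R" unfolding R_def S_def using sigma by simp
  then have "Y = mulop \<mu> ((1 / \<sigma>) *\<^sub>R R)" using mulop_mu_imu(1)[of Y] by simp
  then have YR: "Y = (1 / \<sigma>) *\<^sub>R mulop \<mu> R" using mulop_linear[OF pconts(1)] by (simp add: linear_scale)
  define R' where "R' i = g i - convop (pd i W) Y" for i
  have "wd i (S Y) (g i + r *\<^sub>R 0)" for i
    unfolding Y by (intro wd_add wd_scale wd_const h)
  then have SY: "wd i (S Y) (g i)" for i by simp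
  have R': "wd i R (R' i)" for i unfolding R_def R'_def by (intro wd_diff SY wd_convop W_C1)
  have R'': "\<exists>E. wd j (R' i) E" for i j
    unfolding R'_def using h(2)[of j i] wd_diff wd_convop[OF W_C1(2)] by blast
  define dmu where "dmu i x = - (1 / \<sigma>) * (\<mu> x * dU i x)" for i x
  define D where "D i = (1 / \<sigma>) *\<^sub>R (mulop \<mu> (R' i) + mulop (dmu i) R)" for i
  have D: "wd i Y (D i)" for i
    unfolding D_def using YR wd_scale[OF wd_mult[OF R' mu_C1[folded dmu_def]]] by metis
  moreover have "\<exists>E. wd j (D i) E" for i j
  proof -
    obtain E where E: "wd j (R' i) E" using R'' by blast
    obtain a where a: "C1_along j (dmu i) a" using dmu_C1 unfolding dmu_def[abs_def] by blast
    show ?thesis unfolding D_def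
      using wd_scale[OF wd_add[OF wd_mult[OF E mu_C1] wd_mult[OF R' a]]] by blast
  qed
  moreover have "fluxL Y D i = mulop \<mu> (g i)" for i
    using wd_unique[OF S_wd[where D = D and i = i, OF D] SY[of i]] mulop_mu_imu(1)[of "fluxL Y D i"] by simp
  ultimately show ?thesis by blast
qed

text \<open>\<open>L Y = Q\<close> splits into the weak problem for \<open>h\<close> and
  \<open>S Y = h\<close> modulo constants, the latter by Riesz for \<open>b\<close> on
  \<open>X0\<close>. The bounds on \<open>h\<close> and its gradient are recorded because
  compactness of the inverse is derived from \<open>h\<close>, not from \<open>Y\<close>.\<close>

lemma solve:
  obtains C where "0 \<le> C" "\<And>Q. Q \<in> X0 \<Longrightarrow> \<exists>Y h g. mv_rel Y Q \<and> (\<forall>F\<in>X0. b Y F = inner h F) \<and> (\<forall>i. wd i h (g i)) \<and>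
    norm h \<le> C * norm Q \<and> (\<forall>i. norm (g i) \<le> C * norm Q)"
proof -
  obtain C where C: "0 \<le> C" "\<And>Q. Q \<in> X0 \<Longrightarrow> \<exists>h g. h \<in> X0 \<and> (\<forall>i. wd i h (g i)) \<and> norm h \<le> C * norm Q \<and>
    (\<forall>i. norm (g i) \<le> C * norm Q) \<and>
    (\<forall>P P'. (\<forall>i. wd i P (P' i)) \<longrightarrow> (\<Sum>i\<in>UNIV. inner (mulop \<mu> (g i)) (P' i)) = - inner Q P)"
    using weak_solution by blast
  show ?thesis
  proof (rule that[OF C(1)])
    fix Q assume Q: "Q \<in> X0"
    from C(2)[OF Q] obtain h g where h: "h \<in> X0" "\<And>i. wd i h (g i)" "norm h \<le> C * norm Q" "\<And>i. norm (g i) \<le> C * norm Q"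
      and weak: "\<And>P P'. (\<And>i. wd i P (P' i)) \<Longrightarrow> (\<Sum>i\<in>UNIV. inner (mulop \<mu> (g i)) (P' i)) = - inner Q P" by blast
    obtain Y where Y: "Y \<in> X0" "\<And>F. F \<in> X0 \<Longrightarrow> b Y F = inner h F"
      using form.riesz[OF bounded_linear_inner_right[of h]] by blast
    have "P0 (S Y - h) = 0" by (rule orthogonal_X0) (use Y(2) in \<open>simp add: inner_diff_left b_def\<close>)
    then have SY: "S Y = h + (inner (S Y - h) (casL 0) / vol TYPE('d)) *\<^sub>R casL 0" unfolding P0_def by (simp add: algebra_simps)
    have reg: "\<exists>E. wd j (g i) E" for i j using h(2) weak by (rule regularity)
    obtain D where D: "\<And>i. wd i Y (D i)" "\<And>i j. \<exists>E. wd j (D i) E" "fluxL Y D = (\<lambda>i. mulop \<mu> (g i))"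
      using solution_regular[OF h(2) reg SY] by blast
    have "divL (fluxL Y D) Q" unfolding D(3) divL_def
    proof
      fix k
      have "(\<Sum>i\<in>UNIV. inner (mulop \<mu> (g i)) (of_int (k $ i) *\<^sub>R casL (- k))) = - inner Q (casL k)"
        by (rule weak) (rule wd_casL_casL)
      then show "(\<Sum>i\<in>UNIV. of_int (k $ i) * inner (mulop \<mu> (g i)) (casL (- k))) = - inner Q (casL k)" by simp
    qed
    then have "mv_rel Y Q" unfolding mv_rel_def using D Y(1) Q by blast
    then show "\<exists>Y h g. mv_rel Y Q \<and> (\<forall>F\<in>X0. b Y F = inner h F) \<and> (\<forall>i. wd i h (g i)) \<and>
      norm h \<le> C * norm Q \<and> (\<forall>i. norm (g i) \<le> C * norm Q)" using Y(2) h by blast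
  qed
qed

text \<open>The inverse of \<open>- L\<close>; the sign makes it a positive operator.\<close>

definition G :: "'d l2 \<Rightarrow> 'd l2" where "G Q = - (SOME Y. mv_rel Y Q)"

lemma G_rel: "Q \<in> X0 \<Longrightarrow> mv_rel (- G Q) Q"
  unfolding G_def using solve by (metis (mono_tags, lifting) someI_ex minus_minus)

lemma mv_rel_iff: "mv_rel Y Q \<longleftrightarrow> Q \<in> X0 \<and> Y = - G Q"
  using G_rel[of Q] mv_rel_fun[of Y Q "- G Q"] mv_rel_X0(2)[of Y Q] by auto

lemma norm_le_of_form:
  assumes "Y \<in> X0" "\<And>F. F \<in> X0 \<Longrightarrow> b Y F = inner h F" shows "norm Y \<le> norm h / c\<^sub>0"
proof -
  have "c\<^sub>0 * (norm Y)\<^sup>2 \<le> inner h Y" using c0(2)[of Y] assms by simp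
  also have "\<dots> \<le> norm h * norm Y" by (rule norm_cauchy_schwarz)
  finally have "c\<^sub>0 * norm Y * norm Y \<le> norm h * norm Y" by (simp add: power2_eq_square mult.assoc)
  then have "c\<^sub>0 * norm Y \<le> norm h" by (cases "norm Y = 0") auto
  then show ?thesis using c0(1) by (simp add: field_simps)
qed

sublocale op: compact_positive X0 b c\<^sub>0 G
proof unfold_locales
  fix x y :: "'d l2" and r :: real
  show Gm: "G x \<in> X0" if "x \<in> X0" for x
    using mv_rel_X0(1)[OF G_rel[OF that]] subspace_neg[OF X0_subspace] by fastforce
  show "G (x + y) = G x + G y" if "x \<in> X0" "y \<in> X0"
    using mv_rel_add[OF G_rel[OF that(1)] G_rel[OF that(2)]] unfolding mv_rel_iff by (simp add: algebra_simps)
  show "G (r *\<^sub>R x) = r *\<^sub>R G x" if "x \<in> X0"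
    using mv_rel_scale[OF G_rel[OF that], of r] unfolding mv_rel_iff by simp
  show "b (G x) y = b x (G y)" if "x \<in> X0" "y \<in> X0"
    using mv_sym[OF G_rel[OF that(1)] G_rel[OF that(2)]] form.sym[of "G y" x] by (simp add: form.bsimps)
  show "0 < b (G x) x" if x: "x \<in> X0" "x \<noteq> 0"
  proof (rule ccontr)
    assume n: "\<not> 0 < b (G x) x"
    let ?g = "grad (S (- G x))"
    have "(\<Sum>i\<in>UNIV. inner (mulop \<mu> (?g i)) (?g i)) \<le> 0"
      using mv_energy[OF G_rel[OF x(1)] G_rel[OF x(1)]] n by (simp add: form.bsimps)
    then have "?g i = 0" for i by (rule grad_zero_of_energy)
    then have "divL (\<lambda>i. mulop \<mu> 0) x" using mv_rel_S(2)[OF G_rel[OF x(1)]] by simp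
    then have "inner x (casL k) = 0" for k
      unfolding divL_def using linear_0[OF mulop_linear[OF pconts(1)]] by simp
    then show False using inner_casL_zero x(2) by blast
  qed
  obtain C where C: "0 \<le> C" "\<And>Q. Q \<in> X0 \<Longrightarrow> \<exists>Y h g. mv_rel Y Q \<and> (\<forall>F\<in>X0. b Y F = inner h F) \<and> (\<forall>i. wd i h (g i)) \<and>
    norm h \<le> C * norm Q \<and> (\<forall>i. norm (g i) \<le> C * norm Q)" using solve by blast
  have C': "\<exists>h g. (\<forall>F\<in>X0. b (- G Q) F = inner h F) \<and> (\<forall>i. wd i h (g i)) \<and>
    norm h \<le> C * norm Q \<and> (\<forall>i. norm (g i) \<le> C * norm Q)" if "Q \<in> X0" for Q
    using C(2)[OF that] unfolding mv_rel_iff by blast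
  show "\<exists>C. \<forall>x\<in>X0. norm (G x) \<le> C * norm x"
  proof (intro exI ballI)
    fix Q assume Q: "Q \<in> X0"
    from C'[OF Q] obtain h where h: "\<And>F. F \<in> X0 \<Longrightarrow> b (- G Q) F = inner h F" "norm h \<le> C * norm Q" by blast
    have "norm (- G Q) \<le> norm h / c\<^sub>0" using mv_rel_X0(1)[OF G_rel[OF Q]] h(1) by (rule norm_le_of_form)
    also have "\<dots> \<le> C * norm Q / c\<^sub>0" using h(2) c0(1) by (intro divide_right_mono) auto
    finally show "norm (G Q) \<le> C / c\<^sub>0 * norm Q" by simp
  qed
  show "\<exists>r l. strict_mono r \<and> (\<lambda>n. G (X (r n))) \<longlonglongrightarrow> l" if X: "\<And>n::nat. X n \<in> X0" "bounded (range X)" for X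
  proof -
    obtain B where B: "\<And>n. norm (X n) \<le> B" using X(2) by (auto simp: bounded_iff)
    have "\<forall>n. \<exists>h g. (\<forall>F\<in>X0. b (- G (X n)) F = inner h F) \<and> (\<forall>i. wd i h (g i)) \<and>
      norm h \<le> C * norm (X n) \<and> (\<forall>i. norm (g i) \<le> C * norm (X n))" using C'[OF X(1)] by blast
    then obtain h g where h: "\<And>n F. F \<in> X0 \<Longrightarrow> b (- G (X n)) F = inner (h n) F" "\<And>n i. wd i (h n) (g n i)"
      "\<And>n. norm (h n) \<le> C * norm (X n)" "\<And>n i. norm (g n i) \<le> C * norm (X n)" by metis
    have CB: "C * norm (X n) \<le> C * B" for n using B C(1) by (rule mult_left_mono)
    \<comment> \<open>Rellich's theorem is applied to the auxiliary classes \<open>h n\<close>,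
      whose gradients are bounded; by \<open>d\<close> below, \<open>G (X n)\<close> depends on
      \<open>h n\<close> in a Lipschitz way.\<close>
    obtain r l where r: "strict_mono r" "(\<lambda>n. h (r n)) \<longlonglongrightarrow> l"
      using rellich[of h "C * B" g] h(2) order_trans[OF h(3) CB] order_trans[OF h(4) CB] by blast
    have d: "norm (G (X i) - G (X j)) \<le> norm (h i - h j) / c\<^sub>0" for i j
    proof -
      have "norm (- G (X i) + G (X j)) \<le> norm (h i - h j) / c\<^sub>0"
      proof (rule norm_le_of_form)
        show "- G (X i) + G (X j) \<in> X0" using Gm[OF X(1)] form.M_mem by auto
        show "b (- G (X i) + G (X j)) F = inner (h i - h j) F" if "F \<in> X0" for F
          using h(1)[OF that, of i] h(1)[OF that, of j] by (simp add: form.bsimps inner_diff_left)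
      qed
      then show ?thesis by (metis add.commute minus_add_distrib minus_minus norm_minus_cancel uminus_add_conv_diff)
    qed
    have "Cauchy (\<lambda>n. G (X (r n)))"
    proof (rule metric_CauchyI)
      fix e :: real assume e: "0 < e"
      have "Cauchy (\<lambda>n. h (r n))" using r(2) convergent_Cauchy convergentI by blast
      then obtain M where M: "\<And>m n. M \<le> m \<Longrightarrow> M \<le> n \<Longrightarrow> dist (h (r m)) (h (r n)) < e * c\<^sub>0"
        using e c0(1) by (meson metric_CauchyD mult_pos_pos)
      show "\<exists>M. \<forall>m\<ge>M. \<forall>n\<ge>M. dist (G (X (r m))) (G (X (r n))) < e"
      proof (intro exI[of _ M] allI impI)
        fix m n assume "M \<le> m" "M \<le> n"
        then have "norm (h (r m) - h (r n)) / c\<^sub>0 < e" using M c0(1) by (simp add: dist_norm divide_less_eq)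
        then show "dist (G (X (r m))) (G (X (r n))) < e" using d[of "r m" "r n"] by (simp add: dist_norm)
      qed
    qed
    then show ?thesis using r(1) Cauchy_convergent convergent_def by blast
  qed
qed

end

section \<open>Complex functions, and the operator, spaces and norms of the statement\<close>

section \<open>Real and imaginary parts\<close>

lemma integrable_complex_iff:
  "integrable M (f :: _ \<Rightarrow> complex) \<longleftrightarrow> integrable M (\<lambda>x. Re (f x)) \<and> integrable M (\<lambda>x. Im (f x))"
proof
  assume "integrable M (\<lambda>x. Re (f x)) \<and> integrable M (\<lambda>x. Im (f x))"
  then have "integrable M (\<lambda>x. of_real (Re (f x)) + \<i> * of_real (Im (f x)))" by simp
  then show "integrable M f" by (simp add: complex_eq[symmetric])
qed simp

lemma torus_fun_complex_iff:
  "torus_fun f \<longleftrightarrow> torus_fun (\<lambda>x. Re (f x)) \<and> torus_fun (\<lambda>x. Im (f x))"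
  unfolding torus_fun_def borel_measurable_complex_iff periodic_def by (auto simp: complex_eq_iff)

lemma Lp2_complex_iff:
  fixes f :: "real ^ 'd::finite \<Rightarrow> complex"
  shows "Lp 2 f \<longleftrightarrow> Lp 2 (\<lambda>x. Re (f x)) \<and> Lp 2 (\<lambda>x. Im (f x))"
proof
  assume f: "Lp 2 f"
  then have tf: "torus_fun (\<lambda>x. Re (f x))" "torus_fun (\<lambda>x. Im (f x))" and i: "integrable torus (\<lambda>x. (cmod (f x))\<^sup>2)"
    using torus_fun_complex_iff[of f] by (auto simp: Lp2_iff)
  have "integrable torus (\<lambda>x. (Re (f x))\<^sup>2)" "integrable torus (\<lambda>x. (Im (f x))\<^sup>2)"
    by (rule Bochner_Integration.integrable_bound[OF i];
        use tf in \<open>auto simp: torus_fun_def cmod_power2 intro!: borel_measurable_power measurable_torus\<close>)+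
  then show "Lp 2 (\<lambda>x. Re (f x)) \<and> Lp 2 (\<lambda>x. Im (f x))" using tf by (simp add: Lp2_real_iff)
next
  assume "Lp 2 (\<lambda>x. Re (f x)) \<and> Lp 2 (\<lambda>x. Im (f x))"
  then show "Lp 2 f" unfolding Lp2_real_iff unfolding Lp2_iff torus_fun_complex_iff[of f] cmod_power2 by simp
qed

lemma Lp2_complex_integrable: "Lp 2 f \<Longrightarrow> integrable torus f" for f :: "real ^ 'd::finite \<Rightarrow> complex"
  unfolding Lp2_complex_iff integrable_complex_iff using Lp2_integrable by blast

definition reL :: "(real ^ 'd::finite \<Rightarrow> complex) \<Rightarrow> 'd l2" where "reL f = cl (\<lambda>x. Re (f x))"
definition imL :: "(real ^ 'd::finite \<Rightarrow> complex) \<Rightarrow> 'd l2" where "imL f = cl (\<lambda>x. Im (f x))"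
definition cpx :: "'d::finite l2 \<Rightarrow> 'd l2 \<Rightarrow> real ^ 'd \<Rightarrow> complex" where "cpx F G x = Complex (rp F x) (rp G x)"

lemma reL_cpx [simp]: "reL (cpx F G) = F" and imL_cpx [simp]: "imL (cpx F G) = G"
  by (simp_all add: reL_def imL_def cpx_def)

lemma cpx_Lp2: "Lp 2 (cpx F G)"
  by (simp add: Lp2_complex_iff cpx_def rp_Lp2)

lemma L2_eq_iff:
  assumes "Lp 2 f" "Lp 2 g"
  shows "reL f = reL g \<and> imL f = imL g \<longleftrightarrow> (AE x in torus. f x = g x)"
  using assms unfolding Lp2_complex_iff reL_def imL_def
  by (auto simp: cl_eq_iff complex_eq_iff elim: eventually_mono)

lemma L2_lincomb:
  fixes f g :: "real ^ 'd::finite \<Rightarrow> complex"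
  assumes "Lp 2 f" "Lp 2 g"
  shows L2_lincomb_Lp2: "Lp 2 (\<lambda>x. a * f x + b * g x)"
    and reL_lincomb: "reL (\<lambda>x. a * f x + b * g x) = Re a *\<^sub>R reL f - Im a *\<^sub>R imL f + (Re b *\<^sub>R reL g - Im b *\<^sub>R imL g)"
    and imL_lincomb: "imL (\<lambda>x. a * f x + b * g x) = Re a *\<^sub>R imL f + Im a *\<^sub>R reL f + (Re b *\<^sub>R imL g + Im b *\<^sub>R reL g)"
  using assms unfolding Lp2_complex_iff reL_def imL_def
  by (simp_all add: cl_simps Lp2_add Lp2_diff Lp2_scale)

lemma L2_scale:
  fixes f :: "real ^ 'd::finite \<Rightarrow> complex"
  assumes "Lp 2 f"
  shows "Lp 2 (\<lambda>x. a * f x)" "reL (\<lambda>x. a * f x) = Re a *\<^sub>R reL f - Im a *\<^sub>R imL f"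
    "imL (\<lambda>x. a * f x) = Re a *\<^sub>R imL f + Im a *\<^sub>R reL f"
  using L2_lincomb[OF assms assms, of a 0] by simp_all

lemma L2_diff:
  fixes f g :: "real ^ 'd::finite \<Rightarrow> complex"
  assumes "Lp 2 f" "Lp 2 g"
  shows "Lp 2 (\<lambda>x. f x - g x)" "reL (\<lambda>x. f x - g x) = reL f - reL g" "imL (\<lambda>x. f x - g x) = imL f - imL g"
  using L2_lincomb[OF assms, of 1 "-1"] by simp_all

lemma L2_add:
  fixes f g :: "real ^ 'd::finite \<Rightarrow> complex"
  assumes "Lp 2 f" "Lp 2 g"
  shows "Lp 2 (\<lambda>x. f x + g x)" "reL (\<lambda>x. f x + g x) = reL f + reL g" "imL (\<lambda>x. f x + g x) = imL f + imL g"
  using L2_lincomb[OF assms, of 1 1] by simp_all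

section \<open>Weak derivatives and divergences of complex functions\<close>

lemma test_fun_C1: "test_fun \<phi> \<Longrightarrow> C1_along i \<phi> (pd i \<phi>)"
  unfolding test_fun_def by (intro pd_C1_along) blast+

lemma test_fun_pcont: "test_fun \<phi> \<Longrightarrow> pcont \<phi>" "test_fun \<phi> \<Longrightarrow> pcont (pd i \<phi>)"
  using test_fun_C1 C1_along_pcont by blast+

lemma integrable_pcont_mult:
  fixes f :: "real ^ 'd::finite \<Rightarrow> real"
  assumes "pcont a" "integrable torus f" shows "integrable torus (\<lambda>x. a x * f x)"
  using integrable_mult_continuous[OF assms(2), of a] assms(1) by (simp add: pcont_def mult.commute)

lemma integrable_pcont_scaleR:
  fixes f :: "real ^ 'd::finite \<Rightarrow> complex"
  assumes "pcont a" "integrable torus f" shows "integrable torus (\<lambda>x. a x *\<^sub>R f x)"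
  using assms unfolding integrable_complex_iff by (simp add: integrable_pcont_mult)

lemma integral_scaleR_parts:
  fixes f :: "real ^ 'd::finite \<Rightarrow> complex"
  assumes "pcont a" "integrable torus f"
  shows "Re (\<integral>x. a x *\<^sub>R f x \<partial>torus) = (\<integral>x. a x * Re (f x) \<partial>torus)" "Im (\<integral>x. a x *\<^sub>R f x \<partial>torus) = (\<integral>x. a x * Im (f x) \<partial>torus)"
  using integral_Re[OF integrable_pcont_scaleR[OF assms]] integral_Im[OF integrable_pcont_scaleR[OF assms]] by simp_all

lemma weak_pd_complex_iff:
  fixes f g :: "real ^ 'd::finite \<Rightarrow> complex"
  shows "weak_pd i f g \<longleftrightarrow> weak_pd i (\<lambda>x. Re (f x)) (\<lambda>x. Re (g x)) \<and> weak_pd i (\<lambda>x. Im (f x)) (\<lambda>x. Im (g x))"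
proof (cases "integrable torus f \<and> integrable torus g")
  case True
  then have "weak_pd i f g \<longleftrightarrow> (\<forall>\<phi>. test_fun \<phi> \<longrightarrow>
      (\<integral>x. pd i \<phi> x * Re (f x) \<partial>torus) = - (\<integral>x. \<phi> x * Re (g x) \<partial>torus) \<and>
      (\<integral>x. pd i \<phi> x * Im (f x) \<partial>torus) = - (\<integral>x. \<phi> x * Im (g x) \<partial>torus))"
    unfolding weak_pd_def by (auto simp: complex_eq_iff integral_scaleR_parts test_fun_pcont)
  then show ?thesis using True unfolding weak_pd_def integrable_complex_iff[of torus f] integrable_complex_iff[of torus g] by auto
next
  case False
  then show ?thesis unfolding weak_pd_def integrable_complex_iff[of torus f] integrable_complex_iff[of torus g] by auto
qed

text \<open>The integrability clauses of \<open>weak_div\<close> are kept apart, so that the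
  identity alone splits into real and imaginary parts.\<close>

definition weak_div_real :: "('d::finite \<Rightarrow> real ^ 'd \<Rightarrow> real) \<Rightarrow> (real ^ 'd \<Rightarrow> real) \<Rightarrow> bool" where
  "weak_div_real G f \<longleftrightarrow> (\<forall>\<phi>. test_fun \<phi> \<longrightarrow>
     (\<Sum>i\<in>UNIV. \<integral>x. pd i \<phi> x * G i x \<partial>torus) = - (\<integral>x. \<phi> x * f x \<partial>torus))"

lemma weak_div_complex_iff:
  assumes "\<And>i. integrable torus (G i)" "integrable torus f"
  shows "weak_div G f \<longleftrightarrow> weak_div_real (\<lambda>i x. Re (G i x)) (\<lambda>x. Re (f x)) \<and> weak_div_real (\<lambda>i x. Im (G i x)) (\<lambda>x. Im (f x))"
  using assms unfolding weak_div_def weak_div_real_def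
  by (auto simp: complex_eq_iff integral_scaleR_parts test_fun_pcont)

lemma weak_div_real_iff:
  assumes G: "\<And>i. Lp 2 (G i)" and f: "Lp 2 f"
  shows "weak_div_real G f \<longleftrightarrow> divL (\<lambda>i. cl (G i)) (cl f)"
proof
  assume w: "weak_div_real G f"
  show "divL (\<lambda>i. cl (G i)) (cl f)" unfolding divL_def
  proof
    fix k :: "int ^ 'a"
    have "(\<Sum>i\<in>UNIV. \<integral>x. pd i (cas k) x * G i x \<partial>torus) = - (\<integral>x. cas k x * f x \<partial>torus)"
      using w cas_test_fun unfolding weak_div_real_def by blast
    moreover have "(\<integral>x. pd i (cas k) x * G i x \<partial>torus) = of_int (k $ i) * inner (cl (G i)) (casL (- k))" for i
      unfolding pd_cas inner_casL[OF G] integral_mult_right_zero[symmetric] by (simp add: ac_simps)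
    moreover have "(\<integral>x. cas k x * f x \<partial>torus) = inner (cl f) (casL k)" using f by (simp add: inner_casL mult.commute)
    ultimately show "(\<Sum>i\<in>UNIV. of_int (k $ i) * inner (cl (G i)) (casL (- k))) = - inner (cl f) (casL k)" by simp
  qed
next
  assume D: "divL (\<lambda>i. cl (G i)) (cl f)"
  show "weak_div_real G f" unfolding weak_div_real_def
  proof (intro allI impI)
    fix \<phi> :: "real ^ 'a \<Rightarrow> real" assume t: "test_fun \<phi>"
    note L = test_fun_pcont[OF t, THEN pcont_Lp2]
    have "(\<Sum>i\<in>UNIV. inner (cl (G i)) (cl (pd i \<phi>))) = - inner (cl f) (cl \<phi>)"
      using D by (rule div_pair) (rule wd_C1[OF test_fun_C1[OF t]])
    then show "(\<Sum>i\<in>UNIV. \<integral>x. pd i \<phi> x * G i x \<partial>torus) = - (\<integral>x. \<phi> x * f x \<partial>torus)"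
      using G f L by (simp add: inner_cl mult.commute)
  qed
qed

lemma weak_div_real_cong_AE:
  assumes "\<And>i. AE x in torus. G i x = G' i x" "\<And>i. G i \<in> borel_measurable torus" "\<And>i. G' i \<in> borel_measurable torus"
  shows "weak_div_real G f \<longleftrightarrow> weak_div_real G' f"
proof -
  have "(\<integral>x. pd i \<phi> x * G i x \<partial>torus) = (\<integral>x. pd i \<phi> x * G' i x \<partial>torus)" if "test_fun \<phi>" for i \<phi>
  proof (rule integral_cong_AE)
    have "pd i \<phi> \<in> borel_measurable torus"
      using test_fun_pcont(2)[OF that, of i] by (intro measurable_torus borel_measurable_continuous_onI) (auto simp: pcont_def)
    then show "(\<lambda>x. pd i \<phi> x * G i x) \<in> borel_measurable torus" "(\<lambda>x. pd i \<phi> x * G' i x) \<in> borel_measurable torus"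
      using assms by auto
    show "AE x in torus. pd i \<phi> x * G i x = pd i \<phi> x * G' i x" using assms(1)[of i] by eventually_elim simp
  qed
  then show ?thesis unfolding weak_div_real_def by simp
qed

lemma AE_eq_of_test_funs:
  fixes f g :: "real ^ 'd::finite \<Rightarrow> complex"
  assumes f: "integrable torus f" and g: "integrable torus g"
    and eq: "\<And>\<phi>. test_fun \<phi> \<Longrightarrow> (\<integral>x. \<phi> x *\<^sub>R f x \<partial>torus) = (\<integral>x. \<phi> x *\<^sub>R g x \<partial>torus)"
  shows "AE x in torus. f x = g x"
proof -
  have "AE x in torus. f x - g x = 0"
  proof (rule AE_zero_of_test_funs)
    show "integrable torus (\<lambda>x. f x - g x)" using f g by simp
    fix \<phi> :: "real ^ 'd \<Rightarrow> real" assume t: "test_fun \<phi>"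
    have "integrable torus (\<lambda>x. \<phi> x *\<^sub>R f x)" "integrable torus (\<lambda>x. \<phi> x *\<^sub>R g x)"
      using integrable_pcont_scaleR test_fun_pcont(1)[OF t] f g by blast+
    then show "(\<integral>x. \<phi> x *\<^sub>R (f x - g x) \<partial>torus) = 0" using eq[OF t] by (simp add: scaleR_diff_right)
  qed
  then show ?thesis by simp
qed

lemma weak_pd_unique:
  fixes f f' g g' :: "real ^ 'd::finite \<Rightarrow> complex"
  assumes "weak_pd i f g" "weak_pd i f g'" shows "AE x in torus. g x = g' x"
  using assms unfolding weak_pd_def by (intro AE_eq_of_test_funs) (auto simp: minus_equation_iff)

text \<open>Two weak gradients of \<open>a\<close> agree almost everywhere and hence so do the
  divergences. It makes the choice in \<open>div_grad\<close> harmless.\<close>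

lemma is_div_grad_unique:
  assumes "is_div_grad \<mu> a f" "is_div_grad \<mu> a f'" and m: "pcont \<mu>"
  shows "AE x in torus. f x = f' x"
proof -
  obtain D D' where D: "\<And>i. weak_pd i a (D i)" "weak_div (\<lambda>i x. of_real (\<mu> x) * D i x) f"
    and D': "\<And>i. weak_pd i a (D' i)" "weak_div (\<lambda>i x. of_real (\<mu> x) * D' i x) f'"
    using assms(1,2) unfolding is_div_grad_def by blast
  have e: "AE x in torus. D i x = D' i x" for i using D(1) D'(1) by (rule weak_pd_unique)
  have m': "\<mu> \<in> borel_measurable torus"
    using m by (intro measurable_torus borel_measurable_continuous_onI) (auto simp: pcont_def)
  have int: "integrable torus (D i)" "integrable torus (D' i)" for i using D(1)[of i] D'(1)[of i] by (auto simp: weak_pd_def)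
  have "(\<integral>x. pd i \<phi> x *\<^sub>R (of_real (\<mu> x) * D i x) \<partial>torus) = (\<integral>x. pd i \<phi> x *\<^sub>R (of_real (\<mu> x) * D' i x) \<partial>torus)"
    if t: "test_fun \<phi>" for i \<phi>
  proof (rule integral_cong_AE)
    have "pd i \<phi> \<in> borel_measurable torus"
      using test_fun_pcont(2)[OF t, of i] by (intro measurable_torus borel_measurable_continuous_onI) (auto simp: pcont_def)
    then show "(\<lambda>x. pd i \<phi> x *\<^sub>R (of_real (\<mu> x) * D i x)) \<in> borel_measurable torus"
       "(\<lambda>x. pd i \<phi> x *\<^sub>R (of_real (\<mu> x) * D' i x)) \<in> borel_measurable torus" using int[of i] m' by auto
    show "AE x in torus. pd i \<phi> x *\<^sub>R (of_real (\<mu> x) * D i x) = pd i \<phi> x *\<^sub>R (of_real (\<mu> x) * D' i x)"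
      using e[of i] by eventually_elim simp
  qed
  then show ?thesis using D(2) D'(2) unfolding weak_div_def
    by (intro AE_eq_of_test_funs) (auto simp: minus_equation_iff)
qed

lemma AE_Im_zero:
  fixes g :: "real ^ 'd::finite \<Rightarrow> complex"
  assumes g: "integrable torus g" and z: "\<And>\<phi>. test_fun \<phi> \<Longrightarrow> (\<integral>x. \<phi> x * Im (g x) \<partial>torus) = 0"
  shows "AE x in torus. Im (g x) = 0"
proof (rule AE_zero_of_coefficients)
  show "integrable torus (\<lambda>x. Im (g x))" using g by simp
  show "(\<integral>x. Im (g x) * cas k x \<partial>torus) = 0" for k using z[OF cas_test_fun] by (simp add: mult.commute)
qed

text \<open>Serves the real feedback: the imaginary part of the weak gradient, and with it that of
  the divergence, is orthogonal to all test functions.\<close>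

lemma is_div_grad_real:
  assumes a: "is_div_grad \<mu> a f" and m: "pcont \<mu>" and r: "AE x in torus. a x \<in> \<real>"
  shows "AE x in torus. f x \<in> \<real>"
proof -
  obtain D where D: "\<And>i. weak_pd i a (D i)" "weak_div (\<lambda>i x. of_real (\<mu> x) * D i x) f"
    using a unfolding is_div_grad_def by blast
  have int: "integrable torus (D i)" for i using D(1)[of i] by (auto simp: weak_pd_def)
  have zero: "(\<integral>x. p x * Im (h x) \<partial>torus) = 0" if "AE x in torus. Im (h x) = 0" for p and h :: "real ^ 'a \<Rightarrow> complex"
  proof -
    have "AE x in torus. p x * Im (h x) = 0" using that by eventually_elim simp
    then show ?thesis by (rule integral_eq_zero_AE)
  qed
  have ra: "AE x in torus. Im (a x) = 0" using r by eventually_elim (simp add: complex_is_Real_iff)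
  have ID: "AE x in torus. Im (D i x) = 0" for i
  proof (rule AE_Im_zero[OF int])
    fix \<phi> :: "real ^ 'a \<Rightarrow> real" assume "test_fun \<phi>"
    then have "(\<integral>x. pd i \<phi> x *\<^sub>R Im (a x) \<partial>torus) = - (\<integral>x. \<phi> x *\<^sub>R Im (D i x) \<partial>torus)"
      using D(1)[of i] unfolding weak_pd_complex_iff weak_pd_def by blast
    then show "(\<integral>x. \<phi> x * Im (D i x) \<partial>torus) = 0" using zero[OF ra, of "pd i \<phi>"] by simp
  qed
  have fi: "integrable torus f" and wi: "\<And>i. integrable torus (\<lambda>x. of_real (\<mu> x) * D i x)"
    using D(2) by (auto simp: weak_div_def)
  have w: "weak_div_real (\<lambda>i x. Im (of_real (\<mu> x) * D i x)) (\<lambda>x. Im (f x))"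
    using D(2) unfolding weak_div_complex_iff[OF wi fi] by blast
  have "AE x in torus. Im (f x) = 0"
  proof (rule AE_Im_zero[OF fi])
    fix \<phi> :: "real ^ 'a \<Rightarrow> real" assume t: "test_fun \<phi>"
    have "AE x in torus. Im (of_real (\<mu> x) * D i x) = 0" for i using ID[of i] by eventually_elim simp
    then have "(\<integral>x. pd i \<phi> x * Im (of_real (\<mu> x) * D i x) \<partial>torus) = 0" for i by (rule zero)
    then have "0 = - (\<integral>x. \<phi> x * Im (f x) \<partial>torus)" using w t unfolding weak_div_real_def by fastforce
    then show "(\<integral>x. \<phi> x * Im (f x) \<partial>torus) = 0" by simp
  qed
  then show ?thesis by eventually_elim (simp add: complex_is_Real_iff)
qed

lemma conv_parts:
  fixes f :: "real ^ 'd::finite \<Rightarrow> complex"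
  assumes K: "pcont K" and f: "integrable torus f"
  shows "Re (conv K f x) = conv K (\<lambda>x. Re (f x)) x" "Im (conv K f x) = conv K (\<lambda>x. Im (f x)) x"
proof -
  have "integrable torus (\<lambda>y. K (x - y) * Re (f y))" "integrable torus (\<lambda>y. K (x - y) * Im (f y))"
    using K f unfolding pcont_def by (auto intro!: conv_integrable)
  then have "integrable torus (\<lambda>y. K (x - y) *\<^sub>R f y)" unfolding integrable_complex_iff by simp
  then show "Re (conv K f x) = conv K (\<lambda>x. Re (f x)) x" "Im (conv K f x) = conv K (\<lambda>x. Im (f x)) x"
    unfolding conv_def using integral_Re integral_Im by fastforce+
qed

section \<open>The spaces and the operator of the statement\<close>

context mckean_vlasov
begin

text \<open>Both \<open>\<mu>\<close> and its reciprocal are bounded, so the weight does not change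
  square integrability.\<close>

lemma X_space_iff: "f \<in> X_space \<mu> \<longleftrightarrow> Lp 2 f"
proof -
  have e: "(cmod (f x))\<^sup>2 / \<mu> x = (cmod (f x))\<^sup>2 * imu x" for x by (simp add: imu_inverse)
  have e': "(cmod (f x))\<^sup>2 = (cmod (f x))\<^sup>2 / \<mu> x * \<mu> x" for x using mu_pos[of x] by simp
  have "integrable torus (\<lambda>x. (cmod (f x))\<^sup>2 / \<mu> x) \<longleftrightarrow> integrable torus (\<lambda>x. (cmod (f x))\<^sup>2)"
  proof
    assume "integrable torus (\<lambda>x. (cmod (f x))\<^sup>2 / \<mu> x)"
    from integrable_mult_continuous[OF this, of \<mu>] show "integrable torus (\<lambda>x. (cmod (f x))\<^sup>2)"
      using pconts(1) e' by (simp add: pcont_def)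
  next
    assume "integrable torus (\<lambda>x. (cmod (f x))\<^sup>2)"
    from integrable_mult_continuous[OF this, of imu] show "integrable torus (\<lambda>x. (cmod (f x))\<^sup>2 / \<mu> x)"
      using pconts(2) e by (simp add: pcont_def)
  qed
  then show ?thesis by (simp add: X_space_def Lp2_iff)
qed

lemma X0_mem_cl: "Lp 2 f \<Longrightarrow> cl f \<in> X0 \<longleftrightarrow> (\<integral>x. f x \<partial>torus) = 0"
  by (simp add: X0_def inner_casL cas_zero)

lemma X0_space_iff: "f \<in> X0_space \<mu> \<longleftrightarrow> Lp 2 f \<and> reL f \<in> X0 \<and> imL f \<in> X0"
proof (cases "Lp 2 f")
  case True
  then have "(\<integral>x. f x \<partial>torus) = 0 \<longleftrightarrow> (\<integral>x. Re (f x) \<partial>torus) = 0 \<and> (\<integral>x. Im (f x) \<partial>torus) = 0"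
    using integral_Re[OF Lp2_complex_integrable[OF True]] integral_Im[OF Lp2_complex_integrable[OF True]]
    by (simp add: complex_eq_iff)
  then show ?thesis using True Lp2_complex_iff[of f] unfolding X0_space_def X_space_iff reL_def imL_def by (simp add: X0_mem_cl)
qed (simp add: X0_space_def X_space_iff)

lemma X0_space_Lp2: "f \<in> X0_space \<mu> \<Longrightarrow> Lp 2 f"
  by (simp add: X0_space_iff)

lemma cpx_X0: "F \<in> X0 \<Longrightarrow> F' \<in> X0 \<Longrightarrow> cpx F F' \<in> X0_space \<mu>"
  by (simp add: X0_space_iff cpx_Lp2)

definition flux_real :: "(real ^ 'd \<Rightarrow> real) \<Rightarrow> ('d \<Rightarrow> real ^ 'd \<Rightarrow> real) \<Rightarrow> 'd \<Rightarrow> real ^ 'd \<Rightarrow> real" where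
  "flux_real y D i x = \<sigma> * D i x + y x * dU i x + \<mu> x * conv (pd i W) y x"

lemma MV_flux_parts:
  assumes "integrable torus y"
  shows "Re (MV_flux \<sigma> V W \<mu> y D i x) = flux_real (\<lambda>x. Re (y x)) (\<lambda>i x. Re (D i x)) i x"
    "Im (MV_flux \<sigma> V W \<mu> y D i x) = flux_real (\<lambda>x. Im (y x)) (\<lambda>i x. Im (D i x)) i x"
  unfolding MV_flux_def flux_real_def dU_def using conv_parts[OF W_pcont(2) assms] by (simp_all add: algebra_simps)

lemma flux_real_cl:
  assumes y: "Lp 2 y" and D: "Lp 2 (D i)"
  shows "Lp 2 (flux_real y D i)" "cl (flux_real y D i) = fluxL (cl y) (\<lambda>i. cl (D i)) i"
proof -
  have c: "Lp 2 (conv (pd i W) y)" using conv_pcont[OF W_pcont(2) Lp2_integrable[OF y]] by (rule pcont_Lp2)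
  have L: "Lp 2 (\<lambda>x. \<sigma> * D i x)" "Lp 2 (\<lambda>x. dU i x * y x)" "Lp 2 (\<lambda>x. \<mu> x * conv (pd i W) y x)"
    using y D c pconts by (auto intro: Lp2_scale mul_Lp2)
  have e: "flux_real y D i = (\<lambda>x. \<sigma> * D i x + dU i x * y x + \<mu> x * conv (pd i W) y x)"
    by (simp add: flux_real_def fun_eq_iff mult.commute)
  show "Lp 2 (flux_real y D i)" unfolding e by (intro Lp2_add L)
  show "cl (flux_real y D i) = fluxL (cl y) (\<lambda>i. cl (D i)) i"
    unfolding e fluxL_def cl_simps(2)[OF Lp2_add[OF L(1,2)] L(3)] cl_simps(2)[OF L(1,2)] cl_simps(5)[OF D]
    using y c pconts W_pcont by (simp add: mulop_cl convop_cl)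
qed

lemma weak_div_divL:
  assumes y: "Lp 2 y" and D: "\<And>i. Lp 2 (D i)" and f: "Lp 2 f"
  shows "weak_div_real (flux_real y D) f \<longleftrightarrow> divL (fluxL (cl y) (\<lambda>i. cl (D i))) (cl f)"
  using weak_div_real_iff[of "flux_real y D", OF flux_real_cl(1)[OF y D] f] unfolding flux_real_cl(2)[OF y D] .

lemma sobolev_2_2: "sobolev 2 2 f \<longleftrightarrow> Lp 2 f \<and> (\<forall>i. \<exists>g. weak_pd i f g \<and> Lp 2 g \<and> (\<forall>j. \<exists>h. weak_pd j g h \<and> Lp 2 h))"
  by (simp add: numeral_2_eq_2)

lemma MV_graph0D:
  assumes "(y, f) \<in> MV_graph0 \<sigma> V W \<mu>"
  shows "y \<in> X0_space \<mu>" "f \<in> X0_space \<mu>" "mv_rel (reL y) (reL f)" "mv_rel (imL y) (imL f)"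
proof -
  show X: "y \<in> X0_space \<mu>" "f \<in> X0_space \<mu>" using assms by (auto simp: MV_graph0_def)
  obtain Dy where sob: "sobolev 2 2 y" and Dy: "\<And>i. weak_pd i y (Dy i)" "weak_div (MV_flux \<sigma> V W \<mu> y Dy) f"
    using assms by (auto simp: MV_graph0_def MV_graph_def)
  have y: "Lp 2 y" and f: "Lp 2 f" using X by (auto simp: X0_space_iff)
  have yi: "integrable torus y" and fi: "integrable torus f" using y f by (auto intro: Lp2_complex_integrable)
  obtain g where g: "\<And>i. weak_pd i y (g i)" "\<And>i. Lp 2 (g i)" "\<And>i j. \<exists>h. weak_pd j (g i) h \<and> Lp 2 h"
    using sob unfolding sobolev_2_2 by metis
  \<comment> \<open>The gradient in the operator graph is only known to be integrable, while the
    Sobolev condition gives a square integrable one; they agree almost everywhere, so the flux may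
    be formed with the latter.\<close>
  have ae: "AE x in torus. Dy i x = g i x" for i using Dy(1) g(1) by (rule weak_pd_unique)
  have fl: "integrable torus (MV_flux \<sigma> V W \<mu> y Dy i)" for i using Dy(2) by (auto simp: weak_div_def)
  note wd = Dy(2)[unfolded weak_div_complex_iff[OF fl fi] MV_flux_parts[OF yi]]
  note y' = y[unfolded Lp2_complex_iff] and f' = f[unfolded Lp2_complex_iff] and g' = g(2)[unfolded Lp2_complex_iff]
  have m: "(\<lambda>x. Re (MV_flux \<sigma> V W \<mu> y Dy i x)) \<in> borel_measurable torus" "(\<lambda>x. Im (MV_flux \<sigma> V W \<mu> y Dy i x)) \<in> borel_measurable torus" for i
    using fl[of i] by auto
  have wdi: "wd i (reL y) (reL (g i))" "wd i (imL y) (imL (g i))" for i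
    using g(1)[of i] y' g' unfolding weak_pd_complex_iff reL_def imL_def by (auto simp: weak_pd_iff_wd)
  have wdj: "\<exists>E. wd j (reL (g i)) E" "\<exists>E. wd j (imL (g i)) E" for i j
  proof -
    obtain h where h: "weak_pd j (g i) h" "Lp 2 h" using g(3) by blast
    then have "wd j (reL (g i)) (reL h)" "wd j (imL (g i)) (imL h)"
      using g' unfolding weak_pd_complex_iff reL_def imL_def Lp2_complex_iff[of h] by (auto simp: weak_pd_iff_wd)
    then show "\<exists>E. wd j (reL (g i)) E" "\<exists>E. wd j (imL (g i)) E" by blast+
  qed
  have mf: "flux_real (\<lambda>x. Re (y x)) (\<lambda>i x. Re (g i x)) i \<in> borel_measurable torus"
    "flux_real (\<lambda>x. Im (y x)) (\<lambda>i x. Im (g i x)) i \<in> borel_measurable torus" for i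
    using flux_real_cl(1)[of "\<lambda>x. Re (y x)" "\<lambda>i x. Re (g i x)" i] flux_real_cl(1)[of "\<lambda>x. Im (y x)" "\<lambda>i x. Im (g i x)" i] y' g'
    by (auto dest: Lp2D(4))
  have e: "AE x in torus. flux_real (\<lambda>x. Re (y x)) (\<lambda>i x. Re (Dy i x)) i x = flux_real (\<lambda>x. Re (y x)) (\<lambda>i x. Re (g i x)) i x"
    "AE x in torus. flux_real (\<lambda>x. Im (y x)) (\<lambda>i x. Im (Dy i x)) i x = flux_real (\<lambda>x. Im (y x)) (\<lambda>i x. Im (g i x)) i x" for i
    using ae[of i] by (eventually_elim, simp add: flux_real_def)+
  note m' = m[unfolded MV_flux_parts[OF yi]]
  have "weak_div_real (flux_real (\<lambda>x. Re (y x)) (\<lambda>i x. Re (g i x))) (\<lambda>x. Re (f x))"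
    by (rule weak_div_real_cong_AE[THEN iffD1, rotated 3, OF wd[THEN conjunct1]]) (rule e m' mf)+
  then have "divL (fluxL (reL y) (\<lambda>i. reL (g i))) (reL f)"
    using y' f' g' unfolding reL_def by (subst (asm) weak_div_divL) auto
  then show "mv_rel (reL y) (reL f)" using X wdi(1) wdj(1) by (intro mv_relI) (auto simp: X0_space_iff)
  have "weak_div_real (flux_real (\<lambda>x. Im (y x)) (\<lambda>i x. Im (g i x))) (\<lambda>x. Im (f x))"
    by (rule weak_div_real_cong_AE[THEN iffD1, rotated 3, OF wd[THEN conjunct2]]) (rule e m' mf)+
  then have "divL (fluxL (imL y) (\<lambda>i. imL (g i))) (imL f)"
    using y' f' g' unfolding imL_def by (subst (asm) weak_div_divL) auto
  then show "mv_rel (imL y) (imL f)" using X wdi(2) wdj(2) by (intro mv_relI) (auto simp: X0_space_iff)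
qed

lemma weak_pd_cpx:
  assumes y: "Lp 2 y" and "wd i (reL y) D" "wd i (imL y) E" shows "weak_pd i y (cpx D E)"
  unfolding weak_pd_complex_iff cpx_def complex.sel
  using assms(2,3) y[unfolded Lp2_complex_iff] by (simp add: weak_pd_iff_wd rp_Lp2 reL_def imL_def)

lemma MV_graph0I:
  assumes X: "y \<in> X0_space \<mu>" "f \<in> X0_space \<mu>" and "mv_rel (reL y) (reL f)" "mv_rel (imL y) (imL f)"
  shows "(y, f) \<in> MV_graph0 \<sigma> V W \<mu>"
proof -
  have y: "Lp 2 y" and f: "Lp 2 f" using X by (auto simp: X0_space_iff)
  have yi: "integrable torus y" and fi: "integrable torus f" using y f by (auto intro: Lp2_complex_integrable)
  obtain D where D: "\<And>i. wd i (reL y) (D i)" "\<And>i j. \<exists>E. wd j (D i) E" "divL (fluxL (reL y) D) (reL f)"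
    using assms(3) unfolding mv_rel_def by blast
  obtain D' where D': "\<And>i. wd i (imL y) (D' i)" "\<And>i j. \<exists>E. wd j (D' i) E" "divL (fluxL (imL y) D') (imL f)"
    using assms(4) unfolding mv_rel_def by blast
  define g where "g i = cpx (D i) (D' i)" for i
  have w: "weak_pd i y (g i)" for i unfolding g_def by (rule weak_pd_cpx[OF y D(1) D'(1)])
  have gL: "Lp 2 (g i)" for i unfolding g_def by (rule cpx_Lp2)
  have "\<exists>h. weak_pd j (g i) h \<and> Lp 2 h" for i j
  proof -
    obtain E E' where "wd j (D i) E" "wd j (D' i) E'" using D(2) D'(2) by blast
    then have "weak_pd j (g i) (cpx E E')" by (intro weak_pd_cpx gL) (auto simp: g_def)
    then show ?thesis using cpx_Lp2 by blast
  qed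
  then have "sobolev 2 2 y" unfolding sobolev_2_2 using y w gL by blast
  moreover have "weak_div (MV_flux \<sigma> V W \<mu> y g) f"
  proof -
    note y' = y[unfolded Lp2_complex_iff] and f' = f[unfolded Lp2_complex_iff] and g' = gL[unfolded Lp2_complex_iff]
    have F: "Lp 2 (flux_real (\<lambda>x. Re (y x)) (\<lambda>i x. Re (g i x)) i)" "Lp 2 (flux_real (\<lambda>x. Im (y x)) (\<lambda>i x. Im (g i x)) i)" for i
      using flux_real_cl(1)[of "\<lambda>x. Re (y x)" "\<lambda>i x. Re (g i x)" i] flux_real_cl(1)[of "\<lambda>x. Im (y x)" "\<lambda>i x. Im (g i x)" i] y' g' by auto
    have "integrable torus (MV_flux \<sigma> V W \<mu> y g i)" for i
      unfolding integrable_complex_iff[of torus "MV_flux \<sigma> V W \<mu> y g i"] MV_flux_parts[OF yi] using F[THEN Lp2_integrable] by simp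
    moreover have "weak_div_real (flux_real (\<lambda>x. Re (y x)) (\<lambda>i x. Re (g i x))) (\<lambda>x. Re (f x))"
      using D(3) y' f' g' by (subst weak_div_divL) (auto simp: g_def cpx_def reL_def)
    moreover have "weak_div_real (flux_real (\<lambda>x. Im (y x)) (\<lambda>i x. Im (g i x))) (\<lambda>x. Im (f x))"
      using D'(3) y' f' g' by (subst weak_div_divL) (auto simp: g_def cpx_def imL_def)
    ultimately show ?thesis by (simp add: weak_div_complex_iff fi MV_flux_parts[OF yi])
  qed
  moreover have "f \<in> X_space \<mu>" using X(2) by (simp add: X0_space_def)
  ultimately show ?thesis using w X unfolding MV_graph0_def MV_graph_def by blast
qed

text \<open>\<open>V\<close>, \<open>W\<close> and \<open>\<mu>\<close> are real, so
  \<open>L\<close> acts separately on real and imaginary parts. The domain condition is absorbed,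
  since \<open>G\<close> maps into H2.\<close>

lemma MV_graph0_iff:
  "(y, f) \<in> MV_graph0 \<sigma> V W \<mu> \<longleftrightarrow>
    y \<in> X0_space \<mu> \<and> f \<in> X0_space \<mu> \<and> reL y = - G (reL f) \<and> imL y = - G (imL f)"
  using MV_graph0D MV_graph0I unfolding mv_rel_iff X0_space_iff by blast

section \<open>The inner product of the statement\<close>

abbreviation N :: "(real ^ 'd \<Rightarrow> complex) \<Rightarrow> real" where "N \<equiv> ip_norm (X_ip \<mu>)"

lemma X_ip_parts:
  assumes "Lp 2 f" "Lp 2 g"
  shows "Re (X_ip \<mu> f g) = inner (mulop imu (reL f)) (reL g) + inner (mulop imu (imL f)) (imL g)"
    "Im (X_ip \<mu> f g) = inner (mulop imu (imL f)) (reL g) - inner (mulop imu (reL f)) (imL g)"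
proof -
  note f' = assms(1)[unfolded Lp2_complex_iff] and g' = assms(2)[unfolded Lp2_complex_iff]
  have e: "f x * cnj (g x) / of_real (\<mu> x) = Complex
      (imu x * Re (f x) * Re (g x) + imu x * Im (f x) * Im (g x)) (imu x * Im (f x) * Re (g x) - imu x * Re (f x) * Im (g x))" for x
    using mu_pos[of x] by (simp add: complex_eq_iff Re_divide_of_real Im_divide_of_real imu_inverse add_divide_distrib diff_divide_distrib)
  have L: "Lp 2 (\<lambda>x. imu x * Re (f x))" "Lp 2 (\<lambda>x. imu x * Im (f x))"
    using f' pconts(2) by (auto intro: mul_Lp2)
  have i: "integrable torus (\<lambda>x. imu x * Re (f x) * Re (g x))" "integrable torus (\<lambda>x. imu x * Im (f x) * Im (g x))"
    "integrable torus (\<lambda>x. imu x * Im (f x) * Re (g x))" "integrable torus (\<lambda>x. imu x * Re (f x) * Im (g x))"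
    using L g' by (auto intro: Lp2_mult_integrable)
  have int: "integrable torus (\<lambda>x. f x * cnj (g x) / of_real (\<mu> x))"
    unfolding e integrable_complex_iff[of torus "\<lambda>x. Complex (_ x) (_ x)"] complex.sel using i by simp
  show "Re (X_ip \<mu> f g) = inner (mulop imu (reL f)) (reL g) + inner (mulop imu (imL f)) (imL g)"
    unfolding X_ip_def integral_Re[OF int, symmetric] unfolding e complex.sel reL_def imL_def
    using i L f' g' pconts(2) by (simp add: mulop_cl inner_cl)
  show "Im (X_ip \<mu> f g) = inner (mulop imu (imL f)) (reL g) - inner (mulop imu (reL f)) (imL g)"
    unfolding X_ip_def integral_Im[OF int, symmetric] unfolding e complex.sel reL_def imL_def
    using i L f' g' pconts(2) by (simp add: mulop_cl inner_cl)
qed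

lemma N_sq:
  assumes "Lp 2 f"
  shows "(N f)\<^sup>2 = inner (mulop imu (reL f)) (reL f) + inner (mulop imu (imL f)) (imL f)" "0 \<le> N f"
proof -
  have "0 \<le> inner (mulop imu F) F" for F :: "'d l2"
    using inner_mulop_ge[OF pconts(2), of 0 F] imu_pos by (simp add: less_imp_le)
  then have "0 \<le> Re (X_ip \<mu> f f)" unfolding X_ip_parts[OF assms assms] by simp
  then show "(N f)\<^sup>2 = inner (mulop imu (reL f)) (reL f) + inner (mulop imu (imL f)) (imL f)" "0 \<le> N f"
    unfolding ip_norm_def using X_ip_parts[OF assms assms] by simp_all
qed

text \<open>Both quantities are equivalent to the squared L2 norm, by the bounds on
  \<open>1 / \<mu>\<close> and by coercivity and boundedness of \<open>b\<close>. Estimates can thus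
  be made in \<open>b\<close>, for which the eigenbasis is orthonormal.\<close>

lemma N_equiv: "\<exists>A B. 0 < A \<and> 0 < B \<and> (\<forall>f\<in>X0_space \<mu>. A * (N f)\<^sup>2 \<le> b (reL f) (reL f) + b (imL f) (imL f) \<and>
   b (reL f) (reL f) + b (imL f) (imL f) \<le> B * (N f)\<^sup>2)"
proof -
  obtain m where m: "0 < m" "\<And>x. m \<le> imu x" using bounds by blast
  obtain K where K: "0 < K" "\<And>F. norm (mulop imu F) \<le> norm F * K"
    using bounded_linear.pos_bounded[OF mulop_bounded_linear[OF pconts(2)]] by blast
  obtain L where L: "0 < L" "\<And>F F'. \<bar>b F F'\<bar> \<le> L * norm F * norm F'" using form.bound by blast
  have up: "inner (mulop imu F) F \<le> K / c\<^sub>0 * b F F" for F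
  proof -
    have "inner (mulop imu F) F \<le> norm (mulop imu F) * norm F" by (rule norm_cauchy_schwarz)
    also have "\<dots> \<le> norm F * K * norm F" using K by (intro mult_right_mono) auto
    also have "\<dots> = K / c\<^sub>0 * (c\<^sub>0 * (norm F)\<^sup>2)" using c0(1) by (simp add: power2_eq_square)
    also have "\<dots> \<le> K / c\<^sub>0 * b F F" using c0 K(1) by (intro mult_left_mono) auto
    finally show ?thesis .
  qed
  have lo: "b F F \<le> L / m * inner (mulop imu F) F" for F
  proof -
    have "b F F \<le> L * norm F * norm F" using L(2)[of F F] by linarith
    also have "\<dots> = L / m * (m * (norm F)\<^sup>2)" using m(1) by (simp add: power2_eq_square)
    also have "\<dots> \<le> L / m * inner (mulop imu F) F"
      using L(1) m by (intro mult_left_mono inner_mulop_ge pconts) auto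
    finally show ?thesis .
  qed
  show ?thesis
  proof (intro exI conjI ballI)
    show "0 < c\<^sub>0 / K" "0 < L / m" using c0(1) K(1) L(1) m(1) by auto
    fix f assume "f \<in> X0_space \<mu>"
    then have N: "(N f)\<^sup>2 = inner (mulop imu (reL f)) (reL f) + inner (mulop imu (imL f)) (imL f)"
      by (intro N_sq) (simp add: X0_space_iff)
    have "(N f)\<^sup>2 \<le> K / c\<^sub>0 * (b (reL f) (reL f) + b (imL f) (imL f))"
      unfolding N distrib_left by (intro add_mono up)
    then have "c\<^sub>0 / K * (N f)\<^sup>2 \<le> c\<^sub>0 / K * (K / c\<^sub>0 * (b (reL f) (reL f) + b (imL f) (imL f)))"
      using c0(1) K(1) by (intro mult_left_mono) auto
    then show "c\<^sub>0 / K * (N f)\<^sup>2 \<le> b (reL f) (reL f) + b (imL f) (imL f)" using c0(1) K(1) by simp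
    show "b (reL f) (reL f) + b (imL f) (imL f) \<le> L / m * (N f)\<^sup>2"
      unfolding N distrib_left by (intro add_mono lo)
  qed
qed

lemma N_zero_iff:
  assumes "f \<in> X0_space \<mu>" shows "N f = 0 \<longleftrightarrow> reL f = 0 \<and> imL f = 0"
proof -
  obtain A B where AB: "0 < A" "0 < B" "A * (N f)\<^sup>2 \<le> b (reL f) (reL f) + b (imL f) (imL f)"
   "b (reL f) (reL f) + b (imL f) (imL f) \<le> B * (N f)\<^sup>2" using N_equiv assms by blast
  have X: "reL f \<in> X0" "imL f \<in> X0" using assms by (auto simp: X0_space_iff)
  show ?thesis
  proof
    assume "N f = 0"
    then have "b (reL f) (reL f) + b (imL f) (imL f) \<le> 0" using AB(4) by simp
    then have "b (reL f) (reL f) \<le> 0" "b (imL f) (imL f) \<le> 0" using form.pos[OF X(1)] form.pos[OF X(2)] by linarith+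
    then show "reL f = 0 \<and> imL f = 0" using form.definite X by blast
  next
    assume "reL f = 0 \<and> imL f = 0"
    then have "A * (N f)\<^sup>2 \<le> 0" using AB(3) by (simp add: form.bsimps)
    then show "N f = 0" using AB(1) by (simp add: mult_le_0_iff)
  qed
qed

lemma N_tendsto_iff:
  assumes "eventually (\<lambda>t. f t \<in> X0_space \<mu>) F"
  shows "((\<lambda>t. N (f t)) \<longlongrightarrow> 0) F \<longleftrightarrow> ((\<lambda>t. reL (f t)) \<longlongrightarrow> 0) F \<and> ((\<lambda>t. imL (f t)) \<longlongrightarrow> 0) F"
proof -
  obtain A B where AB: "0 < A" "0 < B" "\<And>f. f \<in> X0_space \<mu> \<Longrightarrow> A * (N f)\<^sup>2 \<le> b (reL f) (reL f) + b (imL f) (imL f)"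
   "\<And>f. f \<in> X0_space \<mu> \<Longrightarrow> b (reL f) (reL f) + b (imL f) (imL f) \<le> B * (N f)\<^sup>2" using N_equiv by blast
  have X: "eventually (\<lambda>t. reL (f t) \<in> X0) F" "eventually (\<lambda>t. imL (f t) \<in> X0) F"
    using assms by (auto simp: X0_space_iff elim: eventually_mono)
  have p: "0 \<le> b (reL h) (reL h)" "0 \<le> b (imL h) (imL h)" if "h \<in> X0_space \<mu>" for h
    using that form.pos by (auto simp: X0_space_iff)
  show ?thesis
  proof
    assume "((\<lambda>t. N (f t)) \<longlongrightarrow> 0) F"
    then have "((\<lambda>t. B * (N (f t))\<^sup>2) \<longlongrightarrow> B * 0\<^sup>2) F" by (intro tendsto_intros)
    then have l: "((\<lambda>t. B * (N (f t))\<^sup>2) \<longlongrightarrow> 0) F" by simp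
    have "((\<lambda>t. b (reL (f t)) (reL (f t))) \<longlongrightarrow> 0) F" "((\<lambda>t. b (imL (f t)) (imL (f t))) \<longlongrightarrow> 0) F"
    proof -
      show "((\<lambda>t. b (reL (f t)) (reL (f t))) \<longlongrightarrow> 0) F"
        by (rule Lim_null_comparison[OF _ l]) (use assms in eventually_elim, use AB(4) p in fastforce)
      show "((\<lambda>t. b (imL (f t)) (imL (f t))) \<longlongrightarrow> 0) F"
        by (rule Lim_null_comparison[OF _ l]) (use assms in eventually_elim, use AB(4) p in fastforce)
    qed
    then show "((\<lambda>t. reL (f t)) \<longlongrightarrow> 0) F \<and> ((\<lambda>t. imL (f t)) \<longlongrightarrow> 0) F"
      using form.tendsto_0_iff[OF X(1)] form.tendsto_0_iff[OF X(2)] by simp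
  next
    assume "((\<lambda>t. reL (f t)) \<longlongrightarrow> 0) F \<and> ((\<lambda>t. imL (f t)) \<longlongrightarrow> 0) F"
    then have "((\<lambda>t. b (reL (f t)) (reL (f t)) + b (imL (f t)) (imL (f t))) \<longlongrightarrow> 0 + 0) F"
      using form.tendsto_0_iff[OF X(1)] form.tendsto_0_iff[OF X(2)] by (intro tendsto_add) auto
    then have "((\<lambda>t. sqrt ((b (reL (f t)) (reL (f t)) + b (imL (f t)) (imL (f t))) / A)) \<longlongrightarrow> sqrt ((0 + 0) / A)) F"
      by (rule tendsto_real_sqrt[OF tendsto_divide[OF _ tendsto_const]]) (use AB(1) in simp)
    then have l: "((\<lambda>t. sqrt ((b (reL (f t)) (reL (f t)) + b (imL (f t)) (imL (f t))) / A)) \<longlongrightarrow> 0) F" by simp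
    show "((\<lambda>t. N (f t)) \<longlongrightarrow> 0) F"
    proof (rule Lim_null_comparison[OF _ l])
      show "\<forall>\<^sub>F t in F. norm (N (f t)) \<le> sqrt ((b (reL (f t)) (reL (f t)) + b (imL (f t)) (imL (f t))) / A)"
        using assms
      proof eventually_elim
        case (elim t)
        have "0 \<le> N (f t)" using elim by (intro N_sq) (simp add: X0_space_iff)
        moreover have "(N (f t))\<^sup>2 \<le> (b (reL (f t)) (reL (f t)) + b (imL (f t)) (imL (f t))) / A"
          using AB(3)[OF elim] AB(1) by (simp add: field_simps)
        ultimately show ?case by (simp add: real_le_rsqrt)
      qed
    qed
  qed
qed

end

section \<open>Unstable modes, feedback, closed loop and Hautus test\<close>

section \<open>The unstable modes\<close>

lemma Lp2_cong_AE:
  fixes f g :: "real ^ 'd::finite \<Rightarrow> complex"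
  assumes "Lp 2 f" "torus_fun g" "AE x in torus. f x = g x" shows "Lp 2 g"
proof -
  have "f \<in> borel_measurable torus" "g \<in> borel_measurable torus"
    using assms(1,2) by (auto simp: Lp2_iff torus_fun_def intro: measurable_torus)
  then have "integrable torus (\<lambda>x. (norm (f x))\<^sup>2) \<longleftrightarrow> integrable torus (\<lambda>x. (norm (g x))\<^sup>2)"
    by (intro integrable_cong_AE) (use assms(3) in \<open>auto elim: eventually_mono\<close>)
  then show ?thesis using assms(1,2) by (simp add: Lp2_iff)
qed

lemma L2_sum:
  fixes f :: "'i \<Rightarrow> real ^ 'd::finite \<Rightarrow> complex"
  assumes "finite A" "\<And>i. i \<in> A \<Longrightarrow> Lp 2 (f i)"
  shows "Lp 2 (\<lambda>x. \<Sum>i\<in>A. w i * f i x) \<and>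
    reL (\<lambda>x. \<Sum>i\<in>A. w i * f i x) = (\<Sum>i\<in>A. Re (w i) *\<^sub>R reL (f i) - Im (w i) *\<^sub>R imL (f i)) \<and>
    imL (\<lambda>x. \<Sum>i\<in>A. w i * f i x) = (\<Sum>i\<in>A. Re (w i) *\<^sub>R imL (f i) + Im (w i) *\<^sub>R reL (f i))"
  using assms
proof (induction A rule: finite_induct)
  case empty
  have "Lp 2 (\<lambda>x :: real ^ 'd. 0 :: complex)" by (simp add: Lp2_complex_iff Lp2_const)
  then show ?case by (simp add: reL_def imL_def cl_simps)
next
  case (insert i A)
  then have "Lp 2 (f i)" "Lp 2 (\<lambda>x. \<Sum>i\<in>A. w i * f i x)" by auto
  from L2_lincomb[OF this, of "w i" 1] show ?case using insert by simp
qed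

lemma X_ip_scale: "X_ip \<mu> (\<lambda>x. c * f x) g = c * X_ip \<mu> f g" "X_ip \<mu> f (\<lambda>x. c * g x) = cnj c * X_ip \<mu> f g"
proof -
  have l: "c * f x * cnj (g x) / of_real (\<mu> x) = c * (f x * cnj (g x) / of_real (\<mu> x))" for x by simp
  show "X_ip \<mu> (\<lambda>x. c * f x) g = c * X_ip \<mu> f g" unfolding X_ip_def l integral_mult_right_zero ..
  have r: "f x * cnj (c * g x) / of_real (\<mu> x) = cnj c * (f x * cnj (g x) / of_real (\<mu> x))" for x by simp
  show "X_ip \<mu> f (\<lambda>x. c * g x) = cnj c * X_ip \<mu> f g" unfolding X_ip_def r integral_mult_right_zero ..
qed

text \<open>The eigenbasis \<open>E\<close> of \<open>G\<close> is a parameter, so that all further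
  objects refer to one fixed basis; its existence is \<open>op.spectral\<close>.\<close>

locale stabilization = mckean_vlasov V W \<mu> \<sigma>
  for V W \<mu> :: "real ^ 'd::finite \<Rightarrow> real" and \<sigma> :: real +
  fixes \<delta> :: real and m :: nat and \<Lambda> :: "nat \<Rightarrow> complex" and \<psi> \<alpha> :: "nat \<Rightarrow> real ^ 'd \<Rightarrow> complex"
    and E :: "'d l2 set" and ev :: "'d l2 \<Rightarrow> real"
  assumes delta: "0 < \<delta>"
    and pairs: "unstable_eigenpairs (MV_graph0 \<sigma> V W \<mu>) \<delta> m \<Lambda> \<psi>"
    and shapes: "\<And>j. j < m \<Longrightarrow> is_div_grad \<mu> (\<alpha> j) (\<psi> j)"
    and basis: "hilbert_basis X0 b c\<^sub>0 E (\<lambda>x. x)"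
    and G_E: "\<And>e. e \<in> E \<Longrightarrow> G e = ev e *\<^sub>R e" and ev_pos: "\<And>e. e \<in> E \<Longrightarrow> 0 < ev e"
    and ev_finite: "\<And>k. 0 < k \<Longrightarrow> finite {e \<in> E. k \<le> ev e}"
begin

sublocale basis: hilbert_basis X0 b c\<^sub>0 E "\<lambda>x. x" by (rule basis)

text \<open>The eigenvalue of \<open>L\<close> at \<open>e\<close>, as \<open>- G\<close> is the
  inverse of \<open>L\<close>. Hence \<open>lam e \<ge> - \<delta>\<close> amounts to
  \<open>ev e \<ge> 1 / \<delta>\<close>, the condition in \<open>Eu\<close>.\<close>

definition lam :: "'d l2 \<Rightarrow> real" where "lam e = - 1 / ev e"

definition Eu :: "'d l2 set" where "Eu = {e \<in> E. 1 / \<delta> \<le> ev e}"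

lemma Eu: "finite Eu" "Eu \<subseteq> E"
  using ev_finite[of "1 / \<delta>"] delta by (auto simp: Eu_def)

lemma lam_Eu: "e \<in> E \<Longrightarrow> e \<in> Eu \<longleftrightarrow> - \<delta> \<le> lam e"
  using ev_pos[of e] delta by (simp add: Eu_def lam_def field_simps)

lemma lam_neg: "e \<in> E \<Longrightarrow> lam e < 0"
  using ev_pos[of e] by (simp add: lam_def)

lemma E_mem: "e \<in> E \<Longrightarrow> e \<in> X0"
  by (rule basis.e_mem)

definition mode :: "'d l2 \<Rightarrow> real ^ 'd \<Rightarrow> complex" where "mode e = cpx e 0"

lemma mode_X0: "e \<in> E \<Longrightarrow> mode e \<in> X0_space \<mu>"
  unfolding mode_def using E_mem X0_subspace by (intro cpx_X0) (auto simp: subspace_0)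

lemma mode_parts [simp]: "reL (mode e) = e" "imL (mode e) = 0" "Lp 2 (mode e)"
  by (auto simp: mode_def cpx_Lp2)

lemma X0_space_scale: "f \<in> X0_space \<mu> \<Longrightarrow> (\<lambda>x. c * f x) \<in> X0_space \<mu>"
  unfolding X0_space_iff by (auto simp: L2_scale intro: form.M_mem)

lemma mode_graph:
  assumes e: "e \<in> E" shows "(mode e, \<lambda>x. of_real (lam e) * mode e x) \<in> MV_graph0 \<sigma> V W \<mu>"
proof -
  have "lam e * ev e = - 1" using ev_pos[OF e] by (simp add: lam_def)
  then have "G (lam e *\<^sub>R e) = - e" using op.G_scale[OF E_mem[OF e], of "lam e"] G_E[OF e] by simp
  then show ?thesis unfolding MV_graph0_iff
    using mode_X0[OF e] X0_space_scale[OF mode_X0[OF e], of "of_real (lam e)"] by (simp add: L2_scale op.G_zero)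
qed

lemma psi_X0: "j < m \<Longrightarrow> \<psi> j \<in> X0_space \<mu>"
  using pairs unfolding unstable_eigenpairs_def eigenspace_def by (auto simp: MV_graph0_iff)

lemma mode_real: "AE x in torus. Im (mode e x) = 0"
  using rp_cl[OF Lp2_const[of 0]] by (simp add: mode_def cpx_def cl_simps)

text \<open>An unstable mode is an eigenfunction, so the last clause of
  \<open>unstable_eigenpairs\<close> expresses it by the \<open>\<psi>\<close> with the same
  eigenvalue. Real \<open>\<psi>\<close> allow real coefficients: the mode is real, so taking real
  parts of the expansion keeps it valid.\<close>

lemma coeffs_ex:
  assumes e: "e \<in> Eu"
  shows "\<exists>c. (AE x in torus. mode e x = (\<Sum>j<m. c j * \<psi> j x)) \<and>
    ((\<forall>j<m. AE x in torus. \<psi> j x \<in> \<real>) \<longrightarrow> (\<forall>j. c j \<in> \<real>))"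
proof -
  have eE: "e \<in> E" using e Eu by auto
  have "- \<delta> \<le> Re (of_real (lam e))" using lam_Eu[OF eE] e by simp
  moreover have "mode e \<in> eigenspace (MV_graph0 \<sigma> V W \<mu>) (of_real (lam e))"
    using mode_graph[OF eE] by (simp add: eigenspace_def)
  ultimately obtain c where c: "AE x in torus. mode e x = (\<Sum>j | j < m \<and> \<Lambda> j = of_real (lam e). c j * \<psi> j x)"
    using pairs unfolding unstable_eigenpairs_def by blast
  \<comment> \<open>Extension by zero to the indices with another eigenvalue, so that all expansions
    run over \<open>j < m\<close>.\<close>
  define c' where "c' j = (if \<Lambda> j = of_real (lam e) then c j else 0)" for j
  have "(\<Sum>j | j < m \<and> \<Lambda> j = of_real (lam e). c j * \<psi> j x) = (\<Sum>j<m. c' j * \<psi> j x)" for x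
    unfolding c'_def by (rule sum.mono_neutral_cong_left) auto
  then have c': "AE x in torus. mode e x = (\<Sum>j<m. c' j * \<psi> j x)" using c by simp
  show ?thesis
  proof (cases "\<forall>j<m. AE x in torus. \<psi> j x \<in> \<real>")
    case True
    then have "AE x in torus. \<forall>j\<in>{..<m}. \<psi> j x \<in> \<real>" by (intro AE_finite_allI) auto
    then have "AE x in torus. mode e x = (\<Sum>j<m. of_real (Re (c' j)) * \<psi> j x)"
      using c' mode_real[of e]
    proof eventually_elim
      case (elim x)
      have "Re (\<Sum>j<m. c' j * \<psi> j x) = (\<Sum>j<m. Re (c' j) * Re (\<psi> j x))"
        unfolding Re_sum using elim(1) by (intro sum.cong refl) (auto simp: complex_is_Real_iff)
      moreover have "Re (\<Sum>j<m. of_real (Re (c' j)) * \<psi> j x) = (\<Sum>j<m. Re (c' j) * Re (\<psi> j x))"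
        by simp
      moreover have "Im (\<Sum>j<m. of_real (Re (c' j)) * \<psi> j x) = 0"
        unfolding Im_sum using elim(1) by (intro sum.neutral) (auto simp: complex_is_Real_iff)
      ultimately show ?case using elim(2,3) by (simp add: complex_eq_iff)
    qed
    then show ?thesis by (intro exI[of _ "\<lambda>j. of_real (Re (c' j))"]) simp
  next
    case False
    then show ?thesis using c' by blast
  qed
qed

definition coef :: "'d l2 \<Rightarrow> nat \<Rightarrow> complex" where
  "coef e = (SOME c. (AE x in torus. mode e x = (\<Sum>j<m. c j * \<psi> j x)) \<and>
    ((\<forall>j<m. AE x in torus. \<psi> j x \<in> \<real>) \<longrightarrow> (\<forall>j. c j \<in> \<real>)))"

lemma coef:
  assumes "e \<in> Eu"
  shows "AE x in torus. mode e x = (\<Sum>j<m. coef e j * \<psi> j x)"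
    "(\<forall>j<m. AE x in torus. \<psi> j x \<in> \<real>) \<Longrightarrow> coef e j \<in> \<real>"
  using someI_ex[OF coeffs_ex[OF assms]] unfolding coef_def[symmetric] by blast+

abbreviation B :: "(nat \<Rightarrow> complex) \<Rightarrow> real ^ 'd \<Rightarrow> complex" where "B \<equiv> control_op \<mu> m \<alpha>"

lemma div_grad_psi:
  assumes j: "j < m" shows "Lp 2 (div_grad \<mu> (\<alpha> j))" "AE x in torus. div_grad \<mu> (\<alpha> j) x = \<psi> j x"
proof -
  have d: "is_div_grad \<mu> (\<alpha> j) (div_grad \<mu> (\<alpha> j))"
    unfolding div_grad_def using someI[of "is_div_grad \<mu> (\<alpha> j)", OF shapes[OF j]] .
  have a: "AE x in torus. \<psi> j x = div_grad \<mu> (\<alpha> j) x"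
    using shapes[OF j] d pconts(1) by (rule is_div_grad_unique)
  then show "AE x in torus. div_grad \<mu> (\<alpha> j) x = \<psi> j x" by eventually_elim simp
  show "Lp 2 (div_grad \<mu> (\<alpha> j))"
    using X0_space_Lp2[OF psi_X0[OF j]] _ a by (rule Lp2_cong_AE) (use d in \<open>simp add: is_div_grad_def\<close>)
qed

lemma B_Lp2: "Lp 2 (B u)"
  using L2_sum[of "{..<m}" "\<lambda>j. div_grad \<mu> (\<alpha> j)" u] div_grad_psi(1) unfolding control_op_def[abs_def] by simp

lemma B_AE: "AE x in torus. B u x = (\<Sum>j<m. u j * \<psi> j x)"
proof -
  have "AE x in torus. \<forall>j\<in>{..<m}. div_grad \<mu> (\<alpha> j) x = \<psi> j x"
    by (intro AE_finite_allI) (auto intro: div_grad_psi)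
  then show ?thesis unfolding control_op_def by eventually_elim (auto intro: sum.cong)
qed

section \<open>The feedback\<close>

text \<open>The component of \<open>y\<close> in each unstable mode is multiplied by
  \<open>- (\<delta> + 1)\<close>, and \<open>coef\<close> rewrites the modes in terms of the
  \<open>\<psi>\<close>, the directions in which the control acts.\<close>

definition F :: "(real ^ 'd \<Rightarrow> complex) \<Rightarrow> nat \<Rightarrow> complex" where
  "F y j = (if j < m then \<Sum>e\<in>Eu. of_real (- (\<delta> + 1)) * Complex (b (reL y) e) (b (imL y) e) * coef e j else 0)"

text \<open>The \<open>b\<close>-orthogonal projection onto the unstable modes.\<close>

definition P :: "'d l2 \<Rightarrow> 'd l2" where "P x = (\<Sum>e\<in>Eu. b x e *\<^sub>R e)"

lemma P_mem: "P x \<in> X0"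
  unfolding P_def using Eu by (intro form.sum_mem form.M_mem E_mem) auto

lemma b_P: "e \<in> E \<Longrightarrow> b (P x) e = (if e \<in> Eu then b x e else 0)"
  unfolding P_def using Eu by (intro basis.b_sum_e)

lemma BF_parts: "reL (B (F y)) = - ((\<delta> + 1) *\<^sub>R P (reL y))" "imL (B (F y)) = - ((\<delta> + 1) *\<^sub>R P (imL y))"
proof -
  define w where "w e = of_real (- (\<delta> + 1)) * Complex (b (reL y) e) (b (imL y) e)" for e
  define h where "h x = (\<Sum>e\<in>Eu. w e * mode e x)" for x
  have h: "Lp 2 h" "reL h = (- (\<delta> + 1)) *\<^sub>R P (reL y)" "imL h = (- (\<delta> + 1)) *\<^sub>R P (imL y)"
    using L2_sum[OF Eu(1), of mode w] unfolding h_def[abs_def] P_def scaleR_sum_right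
    by (simp_all add: w_def)
  have "AE x in torus. \<forall>e\<in>Eu. mode e x = (\<Sum>j<m. coef e j * \<psi> j x)"
    using Eu(1) by (intro AE_finite_allI coef)
  then have "AE x in torus. B (F y) x = h x" using B_AE[of "F y"]
  proof eventually_elim
    case (elim x)
    have "B (F y) x = (\<Sum>j<m. (\<Sum>e\<in>Eu. w e * coef e j) * \<psi> j x)"
      unfolding elim(2) by (intro sum.cong refl) (simp add: F_def w_def)
    also have "\<dots> = (\<Sum>e\<in>Eu. \<Sum>j<m. w e * coef e j * \<psi> j x)"
      unfolding sum_distrib_right by (rule sum.swap)
    also have "\<dots> = h x" unfolding h_def using elim(1)
      by (intro sum.cong refl) (simp add: sum_distrib_left mult.assoc)
    finally show ?case .
  qed
  then have "reL (B (F y)) = reL h \<and> imL (B (F y)) = imL h"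
    by (subst L2_eq_iff) (auto intro: B_Lp2 h)
  then show "reL (B (F y)) = - ((\<delta> + 1) *\<^sub>R P (reL y))" "imL (B (F y)) = - ((\<delta> + 1) *\<^sub>R P (imL y))"
    using h by (simp_all only: scaleR_minus_left)
qed

lemma b_e_le:
  assumes "x \<in> X0" "e \<in> E" shows "\<bar>b x e\<bar> \<le> sqrt (b x x)"
proof -
  have "(b x e)\<^sup>2 \<le> b x x * b e e" using assms(1) E_mem[OF assms(2)] by (rule form.cauchy_schwarz)
  then show ?thesis using basis.ortho[OF assms(2,2)] by (intro real_le_rsqrt) simp
qed

lemma feedback_F: "feedback (X0_space \<mu>) N m F"
  unfolding feedback_def
proof (intro conjI ballI allI)
  show "F f \<in> Cm m" for f by (simp add: F_def Cm_def)
  fix f g :: "real ^ 'd \<Rightarrow> complex" and p q j assume f: "f \<in> X0_space \<mu>" and g: "g \<in> X0_space \<mu>"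
  have "Complex (b (reL (\<lambda>x. p * f x + q * g x)) e) (b (imL (\<lambda>x. p * f x + q * g x)) e) =
    p * Complex (b (reL f) e) (b (imL f) e) + q * Complex (b (reL g) e) (b (imL g) e)" for e
    unfolding L2_lincomb(2,3)[OF f[THEN X0_space_Lp2] g[THEN X0_space_Lp2]]
    by (simp add: complex_eq_iff form.bsimps)
  then show "F (\<lambda>x. p * f x + q * g x) j = p * F f j + q * F g j"
    unfolding F_def by (simp add: sum_distrib_left sum.distrib[symmetric] algebra_simps)
next
  obtain A B' where AB: "0 < A" "0 < B'" "\<And>f. f \<in> X0_space \<mu> \<Longrightarrow> A * (N f)\<^sup>2 \<le> b (reL f) (reL f) + b (imL f) (imL f)"
   "\<And>f. f \<in> X0_space \<mu> \<Longrightarrow> b (reL f) (reL f) + b (imL f) (imL f) \<le> B' * (N f)\<^sup>2" using N_equiv by blast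
  \<comment> \<open>Each of the real and imaginary parts of a coefficient is at most
    \<open>sqrt B' * N f\<close>, which gives the factor 2; the Euclidean norm is bounded by the sum
    of the moduli.\<close>
  define C where "C = (\<Sum>j<m. \<Sum>e\<in>Eu. (\<delta> + 1) * (2 * sqrt B') * cmod (coef e j))"
  show "\<exists>C. \<forall>f\<in>X0_space \<mu>. ip_norm (Cm_ip m) (F f) \<le> C * N f"
  proof (intro exI ballI)
    fix f assume f: "f \<in> X0_space \<mu>"
    have X: "reL f \<in> X0" "imL f \<in> X0" using f by (auto simp: X0_space_iff)
    have N0: "0 \<le> N f" using N_sq f by (simp add: X0_space_iff)
    have bb: "sqrt (b (reL f) (reL f)) \<le> sqrt B' * N f" "sqrt (b (imL f) (imL f)) \<le> sqrt B' * N f"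
      using AB(4)[OF f] form.pos[OF X(1)] form.pos[OF X(2)] N0 AB(2)
      by (auto intro!: real_le_lsqrt simp: power_mult_distrib)
    have w: "cmod (Complex (b (reL f) e) (b (imL f) e)) \<le> 2 * sqrt B' * N f" if e: "e \<in> Eu" for e
    proof -
      have "e \<in> E" using e Eu by auto
      then have "\<bar>b (reL f) e\<bar> \<le> sqrt B' * N f" "\<bar>b (imL f) e\<bar> \<le> sqrt B' * N f"
        using b_e_le[OF X(1)] b_e_le[OF X(2)] bb by (meson order_trans)+
      then show ?thesis using cmod_le[of "Complex (b (reL f) e) (b (imL f) e)"] by simp
    qed
    have "cmod (F f j) \<le> (\<Sum>e\<in>Eu. (\<delta> + 1) * (2 * sqrt B') * cmod (coef e j)) * N f" if j: "j < m" for j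
    proof -
      have "cmod (F f j) \<le> (\<Sum>e\<in>Eu. cmod (of_real (- (\<delta> + 1)) * Complex (b (reL f) e) (b (imL f) e) * coef e j))"
        unfolding F_def using j by (simp add: sum_norm_le)
      also have "\<dots> \<le> (\<Sum>e\<in>Eu. (\<delta> + 1) * (2 * sqrt B') * cmod (coef e j) * N f)"
      proof (rule sum_mono)
        fix e assume e: "e \<in> Eu"
        have "cmod (of_real (- (\<delta> + 1)) * Complex (b (reL f) e) (b (imL f) e) * coef e j) =
          (\<delta> + 1) * cmod (Complex (b (reL f) e) (b (imL f) e)) * cmod (coef e j)"
          unfolding norm_mult norm_of_real using delta by simp
        also have "\<dots> \<le> (\<delta> + 1) * (2 * sqrt B' * N f) * cmod (coef e j)"
          using w[OF e] delta by (intro mult_right_mono mult_left_mono) auto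
        also have "\<dots> = (\<delta> + 1) * (2 * sqrt B') * cmod (coef e j) * N f"
        by (simp only: mult.assoc mult.commute mult.left_commute)
      finally show "cmod (of_real (- (\<delta> + 1)) * Complex (b (reL f) e) (b (imL f) e) * coef e j) \<le>
           (\<delta> + 1) * (2 * sqrt B') * cmod (coef e j) * N f" .
      qed
      finally show ?thesis by (simp add: sum_distrib_right)
    qed
    then have s: "(\<Sum>j<m. cmod (F f j)) \<le> C * N f"
      unfolding C_def sum_distrib_right by (intro sum_mono) (auto simp: sum_distrib_right)
    have "ip_norm (Cm_ip m) (F f) = L2_set (\<lambda>j. cmod (F f j)) {..<m}"
      unfolding ip_norm_def Cm_ip_def L2_set_def by (simp add: complex_mult_cnj cmod_power2)
    also have "\<dots> \<le> (\<Sum>j<m. cmod (F f j))" by (rule L2_set_le_sum) simp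
    finally show "ip_norm (Cm_ip m) (F f) \<le> C * N f" using s by linarith
  qed
qed

section \<open>The closed loop\<close>

text \<open>The eigenvalues of the closed loop: on unstable modes
  \<open>lam e + \<delta> - (\<delta> + 1)\<close>, on stable ones just the shift by
  \<open>\<delta>\<close>.\<close>

definition theta :: "'d l2 \<Rightarrow> real" where "theta e = (if e \<in> Eu then lam e - 1 else lam e + \<delta>)"

text \<open>Eigenvalues below \<open>- 2 \<delta>\<close> leave a gap \<open>\<delta>\<close>; only finitely many stable ones remain.\<close>

definition gap :: real where
  "gap = Min (insert 1 (insert \<delta> ((\<lambda>e. - (lam e + \<delta>)) ` {e \<in> E. 1 / (2 * \<delta>) \<le> ev e \<and> e \<notin> Eu})))"

lemma gap_finite: "finite (insert 1 (insert \<delta> ((\<lambda>e. - (lam e + \<delta>)) ` {e \<in> E. 1 / (2 * \<delta>) \<le> ev e \<and> e \<notin> Eu})))"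
proof -
  have "finite {e \<in> E. 1 / (2 * \<delta>) \<le> ev e}" using delta by (intro ev_finite) simp
  then have "finite {e \<in> E. 1 / (2 * \<delta>) \<le> ev e \<and> e \<notin> Eu}" by (rule rev_finite_subset) auto
  then show ?thesis by simp
qed

lemma gap_pos: "0 < gap"
  unfolding gap_def using gap_finite delta lam_Eu by (subst Min_gr_iff) (auto simp: not_le)

lemma theta_le: assumes e: "e \<in> E" shows "theta e \<le> - gap"
proof (cases "e \<in> Eu")
  case True
  have "gap \<le> 1" unfolding gap_def by (rule Min_le[OF gap_finite]) simp
  then show ?thesis using True lam_neg[OF e] by (simp add: theta_def)
next
  case False
  show ?thesis
  proof (cases "1 / (2 * \<delta>) \<le> ev e")
    case True
    then have "gap \<le> - (lam e + \<delta>)" unfolding gap_def using e False by (intro Min_le[OF gap_finite]) auto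
    then show ?thesis using False by (simp add: theta_def)
  next
    case small: False
    have "gap \<le> \<delta>" unfolding gap_def by (rule Min_le[OF gap_finite]) simp
    moreover have "lam e \<le> - (2 * \<delta>)" using small ev_pos[OF e] delta by (simp add: lam_def field_simps)
    ultimately show ?thesis using False by (simp add: theta_def)
  qed
qed

sublocale sg: diagonal_semigroup X0 b c\<^sub>0 E "\<lambda>x. x" theta gap
  by unfold_locales (auto intro: gap_pos theta_le)

text \<open>With \<open>q = g - \<delta> x + (\<delta> + 1) P x\<close> the right side says
  \<open>L x = q\<close>, that is, \<open>g = L x + \<delta> x - (\<delta> + 1) P x\<close>. Both
  sides are compared coefficientwise through \<open>ev e * lam e = - 1\<close>.\<close>

lemma generator_mv_rel:
  assumes x: "x \<in> X0" and g: "g \<in> X0"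
  shows "(\<forall>e\<in>E. b g e = theta e * b x e) \<longleftrightarrow> x = - G (g - \<delta> *\<^sub>R x + (\<delta> + 1) *\<^sub>R P x)"
proof -
  define q where "q = g - \<delta> *\<^sub>R x + (\<delta> + 1) *\<^sub>R P x"
  have q: "q \<in> X0" unfolding q_def using x g P_mem by (intro form.M_mem)
  have Gq: "- G q \<in> X0" using op.G_mem[OF q] by (rule form.M_mem)
  have bG: "b (- G q) e = - (ev e * b q e)" if "e \<in> E" for e
    using op.G_sym[OF q E_mem[OF that]] G_E[OF that] by (simp add: form.bsimps)
  have bq: "b q e = b g e - theta e * b x e + lam e * b x e" if "e \<in> E" for e
    unfolding q_def using b_P[OF that, of x] by (simp add: form.bsimps theta_def algebra_simps)
  have l: "ev e * lam e = - 1" if "e \<in> E" for e using ev_pos[OF that] by (simp add: lam_def)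
  show ?thesis unfolding q_def[symmetric]
  proof
    assume a: "\<forall>e\<in>E. b g e = theta e * b x e"
    show "x = - G q"
    proof (rule basis.eqI[OF x Gq])
      fix e assume e: "e \<in> E"
      have "b (- G q) e = - (ev e * lam e) * b x e" using bG[OF e] bq[OF e] a e by simp
      then show "b x e = b (- G q) e" using l[OF e] by simp
    qed
  next
    assume a: "x = - G q"
    show "\<forall>e\<in>E. b g e = theta e * b x e"
    proof
      fix e assume e: "e \<in> E"
      have "b x e = - (ev e * b q e)" using bG[OF e] a by simp
      then have "lam e * b x e = - (ev e * lam e) * b q e" by simp
      then have "lam e * b x e = b q e" using l[OF e] by simp
      then show "b g e = theta e * b x e" using bq[OF e] by simp
    qed
  qed
qed

definition T :: "real \<Rightarrow> (real ^ 'd \<Rightarrow> complex) \<Rightarrow> real ^ 'd \<Rightarrow> complex" where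
  "T t f = cpx (sg.T t (reL f)) (sg.T t (imL f))"

lemma T_parts [simp]: "reL (T t f) = sg.T t (reL f)" "imL (T t f) = sg.T t (imL f)" "Lp 2 (T t f)"
  by (simp_all add: T_def cpx_Lp2)

lemma X0_spaceD: "f \<in> X0_space \<mu> \<Longrightarrow> Lp 2 f" "f \<in> X0_space \<mu> \<Longrightarrow> reL f \<in> X0" "f \<in> X0_space \<mu> \<Longrightarrow> imL f \<in> X0"
  by (auto simp: X0_space_iff)

lemma T_X0: "f \<in> X0_space \<mu> \<Longrightarrow> 0 \<le> t \<Longrightarrow> T t f \<in> X0_space \<mu>"
  by (simp add: X0_space_iff sg.T_mem)

lemma X0_space_lincomb: "f \<in> X0_space \<mu> \<Longrightarrow> g \<in> X0_space \<mu> \<Longrightarrow> (\<lambda>x. p * f x + q * g x) \<in> X0_space \<mu>"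
  unfolding X0_space_iff by (auto simp: L2_lincomb intro!: form.M_mem)

lemma X0_space_diff: "f \<in> X0_space \<mu> \<Longrightarrow> g \<in> X0_space \<mu> \<Longrightarrow> (\<lambda>x. f x - g x) \<in> X0_space \<mu>"
  using X0_space_lincomb[of f g 1 "-1"] by simp

lemma N_diff_zero:
  assumes "f \<in> X0_space \<mu>" "g \<in> X0_space \<mu>" "reL f = reL g" "imL f = imL g"
  shows "N (\<lambda>x. f x - g x) = 0"
  using N_zero_iff[OF X0_space_diff[OF assms(1,2)]] L2_diff[OF assms(1,2)[THEN X0_spaceD(1)]] assms(3,4) by simp

lemma sgT_comb:
  assumes "x \<in> X0" "y \<in> X0" "0 \<le> t"
  shows "sg.T t (x + y) = sg.T t x + sg.T t y" "sg.T t (x - y) = sg.T t x - sg.T t y" "sg.T t (r *\<^sub>R x) = r *\<^sub>R sg.T t x"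
  using sg.T_linear[OF assms, of 1 1] sg.T_linear[OF assms, of 1 "-1"] sg.T_linear[OF assms, of r 0] by simp_all

lemma T_linear:
  assumes f: "f \<in> X0_space \<mu>" and g: "g \<in> X0_space \<mu>" and t: "0 \<le> t"
  shows "N (\<lambda>x. T t (\<lambda>x. p * f x + q * g x) x - (p * T t f x + q * T t g x)) = 0"
proof (rule N_diff_zero)
  note fg = X0_spaceD[OF f] X0_spaceD[OF g]
  show "T t (\<lambda>x. p * f x + q * g x) \<in> X0_space \<mu>" "(\<lambda>x. p * T t f x + q * T t g x) \<in> X0_space \<mu>"
    using f g t by (auto intro: T_X0 X0_space_lincomb)
  show "reL (T t (\<lambda>x. p * f x + q * g x)) = reL (\<lambda>x. p * T t f x + q * T t g x)"
    "imL (T t (\<lambda>x. p * f x + q * g x)) = imL (\<lambda>x. p * T t f x + q * T t g x)"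
    using fg t by (simp_all add: L2_lincomb sgT_comb form.M_mem)
qed

lemma T_decay: "\<exists>M. \<forall>t\<ge>0. \<forall>f\<in>X0_space \<mu>. N (T t f) \<le> M * exp (- gap * t) * N f"
proof -
  obtain A B' where AB: "0 < A" "0 < B'" "\<And>f. f \<in> X0_space \<mu> \<Longrightarrow> A * (N f)\<^sup>2 \<le> b (reL f) (reL f) + b (imL f) (imL f)"
   "\<And>f. f \<in> X0_space \<mu> \<Longrightarrow> b (reL f) (reL f) + b (imL f) (imL f) \<le> B' * (N f)\<^sup>2" using N_equiv by blast
  show ?thesis
  proof (intro exI allI impI ballI)
    fix t :: real and f assume t: "0 \<le> t" and f: "f \<in> X0_space \<mu>"
    let ?e = "exp (- gap * t)"
    have "A * (N (T t f))\<^sup>2 \<le> b (sg.T t (reL f)) (sg.T t (reL f)) + b (sg.T t (imL f)) (sg.T t (imL f))"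
      using AB(3)[OF T_X0[OF f t]] by simp
    also have "\<dots> \<le> ?e\<^sup>2 * b (reL f) (reL f) + ?e\<^sup>2 * b (imL f) (imL f)"
      using X0_spaceD[OF f] t by (intro add_mono sg.T_decay)
    also have "\<dots> \<le> ?e\<^sup>2 * (B' * (N f)\<^sup>2)"
      unfolding distrib_left[symmetric] using AB(4)[OF f] by (intro mult_left_mono) auto
    finally have "(N (T t f))\<^sup>2 \<le> B' / A * (?e\<^sup>2 * (N f)\<^sup>2)" using AB(1) by (simp add: field_simps)
    also have "\<dots> = (sqrt (B' / A) * ?e * N f)\<^sup>2" using AB(1,2) by (simp add: power_mult_distrib)
    finally show "N (T t f) \<le> sqrt (B' / A) * ?e * N f"
      by (rule power2_le_imp_le) (use AB N_sq(2)[OF X0_spaceD(1)[OF f]] in simp)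
  qed
qed

lemma T_C0: "C0_semigroup (X0_space \<mu>) N T"
  unfolding C0_semigroup_def
proof (intro conjI allI impI ballI)
  show "T t f \<in> X0_space \<mu>" if "0 \<le> t" "f \<in> X0_space \<mu>" for t f using that by (intro T_X0)
  show "N (\<lambda>x. T t (\<lambda>x. p * f x + q * g x) x - (p * T t f x + q * T t g x)) = 0"
    if "0 \<le> t" "f \<in> X0_space \<mu>" "g \<in> X0_space \<mu>" for t f g p q using that by (intro T_linear)
  show "\<exists>C. \<forall>f\<in>X0_space \<mu>. N (T t f) \<le> C * N f" if "0 \<le> t" for t using T_decay that by blast
  show "N (\<lambda>x. T 0 f x - f x) = 0" if f: "f \<in> X0_space \<mu>" for f
    using f T_X0[OF f, of 0] by (intro N_diff_zero) (auto simp: sg.T_zero X0_spaceD)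
  show "N (\<lambda>x. T (s + t) f x - T s (T t f) x) = 0" if "0 \<le> s" "0 \<le> t" "f \<in> X0_space \<mu>" for s t f
    using that by (intro N_diff_zero T_X0) (auto simp: sg.T_add X0_spaceD)
  show "((\<lambda>t. N (\<lambda>x. T t f x - f x)) \<longlongrightarrow> 0) (at_right 0)" if f: "f \<in> X0_space \<mu>" for f
  proof -
    have "\<forall>\<^sub>F t in at_right 0. (\<lambda>x. T t f x - f x) \<in> X0_space \<mu>"
      using eventually_at_right_less[of 0] by eventually_elim (intro X0_space_diff T_X0 f less_imp_le)
    moreover have "reL (\<lambda>x. T t f x - f x) = sg.T t (reL f) - reL f" "imL (\<lambda>x. T t f x - f x) = sg.T t (imL f) - imL f" for t
      using L2_diff[OF T_parts(3) X0_spaceD(1)[OF f], of t f] by simp_all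
    ultimately show ?thesis using sg.T_cont X0_spaceD[OF f] by (subst N_tendsto_iff) auto
  qed
qed

lemma T_limit_iff:
  assumes f: "f \<in> X0_space \<mu>" and g: "g \<in> X0_space \<mu>"
  shows "((\<lambda>t. N (\<lambda>x. (T t f x - f x) / of_real t - g x)) \<longlongrightarrow> 0) (at_right 0) \<longleftrightarrow>
    reL f = - G (reL g - \<delta> *\<^sub>R reL f + (\<delta> + 1) *\<^sub>R P (reL f)) \<and> imL f = - G (imL g - \<delta> *\<^sub>R imL f + (\<delta> + 1) *\<^sub>R P (imL f))"
proof -
  define h where "h t x = (T t f x - f x) / of_real t - g x" for t x
  have h: "h t = (\<lambda>x. of_real (1 / t) * (T t f x - f x) + (-1) * g x)" for t by (simp add: h_def fun_eq_iff)
  have D: "Lp 2 (\<lambda>x. T t f x - f x)" "reL (\<lambda>x. T t f x - f x) = sg.T t (reL f) - reL f"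
    "imL (\<lambda>x. T t f x - f x) = sg.T t (imL f) - imL f" for t
    using L2_diff[OF T_parts(3) X0_spaceD(1)[OF f], of t f] by simp_all
  have ev: "\<forall>\<^sub>F t in at_right 0. h t \<in> X0_space \<mu>"
    using eventually_at_right_less[of 0] unfolding h
    by eventually_elim (intro X0_space_lincomb X0_space_diff T_X0 f g, simp)
  have parts: "reL (h t) = (1 / t) *\<^sub>R (sg.T t (reL f) - reL f) - reL g" "imL (h t) = (1 / t) *\<^sub>R (sg.T t (imL f) - imL f) - imL g" for t
    unfolding h L2_lincomb(2,3)[OF D(1) X0_spaceD(1)[OF g]] D by simp_all
  have "((\<lambda>t. N (h t)) \<longlongrightarrow> 0) (at_right 0) \<longleftrightarrow>
    ((\<lambda>t. reL (h t)) \<longlongrightarrow> 0) (at_right 0) \<and> ((\<lambda>t. imL (h t)) \<longlongrightarrow> 0) (at_right 0)"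
    using ev by (rule N_tendsto_iff)
  moreover have "(\<lambda>t. N (\<lambda>x. (T t f x - f x) / of_real t - g x)) = (\<lambda>t. N (h t))" by (simp add: h_def[abs_def])
  ultimately show ?thesis unfolding parts
    using sg.generator_iff generator_mv_rel X0_spaceD[OF f] X0_spaceD[OF g] by simp
qed

lemma T_generator: "is_generator (X0_space \<mu>) N T (closed_loop (MV_graph0 \<sigma> V W \<mu>) B \<delta> F)"
  unfolding is_generator_def
proof (intro set_eqI iffI)
  fix z assume "z \<in> closed_loop (MV_graph0 \<sigma> V W \<mu>) B \<delta> F"
  then obtain f g where z: "z = (f, \<lambda>x. g x + of_real \<delta> * f x + B (F f) x)" and fg: "(f, g) \<in> MV_graph0 \<sigma> V W \<mu>"
    unfolding closed_loop_def by blast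
  have f: "f \<in> X0_space \<mu>" and g: "g \<in> X0_space \<mu>" and rel: "reL f = - G (reL g)" "imL f = - G (imL g)"
    using fg by (auto simp: MV_graph0_iff)
  define k where "k x = g x + of_real \<delta> * f x + B (F f) x" for x
  have gf: "Lp 2 (\<lambda>x. g x + of_real \<delta> * f x)" "reL (\<lambda>x. g x + of_real \<delta> * f x) = reL g + \<delta> *\<^sub>R reL f"
     "imL (\<lambda>x. g x + of_real \<delta> * f x) = imL g + \<delta> *\<^sub>R imL f"
    using L2_lincomb[OF X0_spaceD(1)[OF g] X0_spaceD(1)[OF f], of 1 "of_real \<delta>"] by simp_all
  have k: "Lp 2 k" "reL k = reL g + \<delta> *\<^sub>R reL f - (\<delta> + 1) *\<^sub>R P (reL f)" "imL k = imL g + \<delta> *\<^sub>R imL f - (\<delta> + 1) *\<^sub>R P (imL f)"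
    unfolding k_def[abs_def] using L2_add[OF gf(1) B_Lp2] by (simp_all add: gf BF_parts)
  have kX: "k \<in> X0_space \<mu>" unfolding X0_space_iff k(2,3)
    using k(1) X0_spaceD[OF f] X0_spaceD[OF g] P_mem by (auto intro!: form.M_mem)
  have "((\<lambda>t. N (\<lambda>x. (T t f x - f x) / of_real t - k x)) \<longlongrightarrow> 0) (at_right 0)"
    unfolding T_limit_iff[OF f kX] k using rel by simp
  then show "z \<in> {(f, g). f \<in> X0_space \<mu> \<and> g \<in> X0_space \<mu> \<and>
      ((\<lambda>t. N (\<lambda>x. (T t f x - f x) / of_real t - g x)) \<longlongrightarrow> 0) (at_right 0)}"
    using f kX unfolding z k_def[abs_def] by blast
next
  fix z assume "z \<in> {(f, g). f \<in> X0_space \<mu> \<and> g \<in> X0_space \<mu> \<and>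
      ((\<lambda>t. N (\<lambda>x. (T t f x - f x) / of_real t - g x)) \<longlongrightarrow> 0) (at_right 0)}"
  then obtain f k where z: "z = (f, k)" and f: "f \<in> X0_space \<mu>" and kX: "k \<in> X0_space \<mu>" and
    lim: "((\<lambda>t. N (\<lambda>x. (T t f x - f x) / of_real t - k x)) \<longlongrightarrow> 0) (at_right 0)" by blast
  \<comment> \<open>The part of the closed loop due to \<open>L\<close>, obtained by subtracting the
    others pointwise: graphs consist of functions, not classes, so \<open>k\<close> must be
    recovered exactly.\<close>
  define g where "g x = k x - of_real \<delta> * f x - B (F f) x" for x
  have kf: "Lp 2 (\<lambda>x. k x - of_real \<delta> * f x)" "reL (\<lambda>x. k x - of_real \<delta> * f x) = reL k - \<delta> *\<^sub>R reL f"
     "imL (\<lambda>x. k x - of_real \<delta> * f x) = imL k - \<delta> *\<^sub>R imL f"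
    using L2_lincomb[OF X0_spaceD(1)[OF kX] X0_spaceD(1)[OF f], of 1 "- of_real \<delta>"] by simp_all
  have g: "Lp 2 g" "reL g = reL k - \<delta> *\<^sub>R reL f + (\<delta> + 1) *\<^sub>R P (reL f)" "imL g = imL k - \<delta> *\<^sub>R imL f + (\<delta> + 1) *\<^sub>R P (imL f)"
    unfolding g_def[abs_def] using L2_diff[OF kf(1) B_Lp2] by (simp_all add: kf BF_parts)
  have gX: "g \<in> X0_space \<mu>" unfolding X0_space_iff g(2,3)
    using g(1) X0_spaceD[OF f] X0_spaceD[OF kX] P_mem by (auto intro!: form.M_mem)
  have "(f, g) \<in> MV_graph0 \<sigma> V W \<mu>" unfolding MV_graph0_iff g(2,3)
    using f gX lim unfolding T_limit_iff[OF f kX] by blast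
  moreover have "k = (\<lambda>x. g x + of_real \<delta> * f x + B (F f) x)" by (simp add: g_def fun_eq_iff)
  ultimately show "z \<in> closed_loop (MV_graph0 \<sigma> V W \<mu>) B \<delta> F" unfolding z closed_loop_def by blast
qed

lemma stabilizing_F: "stabilizing_feedback (X0_space \<mu>) N m (MV_graph0 \<sigma> V W \<mu>) B \<delta> F"
proof -
  have "exp_stable (X0_space \<mu>) N T" unfolding exp_stable_def using T_decay gap_pos by blast
  then show ?thesis unfolding stabilizing_feedback_def using feedback_F T_C0 T_generator by blast
qed

text \<open>Real shape functions have real \<open>\<psi>\<close> and so real \<open>coef\<close>; a
  real \<open>y\<close> has zero imaginary part as a class.\<close>

lemma F_real:
  assumes a: "\<forall>j<m. AE x in torus. \<alpha> j x \<in> \<real>" and y: "y \<in> X0_space \<mu>" "AE x in torus. y x \<in> \<real>"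
  shows "F y j \<in> \<real>"
proof -
  have "\<forall>j<m. AE x in torus. \<psi> j x \<in> \<real>" using is_div_grad_real[OF shapes pconts(1)] a by blast
  then have c: "coef e j \<in> \<real>" if "e \<in> Eu" for e using coef(2)[OF that] by blast
  have "AE x in torus. Im (y x) = 0" using y(2) by eventually_elim (simp add: complex_is_Real_iff)
  then have "imL y = cl (\<lambda>x. 0)" unfolding imL_def
    using X0_spaceD(1)[OF y(1)] by (intro cl_cong Lp2_const) (simp_all add: Lp2_complex_iff)
  then have "Complex (b (reL y) e) (b (imL y) e) \<in> \<real>" for e by (simp add: cl_simps form.bsimps complex_is_Real_iff)
  then show ?thesis unfolding F_def using c by (auto intro!: sum_in_Reals Reals_mult Reals_of_real)
qed

section \<open>The Hautus test\<close>

text \<open>The modes are total for \<open>b\<close>, while \<open>v\<close> is orthogonal to them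
  in the weighted product. The \<open>b\<close>-representative \<open>y\<close> of the functional
  \<open>\<langle>x / \<mu>, \<cdot>\<rangle>\<close> has zero coefficients, so it vanishes and with
  it the weighted norm of \<open>x\<close>.\<close>

lemma zero_of_modes:
  assumes v: "v \<in> X0_space \<mu>" and o: "\<And>e. e \<in> E \<Longrightarrow> X_ip \<mu> (mode e) v = 0"
  shows "reL v = 0" "imL v = 0"
proof -
  have z: "x = 0" if x: "x \<in> X0" and ox: "\<And>e. e \<in> E \<Longrightarrow> inner (mulop imu e) x = 0" for x
  proof -
    from form.riesz[OF bounded_linear_inner_right[of "mulop imu x"]]
    obtain y where y: "y \<in> X0" "\<And>w. w \<in> X0 \<Longrightarrow> b y w = inner (mulop imu x) w" by blast
    have "b y e = 0" if "e \<in> E" for e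
      unfolding y(2)[OF E_mem[OF that]] inner_mulop[OF pconts(2)] inner_commute[of x] by (rule ox[OF that, unfolded inner_mulop[OF pconts(2)]])
    then have "y = 0" using basis.total y(1) by blast
    then have "inner (mulop imu x) x = 0" using y(2)[OF x] by (simp add: form.bsimps)
    moreover obtain r where r: "0 < r" "\<And>x. r \<le> imu x" using bounds by blast
    ultimately have "r * (norm x)\<^sup>2 \<le> 0" using inner_mulop_ge[OF pconts(2) r(2), of x] by simp
    then show ?thesis using r(1) by (simp add: mult_le_0_iff)
  qed
  have L: "linear (mulop imu)" by (rule mulop_linear[OF pconts(2)])
  have "inner (mulop imu e) (reL v) = 0" "inner (mulop imu e) (imL v) = 0" if "e \<in> E" for e
    using X_ip_parts[OF mode_parts(3)[of e] X0_spaceD(1)[OF v]] o[OF that] by (simp_all add: linear_0[OF L])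
  then show "reL v = 0" "imL v = 0" using z X0_spaceD[OF v] by blast+
qed

lemma X0_zero_iff: "v \<in> X0_zero \<mu> \<longleftrightarrow> v \<in> X0_space \<mu> \<and> reL v = 0 \<and> imL v = 0"
proof -
  have 0: "Lp 2 (\<lambda>x :: real ^ 'd. 0 :: complex)" "reL (\<lambda>x. 0) = 0" "imL (\<lambda>x. 0) = 0"
    by (simp_all add: Lp2_complex_iff Lp2_const reL_def imL_def cl_simps)
  have "reL v = 0 \<and> imL v = 0 \<longleftrightarrow> (AE x in torus. v x = 0)" if "v \<in> X0_space \<mu>"
    using L2_eq_iff[OF X0_spaceD(1)[OF that] 0(1)] unfolding 0(2,3) .
  then show ?thesis unfolding X0_zero_def by auto
qed

lemma X_ip_zero:
  assumes "Lp 2 f" "Lp 2 g" "reL g = 0" "imL g = 0" shows "X_ip \<mu> f g = 0"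
  using X_ip_parts[OF assms(1,2)] assms(3,4) by (simp add: complex_eq_iff)

lemma hautus_test: "hautus (X0_space \<mu>) (X_ip \<mu>) (X0_zero \<mu>) m (MV_graph0 \<sigma> V W \<mu>) B \<delta>"
  unfolding hautus_def
proof (intro allI impI set_eqI iffI)
  fix z v assume z: "- \<delta> \<le> Re z"
  assume "v \<in> eigenspace (adjoint_graph (X0_space \<mu>) (X_ip \<mu>) (X0_space \<mu>) (X_ip \<mu>) (MV_graph0 \<sigma> V W \<mu>)) z \<inter>
    op_kernel (adjoint_graph (Cm m) (Cm_ip m) (X0_space \<mu>) (X_ip \<mu>) (control_graph m B))"
  then have v: "v \<in> X0_space \<mu>"
    and eig: "\<And>f k. (f, k) \<in> MV_graph0 \<sigma> V W \<mu> \<Longrightarrow> X_ip \<mu> k v = X_ip \<mu> f (\<lambda>x. z * v x)"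
    and ker: "\<And>u. u \<in> Cm m \<Longrightarrow> X_ip \<mu> (B u) v = Cm_ip m u (\<lambda>_. 0)"
    unfolding eigenspace_def op_kernel_def adjoint_graph_def control_graph_def by auto
  have "X_ip \<mu> (mode e) v = 0" if e: "e \<in> E" for e
  proof (cases "e \<in> Eu")
    case True
    \<comment> \<open>The control that produces the mode \<open>e\<close>, so that
      \<open>B\<^sup>* v = 0\<close> gives orthogonality to it.\<close>
    define u where "u j = (if j < m then coef e j else 0)" for j
    have "AE x in torus. B u x = mode e x"
      using B_AE[of u] coef(1)[OF True] by eventually_elim (simp add: u_def)
    then have "reL (B u) = reL (mode e) \<and> imL (B u) = imL (mode e)"
      by (subst L2_eq_iff) (auto intro: B_Lp2)
    then have "X_ip \<mu> (mode e) v = X_ip \<mu> (B u) v"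
      using X_ip_parts[OF mode_parts(3)[of e] X0_spaceD(1)[OF v]] X_ip_parts[OF B_Lp2[of u] X0_spaceD(1)[OF v]]
      by (simp add: complex_eq_iff)
    also have "\<dots> = 0" using ker[of u] by (simp add: Cm_def Cm_ip_def u_def)
    finally show ?thesis .
  next
    case False
    \<comment> \<open>The adjoint equation tested with the mode; \<open>cnj z\<close> appears
      because the product is antilinear in its second argument. Its real part is at least
      \<open>- \<delta>\<close>, while a stable mode has \<open>lam e < - \<delta>\<close>.\<close>
    have "of_real (lam e) * X_ip \<mu> (mode e) v = cnj z * X_ip \<mu> (mode e) v"
      using eig[OF mode_graph[OF e]] by (simp add: X_ip_scale)
    moreover have "of_real (lam e) \<noteq> cnj z"
    proof
      assume "of_real (lam e) = cnj z"
      then have "lam e = Re z" by (metis Re_complex_of_real cnj.sel(1))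
      then show False using z False lam_Eu[OF e] by simp
    qed
    ultimately show ?thesis by simp
  qed
  then show "v \<in> X0_zero \<mu>" unfolding X0_zero_iff using v zero_of_modes[OF v] by blast
next
  \<comment> \<open>The test is an equality of sets of functions, so every representative of the
    zero class has to be placed in both kernels.\<close>
  fix z v assume "v \<in> X0_zero \<mu>"
  then have v: "v \<in> X0_space \<mu>" "reL v = 0" "imL v = 0" by (auto simp: X0_zero_iff)
  have zv: "(\<lambda>x. z * v x) \<in> X0_space \<mu>" using v(1) by (rule X0_space_scale)
  have zv0: "reL (\<lambda>x. z * v x) = 0" "imL (\<lambda>x. z * v x) = 0" using L2_scale[OF X0_spaceD(1)[OF v(1)], of z] v by simp_all
  have "X_ip \<mu> k v = X_ip \<mu> f (\<lambda>x. z * v x)" if "(f, k) \<in> MV_graph0 \<sigma> V W \<mu>" for f k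
    using that v zv zv0 X_ip_zero X0_spaceD(1) unfolding MV_graph0_iff by metis
  moreover have "X_ip \<mu> (B u) v = Cm_ip m u (\<lambda>_. 0)" for u
    using X_ip_zero[OF B_Lp2 X0_spaceD(1)[OF v(1)] v(2,3)] by (simp add: Cm_ip_def)
  ultimately show "v \<in> eigenspace (adjoint_graph (X0_space \<mu>) (X_ip \<mu>) (X0_space \<mu>) (X_ip \<mu>) (MV_graph0 \<sigma> V W \<mu>)) z \<inter>
    op_kernel (adjoint_graph (Cm m) (Cm_ip m) (X0_space \<mu>) (X_ip \<mu>) (control_graph m B))"
    unfolding eigenspace_def op_kernel_def adjoint_graph_def control_graph_def using v(1) zv by (auto simp: Cm_def)
qed

end

lemma (in mckean_vlasov) stabilization_exists:
  assumes "0 < \<delta>" and "unstable_eigenpairs (MV_graph0 \<sigma> V W \<mu>) \<delta> m \<Lambda> \<psi>"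
    and "\<And>j. j < m \<Longrightarrow> is_div_grad \<mu> (\<alpha> j) (\<psi> j)"
  obtains E ev where "stabilization V W \<mu> \<sigma> \<delta> m \<Lambda> \<psi> \<alpha> E ev"
proof (rule op.spectral)
  fix E ev assume "hilbert_basis X0 b c\<^sub>0 E (\<lambda>x. x)" "\<And>e. e \<in> E \<Longrightarrow> G e = ev e *\<^sub>R e"
    "\<And>e. e \<in> E \<Longrightarrow> 0 < ev e" "\<And>k. 0 < k \<Longrightarrow> finite {e \<in> E. k \<le> ev e}"
  then show thesis
    by (intro that[of E ev] stabilization.intro mckean_vlasov_axioms stabilization_axioms.intro assms)
qed

theorem theorem3p1:
  fixes V W \<mu> :: "real ^ 'd::finite \<Rightarrow> real"
    and \<sigma> \<epsilon> p \<delta> :: real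
    and m :: nat
    and \<Lambda> :: "nat \<Rightarrow> complex"
    and \<psi> \<alpha> :: "nat \<Rightarrow> real ^ 'd \<Rightarrow> complex"
  assumes "0 < \<sigma>"
    and "0 < \<epsilon>" and "p = max (real CARD('d)) (2 + \<epsilon>)"
    and "periodic V" and "sobolev 1 \<infinity> V" and "sobolev 2 (ennreal p) V" and "Ck 2 V"
    and "periodic W" and "sobolev 2 \<infinity> W" and "even_each W" and "Ck 2 W"
    and "H_stable W \<or> ess_norm W < ereal \<sigma>"
    and "stationary_state \<sigma> V W \<mu>"
    and "0 < \<delta>"
    and "unstable_eigenpairs (MV_graph0 \<sigma> V W \<mu>) \<delta> m \<Lambda> \<psi>"
    and "\<And>j. j < m \<Longrightarrow> sobolev 1 \<infinity> (\<alpha> j)"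
    and "\<And>j. j < m \<Longrightarrow> sobolev 2 (ennreal p) (\<alpha> j)"
    and "\<And>j. j < m \<Longrightarrow> is_div_grad \<mu> (\<alpha> j) (\<psi> j)"
  shows "hautus (X0_space \<mu>) (X_ip \<mu>) (X0_zero \<mu>) m (MV_graph0 \<sigma> V W \<mu>) (control_op \<mu> m \<alpha>) \<delta>
    \<and> stabilizable (X0_space \<mu>) (ip_norm (X_ip \<mu>)) m (MV_graph0 \<sigma> V W \<mu>) (control_op \<mu> m \<alpha>) \<delta>
    \<and> ((\<forall>j<m. AE x in torus. \<alpha> j x \<in> \<real>) \<longrightarrow>
        (\<exists>F. stabilizing_feedback (X0_space \<mu>) (ip_norm (X_ip \<mu>)) m (MV_graph0 \<sigma> V W \<mu>)
               (control_op \<mu> m \<alpha>) \<delta> F \<and>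
             (\<forall>y\<in>X0_space \<mu>. (AE x in torus. y x \<in> \<real>) \<longrightarrow> (\<forall>j<m. F y j \<in> \<real>))))"
proof -
  have "mckean_vlasov V W \<mu> \<sigma>"
    by (rule mckean_vlasov.intro[OF assms(1,4,7,8,11,10,12,13)])
  then obtain E ev where st: "stabilization V W \<mu> \<sigma> \<delta> m \<Lambda> \<psi> \<alpha> E ev"
    by (rule mckean_vlasov.stabilization_exists[OF _ assms(14,15,18)])
  show ?thesis unfolding stabilizable_def
    using stabilization.hautus_test[OF st] stabilization.stabilizing_F[OF st] stabilization.F_real[OF st]
    by blast
qed

end
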